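(* Let $D\subset R$ be a closed rectangle homothetic to $R$, let $0<\alpha<|D|$, $r>0$, $U=0$ (i.e. zero velocity is prescribed on the top side $\Gamma_t$), and let $\Lambda=\Lambda(r,D)>0$ be the uniqueness threshold described in the context. For any $\lambda\in[0,\Lambda]$ there exist a body shape $\widetilde B\in\mathcal{C}_{\alpha,D}$ and a flow shape $(\widetilde V_{\rm in},\widetilde V_{\rm out})\in\mathcal{F}_{r,0}$, such that $\widetilde B$ is asymmetric and/or $(\widetilde V_{\rm in},\widetilde V_{\rm out})$ is non-even, and such that the problem $$-\Delta u+u\cdot\nabla u+\nabla p=0,\quad \nabla\cdot u=0\ \text{ in }\widetilde\Omega=R\setminus\widetilde B,$$ $$u|_{\partial \widetilde B}=u|_{\Gamma_b}=u|_{\Gamma_t}=0,\quad u|_{\Gamma_l}=\lambda \widetilde V_{\rm in}e_1,\quad u|_{\Gamma_r}=\lambda \widetilde V_{\rm out}e_1,$$ $$\mathcal{L}_{\widetilde B}(u,p)=0$$ admits a unique weak solution $(u,p)\in V_*(\widetilde\Omega)\times L^2_0(\widetilde\Omega)$.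
   Context: **Geometry.** Fix $L>H>0$ and $R=(-L,L)\times(-H,H)\subset\mathbb{R}^2$, with bottom, top, left and right sides $\Gamma_b,\Gamma_t,\Gamma_l,\Gamma_r$; $e_1,e_2$ is the canonical basis of $\mathbb{R}^2$ and $|\cdot|$ is Lebesgue measure (area). For a closed rectangle $D\subset R$ homothetic to $R$ and $0<\alpha<|D|$, $\mathcal{C}_{\alpha,D}$ is the set of nonempty compact convex domains $B\subset D$ with $|B|=\alpha$. A body shape is asymmetric if it is not symmetric with respect to the line $x_2=0$. A flow shape $(V_{\rm in},V_{\rm out})$ is even if both components are even functions of $x_2\in(-H,H)$, and non-even otherwise. **Flow shapes.** For $r>0$, $\mathcal{F}_{r,0}$ is the set of pairs $(V_{\rm in},V_{\rm out})\in W^{1,\infty}(-H,H)^2$ such that: (1) $\|V_{\rm in}\|_{W^{1,\infty}(-H,H)}+\|V_{\rm out}\|_{W^{1,\infty}(-H,H)}\le r$; (2) $V_{\rm in}(\pm H)=V_{\rm out}(\pm H)=0$; (3) $\int_{-H}^H V_{\rm in}\,dx_2=\int_{-H}^H V_{\rm out}\,dx_2=1$. **Weak solutions.** For $B\in\mathcal{C}_{\alpha,D}$, $\Omega=R\setminus B$: $H^1_*(\Omega)=\{u\in H^1(\Omega): u=0 \text{ on }\partial B\}$ (vector fields), $V_*(\Omega)=\{u\in H^1_*(\Omega):\nabla\cdot u=0\}$, $L^2_0(\Omega)=\{p\in L^2(\Omega):\int_\Omega p=0\}$. A weak solution of the Navier-Stokes boundary-value problem with flow $\lambda(V_{\rm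 in},V_{\rm out})$ (i.e. with data $u=0$ on $\partial B\cup\Gamma_b\cup\Gamma_t$, $u=\lambda V_{\rm in}e_1$ on $\Gamma_l$, $u=\lambda V_{\rm out}e_1$ on $\Gamma_r$) is $(u,p)\in V_*(\Omega)\times L^2_0(\Omega)$ attaining the boundary data in the trace sense and satisfying $\int_\Omega\nabla u:\nabla\varphi+\int_\Omega(u\cdot\nabla u)\cdot\varphi-\int_\Omega p\,\nabla\cdot\varphi=0$ for all vector fields $\varphi\in H^1_0(\Omega)$. **Lift.** With $\mathbb{T}(u,p)=\nabla u+\nabla u^T-p\mathbb{I}$ and $n$ the unit normal to $\partial\Omega$ outward with respect to $\Omega$, the lift on $B$ is $\mathcal{L}_B(u,p)=-e_2\cdot\langle\mathbb{T}(u,p)n,1\rangle_{\partial B}$, where $\langle\cdot,\cdot\rangle_{\partial B}$ is the duality between $W^{-2/3,3/2}(\partial B)$ and $W^{2/3,3}(\partial B)$. Explicitly, since $\nabla\cdot\mathbb{T}(u,p)=u\cdot\nabla u$, $e_2\cdot\langle\mathbb{T}(u,p)n,1\rangle_{\partial B}=\int_\Omega \mathbb{T}(u,p):\nabla(\phi e_2)+\int_\Omega (u\cdot\nabla u)\cdot \phi e_2$ for any smooth $\phi$ on $\overline R$ equal to $1$ near $B$ and $0$ near $\partial R$. **Threshold $\Lambda$.** Let $\mathcal{S}_0(\Omega)=\min_{u\in H^1_0(\Omega)\setminus\{0\}}\|\nabla u\|_{L^2(\Omega)}^2/\|u\|_{L^4(\Omega)}^2$. $\Lambda=\Lambda(r,D)>0$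 denotes a number such that, for some $C=C(r,D)>0$, for all $B\in\mathcal{C}_{\alpha,D}$, $(V_{\rm in},V_{\rm out})\in\mathcal{F}_{r,0}$ and $\lambda\in[0,\Lambda]$, the Navier-Stokes boundary-value problem with flow $\lambda(V_{\rm in},V_{\rm out})$ has a unique weak solution $(u,p)$, and it satisfies $\|\nabla u\|_{L^2(\Omega)}<\mathcal{S}_0(\Omega)$ and $\|\nabla u\|_{L^2(\Omega)}\le C\lambda$ (such $\Lambda$ exists).
   Formalization: It is assumed that the set of flow shapes F_{r,0} is nonempty (it is empty for small r, e.g. 2Hr<1) and that D, homothetic to R, is symmetric about the line x_2=0 (its centre lies on the axis of R); without these the claim can fail. *)

theory Defs
  imports "HOL-Analysis.Analysis"
begin

section \<open>Weak derivatives\<close>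

text \<open>
  Functions are total; only their values on the domain at hand matter, up to null sets.  The
  Sobolev notions are stated over a Euclidean space so that they serve both the planar domain and
  the interval carrying the flow shapes.
\<close>

definition dir_deriv :: "'a::euclidean_space \<Rightarrow> ('a \<Rightarrow> real) \<Rightarrow> 'a \<Rightarrow> real" where
  "dir_deriv b f x = frechet_derivative f (at x) b"

text \<open>All iterated partial derivatives exist and are differentiable, i.e. \<open>f\<close> is of class
  \<open>C\<^sup>\<infinity>\<close> on the whole space.\<close>

definition smooth :: "('a::euclidean_space \<Rightarrow> real) \<Rightarrow> bool" where
  "smooth f \<longleftrightarrow> (\<forall>bs. set bs \<subseteq> Basis \<longrightarrow> (\<forall>x. foldr dir_deriv bs f differentiable at x))"

definition test_fun :: "'a::euclidean_space set \<Rightarrow> ('a \<Rightarrow> real) \<Rightarrow> bool" where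
  "test_fun S \<phi> \<longleftrightarrow> smooth \<phi> \<and> compact (closure {x. \<phi> x \<noteq> 0}) \<and> closure {x. \<phi> x \<noteq> 0} \<subseteq> S"

definition loc_integrable :: "'a::euclidean_space set \<Rightarrow> ('a \<Rightarrow> real) \<Rightarrow> bool" where
  "loc_integrable S f \<longleftrightarrow> (\<forall>K. compact K \<and> K \<subseteq> S \<longrightarrow> set_integrable lebesgue K f)"

definition is_weak_deriv ::
    "'a::euclidean_space set \<Rightarrow> 'a \<Rightarrow> ('a \<Rightarrow> real) \<Rightarrow> ('a \<Rightarrow> real) \<Rightarrow> bool" where
  "is_weak_deriv S b f g \<longleftrightarrow> loc_integrable S f \<and> loc_integrable S g \<and>
     (\<forall>\<phi>. test_fun S \<phi> \<longrightarrow>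
        (LINT x:S|lebesgue. f x * dir_deriv b \<phi> x) = - (LINT x:S|lebesgue. g x * \<phi> x))"

text \<open>Some representative; weak derivatives on open sets are unique up to null sets.\<close>

definition weak_deriv :: "'a::euclidean_space set \<Rightarrow> 'a \<Rightarrow> ('a \<Rightarrow> real) \<Rightarrow> 'a \<Rightarrow> real" where
  "weak_deriv S b f = (SOME g. is_weak_deriv S b f g)"

section \<open>Lebesgue spaces and \<open>W\<^sup>1\<^sup>,\<^sup>\<infinity>\<close> on an interval\<close>

definition L2 :: "'a::euclidean_space set \<Rightarrow> ('a \<Rightarrow> 'b::euclidean_space) \<Rightarrow> bool" where
  "L2 S f \<longleftrightarrow> set_borel_measurable lebesgue S f \<and> set_integrable lebesgue S (\<lambda>x. (norm (f x))\<^sup>2)"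

definition Lp_norm :: "nat \<Rightarrow> 'a::euclidean_space set \<Rightarrow> ('a \<Rightarrow> 'b::euclidean_space) \<Rightarrow> real" where
  "Lp_norm p S f = root p (LINT x:S|lebesgue. (norm (f x)) ^ p)"

definition ess_bounds :: "'a::euclidean_space set \<Rightarrow> ('a \<Rightarrow> real) \<Rightarrow> real set" where
  "ess_bounds S f = {C. 0 \<le> C \<and> (AE x in lebesgue. x \<in> S \<longrightarrow> \<bar>f x\<bar> \<le> C)}"

definition Linf :: "'a::euclidean_space set \<Rightarrow> ('a \<Rightarrow> real) \<Rightarrow> bool" where
  "Linf S f \<longleftrightarrow> set_borel_measurable lebesgue S f \<and> ess_bounds S f \<noteq> {}"

definition Linf_norm :: "'a::euclidean_space set \<Rightarrow> ('a \<Rightarrow> real) \<Rightarrow> real" where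
  "Linf_norm S f = Inf (ess_bounds S f)"

text \<open>An element of \<open>W\<^sup>1\<^sup>,\<^sup>\<infinity>(a,b)\<close> is represented by its continuous representative on the closed
  interval, which gives meaning to its values at the end points.\<close>

definition W1inf :: "real \<Rightarrow> real \<Rightarrow> (real \<Rightarrow> real) \<Rightarrow> bool" where
  "W1inf a b V \<longleftrightarrow> continuous_on {a..b} V \<and> Linf {a<..<b} V \<and>
     (\<exists>W. is_weak_deriv {a<..<b} 1 V W \<and> Linf {a<..<b} W)"

definition W1inf_norm :: "real \<Rightarrow> real \<Rightarrow> (real \<Rightarrow> real) \<Rightarrow> real" where
  "W1inf_norm a b V = Linf_norm {a<..<b} V + Linf_norm {a<..<b} (weak_deriv {a<..<b} 1 V)"

section \<open>Geometry, body shapes and flow shapes\<close>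

type_synonym plane = "real^2"

definition e1 :: plane where "e1 = axis 1 1"

definition e2 :: plane where "e2 = axis 2 1"

definition rect :: "real \<Rightarrow> real \<Rightarrow> plane set" where
  "rect L H = {x. - L < x$1 \<and> x$1 < L \<and> - H < x$2 \<and> x$2 < H}"

definition side_b :: "real \<Rightarrow> real \<Rightarrow> plane set" where
  "side_b L H = {x. - L \<le> x$1 \<and> x$1 \<le> L \<and> x$2 = - H}"

definition side_t :: "real \<Rightarrow> real \<Rightarrow> plane set" where
  "side_t L H = {x. - L \<le> x$1 \<and> x$1 \<le> L \<and> x$2 = H}"

definition side_l :: "real \<Rightarrow> real \<Rightarrow> plane set" where
  "side_l L H = {x. x$1 = - L \<and> - H \<le> x$2 \<and> x$2 \<le> H}"

definition side_r :: "real \<Rightarrow> real \<Rightarrow> plane set" where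
  "side_r L H = {x. x$1 = L \<and> - H \<le> x$2 \<and> x$2 \<le> H}"

definition closed_homothetic :: "plane set \<Rightarrow> plane set \<Rightarrow> bool" where
  "closed_homothetic D R \<longleftrightarrow> (\<exists>c t. 0 < t \<and> D = (\<lambda>x. c + t *\<^sub>R x) ` closure R)"

definition reflect :: "plane \<Rightarrow> plane" where
  "reflect x = vector [x$1, - x$2]"

definition x1_symmetric :: "plane set \<Rightarrow> bool" where
  "x1_symmetric S \<longleftrightarrow> reflect ` S = S"

definition bodies :: "real \<Rightarrow> plane set \<Rightarrow> plane set set" where
  "bodies \<alpha> D =
     {B. B \<noteq> {} \<and> compact B \<and> convex B \<and> B \<subseteq> D \<and> measure lebesgue B = \<alpha>}"

definition flow_shapes :: "real \<Rightarrow> real \<Rightarrow> ((real \<Rightarrow> real) \<times> (real \<Rightarrow> real)) set" where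
  "flow_shapes H r = {(Vin, Vout).
     W1inf (- H) H Vin \<and> W1inf (- H) H Vout \<and>
     W1inf_norm (- H) H Vin + W1inf_norm (- H) H Vout \<le> r \<and>
     Vin (- H) = 0 \<and> Vin H = 0 \<and> Vout (- H) = 0 \<and> Vout H = 0 \<and>
     (LINT s:{- H<..<H}|lebesgue. Vin s) = 1 \<and> (LINT s:{- H<..<H}|lebesgue. Vout s) = 1}"

definition even_on :: "real \<Rightarrow> (real \<Rightarrow> real) \<Rightarrow> bool" where
  "even_on H V \<longleftrightarrow> (\<forall>s\<in>{- H<..<H}. V (- s) = V s)"

definition even_flow :: "real \<Rightarrow> (real \<Rightarrow> real) \<Rightarrow> (real \<Rightarrow> real) \<Rightarrow> bool" where
  "even_flow H Vin Vout \<longleftrightarrow> even_on H Vin \<and> even_on H Vout"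

section \<open>Sobolev vector fields in the plane\<close>

text \<open>The entry in row \<open>i\<close> and column \<open>j\<close> is \<open>\<partial>\<^sub>j u\<^sub>i\<close>.  The inner product and the norm of
  \<^typ>\<open>real^2^2\<close> are those of Frobenius.\<close>

definition wgrad :: "plane set \<Rightarrow> (plane \<Rightarrow> plane) \<Rightarrow> plane \<Rightarrow> real^2^2" where
  "wgrad \<Omega> u x = (\<chi> i j. weak_deriv \<Omega> (axis j 1) (\<lambda>y. u y $ i) x)"

definition wdiv :: "plane set \<Rightarrow> (plane \<Rightarrow> plane) \<Rightarrow> plane \<Rightarrow> real" where
  "wdiv \<Omega> u x = trace (wgrad \<Omega> u x)"

text \<open>\<open>u \<cdot> \<nabla>u\<close>, with \<open>i\<close>-th component \<open>\<Sum>\<^sub>j u\<^sub>j \<partial>\<^sub>j u\<^sub>i\<close>.\<close>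

definition convection :: "plane set \<Rightarrow> (plane \<Rightarrow> plane) \<Rightarrow> plane \<Rightarrow> plane" where
  "convection \<Omega> u x = wgrad \<Omega> u x *v u x"

definition H1 :: "plane set \<Rightarrow> (plane \<Rightarrow> plane) set" where
  "H1 \<Omega> = {u. L2 \<Omega> u \<and>
     (\<forall>i j. \<exists>g. is_weak_deriv \<Omega> (axis j 1) (\<lambda>y. u y $ i) g \<and> L2 \<Omega> g)}"

text \<open>One-dimensional Hausdorff measure, normalised to be arc length on rectifiable curves.
  It is countably additive on Borel sets because Hausdorff outer measures are metric outer
  measures, so \<^const>\<open>measure_of\<close> does return the intended measure.\<close>

definition hausdorff_pre :: "real \<Rightarrow> plane set \<Rightarrow> ennreal" where
  "hausdorff_pre \<delta> A =
     Inf {(\<Sum>n. ennreal (diameter (C n))) | C :: nat \<Rightarrow> plane set.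
            A \<subseteq> (\<Union>n. C n) \<and> (\<forall>n. bounded (C n) \<and> diameter (C n) \<le> \<delta>)}"

definition hausdorff1 :: "plane measure" where
  "hausdorff1 = measure_of UNIV (sets borel) (\<lambda>A. SUP \<delta>\<in>{0<..}. hausdorff_pre \<delta> A)"

text \<open>The graph of the trace operator \<open>H\<^sup>1(\<Omega>) \<rightarrow> L\<^sup>2(\<partial>\<Omega>)\<close>: the continuous extension of the
  restriction to \<open>\<partial>\<Omega>\<close> of fields that are smooth up to the boundary (these are dense since all the
  domains considered are Lipschitz).\<close>

definition is_trace :: "plane set \<Rightarrow> (plane \<Rightarrow> plane) \<Rightarrow> (plane \<Rightarrow> plane) \<Rightarrow> bool" where
  "is_trace \<Omega> u g \<longleftrightarrow> u \<in> H1 \<Omega> \<and> g \<in> borel_measurable borel \<and>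
     (\<exists>v :: nat \<Rightarrow> plane \<Rightarrow> plane. (\<forall>k i. smooth (\<lambda>x. v k x $ i)) \<and>
        (\<lambda>k. Lp_norm 2 \<Omega> (\<lambda>x. v k x - u x)) \<longlonglongrightarrow> 0 \<and>
        (\<lambda>k. Lp_norm 2 \<Omega> (\<lambda>x. wgrad \<Omega> (v k) x - wgrad \<Omega> u x)) \<longlonglongrightarrow> 0 \<and>
        (\<lambda>k. \<integral>\<^sup>+x\<in>frontier \<Omega>. ennreal ((norm (v k x - g x))\<^sup>2) \<partial>hausdorff1) \<longlonglongrightarrow> 0)"

definition ae_eq_on :: "plane set \<Rightarrow> (plane \<Rightarrow> plane) \<Rightarrow> (plane \<Rightarrow> plane) \<Rightarrow> bool" where
  "ae_eq_on \<Gamma> g h \<longleftrightarrow> (AE x in hausdorff1. x \<in> \<Gamma> \<longrightarrow> g x = h x)"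

definition H1_zero :: "plane set \<Rightarrow> (plane \<Rightarrow> plane) set" where
  "H1_zero \<Omega> = {u \<in> H1 \<Omega>. \<exists>g. is_trace \<Omega> u g \<and> ae_eq_on (frontier \<Omega>) g (\<lambda>_. 0)}"

text \<open>The two arguments are the outer rectangle and the body; the domain is their difference.\<close>

definition H1_star :: "plane set \<Rightarrow> plane set \<Rightarrow> (plane \<Rightarrow> plane) set" where
  "H1_star R B = {u \<in> H1 (R - B). \<exists>g. is_trace (R - B) u g \<and> ae_eq_on (frontier B) g (\<lambda>_. 0)}"

definition V_star :: "plane set \<Rightarrow> plane set \<Rightarrow> (plane \<Rightarrow> plane) set" where
  "V_star R B =
     {u \<in> H1_star R B. AE x in lebesgue. x \<in> R - B \<longrightarrow> wdiv (R - B) u x = 0}"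

definition L2_zero :: "plane set \<Rightarrow> (plane \<Rightarrow> real) set" where
  "L2_zero \<Omega> = {p. L2 \<Omega> p \<and> (LINT x:\<Omega>|lebesgue. p x) = 0}"

section \<open>The Navier-Stokes boundary-value problem\<close>

definition attains_data :: "real \<Rightarrow> real \<Rightarrow> plane set \<Rightarrow> real \<Rightarrow> (real \<Rightarrow> real) \<Rightarrow> (real \<Rightarrow> real) \<Rightarrow>
    (plane \<Rightarrow> plane) \<Rightarrow> bool" where
  "attains_data L H B lam Vin Vout u \<longleftrightarrow>
     (\<exists>g. is_trace (rect L H - B) u g \<and>
        ae_eq_on (frontier B) g (\<lambda>_. 0) \<and>
        ae_eq_on (side_b L H) g (\<lambda>_. 0) \<and>
        ae_eq_on (side_t L H) g (\<lambda>_. 0) \<and>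
        ae_eq_on (side_l L H) g (\<lambda>x. (lam * Vin (x$2)) *\<^sub>R e1) \<and>
        ae_eq_on (side_r L H) g (\<lambda>x. (lam * Vout (x$2)) *\<^sub>R e1))"

definition weak_solution :: "real \<Rightarrow> real \<Rightarrow> plane set \<Rightarrow> real \<Rightarrow> (real \<Rightarrow> real) \<Rightarrow> (real \<Rightarrow> real) \<Rightarrow>
    (plane \<Rightarrow> plane) \<Rightarrow> (plane \<Rightarrow> real) \<Rightarrow> bool" where
  "weak_solution L H B lam Vin Vout u p \<longleftrightarrow>
     (let \<Omega> = rect L H - B in
        u \<in> V_star (rect L H) B \<and> p \<in> L2_zero \<Omega> \<and> attains_data L H B lam Vin Vout u \<and>
        (\<forall>\<phi>\<in>H1_zero \<Omega>.
           (LINT x:\<Omega>|lebesgue. wgrad \<Omega> u x \<bullet> wgrad \<Omega> \<phi> x)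
           + (LINT x:\<Omega>|lebesgue. convection \<Omega> u x \<bullet> \<phi> x)
           - (LINT x:\<Omega>|lebesgue. p x * wdiv \<Omega> \<phi> x) = 0))"

text \<open>Existence and uniqueness, where pairs of functions agreeing almost everywhere on
  \<open>\<Omega>\<close> are identified.\<close>

definition has_unique_pair ::
    "plane set \<Rightarrow> ((plane \<Rightarrow> plane) \<Rightarrow> (plane \<Rightarrow> real) \<Rightarrow> bool) \<Rightarrow> bool" where
  "has_unique_pair \<Omega> P \<longleftrightarrow>
     (\<exists>u p. P u p \<and>
        (\<forall>u' p'. P u' p' \<longrightarrow> (AE x in lebesgue. x \<in> \<Omega> \<longrightarrow> u' x = u x \<and> p' x = p x)))"

section \<open>Lift\<close>

definition stress :: "plane set \<Rightarrow> (plane \<Rightarrow> plane) \<Rightarrow> (plane \<Rightarrow> real) \<Rightarrow> plane \<Rightarrow> real^2^2" where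
  "stress \<Omega> u p x = wgrad \<Omega> u x + transpose (wgrad \<Omega> u x) - p x *\<^sub>R mat 1"

definition cutoff :: "plane set \<Rightarrow> plane set \<Rightarrow> (plane \<Rightarrow> real) \<Rightarrow> bool" where
  "cutoff R B \<phi> \<longleftrightarrow> smooth \<phi> \<and>
     (\<exists>U. open U \<and> B \<subseteq> U \<and> (\<forall>x\<in>U. \<phi> x = 1)) \<and>
     (\<exists>W. open W \<and> frontier R \<subseteq> W \<and> (\<forall>x\<in>W. \<phi> x = 0))"

text \<open>The pairing \<open>e\<^sub>2 \<cdot> \<langle>T(u,p) n, 1\<rangle>\<close> over \<open>\<partial>B\<close>, with \<open>n\<close> outward with respect to
  \<open>R - B\<close>.  As \<open>T(u,p) n\<close> is a functional rather than a function on \<open>\<partial>B\<close>, the pairing is given by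
  the generalised Gauss formula with the extension \<open>\<phi> e\<^sub>2\<close> of the boundary value, where
  \<open>\<nabla> \<cdot> T(u,p) = u \<cdot> \<nabla>u\<close>.\<close>

definition stress_pairing ::
    "plane set \<Rightarrow> plane set \<Rightarrow> (plane \<Rightarrow> real) \<Rightarrow> (plane \<Rightarrow> plane) \<Rightarrow> (plane \<Rightarrow> real) \<Rightarrow> real" where
  "stress_pairing R B \<phi> u p =
     (LINT x:R - B|lebesgue. stress (R - B) u p x \<bullet> wgrad (R - B) (\<lambda>y. \<phi> y *\<^sub>R e2) x)
     + (LINT x:R - B|lebesgue. convection (R - B) u x \<bullet> (\<phi> x *\<^sub>R e2))"

text \<open>For weak solutions the pairing is the same for all cut-off functions: the difference of two
  of them, times \<open>e\<^sub>2\<close>, is an admissible field in the weak formulation.\<close>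

definition lift :: "plane set \<Rightarrow> plane set \<Rightarrow> (plane \<Rightarrow> plane) \<Rightarrow> (plane \<Rightarrow> real) \<Rightarrow> real" where
  "lift R B u p = (THE l. \<forall>\<phi>. cutoff R B \<phi> \<longrightarrow> l = - stress_pairing R B \<phi> u p)"

section \<open>The uniqueness threshold\<close>

definition S0 :: "plane set \<Rightarrow> real" where
  "S0 \<Omega> = Inf {(Lp_norm 2 \<Omega> (wgrad \<Omega> v))\<^sup>2 / (Lp_norm 4 \<Omega> v)\<^sup>2 | v.
                 v \<in> H1_zero \<Omega> \<and> \<not> (AE x in lebesgue. x \<in> \<Omega> \<longrightarrow> v x = 0)}"

definition is_threshold ::
    "real \<Rightarrow> real \<Rightarrow> plane set \<Rightarrow> real \<Rightarrow> real \<Rightarrow> real \<Rightarrow> bool" where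
  "is_threshold L H D \<alpha> r \<Lambda> \<longleftrightarrow> 0 < \<Lambda> \<and>
     (\<exists>C>0. \<forall>B\<in>bodies \<alpha> D. \<forall>(Vin, Vout)\<in>flow_shapes H r. \<forall>lam\<in>{0..\<Lambda>}.
        let \<Omega> = rect L H - B in
          has_unique_pair \<Omega> (weak_solution L H B lam Vin Vout) \<and>
          (\<forall>u p. weak_solution L H B lam Vin Vout u p \<longrightarrow>
             Lp_norm 2 \<Omega> (wgrad \<Omega> u) < S0 \<Omega> \<and> Lp_norm 2 \<Omega> (wgrad \<Omega> u) \<le> C * lam))"

end

theory Submission
  imports Defs
begin

text \<open>
  Only the body is varied; the flow is kept even, which is possible because averaging a flow shape
  with its mirror image gives another flow shape.  Inside \<open>D = [c - a, c + a] \<times> [- b, b]\<close> take the parallelograms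
  \<open>\<bar>x\<^sub>1 - c\<bar> \<le> a\<close>, \<open>\<bar>x\<^sub>2 - e (cos (\<pi>t) (x\<^sub>1 - c) + sin (\<pi>t))\<bar> \<le> m\<close> with \<open>4 a m = \<alpha>\<close>.  None of them is
  symmetric, and those for \<open>t = 0\<close> and \<open>t = 1\<close> are mirror images of each other, so that their lifts
  are opposite.  As the lift depends continuously on \<open>t\<close>, it vanishes for some \<open>t\<close>.

  For the continuity, all domains are mapped by vertical shifts to the rectangle with a rectangular
  hole, and the velocities by the Piola transform, which preserves both vanishing divergence and the
  skew-symmetry of the convection term.  The difference of two transported solutions is then an
  admissible test field, and \<open>\<parallel>\<nabla>u\<parallel> < S\<^sub>0\<close> turns the difference of the two weak formulations into an
  energy estimate.  The pressure does not enter, because testing with a solenoidal extension of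
  \<open>e\<^sub>2\<close> expresses the lift by the velocity alone; the transposed gradient in the stress drops out
  since second derivatives commute.
\<close>

section \<open>Calculus of smooth functions\<close>

text \<open>Two obstacles shape the argument. The symmetric rectangle must not occur on the path
  from a body to its mirror image; so the pair of slope and offset of the midline, up to the factor
  \<open>e\<close>, runs along a half-circle around the origin, the point that stands for this
  rectangle. Moreover, traces are given only through approximating smooth fields. Every identity is
  therefore proved for smooth fields on a domain that can be dissected into rectangles, and then
  passed to the limit; the same dissection yields the fourth powers that the convection term
  requires, by Ladyzhenskaya's argument. Continuity is shown at one parameter at a time: the forms
  at a nearby parameter are compared with those at the fixed one, so that \<open>S0\<close> and the
  coercivity constants enter for a fixed domain only. The test field for the lift is the same in all
  domains, because it equals \<open>e2\<close> wherever the shifts act and the Piola transform of a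
  vertical shift fixes \<open>e2\<close>. Its stream function is even in the vertical coordinate, so
  that reflection reverses the field; this is the source of the opposite signs at the two ends of
  the path.\<close>

lemma dir_deriv_eq:
  assumes "(f has_derivative f') (at x)"
  shows "dir_deriv b f x = f' b"
  using frechet_derivative_at[OF assms] by (simp add: dir_deriv_def)

lemma differentiable_has_derivative_dir_deriv:
  fixes f :: "'a::euclidean_space \<Rightarrow> real"
  assumes "f differentiable at x"
  shows "(f has_derivative (\<lambda>h. \<Sum>b\<in>Basis. (h \<bullet> b) * dir_deriv b f x)) (at x)"
proof -
  have f: "(f has_derivative frechet_derivative f (at x)) (at x)"
    using assms frechet_derivative_works by blast
  have "frechet_derivative f (at x) h = (\<Sum>b\<in>Basis. (h \<bullet> b) * dir_deriv b f x)" for h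
  proof -
    have lin: "linear (frechet_derivative f (at x))"
      using f has_derivative_linear by blast
    have "frechet_derivative f (at x) h = frechet_derivative f (at x) (\<Sum>b\<in>Basis. (h \<bullet> b) *\<^sub>R b)"
      by (simp add: euclidean_representation)
    also have "\<dots> = (\<Sum>b\<in>Basis. (h \<bullet> b) * dir_deriv b f x)"
      by (simp add: linear_sum[OF lin] linear_scale[OF lin] dir_deriv_def)
    finally show ?thesis .
  qed
  then have "frechet_derivative f (at x) = (\<lambda>h. \<Sum>b\<in>Basis. (h \<bullet> b) * dir_deriv b f x)" ..
  with f show ?thesis by metis
qed

text \<open>Smoothness up to order \<open>n\<close>, recursing on the derivative that is applied
  first. Closure under algebraic operations and composition thus becomes an induction on
  \<open>n\<close> with the functions left arbitrary.\<close>

primrec Cn :: "nat \<Rightarrow> ('a::euclidean_space \<Rightarrow> real) \<Rightarrow> bool" where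
  "Cn 0 f = (\<forall>x. f differentiable at x)"
| "Cn (Suc n) f = ((\<forall>x. f differentiable at x) \<and> (\<forall>b\<in>Basis. Cn n (dir_deriv b f)))"

lemma Cn_differentiable: "Cn n f \<Longrightarrow> f differentiable at x"
  by (cases n) auto

lemma Cn_SucD: "Cn (Suc n) f \<Longrightarrow> Cn n f"
  by (induction n arbitrary: f) auto

lemma Cn_iff_foldr:
  "Cn n f \<longleftrightarrow>
     (\<forall>bs. set bs \<subseteq> Basis \<and> length bs \<le> n \<longrightarrow> (\<forall>x. foldr dir_deriv bs f differentiable at x))"
proof (induction n arbitrary: f)
  case 0
  show ?case by auto
next
  case (Suc n)
  show ?case
  proof (intro iffI allI impI)
    fix bs :: "'a list" and x
    assume C: "Cn (Suc n) f" and bs: "set bs \<subseteq> Basis \<and> length bs \<le> Suc n"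
    show "foldr dir_deriv bs f differentiable at x"
    \<comment> \<open>\<open>foldr\<close> applies the last entry first, and \<open>Cn\<close> peels
      off the derivative applied first; hence the split at the end of the list.\<close>
    proof (cases bs rule: rev_cases)
      case Nil
      then show ?thesis using C by auto
    next
      case (snoc cs b)
      have "Cn n (dir_deriv b f)" using C bs snoc by auto
      then show ?thesis using Suc.IH[of "dir_deriv b f"] bs snoc by auto
    qed
  next
    assume *: "\<forall>bs. set bs \<subseteq> Basis \<and> length bs \<le> Suc n \<longrightarrow>
                (\<forall>x. foldr dir_deriv bs f differentiable at x)"
    have "f differentiable at x" for x using *[rule_format, of "[]"] by auto
    moreover have "Cn n (dir_deriv b f)" if "b \<in> Basis" for b
      unfolding Suc.IH
    proof (intro allI impI)
      fix bs :: "'a list" and x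
      assume "set bs \<subseteq> Basis \<and> length bs \<le> n"
      then show "foldr dir_deriv bs (dir_deriv b f) differentiable at x"
        using *[rule_format, of "bs @ [b]"] that by auto
    qed
    ultimately show "Cn (Suc n) f" by auto
  qed
qed

lemma smooth_iff_Cn: "smooth f \<longleftrightarrow> (\<forall>n. Cn n f)"
  unfolding smooth_def Cn_iff_foldr by (meson le_refl)

lemma smooth_differentiable: "smooth f \<Longrightarrow> f differentiable at x"
  using smooth_iff_Cn Cn_differentiable by blast

lemma smooth_continuous_on: "smooth f \<Longrightarrow> continuous_on S f"
  by (meson continuous_at_imp_continuous_on differentiable_imp_continuous_within smooth_differentiable)

lemma smooth_borel [measurable_dest]: "smooth f \<Longrightarrow> f \<in> borel_measurable borel"
  by (simp add: borel_measurable_continuous_onI smooth_continuous_on)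

lemma smooth_dir_deriv: "smooth f \<Longrightarrow> b \<in> Basis \<Longrightarrow> smooth (dir_deriv b f)"
  unfolding smooth_iff_Cn by (metis Cn.simps(2))

lemma dir_deriv_const: "dir_deriv b (\<lambda>x. c) = (\<lambda>x. 0)"
  by (rule ext, subst dir_deriv_eq[OF has_derivative_const]) simp

lemma Cn_const: "Cn n (\<lambda>x. c)"
  by (induction n arbitrary: c) (auto simp: dir_deriv_const)

lemma smooth_const: "smooth (\<lambda>x. c)"
  by (simp add: smooth_iff_Cn Cn_const)

lemma dir_deriv_inner: "dir_deriv b (\<lambda>x. x \<bullet> c) = (\<lambda>x. b \<bullet> c)"
  by (rule ext, subst dir_deriv_eq[OF bounded_linear_imp_has_derivative[OF bounded_linear_inner_left]]) simp

lemma Cn_inner: "Cn n (\<lambda>x. x \<bullet> c)"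
  by (cases n) (auto simp: dir_deriv_inner Cn_const intro!: differentiable_inner)

lemma smooth_inner: "smooth (\<lambda>x. x \<bullet> c)"
  by (simp add: smooth_iff_Cn Cn_inner)

lemma dir_deriv_add:
  assumes "f differentiable at x" "g differentiable at x"
  shows "dir_deriv b (\<lambda>x. f x + g x) x = dir_deriv b f x + dir_deriv b g x"
  using dir_deriv_eq[OF has_derivative_add[OF assms[unfolded frechet_derivative_works]]]
  by (simp add: dir_deriv_def)

lemma dir_deriv_mult:
  fixes f g :: "'a::euclidean_space \<Rightarrow> real"
  assumes "f differentiable at x" "g differentiable at x"
  shows "dir_deriv b (\<lambda>x. f x * g x) x = f x * dir_deriv b g x + dir_deriv b f x * g x"
  using dir_deriv_eq[OF has_derivative_mult[OF assms[unfolded frechet_derivative_works]]]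
  by (simp add: dir_deriv_def)

lemma Cn_add: "Cn n f \<Longrightarrow> Cn n g \<Longrightarrow> Cn n (\<lambda>x. f x + g x)"
proof (induction n arbitrary: f g)
  case (Suc n)
  have "dir_deriv b (\<lambda>x. f x + g x) = (\<lambda>x. dir_deriv b f x + dir_deriv b g x)" for b
    using Suc.prems by (auto intro!: ext dir_deriv_add)
  then show ?case using Suc by (auto intro!: differentiable_add)
qed (auto intro!: differentiable_add)

lemma Cn_mult: "Cn n f \<Longrightarrow> Cn n g \<Longrightarrow> Cn n (\<lambda>x. f x * g x)"
proof (induction n arbitrary: f g)
  case (Suc n)
  have "dir_deriv b (\<lambda>x. f x * g x) = (\<lambda>x. f x * dir_deriv b g x + dir_deriv b f x * g x)" for b
    using Suc.prems by (auto intro!: ext dir_deriv_mult)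
  then show ?case using Suc Cn_SucD[OF Suc.prems(1)] Cn_SucD[OF Suc.prems(2)]
    by (auto intro!: differentiable_mult Cn_add)
qed (auto intro!: differentiable_mult)

lemma smooth_add: "smooth f \<Longrightarrow> smooth g \<Longrightarrow> smooth (\<lambda>x. f x + g x)"
  by (simp add: smooth_iff_Cn Cn_add)

lemma smooth_mult: "smooth f \<Longrightarrow> smooth g \<Longrightarrow> smooth (\<lambda>x. f x * g x)"
  by (simp add: smooth_iff_Cn Cn_mult)

lemma smooth_minus: "smooth f \<Longrightarrow> smooth (\<lambda>x. - f x)"
  using smooth_mult[OF smooth_const[of "-1"]] by simp

lemma smooth_diff: "smooth f \<Longrightarrow> smooth g \<Longrightarrow> smooth (\<lambda>x. f x - g x)"
  using smooth_add[OF _ smooth_minus] by simp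

lemma smooth_power: "smooth f \<Longrightarrow> smooth (\<lambda>x. f x ^ n)"
  by (induction n) (auto intro: smooth_mult smooth_const)

lemma smooth_prod: "(\<And>i. i \<in> I \<Longrightarrow> smooth (f i)) \<Longrightarrow> smooth (\<lambda>x. \<Prod>i\<in>I. f i x)"
  by (induction I rule: infinite_finite_induct) (auto intro: smooth_mult smooth_const)

lemma dir_deriv_inverse:
  fixes f :: "'a::euclidean_space \<Rightarrow> real"
  assumes "f differentiable at x" "f x \<noteq> 0"
  shows "dir_deriv b (\<lambda>x. inverse (f x)) x = - (inverse (f x) * inverse (f x) * dir_deriv b f x)"
  using dir_deriv_eq[OF Deriv.has_derivative_inverse[OF assms(2) assms(1)[unfolded frechet_derivative_works]]]
  by (simp add: dir_deriv_def)

text \<open>The derivative of \<open>1/f\<close> is a product of two factors \<open>1/f\<close> and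
  a derivative of \<open>f\<close>, so the induction hypothesis for the same function closes the
  step.\<close>

lemma smooth_inverse:
  assumes "smooth f" "\<And>x. f x \<noteq> 0"
  shows "smooth (\<lambda>x. inverse (f x))"
proof -
  have "Cn n (\<lambda>x. inverse (f x))" for n
  proof (induction n)
    case 0
    then show ?case using assms smooth_differentiable by (auto intro!: differentiable_inverse)
  next
    case (Suc n)
    have "dir_deriv b (\<lambda>x. inverse (f x)) = (\<lambda>x. (inverse (f x) * inverse (f x)) * ((- 1) * dir_deriv b f x))" for b
      using assms(2) by (simp add: fun_eq_iff dir_deriv_inverse smooth_differentiable[OF assms(1)])
    moreover have "Cn n (\<lambda>x. (inverse (f x) * inverse (f x)) * ((- 1) * dir_deriv b f x))" if "b \<in> Basis" for b
      using smooth_dir_deriv[OF assms(1) that] by (intro Cn_mult Cn_const Suc) (simp add: smooth_iff_Cn)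
    ultimately show ?case
      using differentiable_inverse[OF smooth_differentiable[OF assms(1)] assms(2)] by simp
  qed
  then show ?thesis by (simp add: smooth_iff_Cn)
qed

lemma smooth_divide: "smooth f \<Longrightarrow> smooth g \<Longrightarrow> (\<And>x. g x \<noteq> 0) \<Longrightarrow> smooth (\<lambda>x. f x / g x)"
  unfolding divide_inverse by (intro smooth_mult smooth_inverse)

lemma comp_has_derivative:
  fixes f :: "'b::euclidean_space \<Rightarrow> real" and T :: "'a::euclidean_space \<Rightarrow> 'b"
  assumes "f differentiable at (T x)" "\<And>b. b \<in> Basis \<Longrightarrow> (\<lambda>x. T x \<bullet> b) differentiable at x"
  shows "((\<lambda>x. f (T x)) has_derivative
     (\<lambda>h. \<Sum>b\<in>Basis. frechet_derivative (\<lambda>x. T x \<bullet> b) (at x) h * dir_deriv b f (T x))) (at x)"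
proof -
  have T: "(T has_derivative (\<lambda>h. \<Sum>b\<in>Basis. frechet_derivative (\<lambda>x. T x \<bullet> b) (at x) h *\<^sub>R b)) (at x)"
    using assms(2) unfolding frechet_derivative_works
    by (subst has_derivative_componentwise_within) (auto simp: inner_sum_left inner_Basis if_distrib cong: if_cong)
  show ?thesis
    using has_derivative_compose[OF T differentiable_has_derivative_dir_deriv[OF assms(1)]]
    by (simp add: inner_sum_left inner_Basis if_distrib cong: if_cong)
qed

lemma dir_deriv_comp:
  fixes f :: "'b::euclidean_space \<Rightarrow> real" and T :: "'a::euclidean_space \<Rightarrow> 'b"
  assumes "f differentiable at (T x)" "\<And>b. b \<in> Basis \<Longrightarrow> (\<lambda>x. T x \<bullet> b) differentiable at x"
  shows "dir_deriv c (\<lambda>x. f (T x)) x = (\<Sum>b\<in>Basis. dir_deriv c (\<lambda>x. T x \<bullet> b) x * dir_deriv b f (T x))"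
  by (subst dir_deriv_eq[OF comp_has_derivative[OF assms]]) (auto simp: dir_deriv_def)

lemma Cn_sum: "(\<And>i. i \<in> I \<Longrightarrow> Cn n (f i)) \<Longrightarrow> Cn n (\<lambda>x. \<Sum>i\<in>I. f i x)"
  by (induction I rule: infinite_finite_induct) (auto intro: Cn_add Cn_const)

text \<open>By the chain rule the derivatives of the composite are sums of derivatives of
  \<open>T\<close> times composites with derivatives of \<open>f\<close>. The induction therefore
  generalises over \<open>f\<close> and keeps \<open>T\<close> fixed.\<close>

lemma Cn_comp:
  fixes f :: "'b::euclidean_space \<Rightarrow> real" and T :: "'a::euclidean_space \<Rightarrow> 'b"
  shows "Cn n f \<Longrightarrow> (\<And>b. b \<in> Basis \<Longrightarrow> Cn n (\<lambda>x. T x \<bullet> b)) \<Longrightarrow> Cn n (\<lambda>x. f (T x))"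
proof (induction n arbitrary: f)
  case 0
  show ?case unfolding Cn.simps
    by (intro allI differentiableI, rule comp_has_derivative) (use 0 in \<open>simp_all only: Cn.simps\<close>)
next
  case (Suc n)
  note d = Cn_differentiable[OF Suc.prems(1)] Cn_differentiable[OF Suc.prems(2)]
  have "Cn n (dir_deriv c (\<lambda>x. f (T x)))" if c: "c \<in> Basis" for c
  proof -
    have "dir_deriv c (\<lambda>x. f (T x)) = (\<lambda>x. \<Sum>b\<in>Basis. dir_deriv c (\<lambda>x. T x \<bullet> b) x * dir_deriv b f (T x))"
      by (rule ext, rule dir_deriv_comp[OF d])
    moreover have "Cn n (\<lambda>x. \<Sum>b\<in>Basis. dir_deriv c (\<lambda>x. T x \<bullet> b) x * dir_deriv b f (T x))"
    proof (intro Cn_sum Cn_mult)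
      show "Cn n (dir_deriv c (\<lambda>x. T x \<bullet> b))" if "b \<in> Basis" for b
        using Suc.prems(2)[OF that] c by (simp only: Cn.simps)
      show "Cn n (\<lambda>x. dir_deriv b f (T x))" if "b \<in> Basis" for b
        by (rule Suc.IH[OF _ Cn_SucD[OF Suc.prems(2)]]) (use Suc.prems(1) that in \<open>simp only: Cn.simps\<close>)
    qed
    ultimately show ?thesis by (simp only:)
  qed
  moreover have "(\<lambda>x. f (T x)) differentiable at x" for x
    by (rule differentiableI, rule comp_has_derivative[OF d])
  ultimately show ?case by (simp only: Cn.simps) blast
qed

lemma smooth_comp:
  fixes f :: "'b::euclidean_space \<Rightarrow> real" and T :: "'a::euclidean_space \<Rightarrow> 'b"
  shows "smooth f \<Longrightarrow> (\<And>b. b \<in> Basis \<Longrightarrow> smooth (\<lambda>x. T x \<bullet> b)) \<Longrightarrow> smooth (\<lambda>x. f (T x))"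
  by (simp add: smooth_iff_Cn Cn_comp)

lemma smooth_comp_real:
  fixes f :: "real \<Rightarrow> real"
  shows "smooth f \<Longrightarrow> smooth g \<Longrightarrow> smooth (\<lambda>x. f (g x))"
  by (rule smooth_comp) auto

lemma smooth_ident: "smooth (\<lambda>x::real. x)"
  using smooth_inner[of "1::real"] by simp

text \<open>Derivatives are local. This is how the derivatives of cut-off functions are read off
  wherever the functions are known explicitly.\<close>

lemma smooth_locally_eq:
  assumes "smooth f" "smooth g" "open U" "\<And>x. x \<in> U \<Longrightarrow> f x = g x" "x \<in> U"
  shows "dir_deriv b f x = dir_deriv b g x"
proof -
  have "(f has_derivative frechet_derivative f (at x)) (at x)"
    using assms(1) smooth_differentiable frechet_derivative_works by blast
  then have "(g has_derivative frechet_derivative f (at x)) (at x)"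
    using assms(3-5) has_derivative_transform_within_open by blast
  then show ?thesis by (metis dir_deriv_eq dir_deriv_def)
qed

text \<open>Extension by zero. On the two open sets a derivative of \<open>g\<close> is again the
  derivative of \<open>f\<close> or zero, so the induction reproduces its own hypotheses.\<close>

lemma smooth_glue:
  assumes "smooth f" "open U" "open V" "U \<union> V = UNIV" "\<And>x. x \<in> U \<Longrightarrow> g x = f x"
    "\<And>x. x \<in> V \<Longrightarrow> g x = (0::real)"
  shows "smooth g"
proof -
  have "Cn n g" if "\<And>x. x \<in> U \<Longrightarrow> g x = f x" "\<And>x. x \<in> V \<Longrightarrow> g x = 0" "\<forall>m. Cn m f" for n and g f :: "'a \<Rightarrow> real"
    using that
  proof (induction n arbitrary: g f)
    have d: "g differentiable at x" if h: "\<And>x. x \<in> U \<Longrightarrow> g x = f x" "\<And>x. x \<in> V \<Longrightarrow> g x = 0" "\<forall>m. Cn m f" for x and g f :: "'a \<Rightarrow> real"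
    proof (cases "x \<in> U")
      case True
      have "f differentiable at x" using h Cn_differentiable by blast
      then show ?thesis
        unfolding differentiable_def using True h(1) assms(2)
        by (metis has_derivative_transform_within_open)
    next
      case False
      then have "x \<in> V" using assms(4) by auto
      then have "(g has_derivative (\<lambda>_. 0)) (at x)"
        using has_derivative_transform_within_open[OF has_derivative_const[of 0 "at x"] assms(3)] h(2) by auto
      then show ?thesis unfolding differentiable_def by blast
    qed
    case 0
    then show ?case using d by auto
    case (Suc n)
    have "Cn n (dir_deriv b g)" if b: "b \<in> Basis" for b
    proof (rule Suc.IH)
      show "\<forall>m. Cn m (dir_deriv b f)" using Suc.prems(3) b by (metis Cn.simps(2))
      show "dir_deriv b g x = dir_deriv b f x" if "x \<in> U" for x
      proof -
        have "(f has_derivative frechet_derivative f (at x)) (at x)"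
          using Suc.prems(3) Cn_differentiable frechet_derivative_works by blast
        then have "(g has_derivative frechet_derivative f (at x)) (at x)"
          using has_derivative_transform_within_open[OF _ assms(2) that] Suc.prems(1) by metis
        then show ?thesis by (metis dir_deriv_eq dir_deriv_def)
      qed
      show "dir_deriv b g x = 0" if "x \<in> V" for x
      proof -
        have "(g has_derivative (\<lambda>_. 0)) (at x)"
          using has_derivative_transform_within_open[OF has_derivative_const[of 0 "at x"] assms(3) that] Suc.prems(2) by auto
        then show ?thesis by (simp add: dir_deriv_eq)
      qed
    qed
    then show ?case using d[OF Suc.prems] by auto
  qed
  then show ?thesis using assms unfolding smooth_iff_Cn by blast
qed

subsection \<open>Smooth cut-off functions\<close>

text \<open>The functions \<open>x^(-k) exp(-1/x)\<close> on the positive axis, extended by zero.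
  The whole family is considered because the derivative of a member is a linear combination of two
  others, which makes smoothness of the case \<open>k = 0\<close> a single induction.\<close>

definition flat :: "nat \<Rightarrow> real \<Rightarrow> real" where
  "flat k x = (if x > 0 then inverse x ^ k * exp (- inverse x) else 0)"

lemma flat_has_derivative:
  "(flat k has_real_derivative (flat (k + 2) x - k * flat (k + 1) x)) (at x)"
proof -
  consider "x > 0" | "x < 0" | "x = 0" by linarith
  then show ?thesis
  proof cases
    case 1
    have "((\<lambda>x. inverse x ^ k * exp (- inverse x)) has_real_derivative
        (real k * inverse x ^ (k - 1) * (- (inverse x * inverse x)) * exp (- inverse x)
          + inverse x ^ k * (exp (- inverse x) * (inverse x * inverse x)))) (at x)"
      using 1 by (auto intro!: derivative_eq_intros simp: power2_eq_square)
    moreover have "real k * inverse x ^ (k - 1) * (- (inverse x * inverse x)) * exp (- inverse x)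
          + inverse x ^ k * (exp (- inverse x) * (inverse x * inverse x)) = flat (k + 2) x - k * flat (k + 1) x"
      using 1 by (cases k) (simp_all add: flat_def algebra_simps)
    ultimately have "((\<lambda>x. inverse x ^ k * exp (- inverse x)) has_real_derivative
        (flat (k + 2) x - k * flat (k + 1) x)) (at x)" by simp
    then show ?thesis
      by (rule has_field_derivative_transform_within_open[of _ _ _ "{0<..}"]) (use 1 in \<open>auto simp: flat_def\<close>)
  next
    case 2
    have "((\<lambda>x. 0) has_real_derivative 0) (at x)" by simp
    then have "(flat k has_real_derivative 0) (at x)"
      by (rule has_field_derivative_transform_within_open[of _ _ _ "{..<0}"]) (use 2 in \<open>auto simp: flat_def\<close>)
    then show ?thesis using 2 by (simp add: flat_def)
  next
    case 3
    \<comment> \<open>The difference quotient at the origin takes this form after substituting the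
      inverse; the power is \<open>k + 1\<close> because of the division by
      \<open>y\<close>.\<close>
    have lim: "((\<lambda>y. y ^ (k + 1) * exp (- y)) \<longlongrightarrow> (0::real)) at_top"
      using tendsto_power_div_exp_0[of "k + 1"] by (simp add: exp_minus field_simps)
    have "((\<lambda>y. inverse y ^ (k + 1) * exp (- inverse y)) \<longlongrightarrow> (0::real)) (at_right 0)"
      using filterlim_compose[OF lim filterlim_inverse_at_top_right] by simp
    then have r: "((\<lambda>y. flat k y / y) \<longlongrightarrow> 0) (at_right 0)"
      by (rule Lim_transform_eventually) (auto simp: flat_def eventually_at_right_field field_simps intro!: exI[of _ 1])
    have l: "((\<lambda>y. flat k y / y) \<longlongrightarrow> 0) (at_left 0)"
      by (rule Lim_transform_eventually[OF tendsto_const]) (auto simp: flat_def eventually_at_left_field intro!: exI[of _ "-1"])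
    have "((\<lambda>y. flat k y / y) \<longlongrightarrow> 0) (at 0)"
      using r l by (simp add: filterlim_at_split)
    then show ?thesis
      using 3 by (simp add: has_field_derivative_iff flat_def)
  qed
qed

lemma Cn_flat: "Cn n (flat k)"
proof (induction n arbitrary: k)
  case 0
  show ?case using flat_has_derivative unfolding Cn.simps differentiable_def has_field_derivative_def by blast
next
  case (Suc n)
  have "dir_deriv 1 (flat k) = (\<lambda>x. flat (k + 2) x + (- real k) * flat (k + 1) x)"
    by (rule ext, subst dir_deriv_eq[OF flat_has_derivative[unfolded has_field_derivative_def]]) auto
  moreover have "flat k differentiable at x" for x
    using flat_has_derivative unfolding differentiable_def has_field_derivative_def by blast
  moreover have "Cn n (\<lambda>x. flat (k + 2) x + (- real k) * flat (k + 1) x)"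
    by (intro Cn_add Cn_mult Cn_const Suc)
  ultimately show ?case by simp
qed

abbreviation bump :: "real \<Rightarrow> real" where "bump \<equiv> flat 0"

lemma smooth_bump: "smooth bump"
  by (simp add: smooth_iff_Cn Cn_flat)

lemma bump_pos: "x > 0 \<Longrightarrow> bump x > 0" and bump_nonpos: "x \<le> 0 \<Longrightarrow> bump x = 0"
  and bump_nonneg: "0 \<le> bump x" and bump_le_1: "bump x \<le> 1"
  by (auto simp: flat_def)

lemma smooth_step:
  assumes "p < (q::real)"
  obtains s where "smooth s" "\<And>x. x \<le> p \<Longrightarrow> s x = 0" "\<And>x. q \<le> x \<Longrightarrow> s x = 1"
proof
  let ?s = "\<lambda>x. bump (x - p) / (bump (x - p) + bump (q - x))"
  have "bump (x - p) + bump (q - x) \<noteq> 0" for x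
    using bump_pos[of "x - p"] bump_pos[of "q - x"] bump_nonneg[of "x - p"] bump_nonneg[of "q - x"] assms
    by (smt (verit))
  then show "smooth ?s"
    by (intro smooth_divide smooth_add smooth_comp_real[OF smooth_bump] smooth_diff smooth_const smooth_ident)
  show "?s x = 0" if "x \<le> p" for x using that by (simp add: bump_nonpos)
  show "?s x = 1" if "q \<le> x" for x using that assms bump_pos[of "x - p"] by (simp add: bump_nonpos)
qed

lemma smooth_plateau:
  assumes "p < p'" "p' \<le> q'" "q' < (q::real)"
  obtains s where "smooth s" "\<And>x. x \<le> p \<or> q \<le> x \<Longrightarrow> s x = 0" "\<And>x. p' \<le> x \<Longrightarrow> x \<le> q' \<Longrightarrow> s x = 1"
proof -
  obtain s where s: "smooth s" "\<And>x. x \<le> p \<Longrightarrow> s x = 0" "\<And>x. p' \<le> x \<Longrightarrow> s x = 1"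
    using smooth_step[OF assms(1)] by blast
  obtain r where r: "smooth r" "\<And>x. x \<le> -q \<Longrightarrow> r x = 0" "\<And>x. -q' \<le> x \<Longrightarrow> r x = 1"
    using smooth_step[of "-q" "-q'"] assms by auto
  show thesis
  proof (rule that)
    show "smooth (\<lambda>x. s x * r (- x))"
      by (intro smooth_mult s smooth_comp_real[OF r(1)] smooth_minus smooth_ident)
  qed (use s r in auto)
qed

section \<open>One-dimensional Hausdorff measure\<close>

text \<open>The set function underlying \<open>hausdorff1\<close>, under a name of its own because
  \<open>measure_of\<close> is known to return it only once the Borel sets are shown to be
  measurable for it.\<close>

definition outer1 :: "plane set \<Rightarrow> ennreal" where
  "outer1 A = (SUP \<delta>\<in>{0<..}. hausdorff_pre \<delta> A)"

lemma hausdorff_pre_le: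
  assumes "A \<subseteq> (\<Union>n. C n)" "\<And>n::nat. bounded (C n)" "\<And>n. diameter (C n) \<le> \<delta>"
  shows "hausdorff_pre \<delta> A \<le> (\<Sum>n. ennreal (diameter (C n)))"
  unfolding hausdorff_pre_def using assms by (intro Inf_lower) blast

lemma le_hausdorff_pre:
  assumes "\<And>C::nat \<Rightarrow> plane set. A \<subseteq> (\<Union>n. C n) \<Longrightarrow> (\<And>n. bounded (C n)) \<Longrightarrow> (\<And>n. diameter (C n) \<le> \<delta>)
     \<Longrightarrow> x \<le> (\<Sum>n. ennreal (diameter (C n)))"
  shows "x \<le> hausdorff_pre \<delta> A"
  unfolding hausdorff_pre_def using assms by (intro Inf_greatest) blast

lemma hausdorff_pre_mono: "A \<subseteq> B \<Longrightarrow> hausdorff_pre \<delta> A \<le> hausdorff_pre \<delta> B"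
  by (rule le_hausdorff_pre, rule hausdorff_pre_le) auto

lemma hausdorff_pre_antimono: "\<delta> \<le> \<delta>' \<Longrightarrow> hausdorff_pre \<delta>' A \<le> hausdorff_pre \<delta> A"
  by (rule le_hausdorff_pre, rule hausdorff_pre_le) (auto intro: order_trans)

lemma hausdorff_pre_empty: "0 \<le> \<delta> \<Longrightarrow> hausdorff_pre \<delta> {} = 0"
  using hausdorff_pre_le[of "{}" "\<lambda>_. {}" \<delta>] by simp

text \<open>Coverings of the sets \<open>A i\<close> that are optimal up to
  \<open>e / 2^(i+1)\<close> are merged into one sequence by the pairing function; the errors add up
  to \<open>e\<close>.\<close>

lemma hausdorff_pre_UN_le:
  assumes "0 < \<delta>"
  shows "hausdorff_pre \<delta> (\<Union>i. A i) \<le> (\<Sum>i::nat. hausdorff_pre \<delta> (A i))"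
proof (rule ennreal_le_epsilon)
  fix e :: real assume fin: "(\<Sum>i. hausdorff_pre \<delta> (A i)) < top" and e: "0 < e"
  have "\<exists>C::nat \<Rightarrow> plane set. A i \<subseteq> (\<Union>n. C n) \<and> (\<forall>n. bounded (C n) \<and> diameter (C n) \<le> \<delta>) \<and>
      (\<Sum>n. ennreal (diameter (C n))) \<le> hausdorff_pre \<delta> (A i) + ennreal (e * (1/2) ^ Suc i)" for i
  proof (rule ccontr)
    assume no: "\<not> ?thesis"
    have "hausdorff_pre \<delta> (A i) + ennreal (e * (1/2) ^ Suc i) \<le> hausdorff_pre \<delta> (A i)"
      by (rule le_hausdorff_pre) (metis no linear)
    moreover have "hausdorff_pre \<delta> (A i) < top"
      using fin by (rule ennreal_suminf_lessD)
    moreover have "0 < ennreal (e * (1/2) ^ Suc i)" using e by simp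
    ultimately show False
      by (metis ennreal_add_left_cancel_less add.right_neutral less_le_not_le top.not_eq_extremum)
  qed
  then obtain C where C: "\<And>i. A i \<subseteq> (\<Union>n. C i n)" "\<And>i n. bounded (C i n) \<and> diameter (C i n) \<le> \<delta>"
    "\<And>i. (\<Sum>n::nat. ennreal (diameter (C i n))) \<le> hausdorff_pre \<delta> (A i) + ennreal (e * (1/2) ^ Suc i)"
    by metis
  let ?D = "\<lambda>k. case_prod C (prod_decode k)"
  have "hausdorff_pre \<delta> (\<Union>i. A i) \<le> (\<Sum>k. ennreal (diameter (?D k)))"
  proof (rule hausdorff_pre_le)
    show "(\<Union>i. A i) \<subseteq> (\<Union>k. ?D k)"
    proof safe
      fix x i assume "x \<in> A i"
      then obtain n where "x \<in> C i n" using C(1) by blast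
      then have "x \<in> ?D (prod_encode (i, n))" by simp
      then show "x \<in> (\<Union>k. ?D k)" by (rule UN_I[OF UNIV_I])
    qed
  qed (use C(2) in \<open>auto split: prod.splits\<close>)
  also have "\<dots> = (\<Sum>i. \<Sum>n. ennreal (diameter (C i n)))"
    using suminf_ennreal_2dimen[of "\<lambda>i. \<Sum>n. ennreal (diameter (C i n))" "\<lambda>p. ennreal (diameter (case_prod C p))"]
    by simp
  also have "\<dots> \<le> (\<Sum>i. hausdorff_pre \<delta> (A i) + ennreal (e * (1/2) ^ Suc i))"
    by (rule suminf_le) (use C(3) in auto)
  also have "\<dots> = (\<Sum>i. hausdorff_pre \<delta> (A i)) + (\<Sum>i. ennreal e * ennreal ((1/2) ^ Suc i))"
    using e by (subst suminf_add[symmetric]) (auto simp del: power_Suc simp: ennreal_mult)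
  also have "\<dots> = (\<Sum>i. hausdorff_pre \<delta> (A i)) + e"
    unfolding ennreal_suminf_cmult
    by (subst suminf_ennreal_eq[OF zero_le_power power_half_series]) auto
  finally show "hausdorff_pre \<delta> (\<Union>i. A i) \<le> (\<Sum>i. hausdorff_pre \<delta> (A i)) + e" .
qed

lemma hausdorff_pre_le_outer: "0 < \<delta> \<Longrightarrow> hausdorff_pre \<delta> A \<le> outer1 A"
  unfolding outer1_def by (rule SUP_upper) auto

lemma outer1_mono: "A \<subseteq> B \<Longrightarrow> outer1 A \<le> outer1 B"
  unfolding outer1_def by (intro SUP_mono) (auto intro: hausdorff_pre_mono)

lemma outer1_empty: "outer1 {} = 0"
  unfolding outer1_def by (rule antisym) (auto intro!: SUP_least simp: hausdorff_pre_empty)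

lemma outer1_UN_le: "outer1 (\<Union>i. A i) \<le> (\<Sum>i::nat. outer1 (A i))"
  unfolding outer1_def[of "\<Union>i. A i"]
  by (intro SUP_least order_trans[OF hausdorff_pre_UN_le] suminf_le hausdorff_pre_le_outer) auto

lemma outer1_Un_le: "outer1 (A \<union> B) \<le> outer1 A + outer1 B"
proof -
  let ?F = "\<lambda>i::nat. if i = 0 then A else if i = 1 then B else {}"
  have "A \<union> B = (\<Union>i. ?F i)" by (auto split: if_splits)
  then have "outer1 (A \<union> B) = outer1 (\<Union>i. ?F i)" by (rule arg_cong)
  also have "\<dots> \<le> (\<Sum>i. outer1 (?F i))"
    by (rule outer1_UN_le)
  also have "\<dots> = (\<Sum>i\<in>{0,1}. outer1 (?F i))"
    by (rule suminf_finite) (auto simp: outer1_empty)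
  finally show ?thesis by simp
qed

text \<open>A set of diameter below \<open>d\<close> meets at most one of \<open>A\<close> and
  \<open>B\<close>, so a fine covering of the union separates into coverings of the two
  parts.\<close>

lemma outer1_metric:
  assumes d: "0 < d" and AB: "\<And>a b. a \<in> A \<Longrightarrow> b \<in> B \<Longrightarrow> d \<le> dist a b"
  shows "outer1 A + outer1 B \<le> outer1 (A \<union> B)"
proof -
  have pre: "hausdorff_pre \<delta> A + hausdorff_pre \<delta> B \<le> hausdorff_pre \<delta> (A \<union> B)" if \<delta>: "0 < \<delta>" "\<delta> < d" for \<delta>
  proof (rule le_hausdorff_pre)
    fix C :: "nat \<Rightarrow> plane set"
    assume C: "A \<union> B \<subseteq> (\<Union>n. C n)" "\<And>n. bounded (C n)" "\<And>n. diameter (C n) \<le> \<delta>"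
    let ?A = "\<lambda>n. if C n \<inter> A \<noteq> {} then C n else {}"
    let ?B = "\<lambda>n. if C n \<inter> B \<noteq> {} then C n else {}"
    have "A \<subseteq> (\<Union>n. ?A n)" using C(1) by (force split: if_splits)
    then have "hausdorff_pre \<delta> A \<le> (\<Sum>n. ennreal (diameter (?A n)))"
      by (rule hausdorff_pre_le) (use C(2,3) \<delta> in auto)
    moreover have "B \<subseteq> (\<Union>n. ?B n)" using C(1) by (force split: if_splits)
    then have "hausdorff_pre \<delta> B \<le> (\<Sum>n. ennreal (diameter (?B n)))"
      by (rule hausdorff_pre_le) (use C(2,3) \<delta> in auto)
    ultimately have "hausdorff_pre \<delta> A + hausdorff_pre \<delta> B
        \<le> (\<Sum>n. ennreal (diameter (?A n))) + (\<Sum>n. ennreal (diameter (?B n)))"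
      by (rule add_mono)
    also have "\<dots> = (\<Sum>n. ennreal (diameter (?A n)) + ennreal (diameter (?B n)))"
      by (rule suminf_add) auto
    also have "\<dots> \<le> (\<Sum>n. ennreal (diameter (C n)))"
    proof (rule suminf_le)
      fix n
      have "C n \<inter> A = {} \<or> C n \<inter> B = {}"
      proof (rule ccontr)
        assume "\<not> ?thesis"
        then obtain a b where ab: "a \<in> C n" "a \<in> A" "b \<in> C n" "b \<in> B" by blast
        have "dist a b \<le> diameter (C n)" using diameter_bounded_bound[OF C(2) ab(1,3)] .
        then show False using AB[OF ab(2,4)] C(3)[of n] \<delta> by linarith
      qed
      then show "ennreal (diameter (?A n)) + ennreal (diameter (?B n)) \<le> ennreal (diameter (C n))"
        by auto
    qed auto
    finally show "hausdorff_pre \<delta> A + hausdorff_pre \<delta> B \<le> (\<Sum>n. ennreal (diameter (C n)))" .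
  qed
  \<comment> \<open>Independent mesh sizes for the two sets allow the two suprema to be taken one
    after the other.\<close>
  have both: "hausdorff_pre \<delta>1 A + hausdorff_pre \<delta>2 B \<le> outer1 (A \<union> B)" if "0 < \<delta>1" "0 < \<delta>2" for \<delta>1 \<delta>2
  proof -
    let ?d = "min (d/2) (min \<delta>1 \<delta>2)"
    have "hausdorff_pre \<delta>1 A + hausdorff_pre \<delta>2 B \<le> hausdorff_pre ?d A + hausdorff_pre ?d B"
      by (intro add_mono hausdorff_pre_antimono) auto
    also have "\<dots> \<le> hausdorff_pre ?d (A \<union> B)" using that d by (intro pre) auto
    also have "\<dots> \<le> outer1 (A \<union> B)" using that d by (intro hausdorff_pre_le_outer) auto
    finally show ?thesis .
  qed
  have "hausdorff_pre \<delta>1 A + outer1 B \<le> outer1 (A \<union> B)" if "0 < \<delta>1" for \<delta>1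
    unfolding outer1_def[of B]
    by (subst ennreal_SUP_add_right) (use both that in \<open>auto intro!: SUP_least\<close>)
  then show ?thesis
    unfolding outer1_def[of A]
    by (subst ennreal_SUP_add_left[symmetric]) (auto intro!: SUP_least)
qed

text \<open>The standard argument for metric outer measures: the points of \<open>A\<close> at
  distance at least \<open>1/(n+1)\<close> from \<open>F\<close> are separated from
  \<open>F\<close>, and what is left of \<open>A - F\<close> is a union of thin rings whose outer
  measures are summable, so that the tail is small.\<close>

lemma closed_caratheodory:
  assumes "closed F"
  shows "outer1 (A \<inter> F) + outer1 (A - F) \<le> outer1 A"
proof (cases "F = {} \<or> outer1 A = top")
  case True
  then show ?thesis by (auto simp: outer1_empty)
next
  case False
  then have F: "F \<noteq> {}" and fin: "outer1 A < top" by (auto simp: top.not_eq_extremum)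
  \<comment> \<open>Rings \<open>R n\<close> around \<open>F\<close> whose indices have the same parity are at positive distance from each other.\<close>
  define An where "An n = {x \<in> A. inverse (real (Suc n)) \<le> infdist x F}" for n
  define R where "R n = {x \<in> A. inverse (real (Suc (Suc n))) \<le> infdist x F \<and> infdist x F < inverse (real (Suc n))}" for n
  have inv: "inverse (real (Suc m)) < inverse (real (Suc n))" if "n < m" for n m
    using that by simp
  have met: "outer1 (A \<inter> F) + outer1 (An n) \<le> outer1 A" for n
  proof -
    have "outer1 (A \<inter> F) + outer1 (An n) \<le> outer1 ((A \<inter> F) \<union> An n)"
    proof (rule outer1_metric)
      fix a b assume "a \<in> A \<inter> F" "b \<in> An n"
      then show "inverse (real (Suc n)) \<le> dist a b"
        using infdist_le[of a F b] by (auto simp: An_def dist_commute)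
    qed simp
    also have "\<dots> \<le> outer1 A" by (rule outer1_mono) (auto simp: An_def)
    finally show ?thesis .
  qed
  have rings: "(\<Sum>k<N. outer1 (R (2 * k + p))) \<le> outer1 (\<Union>k<N. R (2 * k + p))" for N p
  proof (induction N)
    case (Suc N)
    have "(\<Sum>k<Suc N. outer1 (R (2 * k + p)))
        \<le> outer1 (\<Union>k<N. R (2 * k + p)) + outer1 (R (2 * N + p))"
      using Suc by (simp add: add_right_mono)
    also have "\<dots> \<le> outer1 ((\<Union>k<N. R (2 * k + p)) \<union> R (2 * N + p))"
    proof (cases N)
      case 0
      then show ?thesis by (simp add: outer1_empty)
    next
      case (Suc M)
      let ?d = "inverse (real (Suc (2 * N + p - 1))) - inverse (real (Suc (2 * N + p)))"
      show ?thesis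
      proof (rule outer1_metric)
        show "0 < ?d" using Suc by (auto intro!: inv[simplified])
        fix a b assume "a \<in> (\<Union>k<N. R (2 * k + p))" and b: "b \<in> R (2 * N + p)"
        then obtain k where k: "k < N" "a \<in> R (2 * k + p)" by blast
        have "inverse (real (Suc (2 * N + p - 1))) \<le> inverse (real (Suc (Suc (2 * k + p))))"
          using k(1) by (intro le_imp_inverse_le) auto
        also have "\<dots> \<le> infdist a F" using k(2) by (simp add: R_def)
        finally have "?d \<le> infdist a F - infdist b F" using b by (simp add: R_def)
        also have "\<dots> \<le> dist a b" using infdist_triangle[of a F b] by simp
        finally show "?d \<le> dist a b" .
      qed
    qed
    also have "\<dots> = outer1 (\<Union>k<Suc N. R (2 * k + p))"
      by (rule arg_cong[where f=outer1]) (auto simp: less_Suc_eq)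
    finally show ?case .
  qed simp
  have rings_le: "(\<Sum>k<N. outer1 (R (2 * k + p))) \<le> outer1 A" for N p
    by (rule order_trans[OF rings outer1_mono]) (auto simp: R_def)
  \<comment> \<open>The rings of even index and those of odd index contribute at most
    \<open>outer1 A\<close> each.\<close>
  have sum_le: "(\<Sum>k<N. outer1 (R k)) \<le> 2 * outer1 A" for N
  proof -
    have "(\<Sum>k<2 * M. outer1 (R k)) =
       (\<Sum>k<M. outer1 (R (2 * k + 0))) + (\<Sum>k<M. outer1 (R (2 * k + 1)))" for M
      by (induction M) (auto simp: ac_simps)
    then have "(\<Sum>k<2 * N. outer1 (R k)) \<le> outer1 A + outer1 A"
      using rings_le by (metis add_mono)
    moreover have "(\<Sum>k<N. outer1 (R k)) \<le> (\<Sum>k<2 * N. outer1 (R k))"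
      by (rule sum_mono2) auto
    ultimately show ?thesis by (simp add: mult_2)
  qed
  define r where "r k = enn2real (outer1 (R k))" for k
  have r: "ennreal (r k) = outer1 (R k)" for k
  proof -
    have "outer1 (R k) \<le> outer1 A" by (rule outer1_mono) (auto simp: R_def)
    then show ?thesis using fin by (simp add: r_def)
  qed
  have r0: "0 \<le> r k" for k by (simp add: r_def)
  have "summable r"
  proof (rule summableI_nonneg_bounded[OF r0])
    fix n
    have "ennreal (\<Sum>k<n. r k) \<le> 2 * outer1 A"
      using sum_le[of n] by (simp add: sum_ennreal[symmetric] r r0)
    then show "(\<Sum>k<n. r k) \<le> enn2real (2 * outer1 A)"
      using fin by (metis enn2real_ennreal enn2real_mono ennreal_mult_less_top ennreal_numeral_less_top sum_nonneg r0)
  qed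
  show ?thesis
  proof (rule ennreal_le_epsilon)
    fix e :: real assume "0 < e"
    obtain N where N: "norm (\<Sum>i. r (i + N)) < e"
      using suminf_exist_split[OF \<open>0 < e\<close> \<open>summable r\<close>] by blast
    have "A - F \<subseteq> An N \<union> (\<Union>i. R (i + N))"
    proof
      fix x assume x: "x \<in> A - F"
      then have pos: "0 < infdist x F"
        using assms F in_closed_iff_infdist_zero[OF assms F, of x] infdist_nonneg[of x F] by force
      show "x \<in> An N \<union> (\<Union>i. R (i + N))"
      proof (cases "x \<in> An N")
        case False
        let ?P = "\<lambda>n. inverse (real (Suc n)) \<le> infdist x F"
        have "\<exists>n. ?P n" using reals_Archimedean[OF pos] by (meson less_imp_le)
        \<comment> \<open>Minimality places \<open>x\<close> in the ring with index
          \<open>n - 1\<close>, and \<open>x\<close> lying outside \<open>An N\<close> forces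
          \<open>N < n\<close>.\<close>
        define n where "n = (LEAST n. ?P n)"
        have n: "?P n" "\<And>m. m < n \<Longrightarrow> \<not> ?P m"
          using LeastI_ex[OF \<open>\<exists>n. ?P n\<close>] not_less_Least unfolding n_def by blast+
        have "N < n"
        proof (rule ccontr)
          assume "\<not> N < n"
          then have "inverse (real (Suc N)) \<le> inverse (real (Suc n))" by (intro le_imp_inverse_le) auto
          then show False using order_trans[OF _ n(1)] False x by (auto simp: An_def)
        qed
        then obtain i where i: "n = Suc (i + N)" by (metis add.commute less_iff_Suc_add)
        have "x \<in> R (i + N)" using n(1) n(2)[of "i + N"] x i by (auto simp: R_def)
        then show ?thesis by blast
      qed simp
    qed
    then have "outer1 (A - F) \<le> outer1 (An N) + outer1 (\<Union>i. R (i + N))"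
      by (meson outer1_Un_le outer1_mono order_trans)
    also have "\<dots> \<le> outer1 (An N) + (\<Sum>i. ennreal (r (i + N)))"
      unfolding r by (intro add_left_mono outer1_UN_le)
    also have "(\<Sum>i. ennreal (r (i + N))) = ennreal (\<Sum>i. r (i + N))"
      by (rule suminf_ennreal2) (use r0 \<open>summable r\<close> summable_iff_shift in auto)
    also have "\<dots> \<le> ennreal e" using N by (intro ennreal_leI) auto
    finally have "outer1 (A - F) \<le> outer1 (An N) + e" by (simp add: add_left_mono)
    then have "outer1 (A \<inter> F) + outer1 (A - F) \<le> (outer1 (A \<inter> F) + outer1 (An N)) + e"
      by (simp add: add.assoc add_left_mono)
    also have "\<dots> \<le> outer1 A + e" by (intro add_right_mono met)
    finally show "outer1 (A \<inter> F) + outer1 (A - F) \<le> outer1 A + e" .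
  qed
qed

section \<open>The Hausdorff measure on the Borel sets\<close>

lemma sets_hausdorff1 [simp, measurable_cong]: "sets hausdorff1 = sets borel"
  unfolding hausdorff1_def by (metis sets.sets_measure_of_eq space_borel)

lemma space_hausdorff1 [simp]: "space hausdorff1 = UNIV"
  using sets_eq_imp_space_eq[OF sets_hausdorff1] by simp

text \<open>Caratheodory's construction gives a measure on the sets that split every set additively.
  Closed sets do so by the preceding estimate, and they generate the Borel sets.\<close>

lemma measure_space_hausdorff: "measure_space UNIV (sets borel) outer1"
proof -
  interpret sigma_algebra UNIV "Pow UNIV :: plane set set" by (rule sigma_algebra_Pow)
  let ?L = "lambda_system UNIV (Pow UNIV) outer1"
  have oms: "outer_measure_space (Pow UNIV) outer1"
    unfolding outer_measure_space_def
    by (auto simp: positive_def outer1_empty increasing_def outer1_mono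
          countably_subadditive_def outer1_UN_le)
  have L: "measure_space UNIV ?L outer1" by (rule caratheodory_lemma[OF oms])
  have "closed F \<Longrightarrow> F \<in> ?L" for F
    unfolding lambda_system_def
  proof (clarsimp, rule antisym)
    fix A assume "closed F"
    then show "outer1 (F \<inter> A) + outer1 ((UNIV - F) \<inter> A) \<le> outer1 A"
      using closed_caratheodory[of F A] by (simp add: Int_commute Diff_eq)
    show "outer1 A \<le> outer1 (F \<inter> A) + outer1 ((UNIV - F) \<inter> A)"
      by (rule order_trans[OF outer1_mono outer1_Un_le]) auto
  qed
  then have "sets borel \<subseteq> ?L"
    unfolding borel_eq_closed using L
    using sigma_algebra.sigma_sets_subset[of UNIV ?L "Collect closed"]
    by (simp add: measure_space_def subset_eq)
  then show ?thesis
    by (rule measure_down[OF L _, rotated]) (metis sets.sigma_algebra_axioms space_borel)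
qed

lemma emeasure_hausdorff1: "A \<in> sets borel \<Longrightarrow> emeasure hausdorff1 A = outer1 A"
  using measure_space_hausdorff
  by (intro emeasure_measure_of[OF hausdorff1_def[folded outer1_def]])
     (auto simp: measure_space_def)

section \<open>Hausdorff measure under Lipschitz maps and along curves\<close>

lemma diameter_image_le:
  fixes f :: "plane \<Rightarrow> plane"
  assumes "\<And>x y. dist (f x) (f y) \<le> K * dist x y" "bounded C" "0 \<le> K"
  shows "diameter (f ` C) \<le> K * diameter C"
proof (rule diameter_le)
  show "f ` C \<noteq> {} \<or> 0 \<le> K * diameter C" using assms(3) diameter_ge_0[OF assms(2)] by simp
  fix u v assume "u \<in> f ` C" "v \<in> f ` C"
  then obtain x y where xy: "x \<in> C" "y \<in> C" "u = f x" "v = f y" by blast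
  have "dist u v \<le> K * dist x y" using assms(1) xy by simp
  also have "\<dots> \<le> K * diameter C"
    by (rule mult_left_mono[OF diameter_bounded_bound[OF assms(2) xy(1,2)] assms(3)])
  finally show "norm (u - v) \<le> K * diameter C" by (simp add: dist_norm)
qed

lemma outer1_lipschitz_image:
  assumes lip: "\<And>x y. dist (f x) (f y) \<le> K * dist x y" and K: "0 < K"
  shows "outer1 (f ` A) \<le> ennreal K * outer1 A"
  unfolding outer1_def[of "f ` A"]
proof (rule SUP_least)
  fix \<delta> :: real assume "\<delta> \<in> {0<..}"
  then have \<delta>: "0 < \<delta>" by simp
  have "hausdorff_pre \<delta> (f ` A) / ennreal K \<le> hausdorff_pre (\<delta> / K) A"
  proof (rule le_hausdorff_pre)
    fix C :: "nat \<Rightarrow> plane set"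
    assume C: "A \<subseteq> (\<Union>n. C n)" "\<And>n. bounded (C n)" "\<And>n. diameter (C n) \<le> \<delta> / K"
    have d: "diameter (f ` C n) \<le> K * diameter (C n)" for n
      by (rule diameter_image_le[OF lip C(2) less_imp_le[OF K]])
    have "hausdorff_pre \<delta> (f ` A) \<le> (\<Sum>n. ennreal (diameter (f ` C n)))"
    proof (rule hausdorff_pre_le)
      show "bounded (f ` C n)" for n
      proof -
        obtain e x where e: "\<forall>y\<in>C n. dist x y \<le> e" using C(2)[of n] bounded_def by metis
        have "dist (f x) (f y) \<le> K * e" if "y \<in> C n" for y
          using lip[of x y] e that K by (meson mult_le_cancel_left_pos order_trans)
        then show ?thesis unfolding bounded_def by blast
      qed
      show "diameter (f ` C n) \<le> \<delta>" for n
        using d[of n] C(3)[of n] K by (simp add: field_simps)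
      show "f ` A \<subseteq> (\<Union>n. f ` C n)" using C(1) by blast
    qed
    also have "\<dots> \<le> (\<Sum>n. ennreal K * ennreal (diameter (C n)))"
      using K d by (intro suminf_le) (auto simp: ennreal_mult[symmetric] diameter_ge_0 C(2) intro!: ennreal_leI)
    also have "\<dots> = ennreal K * (\<Sum>n. ennreal (diameter (C n)))" by simp
    finally show "hausdorff_pre \<delta> (f ` A) / ennreal K \<le> (\<Sum>n. ennreal (diameter (C n)))"
      using K by (simp add: divide_le_posI_ennreal mult.commute)
  qed
  also have "\<dots> \<le> outer1 A" using \<delta> K by (intro hausdorff_pre_le_outer) auto
  finally have "ennreal K * (hausdorff_pre \<delta> (f ` A) / ennreal K) \<le> ennreal K * outer1 A"
    by (rule mult_left_mono) simp
  moreover have "ennreal K * (hausdorff_pre \<delta> (f ` A) / ennreal K) = hausdorff_pre \<delta> (f ` A)"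
    using K by (subst mult.commute, subst ennreal_divide_times) (simp add: ennreal_divide_self)
  ultimately show "hausdorff_pre \<delta> (f ` A) \<le> ennreal K * outer1 A" by simp
qed

text \<open>If a curve does not contract distances, the parameters sent into \<open>C n\<close> lie
  in an interval of length \<open>diameter (C n)\<close>. This comparison bounds integrals along the
  edges of a rectangle by integrals against \<open>hausdorff1\<close>.\<close>

lemma lebesgue_le_hausdorff:
  fixes \<iota> :: "real \<Rightarrow> plane"
  assumes \<iota>: "\<And>s t. \<bar>s - t\<bar> \<le> dist (\<iota> s) (\<iota> t)"
  shows "{s. \<iota> s \<in> E} \<in> sets borel \<Longrightarrow> emeasure lborel {s. \<iota> s \<in> E} \<le> outer1 E"
proof -
  assume meas: "{s. \<iota> s \<in> E} \<in> sets borel"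
  have "emeasure lborel {s. \<iota> s \<in> E} \<le> hausdorff_pre 1 E"
  proof (rule le_hausdorff_pre)
    fix C :: "nat \<Rightarrow> plane set"
    assume C: "E \<subseteq> (\<Union>n. C n)" "\<And>n. bounded (C n)" "\<And>n. diameter (C n) \<le> 1"
    let ?S = "\<lambda>n. {s. \<iota> s \<in> C n}"
    have "\<exists>a. ?S n \<subseteq> {a .. a + diameter (C n)}" for n
    proof (cases "?S n = {}")
      case False
      have d: "\<bar>s - t\<bar> \<le> diameter (C n)" if "s \<in> ?S n" "t \<in> ?S n" for s t
        using \<iota>[of s t] diameter_bounded_bound[OF C(2), of "\<iota> s" n "\<iota> t"] that by auto
      obtain t where t: "t \<in> ?S n" using False by blast
      have bd: "bdd_below (?S n)"
        using d[OF t] by (intro bdd_belowI[of _ "t - diameter (C n)"]) fastforce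
      have "s \<in> {Inf (?S n) .. Inf (?S n) + diameter (C n)}" if s: "s \<in> ?S n" for s
      proof -
        have "Inf (?S n) \<le> s" by (rule cInf_lower[OF s bd])
        moreover have "s - diameter (C n) \<le> Inf (?S n)"
          using d[OF s] False by (intro cInf_greatest) fastforce+
        ultimately show ?thesis by auto
      qed
      then show ?thesis by blast
    qed auto
    then obtain a where a: "\<And>n. ?S n \<subseteq> {a n .. a n + diameter (C n)}" by metis
    have "emeasure lborel {s. \<iota> s \<in> E} \<le> emeasure lborel (\<Union>n. {a n .. a n + diameter (C n)})"
      using a C(1) by (intro emeasure_mono) fastforce+
    also have "\<dots> \<le> (\<Sum>n. emeasure lborel {a n .. a n + diameter (C n)})"
      by (rule emeasure_subadditive_countably) auto
    also have "\<dots> = (\<Sum>n. ennreal (diameter (C n)))" using diameter_ge_0[OF C(2)] by simp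
    finally show "emeasure lborel {s. \<iota> s \<in> E} \<le> (\<Sum>n. ennreal (diameter (C n)))" .
  qed
  also have "\<dots> \<le> outer1 E" by (rule hausdorff_pre_le_outer) simp
  finally show ?thesis .
qed

lemma nn_integral_segment_le:
  fixes \<iota> :: "real \<Rightarrow> plane"
  assumes \<iota>: "\<And>s t. \<bar>s - t\<bar> \<le> dist (\<iota> s) (\<iota> t)" "continuous_on UNIV \<iota>"
    and h: "h \<in> borel_measurable borel"
  shows "(\<integral>\<^sup>+s. h (\<iota> s) \<partial>lborel) \<le> (\<integral>\<^sup>+x. h x \<partial>hausdorff1)"
proof -
  have m: "\<iota> \<in> borel_measurable borel" using \<iota>(2) by (rule borel_measurable_continuous_onI)
  have "(\<integral>\<^sup>+s. h (\<iota> s) \<partial>lborel) = (\<integral>\<^sup>+x. h x \<partial>distr lborel borel \<iota>)"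
    using m h by (subst nn_integral_distr) auto
  also have "\<dots> \<le> (\<integral>\<^sup>+x. h x \<partial>hausdorff1)"
  proof (rule nn_integral_mono_measure)
    show "distr lborel borel \<iota> \<le> hausdorff1"
    proof (subst le_measure)
      show "\<forall>A\<in>sets (distr lborel borel \<iota>). emeasure (distr lborel borel \<iota>) A \<le> emeasure hausdorff1 A"
      proof
        fix A assume "A \<in> sets (distr lborel borel \<iota>)"
        then have A: "A \<in> sets borel" by simp
        have "{s. \<iota> s \<in> A} \<in> sets borel" using measurable_sets[OF m A] by (simp add: vimage_def)
        then show "emeasure (distr lborel borel \<iota>) A \<le> emeasure hausdorff1 A"
          using lebesgue_le_hausdorff[OF \<iota>(1), of A] m A
          by (simp add: emeasure_distr emeasure_hausdorff1 vimage_def)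
      qed
    qed simp
  qed simp
  finally show ?thesis .
qed

text \<open>One constant serves both directions, so that the locale applies to the inverse as well
  (\<open>swap\<close>). Images of sets become preimages under the other map, which keeps them
  Borel.\<close>

locale lipschitz_homeo =
  fixes T S :: "plane \<Rightarrow> plane" and K :: real
  assumes ST: "S (T x) = x" and TS: "T (S x) = x" and K: "0 < K"
    and lipS: "dist (S x) (S y) \<le> K * dist x y" and lipT: "dist (T x) (T y) \<le> K * dist x y"
begin

lemma continuous_T: "continuous_on A T"
proof -
  have "K-lipschitz_on A T" using lipT K by (intro lipschitz_onI) auto
  then show ?thesis by (rule lipschitz_on_continuous_on)
qed

lemma swap: "lipschitz_homeo S T K"
  using ST TS K lipS lipT by unfold_locales auto

lemma emeasure_vimage_le:
  assumes "A \<in> sets borel"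
  shows "emeasure hausdorff1 (T -` A) \<le> ennreal K * emeasure hausdorff1 A"
proof -
  have "T -` A \<in> sets borel"
    using measurable_sets[OF borel_measurable_continuous_onI[OF continuous_T] assms] by simp
  moreover have "T -` A = S ` A" by (auto simp: TS) (metis ST image_iff)
  ultimately show ?thesis
    using outer1_lipschitz_image[OF lipS K, of A] assms by (simp add: emeasure_hausdorff1)
qed

lemma nn_integral_comp_le:
  assumes h: "h \<in> borel_measurable borel"
  shows "(\<integral>\<^sup>+x. h (T x) \<partial>hausdorff1) \<le> ennreal K * (\<integral>\<^sup>+x. h x \<partial>hausdorff1)"
proof -
  have m: "T \<in> borel_measurable borel" by (rule borel_measurable_continuous_onI[OF continuous_T])
  have "(\<integral>\<^sup>+x. h (T x) \<partial>hausdorff1) = (\<integral>\<^sup>+x. h x \<partial>distr hausdorff1 borel T)"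
    using m h by (subst nn_integral_distr) auto
  also have "\<dots> \<le> (\<integral>\<^sup>+x. h x \<partial>scale_measure (ennreal K) hausdorff1)"
  proof (rule nn_integral_mono_measure)
    show "distr hausdorff1 borel T \<le> scale_measure (ennreal K) hausdorff1"
      by (subst le_measure) (use emeasure_vimage_le m in \<open>auto simp: emeasure_distr\<close>)
  qed simp
  also have "\<dots> = ennreal K * (\<integral>\<^sup>+x. h x \<partial>hausdorff1)"
    using h by (subst nn_integral_scale_measure) auto
  finally show ?thesis .
qed

lemma AE_hausdorff1_comp:
  assumes "AE x in hausdorff1. P x"
  shows "AE x in hausdorff1. P (T x)"
proof -
  obtain N where N: "{x. \<not> P x} \<subseteq> N" "emeasure hausdorff1 N = 0" "N \<in> sets borel"
    using assms by (auto elim!: AE_E)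
  have "emeasure hausdorff1 (T -` N) = 0" using emeasure_vimage_le[OF N(3)] N(2) by simp
  moreover have "T -` N \<in> sets borel"
    using measurable_sets[OF borel_measurable_continuous_onI[OF continuous_T] N(3)] by simp
  ultimately show ?thesis using N(1) by (intro AE_I[of _ _ "T -` N"]) auto
qed

end

section \<open>Uniqueness of weak derivatives\<close>

lemma set_integral_lebesgue_on:
  fixes f :: "'a::euclidean_space \<Rightarrow> 'b::euclidean_space"
  assumes "S \<in> sets lebesgue"
  shows "(LINT x:S|lebesgue. f x) = integral\<^sup>L (lebesgue_on S) f"
  using integral_restrict_space[of S lebesgue f] assms by (simp add: set_lebesgue_integral_def)

lemma set_integrable_lebesgue_on:
  fixes f :: "'a::euclidean_space \<Rightarrow> 'b::euclidean_space"
  assumes "S \<in> sets lebesgue"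
  shows "set_integrable lebesgue S f \<longleftrightarrow> integrable (lebesgue_on S) f"
  using integrable_restrict_space[of S lebesgue f] assms by (simp add: set_integrable_def)

lemma borel_imp_lebesgue: "f \<in> borel_measurable borel \<Longrightarrow> f \<in> borel_measurable lebesgue"
  by (rule measurable_completion) simp

text \<open>The positive and the negative part of \<open>h\<close> are densities of two measures
  that agree on open boxes. Boxes are stable under intersection and generate the Borel sets, so the
  densities agree almost everywhere, and both parts of a number are equal only if the number is
  zero.\<close>

lemma borel_zero_on_boxes_AE:
  fixes h :: "'a::euclidean_space \<Rightarrow> real"
  assumes h: "integrable lborel h"
    and zero: "\<And>a b. (LINT x|lborel. indicator (box a b) x * h x) = 0"
  shows "AE x in lborel. h x = 0"
proof -
  have m [measurable]: "h \<in> borel_measurable lborel" using h by auto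
  have fin: "(\<integral>\<^sup>+x. ennreal (g x) * indicator A x \<partial>lborel) < \<infinity>" if "integrable lborel g" "A \<in> sets borel" for g A
  proof -
    have "(\<integral>\<^sup>+x. ennreal (g x) * indicator A x \<partial>lborel) \<le> (\<integral>\<^sup>+x. ennreal (norm (g x)) \<partial>lborel)"
      by (intro nn_integral_mono) (auto simp: indicator_def intro!: ennreal_leI)
    also have "\<dots> < \<infinity>" using that(1) integrable_iff_bounded by blast
    finally show ?thesis .
  qed
  have int: "integrable lborel (\<lambda>x. indicator A x * h x)" if "A \<in> sets borel" for A
    using integrable_mult_indicator[OF _ h, of A] that by simp
  have eq: "(\<integral>\<^sup>+x. ennreal (h x) * indicator (box a b) x \<partial>lborel) = (\<integral>\<^sup>+x. ennreal (- h x) * indicator (box a b) x \<partial>lborel)" for a b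
  proof -
    let ?P = "\<integral>\<^sup>+x. ennreal (h x) * indicator (box a b) x \<partial>lborel"
    let ?N = "\<integral>\<^sup>+x. ennreal (- h x) * indicator (box a b) x \<partial>lborel"
    have "(\<integral>\<^sup>+x. ennreal (indicator (box a b) x * h x) \<partial>lborel) = ?P"
      by (intro nn_integral_cong) (auto simp: indicator_def)
    moreover have "(\<integral>\<^sup>+x. ennreal (- (indicator (box a b) x * h x)) \<partial>lborel) = ?N"
      by (intro nn_integral_cong) (auto simp: indicator_def)
    ultimately have "enn2real ?P - enn2real ?N = 0"
      using real_lebesgue_integral_def[OF int[of "box a b"]] zero[of a b] by simp
    moreover have "?P < \<infinity>" by (rule fin[OF h]) simp
    moreover have "?N < \<infinity>" by (rule fin) (use h in auto)
    ultimately show ?thesis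
      by (metis ennreal_enn2real eq_iff_diff_eq_0 infinity_ennreal_def)
  qed
  have "density lborel (\<lambda>x. ennreal (h x)) = density lborel (\<lambda>x. ennreal (- h x))"
  proof (rule measure_eqI_generator_eq[where E="range (\<lambda>(a, b). box a b)" and \<Omega>=UNIV and A="\<lambda>n. box (- real n *\<^sub>R One) (real n *\<^sub>R One)"])
    show "Int_stable (range (\<lambda>(a, b). box a b :: 'a set))"
      by (auto simp: Int_stable_def box_Int_box)
    show "sets (density lborel (\<lambda>x. ennreal (h x))) = sigma_sets UNIV (range (\<lambda>(a, b). box a b))"
      "sets (density lborel (\<lambda>x. ennreal (- h x))) = sigma_sets UNIV (range (\<lambda>(a, b). box a b))"
      by (simp_all add: borel_eq_box)
    show "(\<Union>n. box (- real n *\<^sub>R One) (real n *\<^sub>R One)) = (UNIV :: 'a set)"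
      using UN_box_eq_UNIV by simp
    fix X assume "X \<in> range (\<lambda>(a, b). box a b :: 'a set)"
    then obtain a b where X: "X = box a b" by auto
    show "emeasure (density lborel (\<lambda>x. ennreal (h x))) X = emeasure (density lborel (\<lambda>x. ennreal (- h x))) X"
      unfolding X using eq[of a b] by (simp add: emeasure_density)
  next
    show "emeasure (density lborel (\<lambda>x. ennreal (h x))) (box (- real n *\<^sub>R One) (real n *\<^sub>R One)) \<noteq> \<infinity>" for n
      using fin[OF h, of "box (- real n *\<^sub>R One) (real n *\<^sub>R One)"] by (simp add: emeasure_density less_top)
  qed auto
  then have "AE x in lborel. ennreal (h x) = ennreal (- h x)"
    by (intro sigma_finite_measure.density_unique[OF sigma_finite_lborel]) auto
  then show ?thesis
    by eventually_elim (smt (verit) ennreal_eq_0_iff ennreal_neg)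
qed

text \<open>Localisation of the preceding lemma: \<open>S\<close> is a countable union of closed
  boxes, on each of which \<open>g\<close> is integrable, and the boundaries of these boxes are null
  sets.\<close>

lemma zero_on_boxes_AE:
  fixes g :: "'a::euclidean_space \<Rightarrow> real"
  assumes S: "open S" and g: "loc_integrable S g"
    and zero: "\<And>a b. cbox a b \<subseteq> S \<Longrightarrow> (LINT x:box a b|lebesgue. g x) = 0"
  shows "AE x in lebesgue. x \<in> S \<longrightarrow> g x = 0"
proof -
  have box: "AE x in lebesgue. x \<in> box a b \<longrightarrow> g x = 0" if ab: "cbox a b \<subseteq> S" for a b
  proof -
    have int: "integrable lebesgue (\<lambda>x. indicator (cbox a b) x * g x)"
      using g ab unfolding loc_integrable_def set_integrable_def by auto
    let ?h = "\<lambda>x. indicator (box a b) x * g x"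
    have "integrable lebesgue (\<lambda>x. indicator (box a b) x * (indicator (cbox a b) x * g x))"
      using integrable_mult_indicator[OF _ int, of "box a b"] by simp
    moreover have "indicator (box a b) x * (indicator (cbox a b) x * g x) = ?h x" for x
      using box_subset_cbox[of a b] by (auto simp: indicator_def)
    ultimately have h: "integrable lebesgue ?h" by simp
    \<comment> \<open>A Borel representative, since the uniqueness argument for densities runs on
      the Borel sets.\<close>
    then obtain h' where h': "h' \<in> borel_measurable lborel" "AE x in lborel. ?h x = h' x"
      using completion_ex_borel_measurable_real[of ?h lborel] by auto
    have ae: "AE x in lebesgue. ?h x = h' x" using h'(2) by (rule AE_completion)
    have m': "h' \<in> borel_measurable lebesgue" using h'(1) by (simp add: borel_imp_lebesgue)
    have "integrable lebesgue h'"
      using integrable_cong_AE[OF _ m' ae] h by auto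
    then have i': "integrable lborel h'" using integrable_completion[OF h'(1)] by simp
    have "AE x in lborel. h' x = 0"
    proof (rule borel_zero_on_boxes_AE[OF i'])
      fix c d
      let ?f = "\<lambda>x. indicator (box c d) x * h' x"
      have "integral\<^sup>L lborel ?f = integral\<^sup>L lebesgue ?f"
        by (rule integral_completion[symmetric]) (use h'(1) in measurable)
      also have "\<dots> = (LINT x|lebesgue. indicator (box c d) x * ?h x)"
      proof (rule integral_cong_AE)
        have b: "indicat_real (box c d) \<in> borel_measurable lebesgue" by (intro borel_imp_lebesgue) simp
        show "?f \<in> borel_measurable lebesgue" by (intro borel_measurable_times b m')
        show "(\<lambda>x. indicator (box c d) x * ?h x) \<in> borel_measurable lebesgue"
          by (intro borel_measurable_times[OF b] borel_measurable_integrable h)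
        show "AE x in lebesgue. ?f x = indicator (box c d) x * ?h x"
          using ae by eventually_elim simp
      qed
      also have "\<dots> = 0"
      proof (cases "box c d \<inter> box a b = {}")
        case True
        then have "indicator (box c d) x * ?h x = 0" for x by (auto simp: indicator_def)
        then show ?thesis by (simp only: Bochner_Integration.integral_zero)
      next
        case False
        obtain p q where pq: "box c d \<inter> box a b = box p q" using box_Int_box[of c d a b] by blast
        have "closure (box p q) \<subseteq> cbox a b"
          using pq box_subset_cbox[of a b] by (intro closure_minimal) auto
        then have "cbox p q \<subseteq> cbox a b" using False pq by (simp add: closure_box)
        then have "(LINT x:box p q|lebesgue. g x) = 0" using zero ab by blast
        moreover have "indicator (box c d) x * ?h x = indicator (box p q) x *\<^sub>R g x" for x
          unfolding pq[symmetric] by (auto simp: indicator_def)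
        ultimately show ?thesis by (simp only: set_lebesgue_integral_def)
      qed
      finally show "integral\<^sup>L lborel ?f = 0" .
    qed
    then have "AE x in lebesgue. h' x = 0" by (rule AE_completion)
    with ae show ?thesis by eventually_elim (auto simp: indicator_def split: if_splits)
  qed
  obtain \<D> where D: "countable \<D>" "\<D> \<subseteq> Pow S" "\<And>X. X \<in> \<D> \<Longrightarrow> \<exists>a b. X = cbox a b" "\<Union>\<D> = S"
    using open_countable_Union_open_cbox[OF S] by metis
  have nx: "AE x in lebesgue. x \<in> X \<longrightarrow> g x = 0" if XD: "X \<in> \<D>" for X
  proof -
    obtain a b where X: "X = cbox a b" using D(3)[OF XD] by blast
    have "negligible (cbox a b - box a b)" by (rule negligible_frontier_interval)
    then have "AE x in lebesgue. x \<notin> cbox a b - box a b"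
      unfolding negligible_iff_null_sets by (rule AE_not_in)
    moreover have "AE x in lebesgue. x \<in> box a b \<longrightarrow> g x = 0" using box X D(2) XD by blast
    ultimately show ?thesis unfolding X by eventually_elim auto
  qed
  have "AE x in lebesgue. \<forall>X\<in>\<D>. x \<in> X \<longrightarrow> g x = 0"
    unfolding AE_ball_countable[OF D(1)] using nx by blast
  then show ?thesis by eventually_elim (use D(4) in blast)
qed

lemma set_lebesgue_integral_eq_zero_off:
  fixes f :: "'a::euclidean_space \<Rightarrow> real"
  assumes "\<And>x. x \<in> S \<Longrightarrow> x \<notin> A \<Longrightarrow> f x = 0" "A \<subseteq> S"
  shows "(LINT x:S|lebesgue. f x) = (LINT x:A|lebesgue. f x)"
  unfolding set_lebesgue_integral_def
  by (rule Bochner_Integration.integral_cong) (use assms in \<open>auto simp: indicator_def\<close>)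

text \<open>The indicator of a box is the pointwise limit of products of flat functions, as
  \<^term>\<open>bump (n * t)\<close> tends to one for positive \<open>t\<close>.\<close>

lemma fundamental_lemma:
  fixes g :: "'a::euclidean_space \<Rightarrow> real"
  assumes S: "open S" and g: "loc_integrable S g"
    and zero: "\<And>\<phi>. test_fun S \<phi> \<Longrightarrow> (LINT x:S|lebesgue. g x * \<phi> x) = 0"
  shows "AE x in lebesgue. x \<in> S \<longrightarrow> g x = 0"
proof (rule zero_on_boxes_AE[OF S g])
  fix a b :: 'a assume ab: "cbox a b \<subseteq> S"
  let ?\<phi> = "\<lambda>n x. \<Prod>i\<in>Basis. bump (real n * ((x - a) \<bullet> i)) * bump (real n * ((b - x) \<bullet> i))"
  have sm: "smooth (?\<phi> n)" for n
    by (intro smooth_prod smooth_mult smooth_comp_real[OF smooth_bump] smooth_const)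
       (auto simp: inner_diff_left intro!: smooth_diff smooth_inner smooth_const)
  have supp: "?\<phi> n x = 0" if "x \<notin> box a b" for n x
  proof -
    obtain i where "i \<in> Basis" "\<not> (a \<bullet> i < x \<bullet> i \<and> x \<bullet> i < b \<bullet> i)"
      using \<open>x \<notin> box a b\<close> unfolding mem_box by blast
    then have i: "i \<in> Basis" "(x - a) \<bullet> i \<le> 0 \<or> (b - x) \<bullet> i \<le> 0"
      by (auto simp: inner_diff_left)
    then have "bump (real n * ((x - a) \<bullet> i)) * bump (real n * ((b - x) \<bullet> i)) = 0"
      by (auto simp: bump_nonpos mult_nonneg_nonpos)
    then show ?thesis using i(1) by (intro prod_zero) auto
  qed
  have test: "test_fun S (?\<phi> n)" for n
  proof -
    have "{x. ?\<phi> n x \<noteq> 0} \<subseteq> cbox a b" using supp box_subset_cbox by blast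
    then have "closure {x. ?\<phi> n x \<noteq> 0} \<subseteq> cbox a b" by (rule closure_minimal) (rule closed_cbox)
    moreover from this have "compact (closure {x. ?\<phi> n x \<noteq> 0})"
      by (meson bounded_cbox bounded_subset closed_closure compact_eq_bounded_closed)
    ultimately show ?thesis using sm ab unfolding test_fun_def by blast
  qed
  have int: "integrable lebesgue (\<lambda>x. indicator (cbox a b) x * g x)"
    using g ab unfolding loc_integrable_def set_integrable_def by auto
  have gm: "(\<lambda>x. indicator (cbox a b) x * g x) \<in> borel_measurable lebesgue" using int by auto
  have le1: "\<bar>?\<phi> n x\<bar> \<le> 1" for n x
    unfolding abs_prod by (rule prod_le_1) (auto simp: abs_mult bump_nonneg bump_le_1 intro: mult_le_one)
  have lim: "(\<lambda>n. ?\<phi> n x) \<longlonglongrightarrow> indicator (box a b) x" for x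
  proof (cases "x \<in> box a b")
    case True
    have bl: "(\<lambda>n. bump (real n * t)) \<longlonglongrightarrow> 1" if "0 < t" for t
    proof -
      have "(\<lambda>n. exp (- (inverse (real n) * inverse t))) \<longlonglongrightarrow> exp (- (0 * inverse t))"
        by (intro tendsto_intros lim_inverse_n)
      moreover have "\<forall>\<^sub>F n in sequentially. exp (- (inverse (real n) * inverse t)) = bump (real n * t)"
        using eventually_gt_at_top[of 0] by eventually_elim (use that in \<open>simp add: flat_def\<close>)
      ultimately show ?thesis using Lim_transform_eventually by force
    qed
    have "(\<lambda>n. ?\<phi> n x) \<longlonglongrightarrow> (\<Prod>i\<in>(Basis::'a set). 1 * 1)"
      using True by (intro tendsto_prod tendsto_mult bl) (auto simp: mem_box inner_diff_left)
    then show ?thesis using True by simp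
  next
    case False
    show ?thesis by (simp only: supp[OF False]) (simp add: False)
  qed
  have "(\<lambda>n. LINT x|lebesgue. (indicator (cbox a b) x * g x) * ?\<phi> n x) \<longlonglongrightarrow>
        (LINT x|lebesgue. (indicator (cbox a b) x * g x) * indicator (box a b) x)"
  proof (rule integral_dominated_convergence[where w="\<lambda>x. norm (indicator (cbox a b) x * g x)"])
    show "(\<lambda>x. indicator (cbox a b) x * g x * ?\<phi> n x) \<in> borel_measurable lebesgue" for n
      by (rule borel_measurable_times[OF gm borel_imp_lebesgue[OF smooth_borel[OF sm]]])
    show "(\<lambda>x. indicator (cbox a b) x * g x * indicator (box a b) x) \<in> borel_measurable lebesgue"
      by (rule borel_measurable_times[OF gm borel_imp_lebesgue]) simp
    show "AE x in lebesgue. (\<lambda>n. indicator (cbox a b) x * g x * ?\<phi> n x) \<longlonglongrightarrow> indicator (cbox a b) x * g x * indicator (box a b) x"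
      by (intro AE_I2 tendsto_mult tendsto_const lim)
    show "AE x in lebesgue. norm (indicator (cbox a b) x * g x * ?\<phi> n x) \<le> norm (indicator (cbox a b) x * g x)" for n
      using le1 by (intro AE_I2) (simp add: abs_mult mult_left_le)
  qed (use int in auto)
  moreover have "(LINT x|lebesgue. (indicator (cbox a b) x * g x) * ?\<phi> n x) = 0" for n
  proof -
    have "(LINT x|lebesgue. (indicator (cbox a b) x * g x) * ?\<phi> n x) = (LINT x:cbox a b|lebesgue. g x * ?\<phi> n x)"
      by (simp add: set_lebesgue_integral_def mult.assoc)
    also have "\<dots> = (LINT x:S|lebesgue. g x * ?\<phi> n x)"
    proof (rule set_lebesgue_integral_eq_zero_off[symmetric, OF _ ab])
      fix x assume "x \<notin> cbox a b"
      then have "x \<notin> box a b" using box_subset_cbox by blast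
      then show "g x * ?\<phi> n x = 0" by (simp only: supp[OF \<open>x \<notin> box a b\<close>] mult_zero_right)
    qed
    finally show ?thesis using zero[OF test[of n]] by simp
  qed
  ultimately have "(LINT x|lebesgue. (indicator (cbox a b) x * g x) * indicator (box a b) x) = 0"
    by (simp add: LIMSEQ_const_iff)
  moreover have "indicator (cbox a b) x * g x * indicator (box a b) x = indicator (box a b) x *\<^sub>R g x" for x
    using box_subset_cbox[of a b] by (auto simp: indicator_def)
  ultimately show "(LINT x:box a b|lebesgue. g x) = 0" by (simp add: set_lebesgue_integral_def)
qed

lemma test_fun_vanish:
  assumes "test_fun S \<phi>" "x \<notin> closure {x. \<phi> x \<noteq> 0}"
  shows "\<phi> x = 0" "dir_deriv b \<phi> x = 0"
proof -
  have "x \<notin> {x. \<phi> x \<noteq> 0}" using assms(2) by (meson closure_subset subsetD)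
  then show "\<phi> x = 0" by simp
  have "smooth \<phi>" using assms(1) by (simp add: test_fun_def)
  have "dir_deriv b \<phi> x = dir_deriv b (\<lambda>_. 0) x"
  proof (rule smooth_locally_eq[OF \<open>smooth \<phi>\<close> smooth_const])
    show "open (- closure {x. \<phi> x \<noteq> 0})" by (simp add: open_Compl)
    show "x \<in> - closure {x. \<phi> x \<noteq> 0}" using assms(2) by simp
    fix y assume "y \<in> - closure {x. \<phi> x \<noteq> 0}"
    then have "y \<notin> {x. \<phi> x \<noteq> 0}" by (meson ComplD closure_subset subsetD)
    then show "\<phi> y = 0" by simp
  qed
  then show "dir_deriv b \<phi> x = 0" by (simp add: dir_deriv_const)
qed

lemma set_integrable_mult_continuous:
  fixes g \<phi> :: "'a::euclidean_space \<Rightarrow> real"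
  assumes K: "compact K" and g: "set_integrable lebesgue K g" and c: "continuous_on UNIV \<phi>"
  shows "set_integrable lebesgue K (\<lambda>x. g x * \<phi> x)"
proof -
  have "bounded (\<phi> ` K)"
    using compact_continuous_image[OF continuous_on_subset[OF c] K] by (auto intro: compact_imp_bounded)
  then obtain M where M: "\<And>x. x \<in> K \<Longrightarrow> \<bar>\<phi> x\<bar> \<le> M" by (auto simp: bounded_iff)
  show ?thesis
    unfolding set_integrable_def
  proof (rule Bochner_Integration.integrable_bound)
    show "integrable lebesgue (\<lambda>x. M * (indicator K x *\<^sub>R g x))"
      using g unfolding set_integrable_def by (rule integrable_mult_right)
    have "(\<lambda>x. (indicator K x *\<^sub>R g x) * \<phi> x) \<in> borel_measurable lebesgue"
      using g c unfolding set_integrable_def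
      by (intro borel_measurable_times) (auto intro: borel_imp_lebesgue borel_measurable_continuous_onI)
    then show "(\<lambda>x. indicator K x *\<^sub>R (g x * \<phi> x)) \<in> borel_measurable lebesgue" by (simp add: mult.assoc)
    show "AE x in lebesgue. norm (indicator K x *\<^sub>R (g x * \<phi> x)) \<le> norm (M * (indicator K x *\<^sub>R g x))"
    proof (intro AE_I2)
      fix x show "norm (indicator K x *\<^sub>R (g x * \<phi> x)) \<le> norm (M * (indicator K x *\<^sub>R g x))"
        using M[of x] by (auto simp: indicator_def abs_mult mult.commute[of M] intro!: mult_left_mono)
    qed
  qed
qed

lemma loc_integrable_test_integrable:
  fixes g :: "'a::euclidean_space \<Rightarrow> real"
  assumes g: "loc_integrable S g" and t: "test_fun S \<phi>" and b: "b \<in> Basis"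
  shows "set_integrable lebesgue S (\<lambda>x. g x * \<phi> x)" "set_integrable lebesgue S (\<lambda>x. g x * dir_deriv b \<phi> x)"
proof -
  let ?K = "closure {x. \<phi> x \<noteq> 0}"
  have K: "compact ?K" "?K \<subseteq> S" "smooth \<phi>" using t by (auto simp: test_fun_def)
  have gK: "set_integrable lebesgue ?K g" using g K unfolding loc_integrable_def by blast
  have eq: "indicator S x *\<^sub>R (g x * \<psi> x) = indicator ?K x *\<^sub>R (g x * \<psi> x)"
    if "\<And>x. x \<notin> ?K \<Longrightarrow> \<psi> x = 0" for \<psi> x using that[of x] K(2) by (auto simp: indicator_def)
  have e1: "indicator S x *\<^sub>R (g x * \<phi> x) = indicator ?K x *\<^sub>R (g x * \<phi> x)" for x
    by (rule eq) (rule test_fun_vanish(1)[OF t])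
  have e2: "indicator S x *\<^sub>R (g x * dir_deriv b \<phi> x) = indicator ?K x *\<^sub>R (g x * dir_deriv b \<phi> x)" for x
    by (rule eq) (rule test_fun_vanish(2)[OF t])
  show "set_integrable lebesgue S (\<lambda>x. g x * \<phi> x)"
    using set_integrable_mult_continuous[OF K(1) gK smooth_continuous_on[OF K(3)]]
    unfolding set_integrable_def by (simp only: e1)
  show "set_integrable lebesgue S (\<lambda>x. g x * dir_deriv b \<phi> x)"
    using set_integrable_mult_continuous[OF K(1) gK smooth_continuous_on[OF smooth_dir_deriv[OF K(3) b]]]
    unfolding set_integrable_def by (simp only: e2)
qed

lemma loc_integrable_diff:
  assumes "loc_integrable S f" "loc_integrable S g" shows "loc_integrable S (\<lambda>x. f x - g x)"
  using assms unfolding loc_integrable_def by (auto intro: set_integral_diff)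

lemma weak_deriv_unique_AE:
  assumes S: "open S" and b: "b \<in> Basis" and gh: "is_weak_deriv S b f g" "is_weak_deriv S b f h"
  shows "AE x in lebesgue. x \<in> S \<longrightarrow> g x = h x"
proof -
  have li: "loc_integrable S g" "loc_integrable S h" using gh by (auto simp: is_weak_deriv_def)
  have "AE x in lebesgue. x \<in> S \<longrightarrow> g x - h x = 0"
  proof (rule fundamental_lemma[OF S loc_integrable_diff[OF li]])
    fix \<phi> assume t: "test_fun S \<phi>"
    have "(LINT x:S|lebesgue. g x * \<phi> x) = (LINT x:S|lebesgue. h x * \<phi> x)"
      using gh t unfolding is_weak_deriv_def by (metis neg_equal_iff_equal)
    then show "(LINT x:S|lebesgue. (g x - h x) * \<phi> x) = 0"
      using loc_integrable_test_integrable(1)[OF li(1) t b] loc_integrable_test_integrable(1)[OF li(2) t b]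
      by (simp add: left_diff_distrib set_integral_diff)
  qed
  then show ?thesis by simp
qed

lemma is_weak_deriv_weak_deriv:
  "is_weak_deriv S b f g \<Longrightarrow> is_weak_deriv S b f (weak_deriv S b f)"
  unfolding weak_deriv_def by (metis someI)

lemma weak_deriv_eq_AE:
  assumes "open S" "b \<in> Basis" "is_weak_deriv S b f g"
  shows "AE x in lebesgue. x \<in> S \<longrightarrow> weak_deriv S b f x = g x"
  using weak_deriv_unique_AE[OF assms(1,2) is_weak_deriv_weak_deriv[OF assms(3)] assms(3)] .

section \<open>Integration over rectangles in the plane\<close>

lemma Basis_plane: "Basis = {axis 1 1, axis 2 1 :: plane}"
  by (auto simp: Basis_vec_def UNIV_2)

lemma axis_in_Basis [simp]: "axis j 1 \<in> (Basis :: plane set)"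
  using exhaust_2[of j] by (auto simp: Basis_plane)

lemma axis_1_neq_2 [simp]: "axis 1 1 \<noteq> (axis 2 1 :: plane)"
  by (simp add: axis_eq_axis)

definition pt :: "real \<Rightarrow> real \<Rightarrow> plane" where "pt s t = vector [s, t]"

lemma pt_nth [simp]: "pt s t $ 1 = s" "pt s t $ 2 = t"
  by (simp_all add: pt_def)

lemma pt_surj: "x = pt (x $ 1) (x $ 2)"
  by (simp add: vec_eq_iff forall_2)

lemma pt_expand: "pt s t = s *\<^sub>R axis 1 1 + t *\<^sub>R axis 2 1"
  by (simp add: vec_eq_iff forall_2 axis_def)

lemma continuous_on_pt [continuous_intros]:
  "continuous_on S f \<Longrightarrow> continuous_on S g \<Longrightarrow> continuous_on S (\<lambda>x. pt (f x) (g x))"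
  unfolding pt_expand by (intro continuous_intros)

lemma borel_pt [measurable]: "(\<lambda>(s, t). pt s t) \<in> borel_measurable (borel \<Otimes>\<^sub>M borel)"
  unfolding borel_prod by (intro borel_measurable_continuous_onI) (auto simp: case_prod_beta intro!: continuous_intros)

text \<open>Gives access to Fubini's theorem: vectors of type \<open>real^2\<close> are not pairs,
  so Lebesgue measure is exhibited as the image of the product measure under
  \<open>pt\<close>.\<close>

lemma lborel_plane: "(lborel :: plane measure) = distr (lborel \<Otimes>\<^sub>M lborel) borel (\<lambda>(s, t). pt s t)"
proof (rule lborel_eqI)
  have m: "(\<lambda>(s, t). pt s t) \<in> lborel \<Otimes>\<^sub>M lborel \<rightarrow>\<^sub>M borel"
    using borel_pt by (simp cong: measurable_cong_sets sets_pair_measure_cong)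
  fix l u :: plane assume lu: "\<And>b. b \<in> Basis \<Longrightarrow> l \<bullet> b \<le> u \<bullet> b"
  have le: "l $ 1 \<le> u $ 1" "l $ 2 \<le> u $ 2"
    using lu[of "axis 1 1"] lu[of "axis 2 1"] by (simp_all add: inner_axis)
  have "(\<lambda>(s, t). pt s t) -` box l u \<inter> space (lborel \<Otimes>\<^sub>M lborel) = {l$1<..<u$1} \<times> {l$2<..<u$2}"
    by (auto simp: mem_box Basis_plane inner_axis space_pair_measure)
  then show "emeasure (distr (lborel \<Otimes>\<^sub>M lborel) borel (\<lambda>(s, t). pt s t)) (box l u) = (\<Prod>b\<in>Basis. (u - l) \<bullet> b)"
    using le m by (simp add: emeasure_distr lborel.emeasure_pair_measure_Times Basis_plane inner_axis inner_diff_left ennreal_mult)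
qed simp

definition Rect :: "real \<Rightarrow> real \<Rightarrow> real \<Rightarrow> real \<Rightarrow> plane set" where
  "Rect a b c d = {x. a \<le> x$1 \<and> x$1 \<le> b \<and> c \<le> x$2 \<and> x$2 \<le> d}"

lemma Rect_cbox: "Rect a b c d = cbox (pt a c) (pt b d)"
  by (auto simp: Rect_def mem_box Basis_plane inner_axis)

lemma compact_Rect [simp]: "compact (Rect a b c d)" "closed (Rect a b c d)" "Rect a b c d \<in> sets borel"
    "Rect a b c d \<in> sets lebesgue"
  by (simp_all add: Rect_cbox closed_cbox)

lemma indicator_Rect: "indicator (Rect a b c d) (pt s t) = (indicator {a..b} s * indicator {c..d} t :: real)"
  by (auto simp: indicator_def Rect_def)

lemma Rect_integrable:
  fixes f :: "plane \<Rightarrow> real"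
  assumes "continuous_on UNIV f"
  shows "integrable lborel (\<lambda>x. indicator (Rect a b c d) x * f x :: real)"
  using borel_integrable_compact[OF compact_Rect(1) continuous_on_subset[OF assms], of a b c d] by simp

lemma integral_plane:
  assumes f: "integrable lborel (f :: plane \<Rightarrow> real)"
  shows "integral\<^sup>L lborel f = (LINT s|lborel. LINT t|lborel. f (pt s t))"
    and "integral\<^sup>L lborel f = (LINT t|lborel. LINT s|lborel. f (pt s t))"
proof -
  have fb: "f \<in> borel_measurable borel" using f by auto
  have m: "(\<lambda>(s, t). pt s t) \<in> lborel \<Otimes>\<^sub>M lborel \<rightarrow>\<^sub>M borel"
    using borel_pt by (simp cong: measurable_cong_sets sets_pair_measure_cong)
  have eq: "(\<lambda>p. f (case p of (s, t) \<Rightarrow> pt s t)) = (\<lambda>(s, t). f (pt s t))" by auto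
  have i: "integrable (lborel \<Otimes>\<^sub>M lborel) (\<lambda>(s, t). f (pt s t))"
    using f integrable_distr_eq[OF m fb, folded lborel_plane] unfolding eq by blast
  have "integral\<^sup>L lborel f = integral\<^sup>L (lborel \<Otimes>\<^sub>M lborel) (\<lambda>(s, t). f (pt s t))"
    using integral_distr[OF m fb, folded lborel_plane] unfolding eq .
  then show "integral\<^sup>L lborel f = (LINT s|lborel. LINT t|lborel. f (pt s t))"
    "integral\<^sup>L lborel f = (LINT t|lborel. LINT s|lborel. f (pt s t))"
    using lborel_pair.integral_fst'[OF i] lborel_pair.integral_snd[OF i] by simp_all
qed

lemma pt_has_derivative:
  "((\<lambda>s. pt s t) has_derivative (\<lambda>h. h *\<^sub>R axis 1 1)) (at s)"
  "((\<lambda>t. pt s t) has_derivative (\<lambda>h. h *\<^sub>R axis 2 1)) (at t)"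
  unfolding pt_expand by (auto intro!: derivative_eq_intros)

lemma dir_deriv_pt:
  assumes "smooth f"
  shows "((\<lambda>s. f (pt s t)) has_real_derivative dir_deriv (axis 1 1) f (pt s t)) (at s)"
    "((\<lambda>t. f (pt s t)) has_real_derivative dir_deriv (axis 2 1) f (pt s t)) (at t)"
proof -
  note F = differentiable_has_derivative_dir_deriv[OF smooth_differentiable[OF assms]]
  show "((\<lambda>s. f (pt s t)) has_real_derivative dir_deriv (axis 1 1) f (pt s t)) (at s)"
    "((\<lambda>t. f (pt s t)) has_real_derivative dir_deriv (axis 2 1) f (pt s t)) (at t)"
    using has_derivative_compose[OF pt_has_derivative(1) F] has_derivative_compose[OF pt_has_derivative(2) F]
    by (simp_all add: has_field_derivative_def Basis_plane inner_axis_axis mult_commute_abs)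
qed

lemma continuous_on_pt_comp:
  "continuous_on UNIV f \<Longrightarrow> continuous_on S (\<lambda>s. f (pt s t))"
  "continuous_on UNIV f \<Longrightarrow> continuous_on S (\<lambda>t. f (pt s t))"
  by (auto intro!: continuous_on_compose2[of UNIV f] continuous_intros)

lemma Rect_integral:
  fixes f :: "plane \<Rightarrow> real"
  assumes "continuous_on UNIV f"
  shows "(LINT x|lborel. indicator (Rect a b c d) x * f x) =
      (LINT s:{a..b}|lborel. (LINT t:{c..d}|lborel. f (pt s t)))"
    and "(LINT x|lborel. indicator (Rect a b c d) x * f x) =
      (LINT t:{c..d}|lborel. (LINT s:{a..b}|lborel. f (pt s t)))"
proof -
  have *: "indicator (Rect a b c d) (pt s t) = (indicator {c..d} t * indicator {a..b} s :: real)" for s t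
    by (simp add: indicator_Rect)
  show "(LINT x|lborel. indicator (Rect a b c d) x * f x) =
      (LINT s:{a..b}|lborel. (LINT t:{c..d}|lborel. f (pt s t)))"
    unfolding integral_plane(1)[OF Rect_integrable[OF assms, of a b c d]]
    by (simp add: indicator_Rect set_lebesgue_integral_def mult.assoc)
  show "(LINT x|lborel. indicator (Rect a b c d) x * f x) =
      (LINT t:{c..d}|lborel. (LINT s:{a..b}|lborel. f (pt s t)))"
    unfolding integral_plane(2)[OF Rect_integrable[OF assms, of a b c d]]
    by (simp add: * set_lebesgue_integral_def mult.assoc)
qed

lemma set_integral_FTC:
  fixes F f :: "real \<Rightarrow> real"
  assumes "a \<le> b" "\<And>x. (F has_real_derivative f x) (at x)" "continuous_on UNIV f"
  shows "(LINT t:{a..b}|lborel. f t) = F b - F a"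
  unfolding set_lebesgue_integral_def
  using assms by (intro integral_FTC_Icc)
    (auto simp: has_real_derivative_iff_has_vector_derivative[symmetric] intro: has_field_derivative_at_within continuous_on_subset)

lemma Rect_integral_dir_deriv:
  assumes f: "smooth f" and ab: "a \<le> b" "c \<le> d"
  shows "(LINT x|lborel. indicator (Rect a b c d) x * dir_deriv (axis 2 1) f x) =
      (LINT s:{a..b}|lborel. f (pt s d) - f (pt s c))"
    and "(LINT x|lborel. indicator (Rect a b c d) x * dir_deriv (axis 1 1) f x) =
      (LINT t:{c..d}|lborel. f (pt b t) - f (pt a t))"
proof -
  have c: "continuous_on UNIV (dir_deriv (axis j 1) f)" for j
    by (intro smooth_continuous_on smooth_dir_deriv f) simp
  have "(LINT t:{c..d}|lborel. dir_deriv (axis 2 1) f (pt s t)) = f (pt s d) - f (pt s c)" for s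
    by (rule set_integral_FTC[OF ab(2) dir_deriv_pt(2)[OF f] continuous_on_pt_comp(2)[OF c]])
  then show "(LINT x|lborel. indicator (Rect a b c d) x * dir_deriv (axis 2 1) f x) =
      (LINT s:{a..b}|lborel. f (pt s d) - f (pt s c))"
    by (simp add: Rect_integral(1)[OF c])
  have "(LINT s:{a..b}|lborel. dir_deriv (axis 1 1) f (pt s t)) = f (pt b t) - f (pt a t)" for t
    by (rule set_integral_FTC[OF ab(1) dir_deriv_pt(1)[OF f] continuous_on_pt_comp(1)[OF c]])
  then show "(LINT x|lborel. indicator (Rect a b c d) x * dir_deriv (axis 1 1) f x) =
      (LINT t:{c..d}|lborel. f (pt b t) - f (pt a t))"
    by (simp add: Rect_integral(2)[OF c])
qed

lemma lborel_eq_lebesgue_integral: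
  fixes f :: "'a::euclidean_space \<Rightarrow> real"
  shows "f \<in> borel_measurable borel \<Longrightarrow> integral\<^sup>L lebesgue f = integral\<^sup>L lborel f"
  by (rule integral_completion) simp

text \<open>Both mixed derivatives have the same integral over every rectangle, namely the
  alternating sum of \<open>f\<close> over the four corners. Their difference thus vanishes almost
  everywhere, and everywhere by continuity.\<close>

lemma clairaut:
  fixes f :: "plane \<Rightarrow> real"
  assumes f: "smooth f"
  shows "dir_deriv (axis 1 1) (dir_deriv (axis 2 1) f) = dir_deriv (axis 2 1) (dir_deriv (axis 1 1) f)"
proof -
  let ?h = "\<lambda>x. dir_deriv (axis 1 1) (dir_deriv (axis 2 1) f) x - dir_deriv (axis 2 1) (dir_deriv (axis 1 1) f) x"
  have sm: "smooth (dir_deriv (axis j 1) f)" "smooth (dir_deriv (axis i 1) (dir_deriv (axis j 1) f))" for i j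
    by (auto intro!: smooth_dir_deriv f)
  have c: "continuous_on S ?h" for S by (intro smooth_continuous_on smooth_diff sm)
  have hb: "?h \<in> borel_measurable borel" by (intro borel_measurable_continuous_onI c)
  have "AE x in lebesgue. x \<in> UNIV \<longrightarrow> ?h x = 0"
  proof (rule zero_on_boxes_AE)
    have "integrable lborel (\<lambda>x. indicator K x *\<^sub>R ?h x)" if "compact K" for K
      using borel_integrable_compact[OF that c] .
    then have "integrable lebesgue (\<lambda>x. indicator K x *\<^sub>R ?h x)" if "compact K" for K
      using that hb by (subst integrable_completion) (auto simp: compact_imp_closed)
    then show "loc_integrable UNIV ?h"
      unfolding loc_integrable_def set_integrable_def by blast
    fix p q :: plane
    show "(LINT x:box p q|lebesgue. ?h x) = 0"
    proof (cases "box p q = {}")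
      case False
      then have pq: "p $ 1 \<le> q $ 1" "p $ 2 \<le> q $ 2"
        by (auto simp: box_eq_empty Basis_plane inner_axis not_le intro: less_imp_le)
      have R: "Rect (p$1) (q$1) (p$2) (q$2) = cbox p q"
        unfolding Rect_cbox by (simp add: pt_surj[symmetric])
      let ?R = "Rect (p$1) (q$1) (p$2) (q$2)"
      have lin: "(LINT t:{a..b}|lborel. f (u t) - f (v t)) = (LINT t:{a..b}|lborel. f (u t)) - (LINT t:{a..b}|lborel. f (v t))"
        if "continuous_on UNIV (\<lambda>t. f (u t))" "continuous_on UNIV (\<lambda>t. f (v t))" for f :: "plane \<Rightarrow> real" and u v and a b :: real
        by (rule set_integral_diff(2)[OF borel_integrable_atLeastAtMost'[OF continuous_on_subset[OF that(1)]]
              borel_integrable_atLeastAtMost'[OF continuous_on_subset[OF that(2)]]]) auto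
      have "(LINT x|lborel. indicator ?R x * dir_deriv (axis 1 1) (dir_deriv (axis 2 1) f) x)
          = (LINT t:{p$2..q$2}|lborel. dir_deriv (axis 2 1) f (pt (q$1) t)) - (LINT t:{p$2..q$2}|lborel. dir_deriv (axis 2 1) f (pt (p$1) t))"
        unfolding Rect_integral_dir_deriv(2)[OF sm(1) pq]
        by (intro lin continuous_on_pt_comp smooth_continuous_on sm)
      also have "\<dots> = (f (pt (q$1) (q$2)) - f (pt (q$1) (p$2))) - (f (pt (p$1) (q$2)) - f (pt (p$1) (p$2)))"
        by (intro arg_cong2[where f="(-)"] set_integral_FTC[OF pq(2) dir_deriv_pt(2)[OF f] continuous_on_pt_comp(2)]
              smooth_continuous_on sm)
      also have "\<dots> = (f (pt (q$1) (q$2)) - f (pt (p$1) (q$2))) - (f (pt (q$1) (p$2)) - f (pt (p$1) (p$2)))" by simp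
      also have "\<dots> = (LINT t:{p$1..q$1}|lborel. dir_deriv (axis 1 1) f (pt t (q$2))) - (LINT t:{p$1..q$1}|lborel. dir_deriv (axis 1 1) f (pt t (p$2)))"
        by (rule sym, intro arg_cong2[where f="(-)"] set_integral_FTC[OF pq(1) dir_deriv_pt(1)[OF f] continuous_on_pt_comp(1)]
              smooth_continuous_on sm)
      also have "\<dots> = (LINT x|lborel. indicator ?R x * dir_deriv (axis 2 1) (dir_deriv (axis 1 1) f) x)"
        unfolding Rect_integral_dir_deriv(1)[OF sm(1) pq]
        by (intro lin[symmetric] continuous_on_pt_comp smooth_continuous_on sm)
      finally have eq: "(LINT x|lborel. indicator ?R x * ?h x) = 0"
        using Rect_integrable[OF smooth_continuous_on[OF sm(2)]]
        by (simp add: right_diff_distrib)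
      have "(LINT x:box p q|lebesgue. ?h x) = (LINT x|lborel. indicator (box p q) x * ?h x)"
        unfolding set_lebesgue_integral_def using hb by (subst lborel_eq_lebesgue_integral) auto
      also have "\<dots> = (LINT x|lborel. indicator ?R x * ?h x)"
      proof (rule integral_cong_AE)
        have "AE x in lebesgue. x \<notin> cbox p q - box p q"
          using negligible_frontier_interval unfolding negligible_iff_null_sets by (rule AE_not_in)
        then have "AE x in lborel. x \<notin> cbox p q - box p q" by (simp add: AE_completion_iff)
        then show "AE x in lborel. indicator (box p q) x * ?h x = indicator ?R x * ?h x"
          unfolding R by eventually_elim (use box_subset_cbox in \<open>auto simp: indicator_def\<close>)
      qed (use hb in \<open>auto simp: R\<close>)
      finally show ?thesis using eq by simp
    qed (simp add: set_lebesgue_integral_def)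
  qed simp
  then have "AE x in lebesgue. x \<in> {x. ?h x = 0}" by simp
  moreover have "closed {x. ?h x = 0}"
    using continuous_closed_preimage_constant[OF c closed_UNIV, of 0] by simp
  ultimately have "x \<in> {x. ?h x = 0}" for x by (intro mem_closed_if_AE_lebesgue)
  then show ?thesis by (intro ext) simp
qed

lemma integral_dir_deriv_compact_support:
  assumes h: "smooth h" and supp: "\<And>x. x \<notin> Rect (-M) M (-M) M \<Longrightarrow> h x = 0" and M: "0 \<le> M"
  shows "(LINT x|lborel. dir_deriv (axis j 1) h x) = 0"
proof -
  \<comment> \<open>Larger by one than the square containing the support, so that \<open>h\<close>
    vanishes on all four edges and its derivatives vanish outside.\<close>
  let ?R = "Rect (-(M+1)) (M+1) (-(M+1)) (M+1)"
  have z: "dir_deriv (axis j 1) h x = 0" if "x \<notin> ?R" for x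
  proof -
    have "dir_deriv (axis j 1) h x = dir_deriv (axis j 1) (\<lambda>_. 0) x"
      by (rule smooth_locally_eq[OF h smooth_const, of "- Rect (-M) M (-M) M"])
         (use that supp in \<open>auto simp: open_Compl\<close>, use M in \<open>auto simp: Rect_def\<close>)
    then show ?thesis by (simp add: dir_deriv_const)
  qed
  have out: "h (pt s (M+1)) = 0" "h (pt s (-(M+1))) = 0" "h (pt (M+1) s) = 0" "h (pt (-(M+1)) s) = 0" for s
    by (auto intro!: supp simp: Rect_def)
  have "(LINT x|lborel. dir_deriv (axis j 1) h x) = (LINT x|lborel. indicator ?R x * dir_deriv (axis j 1) h x)"
    by (rule Bochner_Integration.integral_cong) (use z in \<open>auto simp: indicator_def\<close>)
  also have "\<dots> = 0"
    using Rect_integral_dir_deriv[OF h, of "-(M+1)" "M+1" "-(M+1)" "M+1"] M exhaust_2[of j] out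
    by (auto simp: set_lebesgue_integral_def)
  finally show ?thesis .
qed

lemma test_fun_Rect:
  fixes \<phi> :: "plane \<Rightarrow> real"
  assumes "test_fun S \<phi>"
  obtains M where "0 \<le> M" "\<And>x. x \<notin> Rect (-M) M (-M) M \<Longrightarrow> \<phi> x = 0"
proof -
  have "bounded (closure {x. \<phi> x \<noteq> 0})" using assms compact_imp_bounded by (auto simp: test_fun_def)
  then obtain M where M: "\<And>x. x \<in> closure {x. \<phi> x \<noteq> 0} \<Longrightarrow> norm x \<le> M" by (auto simp: bounded_iff)
  have "\<phi> x = 0" if "x \<notin> Rect (-\<bar>M\<bar>) \<bar>M\<bar> (-\<bar>M\<bar>) \<bar>M\<bar>" for x
  proof (rule ccontr)
    assume "\<phi> x \<noteq> 0"
    then have "norm x \<le> M" by (intro M) (meson closure_subset mem_Collect_eq subsetD)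
    then have "\<bar>x$1\<bar> \<le> \<bar>M\<bar>" "\<bar>x$2\<bar> \<le> \<bar>M\<bar>"
      using component_le_norm_cart[of x 1] component_le_norm_cart[of x 2] by linarith+
    then show False using that by (auto simp: Rect_def)
  qed
  then show thesis using that[of "\<bar>M\<bar>"] by auto
qed

lemma loc_integrable_continuous:
  fixes f :: "'a::euclidean_space \<Rightarrow> real"
  assumes "continuous_on UNIV f" shows "loc_integrable S f"
  unfolding loc_integrable_def set_integrable_def
proof (intro allI impI)
  fix K assume K: "compact K \<and> K \<subseteq> S"
  have "integrable lborel (\<lambda>x. indicator K x *\<^sub>R f x)"
    using borel_integrable_compact[OF _ continuous_on_subset[OF assms]] K by auto
  then show "integrable lebesgue (\<lambda>x. indicator K x *\<^sub>R f x)"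
    using K assms by (subst integrable_completion) (auto simp: compact_imp_closed borel_measurable_continuous_onI)
qed

text \<open>The product with a test function has compact support in the plane, so its derivative
  integrates to zero over the plane; all integrands vanish outside \<open>S\<close>, whatever
  \<open>S\<close> is.\<close>

lemma is_weak_deriv_smooth:
  fixes f :: "plane \<Rightarrow> real"
  assumes f: "smooth f"
  shows "is_weak_deriv S (axis j 1) f (dir_deriv (axis j 1) f)"
  unfolding is_weak_deriv_def
proof (intro conjI allI impI loc_integrable_continuous smooth_continuous_on f smooth_dir_deriv axis_in_Basis)
  fix \<phi> assume t: "test_fun S \<phi>"
  have \<phi>: "smooth \<phi>" using t by (simp add: test_fun_def)
  obtain M where M: "0 \<le> M" "\<And>x. x \<notin> Rect (-M) M (-M) M \<Longrightarrow> \<phi> x = 0" using test_fun_Rect[OF t] by blast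
  have l1: "loc_integrable S f" and l2: "loc_integrable S (dir_deriv (axis j 1) f)"
    by (intro loc_integrable_continuous smooth_continuous_on f smooth_dir_deriv axis_in_Basis)+
  have K: "closure {x. \<phi> x \<noteq> 0} \<subseteq> S" using t by (simp add: test_fun_def)
  have v: "\<phi> x = 0" "dir_deriv (axis j 1) \<phi> x = 0" if "x \<notin> S" for x
    using test_fun_vanish[OF t, of x] K that by blast+
  have i1: "integrable lebesgue (\<lambda>x. f x * dir_deriv (axis j 1) \<phi> x)"
    and i2: "integrable lebesgue (\<lambda>x. dir_deriv (axis j 1) f x * \<phi> x)"
  proof -
    have "indicator S x *\<^sub>R (f x * dir_deriv (axis j 1) \<phi> x) = f x * dir_deriv (axis j 1) \<phi> x"
      "indicator S x *\<^sub>R (dir_deriv (axis j 1) f x * \<phi> x) = dir_deriv (axis j 1) f x * \<phi> x" for x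
      using v[of x] by (auto simp: indicator_def)
    then show "integrable lebesgue (\<lambda>x. f x * dir_deriv (axis j 1) \<phi> x)"
      "integrable lebesgue (\<lambda>x. dir_deriv (axis j 1) f x * \<phi> x)"
      using loc_integrable_test_integrable(2)[OF l1 t axis_in_Basis, of j]
        loc_integrable_test_integrable(1)[OF l2 t axis_in_Basis]
      unfolding set_integrable_def by (simp_all only:)
  qed
  have "(LINT x|lebesgue. f x * dir_deriv (axis j 1) \<phi> x) + (LINT x|lebesgue. dir_deriv (axis j 1) f x * \<phi> x)
     = (LINT x|lebesgue. dir_deriv (axis j 1) (\<lambda>x. f x * \<phi> x) x)"
  proof -
    have "dir_deriv (axis j 1) (\<lambda>x. f x * \<phi> x) = (\<lambda>x. f x * dir_deriv (axis j 1) \<phi> x + dir_deriv (axis j 1) f x * \<phi> x)"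
      by (intro ext dir_deriv_mult smooth_differentiable f \<phi>)
    then show ?thesis by (simp only: Bochner_Integration.integral_add[OF i1 i2])
  qed
  also have "\<dots> = (LINT x|lborel. dir_deriv (axis j 1) (\<lambda>x. f x * \<phi> x) x)"
    by (intro lborel_eq_lebesgue_integral smooth_borel smooth_dir_deriv smooth_mult f \<phi>) simp
  also have "\<dots> = 0"
    by (rule integral_dir_deriv_compact_support[OF smooth_mult[OF f \<phi>] _ M(1)]) (simp add: M(2))
  finally have *: "(LINT x|lebesgue. f x * dir_deriv (axis j 1) \<phi> x) = - (LINT x|lebesgue. dir_deriv (axis j 1) f x * \<phi> x)"
    by simp
  have "(LINT x:S|lebesgue. g x) = (LINT x|lebesgue. g x)" if "\<And>x. x \<notin> S \<Longrightarrow> g x = 0" for g :: "plane \<Rightarrow> real"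
    unfolding set_lebesgue_integral_def
    by (rule Bochner_Integration.integral_cong) (use that in \<open>auto simp: indicator_def\<close>)
  then show "(LINT x:S|lebesgue. f x * dir_deriv (axis j 1) \<phi> x) = - (LINT x:S|lebesgue. dir_deriv (axis j 1) f x * \<phi> x)"
    using * v by simp
qed

section \<open>Square-integrable functions\<close>

definition L2m :: "'a measure \<Rightarrow> ('a \<Rightarrow> real) \<Rightarrow> bool" where
  "L2m N f \<longleftrightarrow> f \<in> borel_measurable N \<and> integrable N (\<lambda>x. (f x)\<^sup>2)"

text \<open>Membership of all terms is part of the notion: the integral of a non-integrable function
  is zero by convention, and the limit condition alone would say nothing about such terms.\<close>

definition cv2 :: "'a measure \<Rightarrow> (nat \<Rightarrow> 'a \<Rightarrow> real) \<Rightarrow> ('a \<Rightarrow> real) \<Rightarrow> bool" where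
  "cv2 N v f \<longleftrightarrow> (\<forall>k. L2m N (v k)) \<and> L2m N f \<and> (\<lambda>k. \<integral>x. (v k x - f x)\<^sup>2 \<partial>N) \<longlonglongrightarrow> 0"

lemma L2m_dominated:
  assumes f: "f \<in> borel_measurable N" and g: "integrable N g" and le: "AE x in N. (f x)\<^sup>2 \<le> g x"
  shows "L2m N f" "(\<integral>x. (f x)\<^sup>2 \<partial>N) \<le> (\<integral>x. g x \<partial>N)"
proof -
  have i: "integrable N (\<lambda>x. (f x)\<^sup>2)"
  proof (rule Bochner_Integration.integrable_bound[OF g])
    show "AE x in N. norm ((f x)\<^sup>2) \<le> norm (g x)" using le by eventually_elim auto
  qed (use f in measurable)
  then show "L2m N f" using f by (simp add: L2m_def)
  show "(\<integral>x. (f x)\<^sup>2 \<partial>N) \<le> (\<integral>x. g x \<partial>N)" by (rule integral_mono_AE[OF i g le])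
qed

lemma L2m_mult_integrable:
  assumes "L2m N f" "L2m N g"
  shows "integrable N (\<lambda>x. f x * g x)"
proof (rule Bochner_Integration.integrable_bound)
  show "integrable N (\<lambda>x. (f x)\<^sup>2 + (g x)\<^sup>2)" using assms by (auto simp: L2m_def)
  show "AE x in N. norm (f x * g x) \<le> norm ((f x)\<^sup>2 + (g x)\<^sup>2)"
  proof (intro AE_I2)
    fix x
    have "2 * \<bar>f x * g x\<bar> \<le> (f x)\<^sup>2 + (g x)\<^sup>2"
      using sum_squares_bound[of "\<bar>f x\<bar>" "\<bar>g x\<bar>"] by (simp add: abs_mult)
    then show "norm (f x * g x) \<le> norm ((f x)\<^sup>2 + (g x)\<^sup>2)" by simp
  qed
qed (use assms in \<open>auto simp: L2m_def\<close>)

lemma L2m_add: assumes "L2m N f" "L2m N g" shows "L2m N (\<lambda>x. f x + g x)"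
proof -
  have "integrable N (\<lambda>x. (f x)\<^sup>2 + 2 * (f x * g x) + (g x)\<^sup>2)"
    using assms L2m_mult_integrable[OF assms] by (intro Bochner_Integration.integrable_add integrable_mult_right) (auto simp: L2m_def)
  then show ?thesis using assms by (auto simp: L2m_def power2_sum algebra_simps)
qed

lemma L2m_cmult: "L2m N f \<Longrightarrow> L2m N (\<lambda>x. c * f x)"
  by (auto simp: L2m_def power_mult_distrib)

lemma L2m_minus: "L2m N f \<Longrightarrow> L2m N (\<lambda>x. - f x)"
  by (auto simp: L2m_def)

lemma L2m_diff: "L2m N f \<Longrightarrow> L2m N g \<Longrightarrow> L2m N (\<lambda>x. f x - g x)"
  using L2m_add[OF _ L2m_minus] by fastforce

lemma L2m_bounded_mult:
  assumes "L2m N f" "c \<in> borel_measurable N" "\<And>x. x \<in> space N \<Longrightarrow> \<bar>c x\<bar> \<le> K"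
  shows "L2m N (\<lambda>x. c x * f x)" "(\<integral>x. (c x * f x)\<^sup>2 \<partial>N) \<le> K\<^sup>2 * (\<integral>x. (f x)\<^sup>2 \<partial>N)"
proof -
  have le: "AE x in N. (c x * f x)\<^sup>2 \<le> K\<^sup>2 * (f x)\<^sup>2"
  proof (rule AE_I2)
    fix x assume "x \<in> space N"
    then have "(c x)\<^sup>2 \<le> K\<^sup>2" using assms(3) by (metis abs_ge_zero power2_abs power_mono)
    then show "(c x * f x)\<^sup>2 \<le> K\<^sup>2 * (f x)\<^sup>2" by (simp add: power_mult_distrib mult_right_mono)
  qed
  have m: "(\<lambda>x. c x * f x) \<in> borel_measurable N" using assms by (auto simp: L2m_def)
  have i: "integrable N (\<lambda>x. K\<^sup>2 * (f x)\<^sup>2)" using assms by (auto simp: L2m_def)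
  show "L2m N (\<lambda>x. c x * f x)" "(\<integral>x. (c x * f x)\<^sup>2 \<partial>N) \<le> K\<^sup>2 * (\<integral>x. (f x)\<^sup>2 \<partial>N)"
    using L2m_dominated[OF m i le] by simp_all
qed

lemma cauchy_schwarz:
  assumes f: "L2m N f" and g: "L2m N g"
  shows "(\<integral>x. \<bar>f x * g x\<bar> \<partial>N) \<le> sqrt (\<integral>x. (f x)\<^sup>2 \<partial>N) * sqrt (\<integral>x. (g x)\<^sup>2 \<partial>N)"
    and "\<bar>\<integral>x. f x * g x \<partial>N\<bar> \<le> sqrt (\<integral>x. (f x)\<^sup>2 \<partial>N) * sqrt (\<integral>x. (g x)\<^sup>2 \<partial>N)"
proof -
  let ?a = "sqrt (\<integral>x. (f x)\<^sup>2 \<partial>N)" and ?b = "sqrt (\<integral>x. (g x)\<^sup>2 \<partial>N)"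
  have i: "integrable N (\<lambda>x. (f x)\<^sup>2)" "integrable N (\<lambda>x. (g x)\<^sup>2)" "integrable N (\<lambda>x. \<bar>f x * g x\<bar>)"
    using f g L2m_mult_integrable[OF f g] by (auto simp: L2m_def)
  have a2: "?a\<^sup>2 = (\<integral>x. (f x)\<^sup>2 \<partial>N)" "?b\<^sup>2 = (\<integral>x. (g x)\<^sup>2 \<partial>N)" by simp_all
  show 1: "(\<integral>x. \<bar>f x * g x\<bar> \<partial>N) \<le> ?a * ?b"
  proof (cases "?a = 0 \<or> ?b = 0")
    case True
    then have "(AE x in N. (f x)\<^sup>2 = 0) \<or> (AE x in N. (g x)\<^sup>2 = 0)"
      using integral_nonneg_eq_0_iff_AE[OF i(1)] integral_nonneg_eq_0_iff_AE[OF i(2)] by auto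
    then have "AE x in N. \<bar>f x * g x\<bar> = 0" by (auto elim: eventually_mono)
    then have "(\<integral>x. \<bar>f x * g x\<bar> \<partial>N) = 0" by (rule integral_eq_zero_AE)
    then show ?thesis by simp
  next
    case False
    then have p: "?a > 0" "?b > 0" by (auto simp: less_le)
    \<comment> \<open>Young's inequality with the weight \<open>?b / ?a\<close>, for which the two
      terms on the right have equal integrals.\<close>
    have "(\<integral>x. \<bar>f x * g x\<bar> \<partial>N) \<le> (\<integral>x. (?b / (2 * ?a)) * (f x)\<^sup>2 + (?a / (2 * ?b)) * (g x)\<^sup>2 \<partial>N)"
    proof (rule integral_mono)
      fix x
      have "0 \<le> (?b * \<bar>f x\<bar> - ?a * \<bar>g x\<bar>)\<^sup>2" by simp
      then have "2 * ?a * ?b * \<bar>f x * g x\<bar> \<le> ?b\<^sup>2 * (f x)\<^sup>2 + ?a\<^sup>2 * (g x)\<^sup>2"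
        by (simp add: power2_eq_square algebra_simps abs_mult)
      then show "\<bar>f x * g x\<bar> \<le> (?b / (2 * ?a)) * (f x)\<^sup>2 + (?a / (2 * ?b)) * (g x)\<^sup>2"
        using p by (simp add: field_simps power2_eq_square del: real_sqrt_mult_self)
    qed (use i in auto)
    also have "\<dots> = (?b / (2 * ?a)) * ?a\<^sup>2 + (?a / (2 * ?b)) * ?b\<^sup>2"
      using i by (simp add: a2)
    also have "\<dots> = ?a * ?b" using p by (simp add: field_simps power2_eq_square del: real_sqrt_mult_self)
    finally show ?thesis .
  qed
  show "\<bar>\<integral>x. f x * g x \<partial>N\<bar> \<le> ?a * ?b"
    using order_trans[OF integral_norm_bound[of N "\<lambda>x. f x * g x"], of "?a * ?b"] 1 unfolding real_norm_def by blast
qed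

lemma integral_square_add_le:
  assumes f: "L2m N f" and g: "L2m N g"
  shows "(\<integral>x. (f x + g x)\<^sup>2 \<partial>N) \<le> 2 * (\<integral>x. (f x)\<^sup>2 \<partial>N) + 2 * (\<integral>x. (g x)\<^sup>2 \<partial>N)"
proof -
  have i: "integrable N (\<lambda>x. (f x)\<^sup>2)" "integrable N (\<lambda>x. (g x)\<^sup>2)" "integrable N (\<lambda>x. (f x + g x)\<^sup>2)"
    using f g L2m_add[OF f g] by (auto simp: L2m_def)
  have "(\<integral>x. (f x + g x)\<^sup>2 \<partial>N) \<le> (\<integral>x. 2 * (f x)\<^sup>2 + 2 * (g x)\<^sup>2 \<partial>N)"
  proof (rule integral_mono)
    fix x show "(f x + g x)\<^sup>2 \<le> 2 * (f x)\<^sup>2 + 2 * (g x)\<^sup>2"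
      using sum_squares_bound[of "f x" "g x"] by (simp add: power2_sum)
  qed (use i in auto)
  then show ?thesis using i by simp
qed

lemma cv2I:
  assumes "\<And>k. L2m N (v k)" "L2m N f" "\<And>k. (\<integral>x. (v k x - f x)\<^sup>2 \<partial>N) \<le> e k" "e \<longlonglongrightarrow> 0"
  shows "cv2 N v f"
  using assms unfolding cv2_def
  by (auto intro!: tendsto_sandwich[OF _ _ tendsto_const assms(4)])

lemma cv2_const: "L2m N f \<Longrightarrow> cv2 N (\<lambda>_. f) f"
  by (simp add: cv2_def)

lemma cv2_add:
  assumes v: "cv2 N v f" and w: "cv2 N w g"
  shows "cv2 N (\<lambda>k x. v k x + w k x) (\<lambda>x. f x + g x)"
proof (rule cv2I)
  show "L2m N (\<lambda>x. v k x + w k x)" "L2m N (\<lambda>x. f x + g x)" for k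
    using v w by (auto simp: cv2_def intro: L2m_add)
  show "(\<integral>x. (v k x + w k x - (f x + g x))\<^sup>2 \<partial>N) \<le> 2 * (\<integral>x. (v k x - f x)\<^sup>2 \<partial>N) + 2 * (\<integral>x. (w k x - g x)\<^sup>2 \<partial>N)" for k
    using integral_square_add_le[of N "\<lambda>x. v k x - f x" "\<lambda>x. w k x - g x"] v w
    by (simp add: cv2_def L2m_diff algebra_simps)
  show "(\<lambda>k. 2 * (\<integral>x. (v k x - f x)\<^sup>2 \<partial>N) + 2 * (\<integral>x. (w k x - g x)\<^sup>2 \<partial>N)) \<longlonglongrightarrow> 0"
    using v w unfolding cv2_def by (auto intro!: tendsto_eq_intros)
qed

lemma cv2_bounded_mult:
  assumes v: "cv2 N v f" and c: "c \<in> borel_measurable N" "\<And>x. x \<in> space N \<Longrightarrow> \<bar>c x\<bar> \<le> K"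
  shows "cv2 N (\<lambda>k x. c x * v k x) (\<lambda>x. c x * f x)"
proof (rule cv2I)
  show "L2m N (\<lambda>x. c x * v k x)" "L2m N (\<lambda>x. c x * f x)" for k
    using v by (auto simp: cv2_def intro!: L2m_bounded_mult(1)[OF _ c])
  show "(\<integral>x. (c x * v k x - c x * f x)\<^sup>2 \<partial>N) \<le> K\<^sup>2 * (\<integral>x. (v k x - f x)\<^sup>2 \<partial>N)" for k
    using L2m_bounded_mult(2)[OF L2m_diff c, of "v k" f] v by (simp add: cv2_def right_diff_distrib)
  show "(\<lambda>k. K\<^sup>2 * (\<integral>x. (v k x - f x)\<^sup>2 \<partial>N)) \<longlonglongrightarrow> 0"
    using v unfolding cv2_def by (auto intro!: tendsto_eq_intros)
qed

lemma cv2_mult_tendsto: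
  assumes v: "cv2 N v f" and w: "cv2 N w g"
  shows "(\<lambda>k. \<integral>x. v k x * w k x \<partial>N) \<longlonglongrightarrow> (\<integral>x. f x * g x \<partial>N)"
proof -
  note L = v[unfolded cv2_def] w[unfolded cv2_def]
  let ?d = "\<lambda>k. \<integral>x. (v k x - f x)\<^sup>2 \<partial>N" and ?e = "\<lambda>k. \<integral>x. (w k x - g x)\<^sup>2 \<partial>N"
  let ?f = "\<integral>x. (f x)\<^sup>2 \<partial>N" and ?g = "\<integral>x. (g x)\<^sup>2 \<partial>N"
  have b: "\<bar>(\<integral>x. v k x * w k x \<partial>N) - (\<integral>x. f x * g x \<partial>N)\<bar> \<le>
     sqrt (?d k) * sqrt (?e k) + sqrt (?d k) * sqrt ?g + sqrt ?f * sqrt (?e k)" for k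
  proof -
    have Ld: "L2m N (\<lambda>x. v k x - f x)" "L2m N (\<lambda>x. w k x - g x)" using L by (auto intro: L2m_diff)
    have i: "integrable N (\<lambda>x. (v k x - f x) * (w k x - g x))" "integrable N (\<lambda>x. (v k x - f x) * g x)"
      "integrable N (\<lambda>x. f x * (w k x - g x))" "integrable N (\<lambda>x. f x * g x)" "integrable N (\<lambda>x. v k x * w k x)"
      using L Ld by (auto intro: L2m_mult_integrable)
    have "(\<integral>x. v k x * w k x \<partial>N) - (\<integral>x. f x * g x \<partial>N) = (\<integral>x. v k x * w k x - f x * g x \<partial>N)"
      using i by simp
    also have "\<dots> = (\<integral>x. (v k x - f x) * (w k x - g x) + (v k x - f x) * g x + f x * (w k x - g x) \<partial>N)"
      by (rule Bochner_Integration.integral_cong) (auto simp: algebra_simps)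
    also have "\<dots> = (\<integral>x. (v k x - f x) * (w k x - g x) \<partial>N) + (\<integral>x. (v k x - f x) * g x \<partial>N) + (\<integral>x. f x * (w k x - g x) \<partial>N)"
      by (subst Bochner_Integration.integral_add, use i in simp, use i in simp)+ simp
    finally show ?thesis
      using cauchy_schwarz(2)[OF Ld] cauchy_schwarz(2)[OF Ld(1), of g] cauchy_schwarz(2)[OF _ Ld(2), of f] L by linarith
  qed
  have "?d \<longlonglongrightarrow> 0" "?e \<longlonglongrightarrow> 0" using L by auto
  then have "(\<lambda>k. sqrt (?d k) * sqrt (?e k) + sqrt (?d k) * sqrt ?g + sqrt ?f * sqrt (?e k)) \<longlonglongrightarrow> 0"
    by (auto intro!: tendsto_eq_intros)
  then have "(\<lambda>k. (\<integral>x. v k x * w k x \<partial>N) - (\<integral>x. f x * g x \<partial>N)) \<longlonglongrightarrow> 0"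
    by (rule Lim_null_comparison[rotated]) (use b in auto)
  then show ?thesis by (simp add: LIM_zero_iff)
qed

lemma cv2_mult_tendsto_const:
  "cv2 N v f \<Longrightarrow> L2m N g \<Longrightarrow> (\<lambda>k. \<integral>x. v k x * g x \<partial>N) \<longlonglongrightarrow> (\<integral>x. f x * g x \<partial>N)"
  using cv2_mult_tendsto[OF _ cv2_const] by blast

section \<open>Fields that are limits of smooth fields up to the boundary\<close>

abbreviation pd :: "2 \<Rightarrow> (plane \<Rightarrow> real) \<Rightarrow> plane \<Rightarrow> real" where "pd j \<equiv> dir_deriv (axis j 1)"

abbreviation bsq :: "plane set \<Rightarrow> (plane \<Rightarrow> real) \<Rightarrow> ennreal" where
  "bsq \<Omega> f \<equiv> \<integral>\<^sup>+x\<in>frontier \<Omega>. ennreal ((f x)\<^sup>2) \<partial>hausdorff1"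

text \<open>The scalar function \<open>f\<close> has weak partial derivatives \<open>F j\<close> and trace \<open>g\<close>, as witnessed by the
  smooth functions \<open>v k\<close>.\<close>

definition approx :: "plane set \<Rightarrow> (nat \<Rightarrow> plane \<Rightarrow> real) \<Rightarrow> (plane \<Rightarrow> real) \<Rightarrow> (2 \<Rightarrow> plane \<Rightarrow> real) \<Rightarrow> (plane \<Rightarrow> real) \<Rightarrow> bool" where
  "approx \<Omega> v f F g \<longleftrightarrow> (\<forall>k. smooth (v k)) \<and> cv2 (lebesgue_on \<Omega>) v f \<and>
     (\<forall>j. cv2 (lebesgue_on \<Omega>) (\<lambda>k. pd j (v k)) (F j)) \<and> g \<in> borel_measurable borel \<and>
     (\<lambda>k. bsq \<Omega> (\<lambda>x. v k x - g x)) \<longlonglongrightarrow> 0"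

definition strace :: "plane set \<Rightarrow> (plane \<Rightarrow> real) \<Rightarrow> (2 \<Rightarrow> plane \<Rightarrow> real) \<Rightarrow> (plane \<Rightarrow> real) \<Rightarrow> bool" where
  "strace \<Omega> f F g \<longleftrightarrow> (\<exists>v. approx \<Omega> v f F g)"

lemma borel_imp_hausdorff1: "h \<in> borel_measurable borel \<Longrightarrow> h \<in> borel_measurable hausdorff1"
  by (simp cong: measurable_cong_sets)

locale bdom =
  fixes \<Omega> :: "plane set"
  assumes open_dom: "open \<Omega>" and bounded_dom: "bounded \<Omega>"
begin

abbreviation "NN \<equiv> lebesgue_on \<Omega>"
abbreviation "null_trace g \<equiv> AE x in hausdorff1. x \<in> frontier \<Omega> \<longrightarrow> g x = 0"

lemma dom_sets: "\<Omega> \<in> sets lebesgue" "\<Omega> \<in> sets borel"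
  using open_dom by auto

lemma finite_measure_dom: "finite_measure NN"
  by (rule finite_measureI) (use emeasure_bounded_finite[OF bounded_dom] dom_sets in
    \<open>auto simp: emeasure_restrict_space less_top\<close>)

lemma bounded_continuous_dom:
  assumes "continuous_on UNIV (c :: plane \<Rightarrow> real)"
  obtains K where "0 \<le> K" "\<And>x. x \<in> closure \<Omega> \<Longrightarrow> \<bar>c x\<bar> \<le> K"
proof -
  have "compact (closure \<Omega>)" using bounded_dom by (simp add: compact_closure)
  then have "bounded (c ` closure \<Omega>)"
    using compact_continuous_image[OF continuous_on_subset[OF assms]] compact_imp_bounded by blast
  then obtain K where "\<And>x. x \<in> closure \<Omega> \<Longrightarrow> \<bar>c x\<bar> \<le> K" by (auto simp: bounded_iff)
  then have "\<And>x. x \<in> closure \<Omega> \<Longrightarrow> \<bar>c x\<bar> \<le> \<bar>K\<bar>" by force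
  then show thesis using that[of "\<bar>K\<bar>"] by auto
qed

lemma continuous_measurable_dom:
  "continuous_on UNIV (c :: plane \<Rightarrow> real) \<Longrightarrow> c \<in> borel_measurable NN"
  by (intro measurable_restrict_space1 borel_imp_lebesgue borel_measurable_continuous_onI)

lemma L2m_mult_continuous:
  assumes "L2m NN f" "continuous_on UNIV c"
  shows "L2m NN (\<lambda>x. c x * f x)"
proof -
  obtain K where "\<And>x. x \<in> closure \<Omega> \<Longrightarrow> \<bar>c x\<bar> \<le> K" using bounded_continuous_dom[OF assms(2)] by blast
  then show ?thesis
    using closure_subset[of \<Omega>]
    by (intro L2m_bounded_mult(1)[OF assms(1) continuous_measurable_dom[OF assms(2)], of K]) auto
qed

lemma cv2_mult_continuous:
  assumes "cv2 NN v f" "continuous_on UNIV c"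
  shows "cv2 NN (\<lambda>k x. c x * v k x) (\<lambda>x. c x * f x)"
proof -
  obtain K where "\<And>x. x \<in> closure \<Omega> \<Longrightarrow> \<bar>c x\<bar> \<le> K" using bounded_continuous_dom[OF assms(2)] by blast
  then show ?thesis
    using closure_subset[of \<Omega>]
    by (intro cv2_bounded_mult[OF assms(1) continuous_measurable_dom[OF assms(2)], of K]) auto
qed

lemma L2m_const: "L2m NN (\<lambda>x. c)"
  using finite_measure.integrable_const[OF finite_measure_dom] by (simp add: L2m_def)

lemma L2m_continuous: "continuous_on UNIV c \<Longrightarrow> L2m NN c"
  using L2m_mult_continuous[OF L2m_const[of 1]] by simp

lemma L2m_integrable: "L2m NN f \<Longrightarrow> integrable NN f"
  using L2m_mult_integrable[OF L2m_const[of 1]] by fastforce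

lemma L2m_loc_integrable:
  assumes "L2m NN f" shows "loc_integrable \<Omega> f"
  unfolding loc_integrable_def
proof (intro allI impI)
  fix K assume K: "compact K \<and> K \<subseteq> \<Omega>"
  have "set_integrable lebesgue \<Omega> f"
    using L2m_integrable[OF assms] dom_sets by (simp add: set_integrable_lebesgue_on)
  then show "set_integrable lebesgue K f"
    by (rule set_integrable_subset) (use K in \<open>auto intro: fmeasurableD[OF lmeasurable_compact]\<close>)
qed

lemma smooth_L2m: "smooth c \<Longrightarrow> L2m NN c" "smooth c \<Longrightarrow> L2m NN (pd j c)"
  by (auto intro!: L2m_continuous smooth_continuous_on smooth_dir_deriv)

lemma approx_smooth: "smooth c \<Longrightarrow> approx \<Omega> (\<lambda>_. c) c (\<lambda>j. pd j c) c"
  by (auto simp: approx_def smooth_L2m cv2_const smooth_borel)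

lemma strace_smooth: "smooth c \<Longrightarrow> strace \<Omega> c (\<lambda>j. pd j c) c"
  using approx_smooth unfolding strace_def by blast

lemma frontier_sets: "frontier \<Omega> \<in> sets borel" "compact (frontier \<Omega>)"
  using bounded_dom by (auto intro!: borel_closed compact_frontier_bounded)

lemma trace_add_tendsto:
  assumes v: "(\<lambda>k. bsq \<Omega> (\<lambda>x. v k x - g x)) \<longlonglongrightarrow> 0"
    and w: "(\<lambda>k. bsq \<Omega> (\<lambda>x. w k x - h x)) \<longlonglongrightarrow> 0"
    and m: "\<And>k. v k \<in> borel_measurable borel" "\<And>k. w k \<in> borel_measurable borel"
       "g \<in> borel_measurable borel" "h \<in> borel_measurable borel"
  shows "(\<lambda>k. bsq \<Omega> (\<lambda>x. v k x + w k x - (g x + h x))) \<longlonglongrightarrow> 0"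
proof (rule tendsto_sandwich[OF _ _ tendsto_const])
  let ?v = "\<lambda>k. bsq \<Omega> (\<lambda>x. v k x - g x)"
  let ?w = "\<lambda>k. bsq \<Omega> (\<lambda>x. w k x - h x)"
  have "(\<lambda>k. 2 * ?v k + 2 * ?w k) \<longlonglongrightarrow> 2 * 0 + 2 * 0"
    by (intro tendsto_add ennreal_tendsto_cmult v w) auto
  then show "(\<lambda>k. 2 * ?v k + 2 * ?w k) \<longlonglongrightarrow> 0" by simp
  have "bsq \<Omega> (\<lambda>x. v k x + w k x - (g x + h x)) \<le> 2 * ?v k + 2 * ?w k" for k
  proof -
    have "bsq \<Omega> (\<lambda>x. v k x + w k x - (g x + h x)) \<le>
       (\<integral>\<^sup>+x. 2 * (ennreal ((v k x - g x)\<^sup>2) * indicator (frontier \<Omega>) x) + 2 * (ennreal ((w k x - h x)\<^sup>2) * indicator (frontier \<Omega>) x) \<partial>hausdorff1)"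
    proof (rule nn_integral_mono)
      fix x
      have "(v k x + w k x - (g x + h x))\<^sup>2 \<le> 2 * (v k x - g x)\<^sup>2 + 2 * (w k x - h x)\<^sup>2"
        using sum_squares_bound[of "v k x - g x" "w k x - h x"] by (simp add: power2_sum power2_eq_square algebra_simps)
      then have "ennreal ((v k x + w k x - (g x + h x))\<^sup>2) \<le> ennreal (2 * (v k x - g x)\<^sup>2 + 2 * (w k x - h x)\<^sup>2)"
        by (rule ennreal_leI)
      also have "\<dots> = 2 * ennreal ((v k x - g x)\<^sup>2) + 2 * ennreal ((w k x - h x)\<^sup>2)"
        by (simp add: ennreal_plus ennreal_mult)
      finally show "ennreal ((v k x + w k x - (g x + h x))\<^sup>2) * indicator (frontier \<Omega>) x \<le>
          2 * (ennreal ((v k x - g x)\<^sup>2) * indicator (frontier \<Omega>) x) + 2 * (ennreal ((w k x - h x)\<^sup>2) * indicator (frontier \<Omega>) x)"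
        by (auto simp: indicator_def)
    qed
    also have "\<dots> = 2 * ?v k + 2 * ?w k"
    proof -
      have [measurable]: "v k \<in> borel_measurable hausdorff1" "w k \<in> borel_measurable hausdorff1"
        "g \<in> borel_measurable hausdorff1" "h \<in> borel_measurable hausdorff1" "frontier \<Omega> \<in> sets hausdorff1"
        using m frontier_sets by (auto intro: borel_imp_hausdorff1)
      show ?thesis by (subst nn_integral_add, measurable, subst (1 2) nn_integral_cmult, measurable)
    qed
    finally show ?thesis .
  qed
  then show "\<forall>\<^sub>F k in sequentially. bsq \<Omega> (\<lambda>x. v k x + w k x - (g x + h x)) \<le> 2 * ?v k + 2 * ?w k"
    by simp
qed auto

lemma approx_add:
  assumes v: "approx \<Omega> v f F g" and w: "approx \<Omega> w f' F' g'"
  shows "approx \<Omega> (\<lambda>k x. v k x + w k x) (\<lambda>x. f x + f' x) (\<lambda>j x. F j x + F' j x) (\<lambda>x. g x + g' x)"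
  unfolding approx_def
proof (intro conjI allI)
  note A = v[unfolded approx_def] w[unfolded approx_def]
  show "smooth (\<lambda>x. v k x + w k x)" for k using A by (auto intro: smooth_add)
  show "cv2 NN (\<lambda>k x. v k x + w k x) (\<lambda>x. f x + f' x)" using A by (auto intro: cv2_add)
  have "pd j (\<lambda>x. v k x + w k x) = (\<lambda>x. pd j (v k) x + pd j (w k) x)" for k j
    using A by (auto intro!: ext dir_deriv_add smooth_differentiable)
  then show "cv2 NN (\<lambda>k. pd j (\<lambda>x. v k x + w k x)) (\<lambda>x. F j x + F' j x)" for j
    using A by (auto intro: cv2_add)
  show "(\<lambda>x. g x + g' x) \<in> borel_measurable borel" using A by auto
  show "(\<lambda>k. bsq \<Omega> (\<lambda>x. v k x + w k x - (g x + g' x))) \<longlonglongrightarrow> 0"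
    by (rule trace_add_tendsto) (use A in \<open>auto intro: smooth_borel\<close>)
qed

lemma approx_mult:
  assumes v: "approx \<Omega> v f F g" and c: "smooth c"
  shows "approx \<Omega> (\<lambda>k x. c x * v k x) (\<lambda>x. c x * f x) (\<lambda>j x. c x * F j x + pd j c x * f x) (\<lambda>x. c x * g x)"
  unfolding approx_def
proof (intro conjI allI)
  note A = v[unfolded approx_def]
  show "smooth (\<lambda>x. c x * v k x)" for k using A c by (auto intro: smooth_mult)
  show "cv2 NN (\<lambda>k x. c x * v k x) (\<lambda>x. c x * f x)"
    using A c by (auto intro: cv2_mult_continuous smooth_continuous_on)
  have "pd j (\<lambda>x. c x * v k x) = (\<lambda>x. c x * pd j (v k) x + pd j c x * v k x)" for k j
    using A c by (auto intro!: ext dir_deriv_mult smooth_differentiable)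
  then show "cv2 NN (\<lambda>k. pd j (\<lambda>x. c x * v k x)) (\<lambda>x. c x * F j x + pd j c x * f x)" for j
    using A c by (auto intro!: cv2_add cv2_mult_continuous smooth_continuous_on smooth_dir_deriv)
  show "(\<lambda>x. c x * g x) \<in> borel_measurable borel" using A smooth_borel[OF c] by auto
  obtain K where K: "0 \<le> K" "\<And>x. x \<in> closure \<Omega> \<Longrightarrow> \<bar>c x\<bar> \<le> K"
    using bounded_continuous_dom[OF smooth_continuous_on[OF c]] by blast
  let ?v = "\<lambda>k. bsq \<Omega> (\<lambda>x. v k x - g x)"
  show "(\<lambda>k. bsq \<Omega> (\<lambda>x. c x * v k x - c x * g x)) \<longlonglongrightarrow> 0"
  proof (rule tendsto_sandwich[OF _ _ tendsto_const])
    have "(\<lambda>k. ennreal (K\<^sup>2) * ?v k) \<longlonglongrightarrow> ennreal (K\<^sup>2) * 0"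
      using A by (intro ennreal_tendsto_cmult) auto
    then show "(\<lambda>k. ennreal (K\<^sup>2) * ?v k) \<longlonglongrightarrow> 0" by simp
    have "bsq \<Omega> (\<lambda>x. c x * v k x - c x * g x) \<le> ennreal (K\<^sup>2) * ?v k" for k
    proof -
      have "bsq \<Omega> (\<lambda>x. c x * v k x - c x * g x) \<le>
         (\<integral>\<^sup>+x. ennreal (K\<^sup>2) * (ennreal ((v k x - g x)\<^sup>2) * indicator (frontier \<Omega>) x) \<partial>hausdorff1)"
      proof (rule nn_integral_mono)
        fix x
        show "ennreal ((c x * v k x - c x * g x)\<^sup>2) * indicator (frontier \<Omega>) x
           \<le> ennreal (K\<^sup>2) * (ennreal ((v k x - g x)\<^sup>2) * indicator (frontier \<Omega>) x)"
        proof (cases "x \<in> frontier \<Omega>")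
          case True
          then have "\<bar>c x\<bar> \<le> K" using K(2) by (simp add: frontier_def)
          then have "(c x)\<^sup>2 \<le> K\<^sup>2" by (metis abs_ge_zero power2_abs power_mono)
          then have "(c x)\<^sup>2 * (v k x - g x)\<^sup>2 \<le> K\<^sup>2 * (v k x - g x)\<^sup>2" by (rule mult_right_mono) simp
          then have "ennreal ((c x * v k x - c x * g x)\<^sup>2) \<le> ennreal (K\<^sup>2 * (v k x - g x)\<^sup>2)"
            by (intro ennreal_leI) (simp add: right_diff_distrib[symmetric] power_mult_distrib)
          then show ?thesis using True by (simp add: ennreal_mult)
        qed simp
      qed
      also have "\<dots> = ennreal (K\<^sup>2) * ?v k"
      proof -
        have [measurable]: "v k \<in> borel_measurable hausdorff1" "g \<in> borel_measurable hausdorff1" "frontier \<Omega> \<in> sets hausdorff1"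
          using A frontier_sets by (auto intro: borel_imp_hausdorff1 smooth_borel)
        show ?thesis by (rule nn_integral_cmult) measurable
      qed
      finally show ?thesis .
    qed
    then show "\<forall>\<^sub>F k in sequentially. bsq \<Omega> (\<lambda>x. c x * v k x - c x * g x) \<le> ennreal (K\<^sup>2) * ?v k"
      by simp
  qed auto
qed

lemma strace_add:
  "strace \<Omega> f F g \<Longrightarrow> strace \<Omega> f' F' g' \<Longrightarrow> strace \<Omega> (\<lambda>x. f x + f' x) (\<lambda>j x. F j x + F' j x) (\<lambda>x. g x + g' x)"
  unfolding strace_def using approx_add by blast

lemma strace_mult:
  "strace \<Omega> f F g \<Longrightarrow> smooth c \<Longrightarrow>
    strace \<Omega> (\<lambda>x. c x * f x) (\<lambda>j x. c x * F j x + pd j c x * f x) (\<lambda>x. c x * g x)"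
  unfolding strace_def using approx_mult by blast

lemma strace_diff:
  assumes "strace \<Omega> f F g" "strace \<Omega> f' F' g'"
  shows "strace \<Omega> (\<lambda>x. f x - f' x) (\<lambda>j x. F j x - F' j x) (\<lambda>x. g x - g' x)"
  using strace_add[OF assms(1) strace_mult[OF assms(2) smooth_const[of "-1"]]] by (simp add: dir_deriv_const)

lemma strace_L2m: assumes "strace \<Omega> f F g" shows "L2m NN f" "L2m NN (F j)"
  using assms by (auto simp: strace_def approx_def cv2_def)

text \<open>Integration by parts against a test function holds for the smooth approximants, and both
  of its sides pass to the limit in the mean square.\<close>

lemma strace_weak_deriv:
  assumes "strace \<Omega> f F g"
  shows "is_weak_deriv \<Omega> (axis j 1) f (F j)"
  unfolding is_weak_deriv_def
proof (intro conjI allI impI)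
  obtain v where v: "approx \<Omega> v f F g" using assms by (auto simp: strace_def)
  show "loc_integrable \<Omega> f" "loc_integrable \<Omega> (F j)" using strace_L2m[OF assms] L2m_loc_integrable by auto
  fix \<phi> assume t: "test_fun \<Omega> \<phi>"
  then have \<phi>: "smooth \<phi>" by (simp add: test_fun_def)
  have eq: "(\<integral>x. v k x * pd j \<phi> x \<partial>NN) = - (\<integral>x. pd j (v k) x * \<phi> x \<partial>NN)" for k
    using is_weak_deriv_smooth[of "v k" \<Omega> j] v t dom_sets
    by (simp add: is_weak_deriv_def approx_def set_integral_lebesgue_on)
  have "(\<lambda>k. \<integral>x. v k x * pd j \<phi> x \<partial>NN) \<longlonglongrightarrow> (\<integral>x. f x * pd j \<phi> x \<partial>NN)"
    using v by (intro cv2_mult_tendsto_const smooth_L2m \<phi>) (simp add: approx_def)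
  moreover have "(\<lambda>k. - (\<integral>x. pd j (v k) x * \<phi> x \<partial>NN)) \<longlonglongrightarrow> - (\<integral>x. F j x * \<phi> x \<partial>NN)"
    using v by (intro tendsto_minus cv2_mult_tendsto_const smooth_L2m \<phi>) (simp add: approx_def)
  ultimately have "(\<integral>x. f x * pd j \<phi> x \<partial>NN) = - (\<integral>x. F j x * \<phi> x \<partial>NN)"
    unfolding eq by (rule LIMSEQ_unique)
  then show "(LINT x:\<Omega>|lebesgue. f x * pd j \<phi> x) = - (LINT x:\<Omega>|lebesgue. F j x * \<phi> x)"
    using dom_sets by (simp add: set_integral_lebesgue_on)
qed

lemma AE_dom: "(AE x in NN. P x) \<longleftrightarrow> (AE x in lebesgue. x \<in> \<Omega> \<longrightarrow> P x)"
  using AE_restrict_space_iff[of \<Omega> lebesgue P] dom_sets by simp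

end

section \<open>Vector fields, their gradients and their traces\<close>

lemma norm_plane: "(norm (x :: plane))\<^sup>2 = (x$1)\<^sup>2 + (x$2)\<^sup>2"
  unfolding power2_norm_eq_inner by (simp add: inner_vec_def sum_2 power2_eq_square)

lemma inner_plane: "(x :: plane) \<bullet> y = x$1 * y$1 + x$2 * y$2"
  by (simp add: inner_vec_def sum_2)

lemma inner_mat: "(A :: real^2^2) \<bullet> B = A$1$1 * B$1$1 + A$1$2 * B$1$2 + A$2$1 * B$2$1 + A$2$2 * B$2$2"
  by (simp add: inner_vec_def sum_2)

lemma norm_mat: "(norm (A :: real^2^2))\<^sup>2 = (A$1$1)\<^sup>2 + (A$1$2)\<^sup>2 + (A$2$1)\<^sup>2 + (A$2$2)\<^sup>2"
  unfolding power2_norm_eq_inner inner_mat by (simp add: power2_eq_square)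

lemma component_sq_le: "((x :: plane) $ i)\<^sup>2 \<le> (norm x)\<^sup>2"
  using exhaust_2[of i] by (auto simp: norm_plane)

lemma component_mat_sq_le: "((A :: real^2^2) $ i $ j)\<^sup>2 \<le> (norm A)\<^sup>2"
  using exhaust_2[of i] exhaust_2[of j] by (auto simp: norm_mat)

lemma measurable_plane_iff:
  "(f :: 'a \<Rightarrow> plane) \<in> borel_measurable N \<longleftrightarrow> (\<forall>i. (\<lambda>x. f x $ i) \<in> borel_measurable N)"
proof -
  have "f \<in> borel_measurable N \<longleftrightarrow> (\<forall>b\<in>Basis. (\<lambda>x. f x \<bullet> b) \<in> borel_measurable N)"
    by (rule borel_measurable_euclidean_space)
  then show ?thesis by (simp add: Basis_plane inner_axis forall_2)
qed

lemma measurable_mat_iff: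
  "(f :: 'a \<Rightarrow> real^2^2) \<in> borel_measurable N \<longleftrightarrow> (\<forall>i j. (\<lambda>x. f x $ i $ j) \<in> borel_measurable N)"
proof -
  have "f \<in> borel_measurable N \<longleftrightarrow> (\<forall>b\<in>Basis. (\<lambda>x. f x \<bullet> b) \<in> borel_measurable N)"
    by (rule borel_measurable_euclidean_space)
  also have "\<dots> \<longleftrightarrow> (\<forall>i j. (\<lambda>x. f x $ i $ j) \<in> borel_measurable N)"
    by (auto simp: Basis_vec_def inner_axis UNIV_2 forall_2)
  finally show ?thesis .
qed

text \<open>Completeness of Lebesgue measure. It is called for because \<open>weak_deriv\<close>
  picks an arbitrary representative, about which measurability is known only through almost
  everywhere equality.\<close>

lemma measurable_lebesgue_AE:
  fixes f g :: "'a::euclidean_space \<Rightarrow> 'b::euclidean_space"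
  assumes f: "f \<in> borel_measurable lebesgue" and ae: "AE x in lebesgue. f x = g x"
  shows "g \<in> borel_measurable lebesgue"
proof (rule measurableI)
  fix A :: "'b set" assume A: "A \<in> sets borel"
  show "g -` A \<inter> space lebesgue \<in> sets lebesgue"
  proof (rule completion.in_sets_AE)
    show "f -` A \<inter> space lebesgue \<in> sets lebesgue" by (rule measurable_sets[OF f A])
    show "AE x in lebesgue. (x \<in> f -` A \<inter> space lebesgue) = (x \<in> g -` A \<inter> space lebesgue)"
      using ae by eventually_elim simp
  qed simp
qed simp

text \<open>\<open>G\<close> is an explicit representative of the gradient. Computations are carried
  out with such representatives, and \<open>wgrad\<close>, which is a choice up to null sets, is
  substituted at the end by almost everywhere equality.\<close>

definition vtrace :: "plane set \<Rightarrow> (plane \<Rightarrow> plane) \<Rightarrow> (plane \<Rightarrow> real^2^2) \<Rightarrow> (plane \<Rightarrow> plane) \<Rightarrow> bool" where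
  "vtrace \<Omega> u G g \<longleftrightarrow> (\<forall>i. strace \<Omega> (\<lambda>x. u x $ i) (\<lambda>j x. G x $ i $ j) (\<lambda>x. g x $ i))"

context bdom begin

lemma set_borel_measurable_dom:
  fixes f :: "plane \<Rightarrow> 'b::euclidean_space"
  shows "set_borel_measurable lebesgue \<Omega> f \<longleftrightarrow> f \<in> borel_measurable NN"
  using borel_measurable_restrict_space_iff[of \<Omega> lebesgue f] dom_sets
  by (simp add: set_borel_measurable_def)

lemma measurable_dom_AE:
  fixes f g :: "plane \<Rightarrow> 'b::euclidean_space"
  assumes f: "f \<in> borel_measurable NN" and ae: "AE x in NN. f x = g x"
  shows "g \<in> borel_measurable NN"
proof -
  have "(\<lambda>x. indicator \<Omega> x *\<^sub>R g x) \<in> borel_measurable lebesgue"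
  proof (rule measurable_lebesgue_AE)
    show "(\<lambda>x. indicator \<Omega> x *\<^sub>R f x) \<in> borel_measurable lebesgue"
      using f unfolding set_borel_measurable_dom[symmetric] set_borel_measurable_def .
    show "AE x in lebesgue. indicator \<Omega> x *\<^sub>R f x = indicator \<Omega> x *\<^sub>R g x"
      using ae[unfolded AE_dom] by eventually_elim (auto simp: indicator_def)
  qed
  then show ?thesis unfolding set_borel_measurable_dom[symmetric] set_borel_measurable_def .
qed

lemma integral_dom_AE:
  fixes f F :: "plane \<Rightarrow> real"
  assumes "AE x in NN. f x = F x" "F \<in> borel_measurable NN"
  shows "(\<integral>x. f x \<partial>NN) = (\<integral>x. F x \<partial>NN)" "(LINT x:\<Omega>|lebesgue. f x) = (\<integral>x. F x \<partial>NN)"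
proof -
  have "f \<in> borel_measurable NN"
    by (rule measurable_dom_AE[OF assms(2)]) (use assms(1) in \<open>auto elim: eventually_mono\<close>)
  then show "(\<integral>x. f x \<partial>NN) = (\<integral>x. F x \<partial>NN)" by (intro integral_cong_AE assms)
  then show "(LINT x:\<Omega>|lebesgue. f x) = (\<integral>x. F x \<partial>NN)" using dom_sets by (simp add: set_integral_lebesgue_on)
qed

lemma L2_iff: fixes f :: "plane \<Rightarrow> 'b::euclidean_space" shows "L2 \<Omega> f \<longleftrightarrow> f \<in> borel_measurable NN \<and> integrable NN (\<lambda>x. (norm (f x))\<^sup>2)"
  using dom_sets by (simp add: L2_def set_borel_measurable_dom set_integrable_lebesgue_on)

lemma L2_real_iff: "L2 \<Omega> f \<longleftrightarrow> L2m NN f" for f :: "plane \<Rightarrow> real"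
  by (simp add: L2_iff L2m_def)

lemma L2_plane_iff: "L2 \<Omega> f \<longleftrightarrow> (\<forall>i. L2m NN (\<lambda>x. f x $ i))" for f :: "plane \<Rightarrow> plane"
proof
  assume L: "L2 \<Omega> f"
  show "\<forall>i. L2m NN (\<lambda>x. f x $ i)"
    by (intro allI L2m_dominated(1)[of _ _ "\<lambda>x. (norm (f x))\<^sup>2"]) (use L in \<open>auto simp: L2_iff measurable_plane_iff component_sq_le\<close>)
next
  assume "\<forall>i. L2m NN (\<lambda>x. f x $ i)"
  then show "L2 \<Omega> f" by (auto simp: L2_iff measurable_plane_iff norm_plane L2m_def)
qed

lemma L2_mat_iff: "L2 \<Omega> f \<longleftrightarrow> (\<forall>i j. L2m NN (\<lambda>x. f x $ i $ j))" for f :: "plane \<Rightarrow> real^2^2"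
proof
  assume L: "L2 \<Omega> f"
  show "\<forall>i j. L2m NN (\<lambda>x. f x $ i $ j)"
    by (intro allI L2m_dominated(1)[of _ _ "\<lambda>x. (norm (f x))\<^sup>2"]) (use L in \<open>auto simp: L2_iff measurable_mat_iff component_mat_sq_le\<close>)
next
  assume "\<forall>i j. L2m NN (\<lambda>x. f x $ i $ j)"
  then show "L2 \<Omega> f" by (auto simp: L2_iff measurable_mat_iff norm_mat L2m_def)
qed

lemma Lp_norm_2: "(Lp_norm 2 \<Omega> f)\<^sup>2 = (\<integral>x. (norm (f x))\<^sup>2 \<partial>NN)"
  using dom_sets by (simp add: Lp_norm_def set_integral_lebesgue_on sqrt_def[symmetric])

lemma Lp_norm_2_tendsto_iff:
  "(\<lambda>k. Lp_norm 2 \<Omega> (f k)) \<longlonglongrightarrow> 0 \<longleftrightarrow> (\<lambda>k. \<integral>x. (norm (f k x))\<^sup>2 \<partial>NN) \<longlonglongrightarrow> 0"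
proof
  assume "(\<lambda>k. Lp_norm 2 \<Omega> (f k)) \<longlonglongrightarrow> 0"
  then have "(\<lambda>k. (Lp_norm 2 \<Omega> (f k))\<^sup>2) \<longlonglongrightarrow> 0\<^sup>2" by (rule tendsto_power)
  then show "(\<lambda>k. \<integral>x. (norm (f k x))\<^sup>2 \<partial>NN) \<longlonglongrightarrow> 0" by (simp add: Lp_norm_2)
next
  assume "(\<lambda>k. \<integral>x. (norm (f k x))\<^sup>2 \<partial>NN) \<longlonglongrightarrow> 0"
  then have "(\<lambda>k. sqrt (\<integral>x. (norm (f k x))\<^sup>2 \<partial>NN)) \<longlonglongrightarrow> sqrt 0" by (rule tendsto_real_sqrt)
  moreover have "Lp_norm 2 \<Omega> (f k) = sqrt (\<integral>x. (norm (f k x))\<^sup>2 \<partial>NN)" for k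
    using dom_sets by (simp add: Lp_norm_def set_integral_lebesgue_on sqrt_def[symmetric])
  ultimately show "(\<lambda>k. Lp_norm 2 \<Omega> (f k)) \<longlonglongrightarrow> 0" by simp
qed

lemma wgrad_AE:
  assumes "\<And>i j. is_weak_deriv \<Omega> (axis j 1) (\<lambda>y. u y $ i) (\<lambda>x. G x $ i $ j)"
  shows "AE x in NN. wgrad \<Omega> u x = G x"
proof -
  have "AE x in NN. weak_deriv \<Omega> (axis j 1) (\<lambda>y. u y $ i) x = G x $ i $ j" for i j
    unfolding AE_dom by (rule weak_deriv_eq_AE[OF open_dom _ assms]) simp
  then have "AE x in NN. \<forall>i\<in>UNIV. \<forall>j\<in>UNIV. weak_deriv \<Omega> (axis j 1) (\<lambda>y. u y $ i) x = G x $ i $ j"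
    by (intro AE_finite_allI) auto
  then show ?thesis by eventually_elim (simp add: wgrad_def vec_eq_iff)
qed

lemma wgrad_smooth_AE:
  assumes "\<And>i. smooth (\<lambda>x. v x $ i)"
  shows "AE x in NN. wgrad \<Omega> v x = (\<chi> i j. pd j (\<lambda>y. v y $ i) x)"
  by (rule wgrad_AE) (simp add: is_weak_deriv_smooth[OF assms])

lemma vtrace_weak_deriv:
  "vtrace \<Omega> u G g \<Longrightarrow> is_weak_deriv \<Omega> (axis j 1) (\<lambda>y. u y $ i) (\<lambda>x. G x $ i $ j)"
  unfolding vtrace_def by (rule strace_weak_deriv) blast

lemma vtrace_wgrad_AE: "vtrace \<Omega> u G g \<Longrightarrow> AE x in NN. wgrad \<Omega> u x = G x"
  by (rule wgrad_AE, rule vtrace_weak_deriv)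

lemma vtrace_H1:
  assumes "vtrace \<Omega> u G g" shows "u \<in> H1 \<Omega>"
proof -
  have s: "strace \<Omega> (\<lambda>x. u x $ i) (\<lambda>j x. G x $ i $ j) (\<lambda>x. g x $ i)" for i using assms by (simp add: vtrace_def)
  show ?thesis
    unfolding H1_def mem_Collect_eq L2_plane_iff L2_real_iff
    using strace_L2m[OF s] strace_weak_deriv[OF s] by meson
qed

text \<open>The approximants of the two components, found independently, form one vector field; the
  squared norms split into sums over the components and over the matrix entries.\<close>

lemma vtrace_is_trace:
  assumes "vtrace \<Omega> u G g" shows "is_trace \<Omega> u g"
proof -
  from assms have "\<forall>i. \<exists>v. approx \<Omega> v (\<lambda>x. u x $ i) (\<lambda>j x. G x $ i $ j) (\<lambda>x. g x $ i)"
    by (simp add: vtrace_def strace_def)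
  then obtain w where w: "\<And>i. approx \<Omega> (w i) (\<lambda>x. u x $ i) (\<lambda>j x. G x $ i $ j) (\<lambda>x. g x $ i)" by metis
  note W = w[unfolded approx_def]
  define v where "v k x = (\<chi> i. w i k x)" for k x
  have vi: "(\<lambda>x. v k x $ i) = w i k" for k i by (simp add: v_def)
  have sm: "smooth (\<lambda>x. v k x $ i)" for k i unfolding vi using W by blast
  have 1: "(\<lambda>k. Lp_norm 2 \<Omega> (\<lambda>x. v k x - u x)) \<longlonglongrightarrow> 0"
  proof -
    have "(\<lambda>k. (\<integral>x. (w 1 k x - u x $ 1)\<^sup>2 \<partial>NN) + (\<integral>x. (w 2 k x - u x $ 2)\<^sup>2 \<partial>NN)) \<longlonglongrightarrow> 0 + 0"
      by (intro tendsto_add) (use W in \<open>auto simp: cv2_def\<close>)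
    moreover have "(\<integral>x. (norm (v k x - u x))\<^sup>2 \<partial>NN) =
        (\<integral>x. (w 1 k x - u x $ 1)\<^sup>2 \<partial>NN) + (\<integral>x. (w 2 k x - u x $ 2)\<^sup>2 \<partial>NN)" for k
    proof -
      have "integrable NN (\<lambda>x. (w i k x - u x $ i)\<^sup>2)" for i
        using W[of i] L2m_diff unfolding cv2_def L2m_def by blast
      then show ?thesis by (simp add: norm_plane v_def)
    qed
    ultimately show ?thesis by (simp add: Lp_norm_2_tendsto_iff)
  qed
  have 2: "(\<lambda>k. Lp_norm 2 \<Omega> (\<lambda>x. wgrad \<Omega> (v k) x - wgrad \<Omega> u x)) \<longlonglongrightarrow> 0"
  proof -
    let ?e = "\<lambda>i j k. \<integral>x. (pd j (w i k) x - G x $ i $ j)\<^sup>2 \<partial>NN"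
    have "(\<lambda>k. ?e 1 1 k + ?e 1 2 k + ?e 2 1 k + ?e 2 2 k) \<longlonglongrightarrow> 0 + 0 + 0 + 0"
      by (intro tendsto_add) (use W in \<open>auto simp: cv2_def\<close>)
    moreover have "(\<integral>x. (norm (wgrad \<Omega> (v k) x - wgrad \<Omega> u x))\<^sup>2 \<partial>NN) = ?e 1 1 k + ?e 1 2 k + ?e 2 1 k + ?e 2 2 k" for k
    proof -
      have i: "integrable NN (\<lambda>x. (pd j (w i k) x - G x $ i $ j)\<^sup>2)" for i j
        using W[of i] L2m_diff unfolding cv2_def L2m_def by blast
      let ?V = "\<lambda>x. \<chi> i j. pd j (\<lambda>y. v k y $ i) x"
      have ae: "AE x in NN. wgrad \<Omega> (v k) x = ?V x" "AE x in NN. wgrad \<Omega> u x = G x"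
        using wgrad_smooth_AE[OF sm] vtrace_wgrad_AE[OF assms] by auto
      have m: "?V \<in> borel_measurable NN" "G \<in> borel_measurable NN"
        using W by (auto simp: measurable_mat_iff vi cv2_def L2m_def)
      have "(\<integral>x. (norm (wgrad \<Omega> (v k) x - wgrad \<Omega> u x))\<^sup>2 \<partial>NN) = (\<integral>x. (norm (?V x - G x))\<^sup>2 \<partial>NN)"
        by (rule integral_dom_AE(1)) (use m ae in \<open>auto elim: eventually_elim2\<close>)
      also have "\<dots> = ?e 1 1 k + ?e 1 2 k + ?e 2 1 k + ?e 2 2 k"
        using i by (simp add: norm_mat vi)
      finally show ?thesis .
    qed
    ultimately show ?thesis by (simp add: Lp_norm_2_tendsto_iff)
  qed
  have 3: "(\<lambda>k. bsq \<Omega> (\<lambda>x. norm (v k x - g x))) \<longlonglongrightarrow> 0"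
  proof -
    let ?e = "\<lambda>i k. bsq \<Omega> (\<lambda>x. w i k x - g x $ i)"
    have "(\<lambda>k. ?e 1 k + ?e 2 k) \<longlonglongrightarrow> 0 + 0" by (intro tendsto_add) (use W in auto)
    moreover have "bsq \<Omega> (\<lambda>x. norm (v k x - g x)) = ?e 1 k + ?e 2 k" for k
    proof -
      have [measurable]: "w i k \<in> borel_measurable hausdorff1" "(\<lambda>x. g x $ i) \<in> borel_measurable hausdorff1" "frontier \<Omega> \<in> sets hausdorff1" for i
        using W[of i] frontier_sets by (auto intro: borel_imp_hausdorff1 smooth_borel)
      have "bsq \<Omega> (\<lambda>x. norm (v k x - g x)) =
        (\<integral>\<^sup>+x. ennreal ((w 1 k x - g x $ 1)\<^sup>2) * indicator (frontier \<Omega>) x + ennreal ((w 2 k x - g x $ 2)\<^sup>2) * indicator (frontier \<Omega>) x \<partial>hausdorff1)"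
        by (intro nn_integral_cong) (simp add: norm_plane v_def ennreal_plus distrib_right)
      also have "\<dots> = ?e 1 k + ?e 2 k" by (rule nn_integral_add) measurable
      finally show ?thesis .
    qed
    ultimately show ?thesis by simp
  qed
  show ?thesis
    unfolding is_trace_def
    using vtrace_H1[OF assms] sm 1 2 3 W by (auto simp: measurable_plane_iff intro!: exI[of _ v])
qed

lemma H1_wgrad:
  assumes "u \<in> H1 \<Omega>"
  shows "is_weak_deriv \<Omega> (axis j 1) (\<lambda>y. u y $ i) (\<lambda>x. wgrad \<Omega> u x $ i $ j)"
    "L2m NN (\<lambda>x. wgrad \<Omega> u x $ i $ j)" "L2m NN (\<lambda>x. u x $ i)"
proof -
  obtain g where g: "is_weak_deriv \<Omega> (axis j 1) (\<lambda>y. u y $ i) g" "L2m NN g"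
    using assms unfolding H1_def L2_real_iff by blast
  show w: "is_weak_deriv \<Omega> (axis j 1) (\<lambda>y. u y $ i) (\<lambda>x. wgrad \<Omega> u x $ i $ j)"
    unfolding wgrad_def using is_weak_deriv_weak_deriv[OF g(1)] by simp
  have ae: "AE x in lebesgue. x \<in> \<Omega> \<longrightarrow> g x = wgrad \<Omega> u x $ i $ j"
    by (rule weak_deriv_unique_AE[OF open_dom axis_in_Basis g(1) w])
  have m: "(\<lambda>x. wgrad \<Omega> u x $ i $ j) \<in> borel_measurable NN"
    by (rule measurable_dom_AE[of g]) (use g(2) ae in \<open>auto simp: L2m_def AE_dom\<close>)
  have "integrable NN (\<lambda>x. (wgrad \<Omega> u x $ i $ j)\<^sup>2)"
  proof (rule integrable_cong_AE[THEN iffD1])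
    show "AE x in NN. (g x)\<^sup>2 = (wgrad \<Omega> u x $ i $ j)\<^sup>2"
      using ae[folded AE_dom] by eventually_elim simp
  qed (use g(2) m in \<open>auto simp: L2m_def\<close>)
  then show "L2m NN (\<lambda>x. wgrad \<Omega> u x $ i $ j)" using m by (simp add: L2m_def)
  show "L2m NN (\<lambda>x. u x $ i)" using assms by (simp add: H1_def L2_plane_iff)
qed

text \<open>Conversely, the error of each component or entry is dominated by the norm of the
  vectorial error. For the smooth approximants \<open>wgrad\<close> is the classical gradient almost
  everywhere.\<close>

lemma is_trace_vtrace:
  assumes t: "is_trace \<Omega> u g" shows "vtrace \<Omega> u (wgrad \<Omega> u) g"
  unfolding vtrace_def
proof
  fix i
  from t obtain v where H: "u \<in> H1 \<Omega>" and gm: "g \<in> borel_measurable borel" and sm: "\<And>k i. smooth (\<lambda>x. v k x $ i)"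
    and 1: "(\<lambda>k. Lp_norm 2 \<Omega> (\<lambda>x. v k x - u x)) \<longlonglongrightarrow> 0"
    and 2: "(\<lambda>k. Lp_norm 2 \<Omega> (\<lambda>x. wgrad \<Omega> (v k) x - wgrad \<Omega> u x)) \<longlonglongrightarrow> 0"
    and 3: "(\<lambda>k. bsq \<Omega> (\<lambda>x. norm (v k x - g x))) \<longlonglongrightarrow> 0"
    unfolding is_trace_def by blast
  note uL = H1_wgrad(2,3)[OF H]
  have "approx \<Omega> (\<lambda>k x. v k x $ i) (\<lambda>x. u x $ i) (\<lambda>j x. wgrad \<Omega> u x $ i $ j) (\<lambda>x. g x $ i)"
    unfolding approx_def
  proof (intro conjI allI sm)
    show "cv2 NN (\<lambda>k x. v k x $ i) (\<lambda>x. u x $ i)"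
    proof (rule cv2I)
      show "L2m NN (\<lambda>x. v k x $ i)" for k by (rule smooth_L2m(1)[OF sm])
      show "(\<lambda>k. \<integral>x. (norm (v k x - u x))\<^sup>2 \<partial>NN) \<longlonglongrightarrow> 0" using 1 by (simp add: Lp_norm_2_tendsto_iff)
      fix k
      have "L2m NN (\<lambda>x. v k x $ l - u x $ l)" for l by (intro L2m_diff smooth_L2m sm uL)
      then have "L2 \<Omega> (\<lambda>x. v k x - u x)" by (simp add: L2_plane_iff)
      then show "(\<integral>x. (v k x $ i - u x $ i)\<^sup>2 \<partial>NN) \<le> (\<integral>x. (norm (v k x - u x))\<^sup>2 \<partial>NN)"
        by (intro L2m_dominated(2)) (use component_sq_le[of "v k _ - u _" i] in \<open>auto simp: L2_iff measurable_plane_iff\<close>)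
    qed (rule uL)
    fix j
    show "cv2 NN (\<lambda>k. pd j (\<lambda>x. v k x $ i)) (\<lambda>x. wgrad \<Omega> u x $ i $ j)"
    proof (rule cv2I)
      show "L2m NN (pd j (\<lambda>x. v k x $ i))" for k by (rule smooth_L2m(2)[OF sm])
      show "(\<lambda>k. \<integral>x. (norm (wgrad \<Omega> (v k) x - wgrad \<Omega> u x))\<^sup>2 \<partial>NN) \<longlonglongrightarrow> 0" using 2 by (simp add: Lp_norm_2_tendsto_iff)
      fix k
      have vH: "v k \<in> H1 \<Omega>"
        unfolding H1_def mem_Collect_eq L2_plane_iff L2_real_iff
        using smooth_L2m[OF sm] is_weak_deriv_smooth[OF sm] by blast
      have "L2m NN (\<lambda>x. wgrad \<Omega> (v k) x $ l $ m - wgrad \<Omega> u x $ l $ m)" for l m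
        by (intro L2m_diff uL H1_wgrad(2)[OF vH])
      then have L: "L2 \<Omega> (\<lambda>x. wgrad \<Omega> (v k) x - wgrad \<Omega> u x)" by (simp add: L2_mat_iff)
      show "(\<integral>x. (pd j (\<lambda>x. v k x $ i) x - wgrad \<Omega> u x $ i $ j)\<^sup>2 \<partial>NN) \<le> (\<integral>x. (norm (wgrad \<Omega> (v k) x - wgrad \<Omega> u x))\<^sup>2 \<partial>NN)"
      proof (rule L2m_dominated(2))
        show "(\<lambda>x. pd j (\<lambda>x. v k x $ i) x - wgrad \<Omega> u x $ i $ j) \<in> borel_measurable NN"
          using smooth_L2m(2)[OF sm] uL unfolding L2m_def by (intro borel_measurable_diff) auto
        show "integrable NN (\<lambda>x. (norm (wgrad \<Omega> (v k) x - wgrad \<Omega> u x))\<^sup>2)" using L by (simp add: L2_iff)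
        show "AE x in NN. (pd j (\<lambda>x. v k x $ i) x - wgrad \<Omega> u x $ i $ j)\<^sup>2 \<le> (norm (wgrad \<Omega> (v k) x - wgrad \<Omega> u x))\<^sup>2"
          using wgrad_smooth_AE[OF sm, of k]
        proof eventually_elim
          case (elim x)
          then have "pd j (\<lambda>x. v k x $ i) x = wgrad \<Omega> (v k) x $ i $ j" by simp
          then show ?case using component_mat_sq_le[of "wgrad \<Omega> (v k) x - wgrad \<Omega> u x" i j] by simp
        qed
      qed
    qed (rule uL)
  next
    show "(\<lambda>x. g x $ i) \<in> borel_measurable borel" using gm by (simp add: measurable_plane_iff)
    show "(\<lambda>k. bsq \<Omega> (\<lambda>x. v k x $ i - g x $ i)) \<longlonglongrightarrow> 0"
    proof (rule tendsto_sandwich[OF _ _ tendsto_const 3])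
      show "\<forall>\<^sub>F k in sequentially. bsq \<Omega> (\<lambda>x. v k x $ i - g x $ i)
          \<le> (bsq \<Omega> (\<lambda>x. norm (v k x - g x)))"
        using component_sq_le[of "v _ _ - g _" i]
        by (intro always_eventually allI nn_integral_mono mult_right_mono ennreal_leI) auto
    qed auto
  qed
  then show "strace \<Omega> (\<lambda>x. u x $ i) (\<lambda>j x. wgrad \<Omega> u x $ i $ j) (\<lambda>x. g x $ i)" unfolding strace_def by blast
qed

end

section \<open>Transport by a diffeomorphism\<close>

lemma smooth_plane_comp:
  fixes f :: "plane \<Rightarrow> real" and T :: "plane \<Rightarrow> plane"
  assumes "smooth f" "\<And>i. smooth (\<lambda>x. T x $ i)" shows "smooth (\<lambda>x. f (T x))"
  by (rule smooth_comp[OF assms(1)]) (use assms(2) in \<open>auto simp: Basis_plane inner_axis\<close>)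

lemma pd_comp:
  fixes f :: "plane \<Rightarrow> real" and T :: "plane \<Rightarrow> plane"
  assumes "smooth f" "\<And>i. smooth (\<lambda>x. T x $ i)"
  shows "pd j (\<lambda>x. f (T x)) x = pd j (\<lambda>x. T x $ 1) x * pd 1 f (T x) + pd j (\<lambda>x. T x $ 2) x * pd 2 f (T x)"
proof -
  have "pd j (\<lambda>x. f (T x)) x = (\<Sum>b\<in>Basis. pd j (\<lambda>x. T x \<bullet> b) x * dir_deriv b f (T x))"
    by (rule dir_deriv_comp) (use smooth_differentiable[OF assms(1)] smooth_differentiable[OF assms(2)] in
       \<open>auto simp: Basis_plane inner_axis\<close>)
  then show ?thesis by (simp add: Basis_plane inner_axis)
qed

definition Dmat :: "(plane \<Rightarrow> plane) \<Rightarrow> plane \<Rightarrow> real^2^2" where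
  "Dmat T x = (\<chi> i j. pd j (\<lambda>y. T y $ i) x)"

lemma has_derivative_Dmat:
  fixes T :: "plane \<Rightarrow> plane"
  assumes "\<And>i. smooth (\<lambda>x. T x $ i)"
  shows "(T has_derivative (\<lambda>h. Dmat T x *v h)) (at x within A)"
proof -
  have "(T has_derivative (\<lambda>h. Dmat T x *v h)) (at x)"
    unfolding has_derivative_componentwise_within[of T]
  proof
    fix b :: plane assume "b \<in> Basis"
    then obtain i where b: "b = axis i 1" by (auto simp: Basis_vec_def)
    show "((\<lambda>x. T x \<bullet> b) has_derivative (\<lambda>h. (Dmat T x *v h) \<bullet> b)) (at x)"
      using differentiable_has_derivative_dir_deriv[OF smooth_differentiable[OF assms[of i]], of x]
      by (simp add: b inner_axis Basis_plane Dmat_def matrix_vector_mult_def sum_2 mult.commute)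
  qed
  then show ?thesis by (rule has_derivative_at_withinI)
qed

locale diffeo = lipschitz_homeo T S K for T S :: "plane \<Rightarrow> plane" and K +
  assumes smT: "\<And>i. smooth (\<lambda>x. T x $ i)" and smS: "\<And>i. smooth (\<lambda>x. S x $ i)"
begin

lemma swap_diffeo: "diffeo S T K"
  using swap smT smS by (simp add: diffeo_def diffeo_axioms_def)

definition jac :: "plane \<Rightarrow> real" where "jac x = \<bar>det (Dmat T x)\<bar>"

lemma jac_continuous: "continuous_on A jac"
  unfolding jac_def det_2 Dmat_def vec_lambda_beta
  by (intro continuous_on_rabs continuous_on_diff continuous_on_mult smooth_continuous_on smooth_dir_deriv smT axis_in_Basis)

lemma inj_T: "inj_on T A"
  by (metis ST inj_onI)

lemma change_of_variables:
  fixes f :: "plane \<Rightarrow> real"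
  assumes A: "A \<in> sets lebesgue"
  shows "set_integrable lebesgue (T ` A) f \<longleftrightarrow> set_integrable lebesgue A (\<lambda>x. jac x * f (T x))" (is ?thesis1)
    and "(LINT y:T ` A|lebesgue. f y) = (LINT x:A|lebesgue. jac x * f (T x))" (is ?thesis2)
proof -
  \<comment> \<open>The change of variables theorem concerns functions with values in
    \<open>real^'n\<close>, so scalars enter as elements of \<open>real^1\<close>.\<close>
  let ?f = "\<lambda>y. vec (f y) :: real^1"
  have d: "(T has_derivative (\<lambda>h. Dmat T x *v h)) (at x within A)" for x
    by (rule has_derivative_Dmat[OF smT])
  have j: "(\<lambda>x. \<bar>det (matrix (\<lambda>h. Dmat T x *v h))\<bar> *\<^sub>R ?f (T x)) = (\<lambda>x. vec (jac x * f (T x)))"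
    by (auto simp: jac_def vec_eq_iff)
  note C = has_absolute_integral_change_of_variables[OF A d inj_T, of ?f, unfolded j]
  have a: "(\<lambda>x. vec (h x) :: real^1) absolutely_integrable_on U \<longleftrightarrow> h absolutely_integrable_on U" for h :: "plane \<Rightarrow> real" and U
    by (simp add: absolutely_integrable_on_1_iff)
  have b: "integral U (\<lambda>x. vec (h x) :: real^1) = vec (integral U h)" for h :: "plane \<Rightarrow> real" and U
    by (simp add: integral_on_1_eq)
  show 1: ?thesis1 using C[of "integral (T ` A) ?f"] C[of "integral A (\<lambda>x. vec (jac x * f (T x)))"] unfolding a by blast
  show ?thesis2
  proof (cases "f absolutely_integrable_on T ` A")
    case True
    then have "integral A (\<lambda>x. vec (jac x * f (T x)) :: real^1) = integral (T ` A) ?f"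
      using C[of "integral (T ` A) ?f"] unfolding a by blast
    then have "integral A (\<lambda>x. jac x * f (T x)) = integral (T ` A) f"
      unfolding b by (simp add: vec_eq_iff)
    then show ?thesis
      using set_lebesgue_integral_eq_integral(2)[OF True] set_lebesgue_integral_eq_integral(2)[OF 1[THEN iffD1, OF True]] by simp
  next
    case False
    \<comment> \<open>Neither side is integrable here, and both integrals are zero by
      convention.\<close>
    then show ?thesis using 1 by (simp add: set_lebesgue_integral_def set_integrable_def not_integrable_integral_eq)
  qed
qed

end

locale diffeo_dom = diffeo T S K + bdom \<Omega> for T S K \<Omega>
begin

lemma image_eq_vimage: "T ` \<Omega> = S -` \<Omega>"
  by (auto simp: ST) (metis TS image_eqI)

sublocale img: bdom "T ` \<Omega>"
proof
  have "continuous_on UNIV S" by (rule lipschitz_homeo.continuous_T[OF swap])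
  then show "open (T ` \<Omega>)" unfolding image_eq_vimage using open_dom by (simp add: continuous_on_open_vimage open_vimage)
  have "compact (T ` closure \<Omega>)"
    using bounded_dom by (intro compact_continuous_image continuous_T) (simp add: compact_closure)
  then show "bounded (T ` \<Omega>)"
    by (meson bounded_subset closure_subset compact_imp_bounded image_mono)
qed

lemma frontier_image: "frontier (T ` \<Omega>) = T ` frontier \<Omega>"
proof -
  have "closure (T ` \<Omega>) = T ` closure \<Omega>"
  proof
    show "T ` closure \<Omega> \<subseteq> closure (T ` \<Omega>)"
      by (rule image_closure_subset[OF continuous_T]) (auto simp: closure_subset)
    have "closed (T ` closure \<Omega>)"
      using bounded_dom by (intro compact_imp_closed compact_continuous_image continuous_T) (simp add: compact_closure)
    then show "closure (T ` \<Omega>) \<subseteq> T ` closure \<Omega>"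
      by (intro closure_minimal image_mono closure_subset)
  qed
  then show ?thesis
    using open_dom img.open_dom inj_T[of UNIV]
    by (simp add: frontier_def interior_open image_set_diff)
qed

lemma integrable_image_iff:
  fixes f :: "plane \<Rightarrow> real"
  shows "integrable (lebesgue_on (T ` \<Omega>)) f \<longleftrightarrow> integrable NN (\<lambda>x. jac x * f (T x))"
  using change_of_variables(1)[OF dom_sets(1)] dom_sets img.dom_sets
  by (simp add: set_integrable_lebesgue_on)

lemma integral_image:
  fixes f :: "plane \<Rightarrow> real"
  shows "(\<integral>y. f y \<partial>lebesgue_on (T ` \<Omega>)) = (\<integral>x. jac x * f (T x) \<partial>NN)"
  using change_of_variables(2)[OF dom_sets(1)] dom_sets img.dom_sets
  by (simp add: set_integral_lebesgue_on)

lemma L2m_comp: assumes h: "L2m NN h" shows "L2m (lebesgue_on (T ` \<Omega>)) (\<lambda>y. h (S y))"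
proof -
  obtain C where C: "\<And>x. x \<in> closure \<Omega> \<Longrightarrow> \<bar>jac x\<bar> \<le> C" using bounded_continuous_dom[OF jac_continuous] by blast
  have bm: "integrable NN (\<lambda>x. jac x * f x)" if "integrable NN f" for f
  proof (rule Bochner_Integration.integrable_bound)
    show "integrable NN (\<lambda>x. C * f x)" using that by simp
    show "(\<lambda>x. jac x * f x) \<in> borel_measurable NN"
      using that continuous_measurable_dom[OF jac_continuous] by auto
    show "AE x in NN. norm (jac x * f x) \<le> norm (C * f x)"
    proof (rule AE_I2)
      fix x assume "x \<in> space NN"
      then have "\<bar>jac x\<bar> \<le> \<bar>C\<bar>" using C[of x] closure_subset by fastforce
      then show "norm (jac x * f x) \<le> norm (C * f x)" by (simp add: abs_mult mult_right_mono)
    qed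
  qed
  have "integrable (lebesgue_on (T ` \<Omega>)) (\<lambda>y. h (S y))" "integrable (lebesgue_on (T ` \<Omega>)) (\<lambda>y. (h (S y))\<^sup>2)"
    unfolding integrable_image_iff using bm L2m_integrable[OF h] h by (simp_all add: ST L2m_def)
  then show ?thesis by (auto simp: L2m_def)
qed

text \<open>The exceptional set is mapped by \<open>T\<close>, and a differentiable map of the plane
  sends null sets to null sets.\<close>

lemma AE_image:
  assumes "AE x in NN. P x" shows "AE y in lebesgue_on (T ` \<Omega>). P (S y)"
proof -
  have "negligible {x\<in>\<Omega>. \<not> P x}"
    using assms[unfolded AE_dom] completion.AE_iff_null_sets[of "\<lambda>x. x \<in> \<Omega> \<longrightarrow> P x" lborel]
    by (simp add: negligible_iff_null_sets)
  moreover have "T differentiable_on {x\<in>\<Omega>. \<not> P x}"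
    unfolding differentiable_on_def differentiable_def using has_derivative_Dmat[OF smT] by blast
  ultimately have "negligible (T ` {x\<in>\<Omega>. \<not> P x})"
    by (intro negligible_differentiable_image_negligible) auto
  moreover have "T ` {x\<in>\<Omega>. \<not> P x} = {y. \<not> (y \<in> T ` \<Omega> \<longrightarrow> P (S y))}" by (auto simp: ST)
  ultimately show ?thesis
    unfolding img.AE_dom by (simp add: completion.AE_iff_null_sets negligible_iff_null_sets)
qed

lemma cv2_comp:
  assumes v: "cv2 NN v f"
  shows "cv2 (lebesgue_on (T ` \<Omega>)) (\<lambda>k y. v k (S y)) (\<lambda>y. f (S y))"
proof -
  obtain C where C: "0 \<le> C" "\<And>x. x \<in> closure \<Omega> \<Longrightarrow> \<bar>jac x\<bar> \<le> C" using bounded_continuous_dom[OF jac_continuous] by blast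
  note V = v[unfolded cv2_def]
  show ?thesis
  proof (rule cv2I)
    show "L2m (lebesgue_on (T ` \<Omega>)) (\<lambda>y. v k (S y))" "L2m (lebesgue_on (T ` \<Omega>)) (\<lambda>y. f (S y))" for k
      using V L2m_comp by auto
    show "(\<lambda>k. C * (\<integral>x. (v k x - f x)\<^sup>2 \<partial>NN)) \<longlonglongrightarrow> 0"
      using V by (auto intro!: tendsto_eq_intros)
    fix k
    have d: "L2m NN (\<lambda>x. v k x - f x)" using V by (auto intro: L2m_diff)
    have "(\<integral>y. (v k (S y) - f (S y))\<^sup>2 \<partial>lebesgue_on (T ` \<Omega>)) = (\<integral>x. jac x * (v k x - f x)\<^sup>2 \<partial>NN)"
      by (simp add: integral_image ST)
    also have "\<dots> \<le> (\<integral>x. C * (v k x - f x)\<^sup>2 \<partial>NN)"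
    proof (rule integral_mono)
      show "integrable NN (\<lambda>x. jac x * (v k x - f x)\<^sup>2)"
        using L2m_mult_integrable[OF L2m_mult_continuous[OF d jac_continuous] d] by (simp add: power2_eq_square mult.assoc)
      show "integrable NN (\<lambda>x. C * (v k x - f x)\<^sup>2)" using d by (simp add: L2m_def)
      fix x assume "x \<in> space NN"
      then have "jac x \<le> C" using C(2)[of x] closure_subset by fastforce
      then show "jac x * (v k x - f x)\<^sup>2 \<le> C * (v k x - f x)\<^sup>2" by (simp add: mult_right_mono)
    qed
    also have "\<dots> = C * (\<integral>x. (v k x - f x)\<^sup>2 \<partial>NN)" by simp
    finally show "(\<integral>y. (v k (S y) - f (S y))\<^sup>2 \<partial>lebesgue_on (T ` \<Omega>)) \<le> C * (\<integral>x. (v k x - f x)\<^sup>2 \<partial>NN)" .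
  qed
qed

text \<open>The approximants are composed with the inverse map. Interior errors grow at most by the
  maximum of the Jacobian on the closure, boundary errors by the Lipschitz constant through the
  comparison of Hausdorff measures; the gradients follow the chain rule with smooth
  coefficients.\<close>

lemma approx_comp:
  assumes v: "approx \<Omega> v f F g"
  shows "approx (T ` \<Omega>) (\<lambda>k y. v k (S y)) (\<lambda>y. f (S y))
     (\<lambda>j y. pd j (\<lambda>x. S x $ 1) y * F 1 (S y) + pd j (\<lambda>x. S x $ 2) y * F 2 (S y)) (\<lambda>y. g (S y))"
  unfolding approx_def
proof (intro conjI allI)
  have V: "\<And>k. smooth (v k)" "cv2 NN v f" "\<And>j. cv2 NN (\<lambda>k. pd j (v k)) (F j)"
    "g \<in> borel_measurable borel" "(\<lambda>k. bsq \<Omega> (\<lambda>x. v k x - g x)) \<longlonglongrightarrow> 0"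
    using v by (auto simp: approx_def)
  show "smooth (\<lambda>y. v k (S y))" for k by (rule smooth_plane_comp[OF V(1) smS])
  show "cv2 (lebesgue_on (T ` \<Omega>)) (\<lambda>k y. v k (S y)) (\<lambda>y. f (S y))" by (rule cv2_comp[OF V(2)])
  have "pd j (\<lambda>y. v k (S y)) = (\<lambda>y. pd j (\<lambda>x. S x $ 1) y * pd 1 (v k) (S y) + pd j (\<lambda>x. S x $ 2) y * pd 2 (v k) (S y))" for j k
    by (rule ext, rule pd_comp[OF V(1) smS])
  then show "cv2 (lebesgue_on (T ` \<Omega>)) (\<lambda>k. pd j (\<lambda>y. v k (S y)))
      (\<lambda>y. pd j (\<lambda>x. S x $ 1) y * F 1 (S y) + pd j (\<lambda>x. S x $ 2) y * F 2 (S y))" for j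
    by (simp only:) (intro cv2_add img.cv2_mult_continuous cv2_comp V smooth_continuous_on smooth_dir_deriv smS axis_in_Basis)
  have Sm: "S \<in> borel_measurable borel"
    by (intro borel_measurable_continuous_onI lipschitz_homeo.continuous_T[OF swap])
  show "(\<lambda>y. g (S y)) \<in> borel_measurable borel" by (rule measurable_compose[OF Sm V(4)])
  let ?v = "\<lambda>k. bsq \<Omega> (\<lambda>x. v k x - g x)"
  show "(\<lambda>k. \<integral>\<^sup>+y\<in>frontier (T ` \<Omega>). ennreal ((v k (S y) - g (S y))\<^sup>2) \<partial>hausdorff1) \<longlonglongrightarrow> 0"
  proof (rule tendsto_sandwich[OF _ _ tendsto_const])
    have "(\<lambda>k. ennreal K * ?v k) \<longlonglongrightarrow> ennreal K * 0" by (intro ennreal_tendsto_cmult V) simp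
    then show "(\<lambda>k. ennreal K * ?v k) \<longlonglongrightarrow> 0" by simp
    have "(\<integral>\<^sup>+y\<in>frontier (T ` \<Omega>). ennreal ((v k (S y) - g (S y))\<^sup>2) \<partial>hausdorff1) \<le> ennreal K * ?v k" for k
    proof -
      let ?h = "\<lambda>x. ennreal ((v k x - g x)\<^sup>2) * indicator (frontier \<Omega>) x"
      have "indicator (frontier (T ` \<Omega>)) y = (indicator (frontier \<Omega>) (S y) :: ennreal)" for y
      proof -
        have "y \<in> frontier (T ` \<Omega>) \<longleftrightarrow> S y \<in> frontier \<Omega>"
          unfolding frontier_image by (metis ST TS imageE image_eqI)
        then show ?thesis by (simp add: indicator_def)
      qed
      moreover have "?h \<in> borel_measurable borel"
      proof -
        have [measurable]: "v k \<in> borel_measurable borel" "g \<in> borel_measurable borel" "frontier \<Omega> \<in> sets borel"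
          by (rule smooth_borel[OF V(1)], rule V(4), rule frontier_sets)
        show ?thesis by measurable
      qed
      ultimately show ?thesis
        using lipschitz_homeo.nn_integral_comp_le[OF swap, of ?h] by simp
    qed
    then show "\<forall>\<^sub>F k in sequentially. (\<integral>\<^sup>+y\<in>frontier (T ` \<Omega>). ennreal ((v k (S y) - g (S y))\<^sup>2) \<partial>hausdorff1) \<le> ennreal K * ?v k"
      by simp
  qed auto
qed

lemma vtrace_comp:
  assumes "vtrace \<Omega> u G g"
  shows "vtrace (T ` \<Omega>) (\<lambda>y. u (S y)) (\<lambda>y. G (S y) ** Dmat S y) (\<lambda>y. g (S y))"
proof -
  have "strace (T ` \<Omega>) (\<lambda>y. u (S y) $ i)
     (\<lambda>j y. pd j (\<lambda>x. S x $ 1) y * G (S y) $ i $ 1 + pd j (\<lambda>x. S x $ 2) y * G (S y) $ i $ 2) (\<lambda>y. g (S y) $ i)" for i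
  proof -
    obtain v where "approx \<Omega> v (\<lambda>x. u x $ i) (\<lambda>j x. G x $ i $ j) (\<lambda>x. g x $ i)"
      using assms unfolding vtrace_def strace_def by blast
    from approx_comp[OF this] show ?thesis unfolding strace_def by blast
  qed
  then show ?thesis
    unfolding vtrace_def by (simp add: matrix_matrix_mult_def sum_2 Dmat_def mult.commute)
qed

end

context bdom begin

lemma vtrace_diff:
  assumes "vtrace \<Omega> u G g" "vtrace \<Omega> v H h"
  shows "vtrace \<Omega> (\<lambda>x. u x - v x) (\<lambda>x. G x - H x) (\<lambda>x. g x - h x)"
  using assms strace_diff unfolding vtrace_def by fastforce

lemma vtrace_smooth:
  assumes "\<And>i. smooth (\<lambda>x. v x $ i)" shows "vtrace \<Omega> v (Dmat v) v"
  unfolding vtrace_def Dmat_def using strace_smooth[OF assms] by simp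

lemma vtrace_matrix_mult:
  assumes N: "\<And>i j. smooth (\<lambda>x. (N x :: real^2^2) $ i $ j)" and u: "vtrace \<Omega> u G g"
  shows "vtrace \<Omega> (\<lambda>x. N x *v u x) (\<lambda>x. N x ** G x + (\<chi> i j. pd j (\<lambda>y. N y $ i $ 1) x * u x $ 1 + pd j (\<lambda>y. N y $ i $ 2) x * u x $ 2)) (\<lambda>x. N x *v g x)"
  unfolding vtrace_def
proof
  fix i
  have s: "strace \<Omega> (\<lambda>x. u x $ l) (\<lambda>j x. G x $ l $ j) (\<lambda>x. g x $ l)" for l using u by (simp add: vtrace_def)
  from strace_add[OF strace_mult[OF s[of 1] N[of i 1]] strace_mult[OF s[of 2] N[of i 2]]]
  show "strace \<Omega> (\<lambda>x. (N x *v u x) $ i) (\<lambda>j x. (N x ** G x + (\<chi> i j. pd j (\<lambda>y. N y $ i $ 1) x * u x $ 1 + pd j (\<lambda>y. N y $ i $ 2) x * u x $ 2)) $ i $ j) (\<lambda>x. (N x *v g x) $ i)"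
    by (simp add: matrix_vector_mult_def matrix_matrix_mult_def sum_2 algebra_simps)
qed

end

section \<open>The rectangle with a rectangular hole\<close>

lemma integrable_plane_fst:
  assumes f: "integrable lborel (f :: plane \<Rightarrow> real)"
  shows "integrable lborel (\<lambda>s. LINT t|lborel. f (pt s t))" "integrable lborel (\<lambda>t. LINT s|lborel. f (pt s t))"
proof -
  have fb: "f \<in> borel_measurable borel" using f by auto
  have m: "(\<lambda>(s, t). pt s t) \<in> lborel \<Otimes>\<^sub>M lborel \<rightarrow>\<^sub>M borel"
    using borel_pt by (simp cong: measurable_cong_sets sets_pair_measure_cong)
  have eq: "(\<lambda>p. f (case p of (s, t) \<Rightarrow> pt s t)) = (\<lambda>(s, t). f (pt s t))" by auto
  have i: "integrable (lborel \<Otimes>\<^sub>M lborel) (\<lambda>(s, t). f (pt s t))"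
    using f integrable_distr_eq[OF m fb, folded lborel_plane] unfolding eq by blast
  show "integrable lborel (\<lambda>s. LINT t|lborel. f (pt s t))" "integrable lborel (\<lambda>t. LINT s|lborel. f (pt s t))"
    using lborel_pair.integrable_fst[OF i] lborel_pair.integrable_snd[OF i] by simp_all
qed

lemma Rect_set_integrable:
  fixes h :: "plane \<Rightarrow> real"
  assumes "continuous_on UNIV h"
  shows "set_integrable lborel {a..b} (\<lambda>s. LINT t:{c..d}|lborel. h (pt s t))"
    "set_integrable lborel {c..d} (\<lambda>t. LINT s:{a..b}|lborel. h (pt s t))"
proof -
  have *: "indicator (Rect a b c d) (pt s t) = (indicator {c..d} t * indicator {a..b} s :: real)" for s t
    by (simp add: indicator_Rect)
  show "set_integrable lborel {a..b} (\<lambda>s. LINT t:{c..d}|lborel. h (pt s t))"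
    using integrable_plane_fst(1)[OF Rect_integrable[OF assms, of a b c d]]
    by (simp add: indicator_Rect set_lebesgue_integral_def set_integrable_def mult.assoc)
  show "set_integrable lborel {c..d} (\<lambda>t. LINT s:{a..b}|lborel. h (pt s t))"
    using integrable_plane_fst(2)[OF Rect_integrable[OF assms, of a b c d]]
    by (simp add: * set_lebesgue_integral_def set_integrable_def mult.assoc)
qed

text \<open>The fundamental theorem applied to the square of \<open>f\<close> between
  \<open>y\<close> and \<open>x\<close>, averaged over all \<open>y\<close> in the interval. The
  lower bound \<open>\<delta>\<close> for the length allows one constant for intervals of different
  lengths.\<close>

lemma sup_le_integral:
  fixes f f' :: "real \<Rightarrow> real"
  assumes d: "\<And>x. (f has_real_derivative f' x) (at x)" and c: "continuous_on UNIV f'" and x: "a \<le> x" "x \<le> b"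
    and \<delta>: "0 < \<delta>" "\<delta> \<le> b - a"
  shows "(f x)\<^sup>2 \<le> (LINT y:{a..b}|lborel. (f y)\<^sup>2 / \<delta> + 2 * \<bar>f y * f' y\<bar>)"
proof -
  have fc: "continuous_on A f" for A
    using d by (meson DERIV_isCont continuous_at_imp_continuous_on)
  have f'c: "continuous_on A f'" for A using c continuous_on_subset by blast
  have i: "set_integrable lborel {u..v} (\<lambda>y. 2 * \<bar>f y * f' y\<bar>)" "set_integrable lborel {u..v} (\<lambda>y. (f y)\<^sup>2)"
    "set_integrable lborel {u..v} (\<lambda>y. 2 * f y * f' y)" for u v
    by (auto intro!: borel_integrable_atLeastAtMost' continuous_intros fc f'c)
  have D: "((\<lambda>y. (f y)\<^sup>2) has_real_derivative 2 * f y * f' y) (at y)" for y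
    by (auto intro!: derivative_eq_intros d)
  let ?A = "LINT y:{a..b}|lborel. 2 * \<bar>f y * f' y\<bar>"
  have step: "(f x)\<^sup>2 \<le> (f y)\<^sup>2 + ?A" if y: "a \<le> y" "y \<le> b" for y
  proof -
    have FTC: "\<bar>(f v)\<^sup>2 - (f u)\<^sup>2\<bar> \<le> ?A" if uv: "a \<le> u" "u \<le> v" "v \<le> b" for u v
    proof -
      have "(f v)\<^sup>2 - (f u)\<^sup>2 = (LINT y:{u..v}|lborel. 2 * f y * f' y)"
        by (rule set_integral_FTC[symmetric, OF uv(2) D]) (intro continuous_intros fc c)
      also have "\<bar>\<dots>\<bar> \<le> (LINT y:{u..v}|lborel. \<bar>2 * f y * f' y\<bar>)"
        using set_integral_norm_bound[OF i(3)[of u v]] by simp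
      also have "\<dots> = (LINT y:{u..v}|lborel. 2 * \<bar>f y * f' y\<bar>)" by (simp add: abs_mult mult.assoc)
      also have "\<dots> \<le> ?A"
        unfolding set_lebesgue_integral_def
        by (rule integral_mono) (use i uv in \<open>auto simp: set_integrable_def indicator_def\<close>)
      finally show ?thesis .
    qed
    show ?thesis
    proof (cases "y \<le> x")
      case True
      then show ?thesis using FTC[of y x] x y by linarith
    next
      case False
      then show ?thesis using FTC[of x y] x y by linarith
    qed
  qed
  have ab: "a \<le> b" using x by simp
  have "(b - a) * (f x)\<^sup>2 = (LINT y:{a..b}|lborel. (f x)\<^sup>2)"
    using ab by (simp add: set_lebesgue_integral_def)
  also have "\<dots> \<le> (LINT y:{a..b}|lborel. (f y)\<^sup>2 + ?A)"
    by (rule set_integral_mono) (use step i ab in \<open>auto intro!: borel_integrable_atLeastAtMost' continuous_intros fc f'c\<close>)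
  also have "\<dots> = (LINT y:{a..b}|lborel. (f y)\<^sup>2) + (b - a) * ?A"
    using ab i(2)[of a b] by (subst set_integral_add) (auto simp: set_lebesgue_integral_def set_integrable_def)
  finally have "(f x)\<^sup>2 \<le> (LINT y:{a..b}|lborel. (f y)\<^sup>2) / (b - a) + ?A"
    using \<delta> by (simp add: field_simps)
  also have "(LINT y:{a..b}|lborel. (f y)\<^sup>2) / (b - a) \<le> (LINT y:{a..b}|lborel. (f y)\<^sup>2) / \<delta>"
    by (rule divide_left_mono) (use \<delta> in \<open>auto simp: set_lebesgue_integral_def intro!: integral_nonneg_AE\<close>)
  finally have "(f x)\<^sup>2 \<le> (LINT y:{a..b}|lborel. (f y)\<^sup>2) / \<delta> + ?A" by simp
  also have "\<dots> = (LINT y:{a..b}|lborel. (f y)\<^sup>2 / \<delta> + 2 * \<bar>f y * f' y\<bar>)"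
    using i[of a b] by (subst set_integral_add) auto
  finally show ?thesis .
qed

text \<open>Ladyzhenskaya's argument: of the two factors \<open>(f x)^2\<close>, one is bounded by
  an integral along the horizontal line through \<open>x\<close>, the other by an integral along the
  vertical line, and the product of these bounds separates the variables.\<close>

lemma Rect_L4:
  assumes f: "smooth f" and \<delta>: "0 < \<delta>" "\<delta> \<le> b - a" "\<delta> \<le> d - c"
  shows "(LINT x|lborel. indicator (Rect a b c d) x * f x ^ 4) \<le>
    (LINT x|lborel. indicator (Rect a b c d) x * ((f x)\<^sup>2 / \<delta> + 2 * \<bar>f x * pd 1 f x\<bar>)) *
    (LINT x|lborel. indicator (Rect a b c d) x * ((f x)\<^sup>2 / \<delta> + 2 * \<bar>f x * pd 2 f x\<bar>))"
proof -
  let ?h = "\<lambda>j x. (f x)\<^sup>2 / \<delta> + 2 * \<bar>f x * pd j f x\<bar>"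
  have fc: "continuous_on A f" "continuous_on A (pd j f)" for A j
    by (auto intro!: smooth_continuous_on smooth_dir_deriv f)
  have hc: "continuous_on UNIV (?h j)" for j by (intro continuous_intros fc) (use \<delta> in auto)
  have f4: "continuous_on UNIV (\<lambda>x. f x ^ 4)" by (intro continuous_intros fc)
  let ?F = "\<lambda>t. LINT s:{a..b}|lborel. ?h 1 (pt s t)" and ?G = "\<lambda>s. LINT t:{c..d}|lborel. ?h 2 (pt s t)"
  have F: "(f (pt s t))\<^sup>2 \<le> ?F t" if "s \<in> {a..b}" for s t
    using sup_le_integral[OF dir_deriv_pt(1)[OF f] continuous_on_pt_comp(1)[OF fc(2)], of a s b \<delta> t] that \<delta> by auto
  have G: "(f (pt s t))\<^sup>2 \<le> ?G s" if "t \<in> {c..d}" for s t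
    using sup_le_integral[OF dir_deriv_pt(2)[OF f] continuous_on_pt_comp(2)[OF fc(2)], of c t d \<delta> s] that \<delta> by auto
  have Gi: "set_integrable lborel {a..b} ?G" and Fi: "set_integrable lborel {c..d} ?F"
    using Rect_set_integrable[OF hc] by auto
  have F0: "0 \<le> ?F t" and G0: "0 \<le> ?G s" for s t
    using \<delta> by (auto simp: set_lebesgue_integral_def intro!: integral_nonneg_AE)
  have "(LINT x|lborel. indicator (Rect a b c d) x * f x ^ 4) = (LINT s:{a..b}|lborel. (LINT t:{c..d}|lborel. f (pt s t) ^ 4))"
    by (rule Rect_integral(1)[OF f4])
  also have "\<dots> \<le> (LINT s:{a..b}|lborel. ?G s * (LINT t:{c..d}|lborel. ?F t))"
  proof (rule set_integral_mono)
    show "set_integrable lborel {a..b} (\<lambda>s. LINT t:{c..d}|lborel. f (pt s t) ^ 4)" by (rule Rect_set_integrable(1)[OF f4])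
    show "set_integrable lborel {a..b} (\<lambda>s. ?G s * (LINT t:{c..d}|lborel. ?F t))" using Gi by simp
    fix s assume s: "s \<in> {a..b}"
    have "(LINT t:{c..d}|lborel. f (pt s t) ^ 4) \<le> (LINT t:{c..d}|lborel. ?G s * ?F t)"
    proof (rule set_integral_mono)
      show "set_integrable lborel {c..d} (\<lambda>t. f (pt s t) ^ 4)"
        by (intro borel_integrable_atLeastAtMost' continuous_on_pt_comp f4)
      show "set_integrable lborel {c..d} (\<lambda>t. ?G s * ?F t)" using Fi by simp
      fix t assume t: "t \<in> {c..d}"
      have "(f (pt s t))\<^sup>2 * (f (pt s t))\<^sup>2 \<le> ?G s * ?F t"
        by (rule mult_mono[OF G[OF t] F[OF s] G0]) simp
      then show "f (pt s t) ^ 4 \<le> ?G s * ?F t" by (simp add: power4_eq_xxxx power2_eq_square mult.assoc)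
    qed
    also have "\<dots> = ?G s * (LINT t:{c..d}|lborel. ?F t)" by simp
    finally show "(LINT t:{c..d}|lborel. f (pt s t) ^ 4) \<le> ?G s * (LINT t:{c..d}|lborel. ?F t)" .
  qed
  also have "\<dots> = (LINT s:{a..b}|lborel. ?G s) * (LINT t:{c..d}|lborel. ?F t)" by simp
  also have "\<dots> = (LINT x|lborel. indicator (Rect a b c d) x * ?h 2 x) * (LINT x|lborel. indicator (Rect a b c d) x * ?h 1 x)"
    by (simp add: Rect_integral(1)[OF hc, of a b c d 2] Rect_integral(2)[OF hc, of a b c d 1])
  finally show ?thesis by (simp add: mult.commute)
qed

lemma AE_coordinate: "AE x in lborel. (x :: plane) $ i \<noteq> c"
proof -
  have "negligible {x :: plane. x \<bullet> axis i 1 = c}"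
    by (rule negligible_standard_hyperplane) simp
  then have "AE x in lebesgue. x \<notin> {x :: plane. x \<bullet> axis i 1 = c}"
    unfolding negligible_iff_null_sets by (rule AE_not_in)
  then show ?thesis by (simp add: AE_completion_iff inner_axis)
qed

text \<open>The reference domain. Its hole is symmetric about the horizontal axis, and all domains
  of the family are images of this one under vertical shifts.\<close>

locale holed =
  fixes L H p q m :: real
  assumes pq: "- L < p" "p < q" "q < L" and mH: "0 < m" "m < H"
begin

definition hole :: "plane set" where "hole = Rect p q (-m) m"
definition \<Omega> :: "plane set" where "\<Omega> = rect L H - hole"

lemma in_Om: "x \<in> \<Omega> \<longleftrightarrow> - L < x$1 \<and> x$1 < L \<and> - H < x$2 \<and> x$2 < H \<and> \<not> (p \<le> x$1 \<and> x$1 \<le> q \<and> -m \<le> x$2 \<and> x$2 \<le> m)"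
  by (auto simp: \<Omega>_def hole_def rect_def Rect_def)

lemma open_rect: "open (rect L H)"
proof -
  have "rect L H = box (pt (-L) (-H)) (pt L H)" by (auto simp: rect_def mem_box Basis_plane inner_axis)
  then show ?thesis by (simp add: open_box)
qed

sublocale bdom \<Omega>
proof
  show "open \<Omega>" unfolding \<Omega>_def hole_def by (intro open_Diff open_rect compact_Rect)
  have "\<Omega> \<subseteq> Rect (-L) L (-H) H" by (auto simp: in_Om Rect_def)
  then show "bounded \<Omega>" by (rule bounded_subset[rotated]) (simp add: compact_imp_bounded)
qed

lemma Rect_subset_closure:
  assumes "{x. a < x$1 \<and> x$1 < b \<and> c < x$2 \<and> x$2 < d} \<subseteq> \<Omega>" "a < b" "c < d"
  shows "Rect a b c d \<subseteq> closure \<Omega>"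
proof -
  have "box (pt a c) (pt b d) = {x. a < x$1 \<and> x$1 < b \<and> c < x$2 \<and> x$2 < d}"
    by (auto simp: mem_box Basis_plane inner_axis)
  then have "closure (box (pt a c) (pt b d)) \<subseteq> closure \<Omega>" using assms(1) by (metis closure_mono)
  moreover have "pt ((a+b)/2) ((c+d)/2) \<in> box (pt a c) (pt b d)" using assms by (auto simp: mem_box Basis_plane inner_axis)
  then have "closure (box (pt a c) (pt b d)) = Rect a b c d" unfolding Rect_cbox by (intro closure_box) auto
  ultimately show ?thesis by simp
qed

text \<open>These points carry all edge integrals of the two dissections below. Each of them lies on
  the closure of one of the four rectangles that surround the hole.\<close>

lemma frontier_points:
  shows "\<bar>x$1\<bar> \<le> L \<Longrightarrow> \<bar>x$2\<bar> = H \<Longrightarrow> x \<in> frontier \<Omega>"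
    "\<bar>x$1\<bar> = L \<Longrightarrow> \<bar>x$2\<bar> \<le> H \<Longrightarrow> x \<in> frontier \<Omega>"
    "p \<le> x$1 \<Longrightarrow> x$1 \<le> q \<Longrightarrow> \<bar>x$2\<bar> = m \<Longrightarrow> x \<in> frontier \<Omega>"
    "x$1 = p \<or> x$1 = q \<Longrightarrow> \<bar>x$2\<bar> \<le> m \<Longrightarrow> x \<in> frontier \<Omega>"
proof -
  have R: "Rect (-L) p (-H) H \<subseteq> closure \<Omega>" "Rect q L (-H) H \<subseteq> closure \<Omega>"
    "Rect (-L) L (-H) (-m) \<subseteq> closure \<Omega>" "Rect (-L) L m H \<subseteq> closure \<Omega>"
    by (rule Rect_subset_closure; use pq mH in \<open>auto simp: in_Om\<close>)+
  have U: "x \<in> frontier \<Omega>" if "x \<in> Rect (-L) p (-H) H \<union> Rect q L (-H) H \<union> Rect (-L) L (-H) (-m) \<union> Rect (-L) L m H" "x \<notin> \<Omega>"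
    using that R open_dom by (auto simp: frontier_def interior_open)
  have U1: "x \<in> frontier \<Omega>" if "-L \<le> x$1" "x$1 \<le> p" "-H \<le> x$2" "x$2 \<le> H" "x \<notin> \<Omega>"
    using that by (intro U) (simp_all add: Rect_def)
  have U2: "x \<in> frontier \<Omega>" if "q \<le> x$1" "x$1 \<le> L" "-H \<le> x$2" "x$2 \<le> H" "x \<notin> \<Omega>"
    using that by (intro U) (simp_all add: Rect_def)
  have U3: "x \<in> frontier \<Omega>" if "-L \<le> x$1" "x$1 \<le> L" "-H \<le> x$2" "x$2 \<le> -m" "x \<notin> \<Omega>"
    using that by (intro U) (simp_all add: Rect_def)
  have U4: "x \<in> frontier \<Omega>" if "-L \<le> x$1" "x$1 \<le> L" "m \<le> x$2" "x$2 \<le> H" "x \<notin> \<Omega>"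
    using that by (intro U) (simp_all add: Rect_def)
  {
    assume x: "\<bar>x$1\<bar> \<le> L" "\<bar>x$2\<bar> = H"
    then have "-L \<le> x$1" "x$1 \<le> L" "x \<notin> \<Omega>" "x$2 = H \<or> x$2 = -H" by (auto simp: in_Om)
    then show "x \<in> frontier \<Omega>" using mH by (elim disjE) (rule U4, simp_all, rule U3, simp_all)
  next
    assume x: "\<bar>x$1\<bar> = L" "\<bar>x$2\<bar> \<le> H"
    then have "-H \<le> x$2" "x$2 \<le> H" "x \<notin> \<Omega>" "x$1 = L \<or> x$1 = -L" by (auto simp: in_Om)
    then show "x \<in> frontier \<Omega>" using pq by (elim disjE) (rule U2, simp_all, rule U1, simp_all)
  next
    assume x: "p \<le> x$1" "x$1 \<le> q" "\<bar>x$2\<bar> = m"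
    then have "-L \<le> x$1" "x$1 \<le> L" "x \<notin> \<Omega>" "x$2 = m \<or> x$2 = -m" using pq mH by (auto simp: in_Om)
    then show "x \<in> frontier \<Omega>" using mH by (elim disjE) (rule U4, simp_all, rule U3, simp_all)
  next
    assume x: "x$1 = p \<or> x$1 = q" "\<bar>x$2\<bar> \<le> m"
    then have "-H \<le> x$2" "x$2 \<le> H" "x \<notin> \<Omega>" using pq mH by (auto simp: in_Om)
    then show "x \<in> frontier \<Omega>" using pq x(1) by (elim disjE) (rule U1, simp_all, rule U2, simp_all)
  }
qed

lemma lebesgue_on_integral:
  fixes f :: "plane \<Rightarrow> real"
  assumes "continuous_on UNIV f"
  shows "(\<integral>x. f x \<partial>NN) = (LINT x|lborel. indicator \<Omega> x * f x)"
proof -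
  have "(\<integral>x. f x \<partial>NN) = (LINT x|lebesgue. indicator \<Omega> x * f x)"
    using set_integral_lebesgue_on[OF dom_sets(1), of f] by (simp add: set_lebesgue_integral_def)
  also have "\<dots> = (LINT x|lborel. indicator \<Omega> x * f x)"
  proof (rule lborel_eq_lebesgue_integral)
    have [measurable]: "f \<in> borel_measurable borel" "\<Omega> \<in> sets borel"
      using dom_sets assms by (auto intro: borel_measurable_continuous_onI)
    show "(\<lambda>x. indicator \<Omega> x * f x) \<in> borel_measurable borel" by measurable
  qed
  finally show ?thesis .
qed

lemma Om_lborel_integrable:
  fixes f :: "plane \<Rightarrow> real"
  assumes "continuous_on UNIV f"
  shows "integrable lborel (\<lambda>x. indicator \<Omega> x * f x)"
proof -
  have "integrable lborel (\<lambda>x. indicator \<Omega> x *\<^sub>R (indicator (Rect (-L) L (-H) H) x * f x))"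
    by (rule integrable_mult_indicator) (use dom_sets Rect_integrable[OF assms] in auto)
  moreover have "indicator \<Omega> x *\<^sub>R (indicator (Rect (-L) L (-H) H) x * f x) = indicator \<Omega> x * f x" for x
    by (auto simp: indicator_def in_Om Rect_def)
  ultimately show ?thesis by (simp only:)
qed

text \<open>Two dissections: into columns, whose horizontal edges all lie on the boundary of the
  domain, and into rows, whose vertical edges do. Integrating a vertical derivative over columns or
  a horizontal one over rows therefore produces boundary values only.\<close>

lemma integral_split:
  fixes f :: "plane \<Rightarrow> real"
  assumes c: "continuous_on UNIV f"
  shows "(\<integral>x. f x \<partial>NN) =
      (LINT x|lborel. indicator (Rect (-L) p (-H) H) x * f x) + (LINT x|lborel. indicator (Rect p q (-H) (-m)) x * f x)
    + (LINT x|lborel. indicator (Rect p q m H) x * f x) + (LINT x|lborel. indicator (Rect q L (-H) H) x * f x)"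
    and "(\<integral>x. f x \<partial>NN) =
      (LINT x|lborel. indicator (Rect (-L) L (-H) (-m)) x * f x) + (LINT x|lborel. indicator (Rect (-L) p (-m) m) x * f x)
    + (LINT x|lborel. indicator (Rect q L (-m) m) x * f x) + (LINT x|lborel. indicator (Rect (-L) L m H) x * f x)"
proof -
  note i = Rect_integrable[OF c]
  have ae: "AE x in lborel. (x::plane) $ 1 \<notin> {-L, p, q, L} \<and> (x::plane) $ 2 \<notin> {-H, -m, m, H}"
  proof -
    have "AE x in lborel. (x::plane) $ 1 \<noteq> -L \<and> x $ 1 \<noteq> p \<and> x $ 1 \<noteq> q \<and> x $ 1 \<noteq> L \<and>
       x $ 2 \<noteq> -H \<and> x $ 2 \<noteq> -m \<and> x $ 2 \<noteq> m \<and> x $ 2 \<noteq> H"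
      by (intro AE_conjI AE_coordinate)
    then show ?thesis by eventually_elim auto
  qed
  have "(\<integral>x. f x \<partial>NN) = (LINT x|lborel. indicator (Rect (-L) p (-H) H) x * f x + indicator (Rect p q (-H) (-m)) x * f x
    + indicator (Rect p q m H) x * f x + indicator (Rect q L (-H) H) x * f x)"
    unfolding lebesgue_on_integral[OF c]
  proof (rule integral_cong_AE)
    show "AE x in lborel. indicator \<Omega> x * f x = indicator (Rect (-L) p (-H) H) x * f x + indicator (Rect p q (-H) (-m)) x * f x
      + indicator (Rect p q m H) x * f x + indicator (Rect q L (-H) H) x * f x"
      using ae
    proof eventually_elim
      case (elim x)
      show ?case
      proof (cases "x \<in> rect L H")
        case True
        then show ?thesis
          using elim pq mH
          by (cases "x$1 < p"; cases "x$1 < q"; cases "x$2 < - m"; cases "x$2 < m")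
            (simp_all add: indicator_def in_Om Rect_def rect_def)
      next
        case False
        then have "x \<notin> \<Omega>" "x \<notin> Rect (-L) L (-H) H" using elim by (auto simp: in_Om rect_def Rect_def)
        then show ?thesis using pq mH by (auto simp: indicator_def Rect_def)
      qed
    qed
  qed (use i Om_lborel_integrable[OF c] in auto)
  then show "(\<integral>x. f x \<partial>NN) =
      (LINT x|lborel. indicator (Rect (-L) p (-H) H) x * f x) + (LINT x|lborel. indicator (Rect p q (-H) (-m)) x * f x)
    + (LINT x|lborel. indicator (Rect p q m H) x * f x) + (LINT x|lborel. indicator (Rect q L (-H) H) x * f x)"
    using i by simp
  have "(\<integral>x. f x \<partial>NN) = (LINT x|lborel. indicator (Rect (-L) L (-H) (-m)) x * f x + indicator (Rect (-L) p (-m) m) x * f x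
    + indicator (Rect q L (-m) m) x * f x + indicator (Rect (-L) L m H) x * f x)"
    unfolding lebesgue_on_integral[OF c]
  proof (rule integral_cong_AE)
    show "AE x in lborel. indicator \<Omega> x * f x = indicator (Rect (-L) L (-H) (-m)) x * f x + indicator (Rect (-L) p (-m) m) x * f x
      + indicator (Rect q L (-m) m) x * f x + indicator (Rect (-L) L m H) x * f x"
      using ae
    proof eventually_elim
      case (elim x)
      show ?case
      proof (cases "x \<in> rect L H")
        case True
        then show ?thesis
          using elim pq mH
          by (cases "x$1 < p"; cases "x$1 < q"; cases "x$2 < - m"; cases "x$2 < m")
            (simp_all add: indicator_def in_Om Rect_def rect_def)
      next
        case False
        then have "x \<notin> \<Omega>" "x \<notin> Rect (-L) L (-H) H" using elim by (auto simp: in_Om rect_def Rect_def)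
        then show ?thesis using pq mH by (auto simp: indicator_def Rect_def)
      qed
    qed
  qed (use i Om_lborel_integrable[OF c] in auto)
  then show "(\<integral>x. f x \<partial>NN) =
      (LINT x|lborel. indicator (Rect (-L) L (-H) (-m)) x * f x) + (LINT x|lborel. indicator (Rect (-L) p (-m) m) x * f x)
    + (LINT x|lborel. indicator (Rect q L (-m) m) x * f x) + (LINT x|lborel. indicator (Rect (-L) L m H) x * f x)"
    using i by simp
qed

abbreviation bint :: "(plane \<Rightarrow> real) \<Rightarrow> ennreal" where
  "bint f \<equiv> (\<integral>\<^sup>+x\<in>frontier \<Omega>. ennreal \<bar>f x\<bar> \<partial>hausdorff1)"

lemma edge_le:
  fixes \<iota> :: "real \<Rightarrow> plane"
  assumes f: "continuous_on UNIV f" and \<iota>: "\<And>s t. \<bar>s - t\<bar> \<le> dist (\<iota> s) (\<iota> t)" "continuous_on UNIV \<iota>"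
    and fr: "\<And>s. s \<in> {a..b} \<Longrightarrow> \<iota> s \<in> frontier \<Omega>"
  shows "ennreal (LINT s:{a..b}|lborel. \<bar>f (\<iota> s)\<bar>) \<le> bint f"
proof -
  have c: "continuous_on A (\<lambda>s. \<bar>f (\<iota> s)\<bar>)" for A
    by (intro continuous_intros continuous_on_compose2[OF f] continuous_on_subset[OF \<iota>(2)]) auto
  have i: "set_integrable lborel {a..b} (\<lambda>s. \<bar>f (\<iota> s)\<bar>)"
    by (rule borel_integrable_atLeastAtMost'[OF c])
  have "ennreal (LINT s:{a..b}|lborel. \<bar>f (\<iota> s)\<bar>) = (\<integral>\<^sup>+s. ennreal (indicator {a..b} s * \<bar>f (\<iota> s)\<bar>) \<partial>lborel)"
    using i unfolding set_lebesgue_integral_def set_integrable_def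
    by (subst nn_integral_eq_integral[symmetric]) auto
  also have "\<dots> \<le> (\<integral>\<^sup>+s. (\<lambda>x. ennreal \<bar>f x\<bar> * indicator (frontier \<Omega>) x) (\<iota> s) \<partial>lborel)"
    by (rule nn_integral_mono) (use fr in \<open>auto simp: indicator_def\<close>)
  also have "\<dots> \<le> bint f"
  proof (rule nn_integral_segment_le[OF \<iota>])
    have [measurable]: "f \<in> borel_measurable borel" "frontier \<Omega> \<in> sets borel"
      using f frontier_sets by (auto intro: borel_measurable_continuous_onI)
    show "(\<lambda>x. ennreal \<bar>f x\<bar> * indicator (frontier \<Omega>) x) \<in> borel_measurable borel" by measurable
  qed
  finally show ?thesis .
qed

lemma dist_pt: "\<bar>s - s'\<bar> \<le> dist (pt s t) (pt s' t)" "\<bar>s - s'\<bar> \<le> dist (pt t s) (pt t s')"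
  using component_le_norm_cart[of "pt s t - pt s' t" 1] component_le_norm_cart[of "pt t s - pt t s'" 2]
  by (auto simp: dist_norm)

lemma integral_diff_edges_le:
  assumes f: "smooth f" and \<iota>: "\<And>s t. \<bar>s - t\<bar> \<le> dist (\<iota> s) (\<iota> t)" "continuous_on UNIV \<iota>"
     "\<And>s t. \<bar>s - t\<bar> \<le> dist (\<kappa> s) (\<kappa> t)" "continuous_on UNIV \<kappa>"
    and fr: "\<And>s. s \<in> {a..b} \<Longrightarrow> \<iota> s \<in> frontier \<Omega>" "\<And>s. s \<in> {a..b} \<Longrightarrow> \<kappa> s \<in> frontier \<Omega>"
  shows "ennreal \<bar>LINT s:{a..b}|lborel. f (\<iota> s) - f (\<kappa> s)\<bar> \<le> 2 * bint f"
proof -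
  have c: "continuous_on A (\<lambda>s. f (\<iota> s))" "continuous_on A (\<lambda>s. f (\<kappa> s))" for A
    by (auto intro!: continuous_on_compose2[OF smooth_continuous_on[OF f, of UNIV]] continuous_on_subset[OF \<iota>(2)] continuous_on_subset[OF \<iota>(4)])
  have i: "set_integrable lborel {a..b} (\<lambda>s. \<bar>f (\<iota> s)\<bar>)" "set_integrable lborel {a..b} (\<lambda>s. \<bar>f (\<kappa> s)\<bar>)"
     "set_integrable lborel {a..b} (\<lambda>s. f (\<iota> s) - f (\<kappa> s))"
    by (intro borel_integrable_atLeastAtMost' continuous_intros c)+
  have "\<bar>LINT s:{a..b}|lborel. f (\<iota> s) - f (\<kappa> s)\<bar> \<le> (LINT s:{a..b}|lborel. \<bar>f (\<iota> s) - f (\<kappa> s)\<bar>)"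
    using set_integral_norm_bound[OF i(3)] by simp
  also have "\<dots> \<le> (LINT s:{a..b}|lborel. \<bar>f (\<iota> s)\<bar> + \<bar>f (\<kappa> s)\<bar>)"
    by (rule set_integral_mono) (use i set_integrable_abs[OF i(3)] in \<open>auto intro: set_integral_add\<close>)
  also have "\<dots> = (LINT s:{a..b}|lborel. \<bar>f (\<iota> s)\<bar>) + (LINT s:{a..b}|lborel. \<bar>f (\<kappa> s)\<bar>)"
    by (rule set_integral_add(2)[OF i(1,2)])
  finally have "ennreal \<bar>LINT s:{a..b}|lborel. f (\<iota> s) - f (\<kappa> s)\<bar> \<le> ennreal ((LINT s:{a..b}|lborel. \<bar>f (\<iota> s)\<bar>) + (LINT s:{a..b}|lborel. \<bar>f (\<kappa> s)\<bar>))"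
    by (rule ennreal_leI)
  also have "\<dots> = ennreal (LINT s:{a..b}|lborel. \<bar>f (\<iota> s)\<bar>) + ennreal (LINT s:{a..b}|lborel. \<bar>f (\<kappa> s)\<bar>)"
    by (rule ennreal_plus) (auto simp: set_lebesgue_integral_def intro!: integral_nonneg_AE)
  also have "\<dots> \<le> bint f + bint f"
    by (intro add_mono edge_le smooth_continuous_on[OF f] \<iota> fr)
  finally show ?thesis by (simp add: mult_2)
qed

text \<open>This inequality replaces the divergence theorem: it survives the passage to the limit, and its
  right-hand side vanishes for products with a factor of zero trace.\<close>

lemma gauss_inequality:
  assumes f: "smooth f"
  shows "ennreal \<bar>\<integral>x. pd j f x \<partial>NN\<bar> \<le> 8 * bint f"
proof -
  have c: "continuous_on UNIV (pd j f)" by (intro smooth_continuous_on smooth_dir_deriv f) simp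
  \<comment> \<open>Four rectangles with two edges each give the factor 8.\<close>
  have sum4: "ennreal \<bar>A + B + C + D\<bar> \<le> 8 * X"
    if "ennreal \<bar>A\<bar> \<le> 2 * X" "ennreal \<bar>B\<bar> \<le> 2 * X" "ennreal \<bar>C\<bar> \<le> 2 * X" "ennreal \<bar>D\<bar> \<le> 2 * X" for A B C D X
  proof -
    have "ennreal \<bar>A + B + C + D\<bar> \<le> ennreal (\<bar>A\<bar> + \<bar>B\<bar> + \<bar>C\<bar> + \<bar>D\<bar>)" by (rule ennreal_leI) auto
    also have "\<dots> = ennreal \<bar>A\<bar> + ennreal \<bar>B\<bar> + ennreal \<bar>C\<bar> + ennreal \<bar>D\<bar>" by (simp add: ennreal_plus)
    also have "\<dots> \<le> 2 * X + 2 * X + 2 * X + 2 * X" by (intro add_mono that)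
    also have "\<dots> = 8 * X" by (simp add: distrib_right[symmetric])
    finally show ?thesis .
  qed
  have cp: "continuous_on UNIV (\<lambda>s. pt s t)" "continuous_on UNIV (\<lambda>s. pt t s)" for t by (intro continuous_intros)+
  show ?thesis
  proof (cases "j = 2")
    case True
    have r: "ennreal \<bar>LINT x|lborel. indicator (Rect a b c' d) x * pd 2 f x\<bar> \<le> 2 * bint f"
      if "a \<le> b" "c' \<le> d" "\<And>s. s \<in> {a..b} \<Longrightarrow> pt s c' \<in> frontier \<Omega> \<and> pt s d \<in> frontier \<Omega>" for a b c' d
      unfolding Rect_integral_dir_deriv(1)[OF f that(1,2)]
      by (rule integral_diff_edges_le[OF f dist_pt(1) cp(1) dist_pt(1) cp(1)]) (use that(3) in auto)
    show ?thesis
      unfolding integral_split(1)[OF c] unfolding True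
      by (intro sum4 r) (use pq mH in \<open>auto intro: frontier_points(1,3)\<close>)
  next
    case False
    then have j1: "j = 1" using exhaust_2[of j] by auto
    have r: "ennreal \<bar>LINT x|lborel. indicator (Rect a b c' d) x * pd 1 f x\<bar> \<le> 2 * bint f"
      if "a \<le> b" "c' \<le> d" "\<And>s. s \<in> {c'..d} \<Longrightarrow> pt a s \<in> frontier \<Omega> \<and> pt b s \<in> frontier \<Omega>" for a b c' d
      unfolding Rect_integral_dir_deriv(2)[OF f that(1,2)]
      by (rule integral_diff_edges_le[OF f dist_pt(2) cp(2) dist_pt(2) cp(2)]) (use that(3) in auto)
    show ?thesis
      unfolding integral_split(2)[OF c] unfolding j1
      by (intro sum4 r) (use pq mH in \<open>auto intro: frontier_points(2,4)\<close>)
  qed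
qed

end

section \<open>Fourth-power integrability and integration by parts with zero trace\<close>

lemma dir_deriv_diff:
  assumes "f differentiable at x" "g differentiable at x"
  shows "dir_deriv b (\<lambda>x. f x - g x) x = dir_deriv b f x - dir_deriv b g x"
  using dir_deriv_eq[OF has_derivative_diff[OF assms[unfolded frechet_derivative_works]]]
  by (simp add: dir_deriv_def)

lemma L4_mult:
  assumes a: "L2m N (\<lambda>x. (a x)\<^sup>2)" "a \<in> borel_measurable N" and b: "L2m N (\<lambda>x. (b x)\<^sup>2)" "b \<in> borel_measurable N"
  shows "L2m N (\<lambda>x. a x * b x)"
    "(\<integral>x. (a x * b x)\<^sup>2 \<partial>N) \<le> sqrt (\<integral>x. (a x) ^ 4 \<partial>N) * sqrt (\<integral>x. (b x) ^ 4 \<partial>N)"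
proof -
  have "integrable N (\<lambda>x. (a x)\<^sup>2 * (b x)\<^sup>2)" by (rule L2m_mult_integrable[OF a(1) b(1)])
  then show "L2m N (\<lambda>x. a x * b x)" using a b by (simp add: L2m_def power_mult_distrib)
  show "(\<integral>x. (a x * b x)\<^sup>2 \<partial>N) \<le> sqrt (\<integral>x. (a x) ^ 4 \<partial>N) * sqrt (\<integral>x. (b x) ^ 4 \<partial>N)"
    using order_trans[OF abs_ge_self cauchy_schwarz(2)[OF a(1) b(1)]]
    by (simp add: power_mult_distrib flip: power_mult)
qed

context holed begin

definition energy :: "(plane \<Rightarrow> real) \<Rightarrow> (2 \<Rightarrow> plane \<Rightarrow> real) \<Rightarrow> real" where
  "energy f F = (\<integral>x. (f x)\<^sup>2 \<partial>NN) + (\<integral>x. (F 1 x)\<^sup>2 \<partial>NN) + (\<integral>x. (F 2 x)\<^sup>2 \<partial>NN)"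

lemma energy_nonneg: "0 \<le> energy f F"
  by (auto simp: energy_def intro!: add_nonneg_nonneg integral_nonneg_AE)

text \<open>A lower bound for the side lengths of the four rectangles to which
  \<open>Rect_L4\<close> is applied: the two columns of full height and the two rows of full
  width.\<close>

definition gap :: real where "gap = min (min (p + L) (L - q)) (H - m)"

lemma gap: "0 < gap" "gap \<le> p + L" "gap \<le> L - q" "gap \<le> H - m" "gap \<le> 2 * H" "gap \<le> 2 * L"
  using pq mH by (auto simp: gap_def)

definition CL :: real where "CL = 4 * (1 / gap + 1)\<^sup>2"

lemma L4_smooth:
  assumes f: "smooth f"
  shows "(\<integral>x. f x ^ 4 \<partial>NN) \<le> CL * (energy f (\<lambda>j. pd j f))\<^sup>2"
proof -
  let ?h = "\<lambda>j x. (f x)\<^sup>2 / gap + 2 * \<bar>f x * pd j f x\<bar>"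
  let ?E = "energy f (\<lambda>j. pd j f)"
  let ?I = "\<lambda>a b c d h. LINT x|lborel. indicator (Rect a b c d) x * h x"
  have fc: "continuous_on A f" "continuous_on A (pd j f)" for A j
    by (auto intro!: smooth_continuous_on smooth_dir_deriv f)
  have hc: "continuous_on UNIV (?h j)" for j by (intro continuous_intros fc) (use gap in auto)
  have f4: "continuous_on UNIV (\<lambda>x. f x ^ 4)" by (intro continuous_intros fc)
  have h0: "0 \<le> ?h j x" for j x using gap by simp
  have hE: "(\<integral>x. ?h j x \<partial>NN) \<le> (1 / gap + 1) * ?E" for j
  proof -
    have "(\<integral>x. ?h j x \<partial>NN) \<le> (\<integral>x. (1 / gap + 1) * (f x)\<^sup>2 + (pd j f x)\<^sup>2 \<partial>NN)"
    proof (rule integral_mono)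
      show "integrable NN (?h j)" by (rule L2m_integrable[OF L2m_continuous[OF hc]])
      show "integrable NN (\<lambda>x. (1 / gap + 1) * (f x)\<^sup>2 + (pd j f x)\<^sup>2)"
        by (intro L2m_integrable L2m_continuous continuous_intros fc)
      fix x show "?h j x \<le> (1 / gap + 1) * (f x)\<^sup>2 + (pd j f x)\<^sup>2"
        using sum_squares_bound[of "\<bar>f x\<bar>" "\<bar>pd j f x\<bar>"] by (simp add: abs_mult distrib_right)
    qed
    also have "\<dots> = (1 / gap + 1) * (\<integral>x. (f x)\<^sup>2 \<partial>NN) + (\<integral>x. (pd j f x)\<^sup>2 \<partial>NN)"
      using smooth_L2m[OF f] by (simp add: L2m_def)
    also have "\<dots> \<le> (1 / gap + 1) * (\<integral>x. (f x)\<^sup>2 \<partial>NN) + (1 / gap + 1) * (\<integral>x. (pd j f x)\<^sup>2 \<partial>NN)"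
    proof -
      have "1 * (\<integral>x. (pd j f x)\<^sup>2 \<partial>NN) \<le> (1 / gap + 1) * (\<integral>x. (pd j f x)\<^sup>2 \<partial>NN)"
        by (rule mult_right_mono) (use gap in \<open>auto intro!: integral_nonneg_AE\<close>)
      then show ?thesis by simp
    qed
    also have "\<dots> \<le> (1 / gap + 1) * ?E"
      using gap exhaust_2[of j] unfolding distrib_left[symmetric] energy_def
      by (intro mult_left_mono) (auto intro!: integral_nonneg_AE)
    finally show ?thesis .
  qed
  have nn: "0 \<le> ?I a b c d h" if "\<And>x. 0 \<le> h x" for h :: "plane \<Rightarrow> real" and a b c d
    using that by (intro integral_nonneg_AE) simp
  have rect: "?I a b c d (\<lambda>x. f x ^ 4) \<le> (1 / gap + 1)\<^sup>2 * ?E\<^sup>2"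
    if "gap \<le> b - a" "gap \<le> d - c" and le: "\<And>j. ?I a b c d (?h j) \<le> (\<integral>x. ?h j x \<partial>NN)" for a b c d
  proof -
    have le': "?I a b c d (?h j) \<le> (1 / gap + 1) * ?E" for j using le[of j] hE[of j] by linarith
    have "?I a b c d (\<lambda>x. f x ^ 4) \<le> ?I a b c d (?h 1) * ?I a b c d (?h 2)"
      by (rule Rect_L4[OF f gap(1) that(1,2)])
    also have "\<dots> \<le> ((1 / gap + 1) * ?E) * ((1 / gap + 1) * ?E)"
      by (rule mult_mono[OF le' le' _ nn]) (use gap energy_nonneg h0 in \<open>auto intro!: mult_nonneg_nonneg\<close>)
    finally show ?thesis by (simp add: power2_eq_square algebra_simps)
  qed
  have A: "?I (-L) p (-H) H (\<lambda>x. f x ^ 4) \<le> (1 / gap + 1)\<^sup>2 * ?E\<^sup>2"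
  proof (rule rect)
    show "?I (-L) p (-H) H (?h j) \<le> (\<integral>x. ?h j x \<partial>NN)" for j
      using integral_split(1)[OF hc[of j]] nn[of "?h j" p q "-H" "-m", OF h0] nn[of "?h j" p q m H, OF h0] nn[of "?h j" q L "-H" H, OF h0] by linarith
  qed (use gap in auto)
  have B: "?I q L (-H) H (\<lambda>x. f x ^ 4) \<le> (1 / gap + 1)\<^sup>2 * ?E\<^sup>2"
  proof (rule rect)
    show "?I q L (-H) H (?h j) \<le> (\<integral>x. ?h j x \<partial>NN)" for j
      using integral_split(1)[OF hc[of j]] nn[of "?h j" p q "-H" "-m", OF h0] nn[of "?h j" p q m H, OF h0] nn[of "?h j" "-L" p "-H" H, OF h0] by linarith
  qed (use gap in auto)
  have C: "?I (-L) L (-H) (-m) (\<lambda>x. f x ^ 4) \<le> (1 / gap + 1)\<^sup>2 * ?E\<^sup>2"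
  proof (rule rect)
    show "?I (-L) L (-H) (-m) (?h j) \<le> (\<integral>x. ?h j x \<partial>NN)" for j
      using integral_split(2)[OF hc[of j]] nn[of "?h j" "-L" p "-m" m, OF h0] nn[of "?h j" q L "-m" m, OF h0] nn[of "?h j" "-L" L m H, OF h0] by linarith
  qed (use gap in auto)
  have D: "?I (-L) L m H (\<lambda>x. f x ^ 4) \<le> (1 / gap + 1)\<^sup>2 * ?E\<^sup>2"
  proof (rule rect)
    show "?I (-L) L m H (?h j) \<le> (\<integral>x. ?h j x \<partial>NN)" for j
      using integral_split(2)[OF hc[of j]] nn[of "?h j" "-L" p "-m" m, OF h0] nn[of "?h j" q L "-m" m, OF h0] nn[of "?h j" "-L" L "-H" "-m", OF h0] by linarith
  qed (use gap in auto)
  \<comment> \<open>The cells directly above and below the hole are enlarged to the rows of full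
    width, whose sides are controlled by \<open>gap\<close>.\<close>
  have mono: "?I p q c d (\<lambda>x. f x ^ 4) \<le> ?I (-L) L c d (\<lambda>x. f x ^ 4)" for c d
    by (rule integral_mono) (use Rect_integrable[OF f4] pq in \<open>auto simp: indicator_def Rect_def\<close>)
  show ?thesis
    unfolding integral_split(1)[OF f4] CL_def using A B C D mono[of "-H" "-m"] mono[of m H] by linarith
qed

lemma approx_energy_diff:
  assumes v: "approx \<Omega> v f F g"
  shows "energy (\<lambda>x. v k x - v l x) (\<lambda>j. pd j (\<lambda>x. v k x - v l x)) \<le>
    2 * energy (\<lambda>x. v k x - f x) (\<lambda>j x. pd j (v k) x - F j x) + 2 * energy (\<lambda>x. v l x - f x) (\<lambda>j x. pd j (v l) x - F j x)"
proof -
  have V: "\<And>k. smooth (v k)" "cv2 NN v f" "\<And>j. cv2 NN (\<lambda>k. pd j (v k)) (F j)"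
    using v by (auto simp: approx_def)
  have tri: "(\<integral>x. (a x - b x)\<^sup>2 \<partial>NN) \<le> 2 * (\<integral>x. (a x - c x)\<^sup>2 \<partial>NN) + 2 * (\<integral>x. (b x - c x)\<^sup>2 \<partial>NN)"
    if "L2m NN a" "L2m NN b" "L2m NN c" for a b c
    using integral_square_add_le[OF L2m_diff[OF that(1,3)] L2m_diff[OF that(3,2)]] by (simp add: power2_commute)
  have d: "pd j (\<lambda>x. v k x - v l x) = (\<lambda>x. pd j (v k) x - pd j (v l) x)" for j
    by (intro ext dir_deriv_diff smooth_differentiable V)
  have L: "L2m NN (v k)" "L2m NN (pd j (v k))" "L2m NN f" "L2m NN (F j)" for k j
    using V(2) V(3)[of j] unfolding cv2_def by blast+
  have sum3: "a + b + c \<le> 2 * (a1 + b1 + c1) + 2 * (a2 + b2 + c2)"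
    if "a \<le> 2 * a1 + 2 * a2" "b \<le> 2 * b1 + 2 * b2" "c \<le> 2 * c1 + 2 * c2" for a b c a1 b1 c1 a2 b2 c2 :: real
    using add_mono[OF add_mono[OF that(1,2)] that(3)] by (simp add: algebra_simps)
  show ?thesis
    unfolding energy_def d
    by (rule sum3[OF tri[OF L(1) L(1) L(3)] tri[OF L(2) L(2) L(4)] tri[OF L(2) L(2) L(4)]])
qed

lemma approx_energy_tendsto:
  assumes v: "approx \<Omega> v f F g"
  shows "(\<lambda>k. energy (\<lambda>x. v k x - f x) (\<lambda>j x. pd j (v k) x - F j x)) \<longlonglongrightarrow> 0"
proof -
  have "(\<lambda>k. energy (\<lambda>x. v k x - f x) (\<lambda>j x. pd j (v k) x - F j x)) \<longlonglongrightarrow> 0 + 0 + 0"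
    unfolding energy_def by (intro tendsto_add) (use v in \<open>auto simp: approx_def cv2_def\<close>)
  then show ?thesis by simp
qed

text \<open>\<open>L4_smooth\<close> is applied to the differences \<open>v k - v (r n)\<close>,
  whose energy is small because the approximants converge. Along a subsequence converging almost
  everywhere, Fatou's lemma replaces \<open>v (r n)\<close> by \<open>f\<close>.\<close>

lemma approx_L4:
  assumes v: "approx \<Omega> v f F g"
  shows "L2m NN (\<lambda>x. (f x)\<^sup>2)" "\<And>k. L2m NN (\<lambda>x. (v k x - f x)\<^sup>2)"
    "(\<lambda>k. \<integral>x. (v k x - f x) ^ 4 \<partial>NN) \<longlonglongrightarrow> 0"
proof -
  let ?M = "NN"
  have V: "\<And>k. smooth (v k)" "cv2 ?M v f" "\<And>j. cv2 ?M (\<lambda>k. pd j (v k)) (F j)"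
    using v by (auto simp: approx_def)
  have Ld: "L2m ?M (\<lambda>x. v k x - f x)" for k using V(2) by (auto simp: cv2_def intro: L2m_diff)
  have [measurable]: "v k \<in> borel_measurable ?M" "f \<in> borel_measurable ?M" for k
    using V(2) by (auto simp: cv2_def L2m_def)
  define e where "e k = energy (\<lambda>x. v k x - f x) (\<lambda>j x. pd j (v k) x - F j x)" for k
  have e: "e \<longlonglongrightarrow> 0" "\<And>k. 0 \<le> e k"
    using approx_energy_tendsto[OF v] energy_nonneg unfolding e_def[abs_def] by blast+
  have "\<exists>r. strict_mono r \<and> (AE x in ?M. (\<lambda>n. (v (r n) x - f x)\<^sup>2) \<longlonglongrightarrow> 0)"
    by (rule tendsto_L1_AE_subseq) (use Ld V(2) in \<open>auto simp: L2m_def cv2_def\<close>)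
  then obtain r where r: "strict_mono r" "AE x in ?M. (\<lambda>n. (v (r n) x - f x)\<^sup>2) \<longlonglongrightarrow> 0" by blast
  have CL0: "0 \<le> CL" by (simp add: CL_def)
  have bound: "(\<integral>\<^sup>+x. ennreal ((v k x - f x) ^ 4) \<partial>?M) \<le> ennreal (CL * (2 * e k + 2 * \<epsilon>)\<^sup>2)" if \<epsilon>: "0 < \<epsilon>" for k \<epsilon>
  proof -
    have "(\<integral>\<^sup>+x. ennreal ((v k x - f x) ^ 4) \<partial>?M) \<le> (\<integral>\<^sup>+x. liminf (\<lambda>n. ennreal ((v k x - v (r n) x) ^ 4)) \<partial>?M)"
    proof (rule nn_integral_mono_AE)
      show "AE x in ?M. ennreal ((v k x - f x) ^ 4) \<le> liminf (\<lambda>n. ennreal ((v k x - v (r n) x) ^ 4))"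
        using r(2)
      proof eventually_elim
        case (elim x)
        then have "(\<lambda>n. sqrt ((v (r n) x - f x)\<^sup>2)) \<longlonglongrightarrow> sqrt 0" by (rule tendsto_real_sqrt)
        then have "(\<lambda>n. v (r n) x - f x) \<longlonglongrightarrow> 0" by (simp add: tendsto_rabs_zero_iff)
        then have "(\<lambda>n. v (r n) x) \<longlonglongrightarrow> f x" by (simp add: LIM_zero_iff)
        then have "(\<lambda>n. ennreal ((v k x - v (r n) x) ^ 4)) \<longlonglongrightarrow> ennreal ((v k x - f x) ^ 4)"
          by (intro tendsto_intros)
        from lim_imp_Liminf[OF trivial_limit_sequentially this] show ?case by (simp only: order_refl)
      qed
    qed
    also have "\<dots> \<le> liminf (\<lambda>n. \<integral>\<^sup>+x. ennreal ((v k x - v (r n) x) ^ 4) \<partial>?M)"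
      by (rule nn_integral_liminf) measurable
    also have "\<dots> \<le> limsup (\<lambda>n. \<integral>\<^sup>+x. ennreal ((v k x - v (r n) x) ^ 4) \<partial>?M)"
      by (rule Liminf_le_Limsup) simp
    also have "\<dots> \<le> ennreal (CL * (2 * e k + 2 * \<epsilon>)\<^sup>2)"
    proof (rule Limsup_bounded)
      have "(e \<circ> r) \<longlonglongrightarrow> 0" by (rule LIMSEQ_subseq_LIMSEQ[OF e(1) r(1)])
      then have "\<forall>\<^sub>F n in sequentially. e (r n) < \<epsilon>" using order_tendstoD(2)[of _ 0 sequentially \<epsilon>] \<epsilon> by (auto simp: o_def)
      then show "\<forall>\<^sub>F n in sequentially. (\<integral>\<^sup>+x. ennreal ((v k x - v (r n) x) ^ 4) \<partial>?M) \<le> ennreal (CL * (2 * e k + 2 * \<epsilon>)\<^sup>2)"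
      proof eventually_elim
        case (elim n)
        have sm: "smooth (\<lambda>x. v k x - v (r n) x)" by (intro smooth_diff V)
        have "(\<integral>\<^sup>+x. ennreal ((v k x - v (r n) x) ^ 4) \<partial>?M) = ennreal (\<integral>x. (v k x - v (r n) x) ^ 4 \<partial>?M)"
          by (rule nn_integral_eq_integral) (auto intro!: L2m_integrable smooth_L2m smooth_power sm)
        also have "\<dots> \<le> ennreal (CL * (energy (\<lambda>x. v k x - v (r n) x) (\<lambda>j. pd j (\<lambda>x. v k x - v (r n) x)))\<^sup>2)"
          by (rule ennreal_leI[OF L4_smooth[OF sm]])
        also have "\<dots> \<le> ennreal (CL * (2 * e k + 2 * \<epsilon>)\<^sup>2)"
        proof (intro ennreal_leI mult_left_mono power_mono CL0 energy_nonneg)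
          show "energy (\<lambda>x. v k x - v (r n) x) (\<lambda>j. pd j (\<lambda>x. v k x - v (r n) x)) \<le> 2 * e k + 2 * \<epsilon>"
            using approx_energy_diff[OF v, of k "r n"] elim unfolding e_def by linarith
        qed
        finally show ?case .
      qed
    qed
    finally show ?thesis .
  qed
  have i4: "integrable ?M (\<lambda>x. (v k x - f x) ^ 4)" for k
  proof (rule integrableI_bounded)
    have "(\<integral>\<^sup>+x. ennreal (norm ((v k x - f x) ^ 4)) \<partial>?M) \<le> ennreal (CL * (2 * e k + 2 * 1)\<^sup>2)"
      using bound[of 1 k] by simp
    also have "\<dots> < \<infinity>" by simp
    finally show "(\<integral>\<^sup>+x. ennreal (norm ((v k x - f x) ^ 4)) \<partial>?M) < \<infinity>" .
  qed measurable
  show d4: "L2m ?M (\<lambda>x. (v k x - f x)\<^sup>2)" for k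
    unfolding L2m_def using i4[of k] by (simp flip: power_mult)
  \<comment> \<open>The choice \<open>1 / (k + 1)\<close> for the free error in \<open>bound\<close>
    makes the right-hand side a null sequence.\<close>
  have le: "(\<integral>x. (v k x - f x) ^ 4 \<partial>?M) \<le> CL * (2 * e k + 2 * inverse (real (Suc k)))\<^sup>2" for k
  proof -
    have "ennreal (\<integral>x. (v k x - f x) ^ 4 \<partial>?M) \<le> ennreal (CL * (2 * e k + 2 * inverse (real (Suc k)))\<^sup>2)"
      using bound[of "inverse (real (Suc k))" k] nn_integral_eq_integral[OF i4[of k]] by simp
    then show ?thesis using CL0 by (subst (asm) ennreal_le_iff) auto
  qed
  show "(\<lambda>k. \<integral>x. (v k x - f x) ^ 4 \<partial>?M) \<longlonglongrightarrow> 0"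
  proof (rule tendsto_sandwich[OF _ _ tendsto_const])
    have "(\<lambda>k. CL * (2 * e k + 2 * inverse (real (Suc k)))\<^sup>2) \<longlonglongrightarrow> CL * (2 * 0 + 2 * 0)\<^sup>2"
      by (intro tendsto_intros e LIMSEQ_inverse_real_of_nat)
    then show "(\<lambda>k. CL * (2 * e k + 2 * inverse (real (Suc k)))\<^sup>2) \<longlonglongrightarrow> 0" by simp
  qed (use le in \<open>auto intro!: always_eventually integral_nonneg_AE\<close>)
  have "L2m ?M (\<lambda>x. 2 * (v 0 x)\<^sup>2 + 2 * (v 0 x - f x)\<^sup>2)"
    by (intro L2m_add L2m_cmult d4 smooth_L2m smooth_power V)
  then have "integrable ?M (\<lambda>x. (2 * (v 0 x)\<^sup>2 + 2 * (v 0 x - f x)\<^sup>2)\<^sup>2)" by (simp add: L2m_def)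
  then show "L2m ?M (\<lambda>x. (f x)\<^sup>2)"
  proof (rule L2m_dominated(1)[rotated])
    show "AE x in ?M. ((f x)\<^sup>2)\<^sup>2 \<le> (2 * (v 0 x)\<^sup>2 + 2 * (v 0 x - f x)\<^sup>2)\<^sup>2"
    proof (intro AE_I2 power_mono)
      fix x show "(f x)\<^sup>2 \<le> 2 * (v 0 x)\<^sup>2 + 2 * (v 0 x - f x)\<^sup>2"
        using sum_squares_bound[of "v 0 x" "v 0 x - f x"] zero_le_power2[of "2 * v 0 x - f x"]
        by (simp add: power2_eq_square algebra_simps)
    qed simp
  qed measurable
qed

lemma strace_L4: "strace \<Omega> f F g \<Longrightarrow> L2m NN (\<lambda>x. (f x)\<^sup>2)"
  using approx_L4(1) unfolding strace_def by blast

text \<open>For the approximants the left-hand side is the integral of the derivative of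
  \<open>a * (v k)^2\<close>, which \<open>gauss_inequality\<close> bounds by a boundary integral of
  \<open>(v k)^2\<close>. Since \<open>g\<close> vanishes there, this is a multiple of the squared
  error of the trace.\<close>

lemma ibp_smooth_coefficient:
  assumes a: "smooth a" and f: "approx \<Omega> v f F g" and zero: "null_trace g"
  shows "(\<integral>x. pd j a x * (f x * f x) \<partial>NN) + 2 * (\<integral>x. (a x * f x) * F j x \<partial>NN) = 0"
proof -
  let ?M = "NN"
  have V: "\<And>k. smooth (v k)" "cv2 ?M v f" "\<And>j. cv2 ?M (\<lambda>k. pd j (v k)) (F j)"
      "(\<lambda>k. bsq \<Omega> (\<lambda>x. v k x - g x)) \<longlonglongrightarrow> 0" "g \<in> borel_measurable borel"
    using f by (auto simp: approx_def)
  have ac: "continuous_on UNIV a" "continuous_on UNIV (pd j a)" by (intro smooth_continuous_on smooth_dir_deriv a axis_in_Basis)+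
  obtain K where K: "0 \<le> K" "\<And>x. x \<in> closure \<Omega> \<Longrightarrow> \<bar>a x\<bar> \<le> K" using bounded_continuous_dom[OF ac(1)] by blast
  let ?J = "\<lambda>k. (\<integral>x. (pd j a x * v k x) * v k x \<partial>?M) + 2 * (\<integral>x. (a x * v k x) * pd j (v k) x \<partial>?M)"
  have "?J \<longlonglongrightarrow> (\<integral>x. (pd j a x * f x) * f x \<partial>?M) + 2 * (\<integral>x. (a x * f x) * F j x \<partial>?M)"
    by (intro tendsto_add tendsto_mult tendsto_const cv2_mult_tendsto cv2_mult_continuous ac V)
  moreover have "?J \<longlonglongrightarrow> 0"
  proof -
    let ?b = "\<lambda>k. bsq \<Omega> (\<lambda>x. v k x - g x)"
    have le: "ennreal \<bar>?J k\<bar> \<le> ennreal (8 * K) * ?b k" for k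
    proof -
      have sm: "smooth (\<lambda>x. a x * (v k x * v k x))" by (intro smooth_mult a V)
      have "pd j (\<lambda>x. a x * (v k x * v k x)) = (\<lambda>x. (pd j a x * v k x) * v k x + 2 * ((a x * v k x) * pd j (v k) x))"
      proof
        fix x
        have "pd j (\<lambda>x. a x * (v k x * v k x)) x = a x * pd j (\<lambda>x. v k x * v k x) x + pd j a x * (v k x * v k x)"
          by (intro dir_deriv_mult smooth_differentiable smooth_mult a V)
        also have "pd j (\<lambda>x. v k x * v k x) x = v k x * pd j (v k) x + pd j (v k) x * v k x"
          by (intro dir_deriv_mult smooth_differentiable V)
        finally show "pd j (\<lambda>x. a x * (v k x * v k x)) x = (pd j a x * v k x) * v k x + 2 * ((a x * v k x) * pd j (v k) x)"
          by (simp add: algebra_simps)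
      qed
      moreover have "integrable ?M (\<lambda>x. (pd j a x * v k x) * v k x)" "integrable ?M (\<lambda>x. (a x * v k x) * pd j (v k) x)"
        by (intro L2m_integrable smooth_L2m smooth_mult smooth_dir_deriv a V axis_in_Basis)+
      ultimately have "(\<integral>x. pd j (\<lambda>x. a x * (v k x * v k x)) x \<partial>?M) = ?J k" by simp
      then have "ennreal \<bar>?J k\<bar> \<le> 8 * bint (\<lambda>x. a x * (v k x * v k x))" using gauss_inequality[OF sm, of j] by simp
      also have "bint (\<lambda>x. a x * (v k x * v k x)) \<le> (\<integral>\<^sup>+x. ennreal K * (ennreal ((v k x - g x)\<^sup>2) * indicator (frontier \<Omega>) x) \<partial>hausdorff1)"
      proof (rule nn_integral_mono_AE)
        show "AE x in hausdorff1. ennreal \<bar>a x * (v k x * v k x)\<bar> * indicator (frontier \<Omega>) x \<le> ennreal K * (ennreal ((v k x - g x)\<^sup>2) * indicator (frontier \<Omega>) x)"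
          using zero
        proof eventually_elim
          case (elim x)
          show ?case
          proof (cases "x \<in> frontier \<Omega>")
            case True
            then have "\<bar>a x\<bar> \<le> K" "g x = 0" using K(2) elim by (auto simp: frontier_def)
            then have "\<bar>a x * (v k x * v k x)\<bar> \<le> K * (v k x - g x)\<^sup>2"
              by (simp add: abs_mult power2_eq_square mult_right_mono)
            then have "ennreal \<bar>a x * (v k x * v k x)\<bar> \<le> ennreal (K * (v k x - g x)\<^sup>2)" by (rule ennreal_leI)
            then show ?thesis using True K(1) by (simp add: ennreal_mult)
          qed simp
        qed
      qed
      also have "\<dots> = ennreal K * ?b k"
      proof -
        have [measurable]: "v k \<in> borel_measurable hausdorff1" "g \<in> borel_measurable hausdorff1" "frontier \<Omega> \<in> sets hausdorff1"
          using V(5) frontier_sets smooth_borel[OF V(1)] by (auto intro: borel_imp_hausdorff1)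
        show ?thesis by (rule nn_integral_cmult) measurable
      qed
      finally have "ennreal \<bar>?J k\<bar> \<le> 8 * (ennreal K * ?b k)" by (simp add: mult_left_mono)
      also have "\<dots> = ennreal (8 * K) * ?b k" using K(1) by (simp add: ennreal_mult mult.assoc)
      finally show ?thesis .
    qed
    have lim: "(\<lambda>k. ennreal (8 * K) * ?b k) \<longlonglongrightarrow> 0"
      using ennreal_tendsto_cmult[OF _ V(4), of "ennreal (8 * K)"] by simp
    have "(\<lambda>k. ennreal \<bar>?J k\<bar>) \<longlonglongrightarrow> 0"
    proof (rule tendsto_sandwich[OF _ _ tendsto_const lim])
      show "\<forall>\<^sub>F k in sequentially. ennreal \<bar>?J k\<bar> \<le> ennreal (8 * K) * ?b k"
        by (rule always_eventually) (rule allI, rule le)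
    qed simp
    then have "(\<lambda>k. \<bar>?J k\<bar>) \<longlonglongrightarrow> 0" unfolding ennreal_0[symmetric] by (subst (asm) tendsto_ennreal_iff) auto
    then show ?thesis by (simp only: tendsto_rabs_zero_iff)
  qed
  ultimately have "(\<integral>x. (pd j a x * f x) * f x \<partial>?M) + 2 * (\<integral>x. (a x * f x) * F j x \<partial>?M) = 0"
    by (rule LIMSEQ_unique)
  then show ?thesis by (simp add: mult.assoc)
qed

text \<open>The coefficient \<open>U\<close> is approximated by smooth ones. Fourth powers enter
  here: they give the convergence of \<open>a k * f\<close> to \<open>U * f\<close> in the mean
  square, whereas the derivatives of \<open>a k\<close> are paired with the square-integrable
  function \<open>f^2\<close>.\<close>

lemma ibp_zero_trace:
  assumes U: "strace \<Omega> U G h" and f: "strace \<Omega> f F g" and zero: "null_trace g"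
  shows "(\<integral>x. G j x * (f x)\<^sup>2 \<partial>NN) + 2 * (\<integral>x. (U x * f x) * F j x \<partial>NN) = 0"
    "integrable NN (\<lambda>x. G j x * (f x)\<^sup>2)" "integrable NN (\<lambda>x. (U x * f x) * F j x)"
proof -
  let ?M = "NN"
  obtain v where v: "approx \<Omega> v f F g" using f by (auto simp: strace_def)
  obtain a where a: "approx \<Omega> a U G h" using U by (auto simp: strace_def)
  have A: "\<And>k. smooth (a k)" "cv2 ?M a U" "\<And>j. cv2 ?M (\<lambda>k. pd j (a k)) (G j)"
    using a by (auto simp: approx_def)
  note f4 = approx_L4(1)[OF v] and a4 = approx_L4[OF a] and U4 = approx_L4(1)[OF a]
  note fL = strace_L2m[OF f] and UL = strace_L2m[OF U]
  have m [measurable]: "f \<in> borel_measurable ?M" "U \<in> borel_measurable ?M" "a k \<in> borel_measurable ?M" for k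
    using fL UL A by (auto simp: L2m_def cv2_def)
  have "cv2 ?M (\<lambda>k x. a k x * f x) (\<lambda>x. U x * f x)"
  proof (rule cv2I)
    show "L2m ?M (\<lambda>x. a k x * f x)" for k by (rule L4_mult(1)[OF _ m(3) f4 m(1)]) (intro smooth_L2m smooth_power A)
    show "L2m ?M (\<lambda>x. U x * f x)" by (rule L4_mult(1)[OF U4 m(2) f4 m(1)])
    show "(\<integral>x. (a k x * f x - U x * f x)\<^sup>2 \<partial>?M) \<le> sqrt (\<integral>x. (a k x - U x) ^ 4 \<partial>?M) * sqrt (\<integral>x. f x ^ 4 \<partial>?M)" for k
      using L4_mult(2)[OF a4(2)[of k] _ f4 m(1)] by (simp add: left_diff_distrib)
    have "(\<lambda>k. sqrt (\<integral>x. (a k x - U x) ^ 4 \<partial>?M) * sqrt (\<integral>x. f x ^ 4 \<partial>?M)) \<longlonglongrightarrow> sqrt 0 * sqrt (\<integral>x. f x ^ 4 \<partial>?M)"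
      by (intro tendsto_intros a4(3))
    then show "(\<lambda>k. sqrt (\<integral>x. (a k x - U x) ^ 4 \<partial>?M) * sqrt (\<integral>x. f x ^ 4 \<partial>?M)) \<longlonglongrightarrow> 0" by simp
  qed
  then have "(\<lambda>k. (\<integral>x. pd j (a k) x * (f x)\<^sup>2 \<partial>?M) + 2 * (\<integral>x. (a k x * f x) * F j x \<partial>?M)) \<longlonglongrightarrow>
     (\<integral>x. G j x * (f x)\<^sup>2 \<partial>?M) + 2 * (\<integral>x. (U x * f x) * F j x \<partial>?M)"
    by (intro tendsto_add tendsto_mult tendsto_const cv2_mult_tendsto_const A f4 fL)
  moreover have "(\<integral>x. pd j (a k) x * (f x)\<^sup>2 \<partial>?M) + 2 * (\<integral>x. (a k x * f x) * F j x \<partial>?M) = 0" for k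
    using ibp_smooth_coefficient[OF A(1) v zero] by (simp add: power2_eq_square)
  ultimately show "(\<integral>x. G j x * (f x)\<^sup>2 \<partial>?M) + 2 * (\<integral>x. (U x * f x) * F j x \<partial>?M) = 0"
    by (simp add: LIMSEQ_const_iff)
  show "integrable ?M (\<lambda>x. G j x * (f x)\<^sup>2)" by (rule L2m_mult_integrable[OF UL(2) f4])
  show "integrable ?M (\<lambda>x. (U x * f x) * F j x)"
    by (rule L2m_mult_integrable[OF L4_mult(1)[OF U4 m(2) f4 m(1)] fL(2)])
qed

end

section \<open>Vertical shifts and the Piola transform\<close>

abbreviation dd :: "(real \<Rightarrow> real) \<Rightarrow> real \<Rightarrow> real" where "dd \<equiv> dir_deriv 1"

lemma smooth_dd: "smooth f \<Longrightarrow> smooth (dd f)"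
  by (rule smooth_dir_deriv) auto

lemma dd_has_derivative: "smooth f \<Longrightarrow> (f has_real_derivative dd f x) (at x)"
  using differentiable_has_derivative_dir_deriv[OF smooth_differentiable, of f x]
  by (simp add: has_field_derivative_def mult_commute_abs)

lemma smooth_coord: "smooth (\<lambda>x::plane. x $ i)"
  using smooth_inner[of "axis i 1 :: plane"] by (simp add: inner_axis)

lemma smooth_of_coord: "smooth f \<Longrightarrow> smooth (\<lambda>x::plane. f (x $ i))"
  by (rule smooth_comp_real[OF _ smooth_coord])

lemma pd_coord: "pd j (\<lambda>x. x $ i) = (\<lambda>x. if i = j then 1 else 0)"
proof -
  have "(\<lambda>x::plane. x \<bullet> axis i 1) = (\<lambda>x. x $ i)" by (simp add: inner_axis)
  moreover have "(axis j 1 :: plane) \<bullet> axis i 1 = (if i = j then 1 else 0)" by (auto simp: inner_axis_axis)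
  ultimately show ?thesis using dir_deriv_inner[of "axis j 1" "axis i 1 :: plane"] by (simp only:)
qed

lemma pd_of_coord: assumes "smooth f" shows "pd j (\<lambda>x. f (x $ i)) x = (if i = j then dd f (x $ i) else 0)"
proof -
  have "pd j (\<lambda>x. f (x $ i)) x = (\<Sum>b\<in>Basis. pd j (\<lambda>x. x $ i \<bullet> b) x * dir_deriv b f (x $ i))"
    by (rule dir_deriv_comp) (use smooth_differentiable[OF assms] smooth_differentiable[OF smooth_coord] in auto)
  then show ?thesis by (simp add: pd_coord)
qed

lemma smooth_bounded_derivative_lipschitz:
  assumes "smooth f" "\<And>x. \<bar>dd f x\<bar> \<le> M"
  shows "\<bar>f s - f t\<bar> \<le> M * \<bar>s - t\<bar>"
  using field_differentiable_bound[of UNIV f "dd f" M t s] dd_has_derivative[OF assms(1)] assms(2)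
  by (simp add: abs_minus_commute)

text \<open>The map adds \<open>ct (x2) * k (x1)\<close> to the second coordinate. The condition
  \<open>small\<close> keeps its vertical derivative at least \<open>1/2\<close>, which makes it
  invertible on every vertical line; the bounds by \<open>M\<close> make it and its inverse
  Lipschitz on the whole plane, as the comparison of boundary integrals demands.\<close>

locale shift =
  fixes k ct :: "real \<Rightarrow> real" and M :: real
  assumes smk: "smooth k" and smct: "smooth ct" and M: "1 \<le> M"
    and bounds: "\<And>s. \<bar>k s\<bar> \<le> M" "\<And>s. \<bar>dd k s\<bar> \<le> M" "\<And>s. \<bar>ct s\<bar> \<le> M" "\<And>s. \<bar>dd ct s\<bar> \<le> M"
    and small: "\<And>s t. \<bar>dd ct t * k s\<bar> \<le> 1/2"
begin

definition \<tau> :: "plane \<Rightarrow> real" where "\<tau> x = x$2 + ct (x$2) * k (x$1)"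
definition T :: "plane \<Rightarrow> plane" where "T x = pt (x$1) (\<tau> x)"
definition J :: "plane \<Rightarrow> real" where "J x = 1 + dd ct (x$2) * k (x$1)"
definition \<tau>1 :: "plane \<Rightarrow> real" where "\<tau>1 x = ct (x$2) * dd k (x$1)"

lemma J_ge: "1/2 \<le> J x" "0 < J x" "J x \<noteq> 0"
proof -
  show "1/2 \<le> J x" using small[of "x$2" "x$1"] unfolding J_def by linarith
  then show "0 < J x" "J x \<noteq> 0" by auto
qed

lemma smooth_\<tau>: "smooth \<tau>" and smooth_J: "smooth J" and smooth_\<tau>1: "smooth \<tau>1"
  unfolding \<tau>_def[abs_def] J_def[abs_def] \<tau>1_def[abs_def]
  by (intro smooth_add smooth_mult smooth_const smooth_coord smooth_of_coord smooth_dd smk smct)+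

lemma pd_product_coord:
  assumes "smooth f" "smooth g"
  shows "pd 1 (\<lambda>x. f (x$2) * g (x$1)) x = f (x$2) * dd g (x$1)"
    "pd 2 (\<lambda>x. f (x$2) * g (x$1)) x = dd f (x$2) * g (x$1)"
  by (subst dir_deriv_mult; simp add: smooth_differentiable smooth_of_coord assms pd_of_coord)+

lemma pd_\<tau>: "pd 1 \<tau> x = \<tau>1 x" "pd 2 \<tau> x = J x"
  unfolding \<tau>_def[abs_def] \<tau>1_def J_def
  by (subst dir_deriv_add; simp add: smooth_differentiable smooth_coord smooth_mult smooth_of_coord smk smct pd_product_coord pd_coord)+

lemma smooth_T: "smooth (\<lambda>x. T x $ i)"
  using exhaust_2[of i] smooth_coord smooth_\<tau> by (auto simp: T_def)

lemma Dmat_T: "Dmat T x = (\<chi> i j. if i = 1 then (if j = 1 then 1 else 0) else (if j = 1 then \<tau>1 x else J x))"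
proof -
  have "pd j (\<lambda>y. T y $ 1) x = (if j = 1 then 1 else 0)" "pd j (\<lambda>y. T y $ 2) x = (if j = 1 then \<tau>1 x else J x)" for j
    using exhaust_2[of j] pd_coord[of j 1] pd_\<tau> by (auto simp: T_def cong: if_cong)
  then show ?thesis by (simp add: Dmat_def vec_eq_iff forall_2)
qed

definition \<psi> :: "real \<Rightarrow> real \<Rightarrow> real" where "\<psi> s t = t + ct t * k s"

lemma \<psi>_derivative: "(\<psi> s has_real_derivative (1 + dd ct t * k s)) (at t)"
  unfolding \<psi>_def[abs_def] by (auto intro!: derivative_eq_intros dd_has_derivative[OF smct])

lemma \<psi>_expand: "\<bar>t - t'\<bar> \<le> 2 * \<bar>\<psi> s t - \<psi> s t'\<bar>"
proof -
  have *: "t - t' \<le> 2 * (\<psi> s t - \<psi> s t')" if "t' < t" for t t'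
  proof -
    have "\<exists>z>t'. z < t \<and> \<psi> s t - \<psi> s t' = (t - t') * (1 + dd ct z * k s)"
      by (rule MVT2[OF that]) (rule \<psi>_derivative)
    then obtain z where "\<psi> s t - \<psi> s t' = (t - t') * (1 + dd ct z * k s)" by blast
    moreover have "(t - t') * (1/2) \<le> (t - t') * (1 + dd ct z * k s)"
      using small[of z s] that by (intro mult_left_mono) (auto simp: abs_le_iff)
    ultimately have "(t - t') * (1/2) \<le> \<psi> s t - \<psi> s t'" by simp
    then show ?thesis by simp
  qed
  show ?thesis using *[of t' t] *[of t t'] by (cases t t' rule: linorder_cases) auto
qed

lemma \<psi>_surj: "\<exists>t. \<psi> s t = y"
proof -
  have "continuous_on {y - M * M .. y + M * M} (\<psi> s)"
    using \<psi>_derivative by (meson DERIV_isCont continuous_at_imp_continuous_on)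
  moreover have b: "\<bar>ct t * k s\<bar> \<le> M * M" for t
    unfolding abs_mult by (intro mult_mono bounds) (use M in auto)
  moreover have "\<psi> s (y - M * M) \<le> y" "y \<le> \<psi> s (y + M * M)"
    using b[of "y - M * M"] b[of "y + M * M"] by (auto simp: \<psi>_def abs_le_iff)
  ultimately show ?thesis
    using IVT'[of "\<psi> s" "y - M * M" y "y + M * M"] M by auto
qed

definition S :: "plane \<Rightarrow> plane" where "S y = pt (y$1) (SOME t. \<psi> (y$1) t = y$2)"

lemma S_2: "\<psi> (y$1) (S y $ 2) = y$2"
  unfolding S_def using someI_ex[OF \<psi>_surj] by simp

lemma \<tau>_\<psi>: "\<tau> x = \<psi> (x$1) (x$2)" by (simp add: \<tau>_def \<psi>_def)

lemma TS: "T (S y) = y"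
proof -
  have "S y $ 1 = y $ 1" by (simp add: S_def)
  then show ?thesis using S_2[of y] pt_surj[of y] by (simp add: T_def \<tau>_\<psi>)
qed

lemma \<psi>_inj: "\<psi> s t = \<psi> s t' \<Longrightarrow> t = t'"
  using \<psi>_expand[of t t' s] by simp

lemma ST: "S (T x) = x"
proof -
  have "\<psi> (x$1) (S (T x) $ 2) = \<psi> (x$1) (x$2)" using S_2[of "T x"] by (simp add: T_def \<tau>_\<psi>)
  then have "S (T x) $ 2 = x $ 2" by (rule \<psi>_inj)
  then show ?thesis using pt_surj[of x] by (simp add: vec_eq_iff forall_2 S_def T_def)
qed

lemma dist_plane_le: "dist (x::plane) y \<le> \<bar>x$1 - y$1\<bar> + \<bar>x$2 - y$2\<bar>"
  using norm_le_l1_cart[of "x - y"] by (simp add: dist_norm sum_2)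

lemma coord_le_dist: "\<bar>x$i - y$i\<bar> \<le> dist (x::plane) y"
  using component_le_norm_cart[of "x - y" i] by (simp add: dist_norm)

lemma k_lip: "\<bar>ct t * k s - ct t * k s'\<bar> \<le> M * M * \<bar>s - s'\<bar>"
proof -
  have "\<bar>ct t * k s - ct t * k s'\<bar> = \<bar>ct t\<bar> * \<bar>k s - k s'\<bar>" by (simp add: abs_mult right_diff_distrib[symmetric])
  also have "\<dots> \<le> M * (M * \<bar>s - s'\<bar>)"
    by (intro mult_mono bounds smooth_bounded_derivative_lipschitz smk) (use M in auto)
  finally show ?thesis by (simp add: mult.assoc)
qed

text \<open>A generous Lipschitz constant common to the shift and its inverse.\<close>

definition K where "K = 10 * M * M"

lemma MM: "1 \<le> M * M"
  using mult_mono[of 1 M 1 M] M by simp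

lemma lip_T: "dist (T x) (T y) \<le> K * dist x y"
proof -
  have a: "\<bar>ct (x$2) * k (y$1) - ct (y$2) * k (y$1)\<bar> \<le> M * M * \<bar>x$2 - y$2\<bar>"
  proof -
    have "\<bar>ct (x$2) * k (y$1) - ct (y$2) * k (y$1)\<bar> = \<bar>ct (x$2) - ct (y$2)\<bar> * \<bar>k (y$1)\<bar>"
      by (simp add: abs_mult left_diff_distrib[symmetric])
    also have "\<dots> \<le> (M * \<bar>x$2 - y$2\<bar>) * M"
      by (intro mult_mono bounds smooth_bounded_derivative_lipschitz smct) (use M in auto)
    finally show ?thesis by (simp add: mult_ac)
  qed
  have b: "\<bar>\<tau> x - \<tau> y\<bar> \<le> \<bar>x$2 - y$2\<bar> + M * M * \<bar>x$1 - y$1\<bar> + M * M * \<bar>x$2 - y$2\<bar>"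
    using a k_lip[of "x$2" "x$1" "y$1"] unfolding \<tau>_def by linarith
  have c: "M * M * \<bar>x$i - y$i\<bar> \<le> M * M * dist x y" for i
    by (intro mult_left_mono coord_le_dist) (use MM in auto)
  have "1 * dist x y \<le> M * M * dist x y" by (intro mult_right_mono MM) simp
  then have "dist (T x) (T y) \<le> 10 * (M * M * dist x y)"
    using dist_plane_le[of "T x" "T y"] b c[of 1] c[of 2] coord_le_dist[of x 1 y] coord_le_dist[of x 2 y]
    unfolding T_def pt_nth by linarith
  then show ?thesis by (simp add: K_def mult.assoc)
qed

lemma lip_S: "dist (S x) (S y) \<le> K * dist x y"
proof -
  let ?u = "S x" and ?v = "S y"
  have 1: "?u $ 1 = x $ 1" "?v $ 1 = y $ 1" by (simp_all add: S_def)
  have "\<bar>?u$2 - ?v$2\<bar> \<le> 2 * \<bar>\<psi> (x$1) (?u$2) - \<psi> (x$1) (?v$2)\<bar>" by (rule \<psi>_expand)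
  also have "\<dots> \<le> 2 * (\<bar>x$2 - y$2\<bar> + M * M * \<bar>x$1 - y$1\<bar>)"
  proof (rule mult_left_mono)
    show "\<bar>\<psi> (x$1) (?u$2) - \<psi> (x$1) (?v$2)\<bar> \<le> \<bar>x$2 - y$2\<bar> + M * M * \<bar>x$1 - y$1\<bar>"
      using S_2[of x] S_2[of y] k_lip[of "?v$2" "x$1" "y$1"] unfolding \<psi>_def by linarith
  qed simp
  finally have b: "\<bar>?u$2 - ?v$2\<bar> \<le> 2 * (\<bar>x$2 - y$2\<bar> + M * M * \<bar>x$1 - y$1\<bar>)" .
  have c: "M * M * \<bar>x$i - y$i\<bar> \<le> M * M * dist x y" for i
    by (intro mult_left_mono coord_le_dist) (use MM in auto)
  have "1 * dist x y \<le> M * M * dist x y" by (intro mult_right_mono MM) simp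
  then have e: "dist x y \<le> M * M * dist x y" by simp
  have u: "\<bar>?u$2 - ?v$2\<bar> \<le> 2 * \<bar>x$2 - y$2\<bar> + 2 * (M * M * \<bar>x$1 - y$1\<bar>)"
    using b by (simp add: distrib_left)
  have aux: "d \<le> 10 * X" if "e \<le> X" "u \<le> 2 * b + 2 * Y" "d \<le> a + u" "Y \<le> X" "a \<le> e" "b \<le> e" "0 \<le> e"
    for a b d e u X Y :: real using that by linarith
  have "dist (S x) (S y) \<le> 10 * (M * M * dist x y)"
    by (rule aux[OF e u dist_plane_le[of ?u ?v, unfolded 1] c coord_le_dist coord_le_dist zero_le_dist])
  then show ?thesis by (simp add: K_def mult.assoc)
qed

section \<open>Derivatives of the inverse shift\<close>

lemma K_pos: "0 < K" using MM unfolding K_def by simp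

text \<open>The inverse of the derivative matrix of \<open>T\<close> at \<open>x\<close>, hence the
  derivative matrix of \<open>S\<close> at \<open>T x\<close>. It is triangular because the first
  coordinate is kept.\<close>

definition Kmat :: "plane \<Rightarrow> real^2^2" where
  "Kmat x = (\<chi> i j. if i = 1 then (if j = 1 then 1 else 0) else (if j = 1 then - \<tau>1 x / J x else 1 / J x))"

lemma Kmat_Dmat: "Kmat x ** Dmat T x = mat 1" "Dmat T x ** Kmat x = mat 1"
  using J_ge(3)[of x] by (auto simp: Kmat_def Dmat_T matrix_matrix_mult_def mat_def vec_eq_iff forall_2 sum_2 field_simps)

lemma S_has_derivative: "(S has_derivative (\<lambda>h. Kmat (S y) *v h)) (at y)"
proof (rule has_derivative_inverse_basic)
  show "(T has_derivative (\<lambda>h. Dmat T (S y) *v h)) (at (S y))" by (rule has_derivative_Dmat[OF smooth_T])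
  show "bounded_linear (\<lambda>h. Kmat (S y) *v h)" by (simp add: linear_conv_bounded_linear[symmetric] matrix_vector_mul_linear)
  show "(\<lambda>h. Kmat (S y) *v h) \<circ> (\<lambda>h. Dmat T (S y) *v h) = id"
    by (auto simp: fun_eq_iff matrix_vector_mul_assoc Kmat_Dmat)
  have "K-lipschitz_on UNIV S" using lip_S K_pos by (intro lipschitz_onI) auto
  then have "continuous_on UNIV S" by (rule lipschitz_on_continuous_on)
  then show "continuous (at y) S" by (simp add: continuous_on_eq_continuous_at)
  show "open (UNIV :: plane set)" "y \<in> UNIV" by auto
  show "T (S z) = z" if "z \<in> UNIV" for z by (rule TS)
qed

lemma S_component_derivative: "((\<lambda>y. S y $ i) has_derivative (\<lambda>h. (Kmat (S y) *v h) $ i)) (at y)"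
  by (rule bounded_linear.has_derivative[OF bounded_linear_vec_nth S_has_derivative])

lemma pd_S: "pd j (\<lambda>y. S y $ i) y = Kmat (S y) $ i $ j"
  using dir_deriv_eq[OF S_component_derivative, of "axis j 1" i y]
  by (simp add: matrix_vector_mult_basis column_def)

lemma Dmat_S: "Dmat S y = Kmat (S y)"
  by (simp add: Dmat_def pd_S vec_eq_iff)

lemma smooth_Kmat: "smooth (\<lambda>x. Kmat x $ i $ j)"
proof -
  have "smooth (\<lambda>x. - \<tau>1 x / J x)" "smooth (\<lambda>x. 1 / J x)"
    by (intro smooth_divide smooth_minus smooth_\<tau>1 smooth_J smooth_const J_ge)+
  then show ?thesis unfolding Kmat_def by (cases "i = 1"; cases "j = 1") (simp_all add: smooth_const)
qed

text \<open>Bootstrapping: the derivatives of \<open>S\<close> are the entries of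
  \<open>Kmat\<close> composed with \<open>S\<close>, so \<open>S\<close> gains one order of
  differentiability in each round.\<close>

lemma smooth_S: "smooth (\<lambda>y. S y $ i)"
proof -
  have "\<forall>i. Cn n (\<lambda>y. S y $ i)" for n
  proof (induction n)
    case 0
    show ?case using S_component_derivative by (auto simp: differentiable_def)
  next
    case (Suc n)
    have "Cn n (\<lambda>y. Kmat (S y) $ i $ j)" for i j
      by (rule Cn_comp[of n "\<lambda>x. Kmat x $ i $ j" S])
         (use smooth_Kmat Suc in \<open>auto simp: smooth_iff_Cn Basis_plane inner_axis\<close>)
    then have "Cn n (pd j (\<lambda>y. S y $ i))" for i j
      by (simp add: pd_S[abs_def])
    moreover have "(\<lambda>y. S y $ i) differentiable at y" for i y
      using S_component_derivative by (auto simp: differentiable_def)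
    ultimately show ?case by (auto simp: Basis_plane)
  qed
  then show ?thesis by (simp add: smooth_iff_Cn)
qed

sublocale diffeo T S K
  by unfold_locales (rule ST TS K_pos lip_S lip_T smooth_T smooth_S)+

lemma jac_eq: "jac x = J x"
  using J_ge(2)[of x] by (simp add: jac_def det_2 Dmat_T)

definition Nmat :: "plane \<Rightarrow> real^2^2" where
  "Nmat x = (\<chi> i j. if i = 1 then (if j = 1 then 1 / J x else 0) else (if j = 1 then \<tau>1 x / J x else 1))"

definition Nadj :: "plane \<Rightarrow> real^2^2" where
  "Nadj x = (\<chi> i j. if i = 1 then (if j = 1 then J x else 0) else (if j = 1 then - \<tau>1 x else 1))"

lemma Nmat_Nadj: "Nmat x ** Nadj x = mat 1" "Nadj x ** Nmat x = mat 1"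
  using J_ge(3)[of x] by (auto simp: Nmat_def Nadj_def matrix_matrix_mult_def mat_def vec_eq_iff forall_2 sum_2 field_simps)

lemma smooth_Nmat: "smooth (\<lambda>x. Nmat x $ i $ j)"
proof -
  have "smooth (\<lambda>x. \<tau>1 x / J x)" "smooth (\<lambda>x. 1 / J x)"
    by (intro smooth_divide smooth_\<tau>1 smooth_J smooth_const J_ge)+
  then show ?thesis unfolding Nmat_def by (cases "i = 1"; cases "j = 1") (simp_all add: smooth_const)
qed

lemma smooth_Nadj: "smooth (\<lambda>x. Nadj x $ i $ j)"
  unfolding Nadj_def using smooth_J smooth_minus[OF smooth_\<tau>1]
  by (cases "i = 1"; cases "j = 1") (simp_all add: smooth_const)

text \<open>The Piola transform; \<open>Nmat\<close> is \<open>DT\<close> divided by its determinant, and \<open>Nadj\<close> the inverse of \<open>Nmat\<close>.\<close>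

definition push :: "(plane \<Rightarrow> plane) \<Rightarrow> plane \<Rightarrow> plane" where "push v y = Nmat (S y) *v v (S y)"
definition pull :: "(plane \<Rightarrow> plane) \<Rightarrow> plane \<Rightarrow> plane" where "pull u x = Nadj x *v u (T x)"

lemma push_pull: "push (pull u) = u" and pull_push: "pull (push v) = v"
  by (auto simp: push_def pull_def fun_eq_iff matrix_vector_mul_assoc Nmat_Nadj ST TS)

text \<open>The gradient of the Piola transform at \<open>T x\<close>, for a field with value
  \<open>v\<close> and gradient \<open>G\<close> at \<open>x\<close>: the product rule for
  \<open>Nmat\<close>, followed by the chain rule with \<open>Kmat\<close>. Since
  \<open>Nmat\<close> is not constant, the value of the field enters along with its
  gradient.\<close>

definition Emat :: "plane \<Rightarrow> plane \<Rightarrow> real^2^2 \<Rightarrow> real^2^2" where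
  "Emat x v G = (Nmat x ** G + (\<chi> i j. pd j (\<lambda>y. Nmat y $ i $ 1) x * v $ 1 + pd j (\<lambda>y. Nmat y $ i $ 2) x * v $ 2)) ** Kmat x"

lemma vtrace_push:
  assumes "bdom \<Omega>" "vtrace \<Omega> v G g"
  shows "vtrace (T ` \<Omega>) (push v) (\<lambda>y. Emat (S y) (v (S y)) (G (S y))) (push g)"
proof -
  interpret bdom \<Omega> by fact
  interpret diffeo_dom T S K \<Omega> by unfold_locales
  show ?thesis
    using vtrace_comp[OF vtrace_matrix_mult[OF smooth_Nmat assms(2)]]
    unfolding push_def[abs_def] Emat_def Dmat_S by simp
qed

lemma vtrace_pull:
  assumes "bdom (T ` \<Omega>)" "vtrace (T ` \<Omega>) u G g"
  shows "\<exists>G'. vtrace \<Omega> (pull u) G' (pull g)"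
proof -
  have im: "S ` T ` \<Omega> = \<Omega>" by (simp add: image_image ST)
  interpret D: bdom "T ` \<Omega>" by fact
  interpret S: diffeo_dom S T K "T ` \<Omega>"
    by (rule diffeo_dom.intro[OF swap_diffeo]) unfold_locales
  have "bdom \<Omega>" using S.img.bdom_axioms unfolding im .
  then interpret bdom \<Omega> .
  show ?thesis
    using vtrace_matrix_mult[OF smooth_Nadj S.vtrace_comp[OF assms(2), unfolded im]]
    unfolding pull_def[abs_def] by blast
qed

text \<open>With \<open>A = ct(x\<^sub>2)\<close> and its derivatives \<open>A'\<close>, \<open>A''\<close>, and \<open>a = k(x\<^sub>1)\<close> with \<open>a'\<close>, \<open>a''\<close>.\<close>

definition Eformula :: "real \<Rightarrow> real \<Rightarrow> real \<Rightarrow> real \<Rightarrow> real \<Rightarrow> real \<Rightarrow> real \<Rightarrow> plane \<Rightarrow> real^2^2 \<Rightarrow> real^2^2" where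
  "Eformula j A A' A'' a a' a'' v G =
    (let m = 1 / j; q = A * a' / j;
         m1 = - (A' * a') / j\<^sup>2; m2 = - (A'' * a) / j\<^sup>2;
         q1 = A * a'' / j - A * a' * (A' * a') / j\<^sup>2; q2 = A' * a' / j - A * a' * (A'' * a) / j\<^sup>2;
         y11 = m * G$1$1 + m1 * v$1; y12 = m * G$1$2 + m2 * v$1;
         y21 = q * G$1$1 + G$2$1 + q1 * v$1; y22 = q * G$1$2 + G$2$2 + q2 * v$1
     in (\<chi> i l. if i = 1 then (if l = 1 then y11 - q * y12 else m * y12) else (if l = 1 then y21 - q * y22 else m * y22)))"

lemma pd_quot:
  assumes "smooth f" shows "pd l (\<lambda>x. f x / J x) x = pd l f x / J x - f x * pd l J x / (J x)\<^sup>2"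
proof -
  have "pd l (\<lambda>x. f x * inverse (J x)) x = f x * pd l (\<lambda>x. inverse (J x)) x + pd l f x * inverse (J x)"
    by (intro dir_deriv_mult smooth_differentiable assms smooth_inverse smooth_J J_ge)
  also have "pd l (\<lambda>x. inverse (J x)) x = - (inverse (J x) * inverse (J x) * pd l J x)"
    by (intro dir_deriv_inverse smooth_differentiable smooth_J J_ge)
  finally show ?thesis by (simp add: divide_inverse power2_eq_square algebra_simps)
qed

lemma pd_J: "pd 1 J x = dd ct (x$2) * dd k (x$1)" "pd 2 J x = dd (dd ct) (x$2) * k (x$1)"
  unfolding J_def[abs_def]
  by (subst dir_deriv_add; simp add: smooth_differentiable smooth_const smooth_mult smooth_of_coord smooth_dd smk smct pd_product_coord dir_deriv_const)+

lemma pd_\<tau>1: "pd 1 \<tau>1 x = ct (x$2) * dd (dd k) (x$1)" "pd 2 \<tau>1 x = dd ct (x$2) * dd k (x$1)"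
  unfolding \<tau>1_def[abs_def] by (simp_all add: pd_product_coord smooth_dd smk smct)

text \<open>Written in scalars, so that joint continuity in the parameter and the point can be read
  off and the trace computed.\<close>

lemma Emat_formula: "Emat x v G = Eformula (J x) (ct (x$2)) (dd ct (x$2)) (dd (dd ct) (x$2)) (k (x$1)) (dd k (x$1)) (dd (dd k) (x$1)) v G"
proof -
  have N: "(\<lambda>y. Nmat y $ 1 $ 1) = (\<lambda>y. 1 / J y)" "(\<lambda>y. Nmat y $ 1 $ 2) = (\<lambda>y. 0)"
    "(\<lambda>y. Nmat y $ 2 $ 1) = (\<lambda>y. \<tau>1 y / J y)" "(\<lambda>y. Nmat y $ 2 $ 2) = (\<lambda>y. 1)"
    by (auto simp: Nmat_def)
  show ?thesis
    unfolding Emat_def Eformula_def Let_def vec_eq_iff forall_2 matrix_matrix_mult_def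
    by (simp add: sum_2 N pd_quot smooth_\<tau>1 smooth_const dir_deriv_const pd_J pd_\<tau>1 Nmat_def Kmat_def)
       (simp add: \<tau>1_def algebra_simps)
qed

text \<open>The Piola identity: the terms with derivatives of \<open>Nmat\<close> cancel in the
  trace. Because the remaining factor never vanishes, zero divergence is preserved in both
  directions.\<close>

lemma trace_Emat: "trace (Emat x v G) = trace G / J x"
  unfolding Emat_formula Eformula_def Let_def trace_def sum_2
  using J_ge(3)[of x] by (simp add: field_simps power2_eq_square)

end

section \<open>Stability of the transported forms\<close>

lemma norm_matrix_vector_le: "norm ((A :: real^2^2) *v x) \<le> norm A * norm x"
proof (rule power2_le_imp_le)
  have "((A *v x) $ i)\<^sup>2 \<le> (norm (A $ i))\<^sup>2 * (norm x)\<^sup>2" for i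
  proof -
    have "(A *v x) $ i = A $ i \<bullet> x" by (simp add: matrix_vector_mult_def inner_vec_def)
    then have "\<bar>(A *v x) $ i\<bar> \<le> norm (A $ i) * norm x" using Cauchy_Schwarz_ineq2[of "A $ i" x] by simp
    then show ?thesis by (metis abs_ge_zero power2_abs power_mono power_mult_distrib)
  qed
  then have "(norm (A *v x))\<^sup>2 \<le> ((norm (A $ 1))\<^sup>2 + (norm (A $ 2))\<^sup>2) * (norm x)\<^sup>2"
    by (simp add: norm_plane[of "A *v x"] distrib_right add_mono)
  also have "(norm (A $ 1))\<^sup>2 + (norm (A $ 2))\<^sup>2 = (norm A)\<^sup>2" by (simp add: norm_mat norm_plane)
  finally show "(norm (A *v x))\<^sup>2 \<le> (norm A * norm x)\<^sup>2" by (simp add: power_mult_distrib)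
qed simp

type_synonym mat2 = "real^2^2"

text \<open>The integrability required by the forms: second powers of value and gradient, and fourth
  powers of the value for the convection term.\<close>

definition fld :: "plane measure \<Rightarrow> (plane \<Rightarrow> plane) \<Rightarrow> (plane \<Rightarrow> mat2) \<Rightarrow> bool" where
  "fld N v G \<longleftrightarrow> v \<in> borel_measurable N \<and> G \<in> borel_measurable N \<and>
     L2m N (\<lambda>x. norm (v x, G x)) \<and> L2m N (\<lambda>x. (norm (v x))\<^sup>2)"

definition nrm2 :: "plane measure \<Rightarrow> (plane \<Rightarrow> plane) \<Rightarrow> (plane \<Rightarrow> mat2) \<Rightarrow> real" where
  "nrm2 N v G = sqrt (\<integral>x. (norm (v x, G x))\<^sup>2 \<partial>N)"

definition nrm4 :: "plane measure \<Rightarrow> (plane \<Rightarrow> plane) \<Rightarrow> real" where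
  "nrm4 N v = sqrt (sqrt (\<integral>x. (norm (v x)) ^ 4 \<partial>N))"

lemma nrm_nonneg: "0 \<le> nrm2 N v G" "0 \<le> nrm4 N v"
  by (auto simp: nrm2_def nrm4_def intro!: integral_nonneg_AE)

lemma dominated_integral:
  fixes F g :: "'a \<Rightarrow> real"
  assumes "F \<in> borel_measurable N" "integrable N g" "\<And>x. x \<in> space N \<Longrightarrow> \<bar>F x\<bar> \<le> g x"
  shows "integrable N F" "\<bar>\<integral>x. F x \<partial>N\<bar> \<le> (\<integral>x. g x \<partial>N)"
proof -
  have g0: "0 \<le> g x" if "x \<in> space N" for x using assms(3)[OF that] by linarith
  show i: "integrable N F"
    by (rule Bochner_Integration.integrable_bound[OF assms(2,1)]) (use assms(3) in \<open>auto intro!: AE_I2 intro: order_trans[OF _ abs_ge_self]\<close>)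
  have "\<bar>\<integral>x. F x \<partial>N\<bar> \<le> (\<integral>x. \<bar>F x\<bar> \<partial>N)"
    using integral_norm_bound[of N F] unfolding real_norm_def .
  also have "\<dots> \<le> (\<integral>x. g x \<partial>N)"
    by (rule integral_mono) (use i assms in auto)
  finally show "\<bar>\<integral>x. F x \<partial>N\<bar> \<le> (\<integral>x. g x \<partial>N)" .
qed

lemma bilinear_bound:
  assumes f: "fld N v G" "fld N w H" and F: "F \<in> borel_measurable N"
    and le: "\<And>x. x \<in> space N \<Longrightarrow> \<bar>F x\<bar> \<le> c * (norm (v x, G x) * norm (w x, H x))"
    and c: "0 \<le> c"
  shows "integrable N F" "\<bar>\<integral>x. F x \<partial>N\<bar> \<le> c * (nrm2 N v G * nrm2 N w H)"
proof -
  have L: "L2m N (\<lambda>x. norm (v x, G x))" "L2m N (\<lambda>x. norm (w x, H x))" using f by (auto simp: fld_def)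
  have i: "integrable N (\<lambda>x. c * (norm (v x, G x) * norm (w x, H x)))"
    by (intro integrable_mult_right L2m_mult_integrable L)
  show "integrable N F" by (rule dominated_integral(1)[OF F i le])
  have "\<bar>\<integral>x. F x \<partial>N\<bar> \<le> c * (\<integral>x. norm (v x, G x) * norm (w x, H x) \<partial>N)"
    using dominated_integral(2)[OF F i le] by simp
  also have "\<dots> \<le> c * (nrm2 N v G * nrm2 N w H)"
    unfolding nrm2_def by (intro mult_left_mono[OF order_trans[OF abs_ge_self cauchy_schwarz(2)[OF L]]] c)
  finally show "\<bar>\<integral>x. F x \<partial>N\<bar> \<le> c * (nrm2 N v G * nrm2 N w H)" .
qed

text \<open>Hoelder's inequality with exponents 2, 4 and 4, obtained by applying the Cauchy-Schwarz
  inequality twice.\<close>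

lemma trilinear_bound:
  assumes f: "fld N v G" "fld N u U" "fld N w W" and F: "F \<in> borel_measurable N"
    and le: "\<And>x. x \<in> space N \<Longrightarrow> \<bar>F x\<bar> \<le> c * (norm (v x, G x) * (norm (u x) * norm (w x)))"
    and c: "0 \<le> c"
  shows "integrable N F" "\<bar>\<integral>x. F x \<partial>N\<bar> \<le> c * (nrm2 N v G * (nrm4 N u * nrm4 N w))"
proof -
  have L: "L2m N (\<lambda>x. norm (v x, G x))" "L2m N (\<lambda>x. (norm (u x))\<^sup>2)" "L2m N (\<lambda>x. (norm (w x))\<^sup>2)"
    and [measurable]: "u \<in> borel_measurable N" "w \<in> borel_measurable N"
    using f by (auto simp: fld_def)
  have m: "(\<lambda>x. norm (u x)) \<in> borel_measurable N" "(\<lambda>x. norm (w x)) \<in> borel_measurable N" by measurable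
  note uw = L4_mult[OF L(2) m(1) L(3) m(2)]
  have i: "integrable N (\<lambda>x. c * (norm (v x, G x) * (norm (u x) * norm (w x))))"
    by (intro integrable_mult_right L2m_mult_integrable L uw)
  show "integrable N F" by (rule dominated_integral(1)[OF F i le])
  have "\<bar>\<integral>x. F x \<partial>N\<bar> \<le> c * (\<integral>x. norm (v x, G x) * (norm (u x) * norm (w x)) \<partial>N)"
    using dominated_integral(2)[OF F i le] by simp
  also have "\<dots> \<le> c * (nrm2 N v G * sqrt (\<integral>x. (norm (u x) * norm (w x))\<^sup>2 \<partial>N))"
    unfolding nrm2_def by (intro mult_left_mono[OF order_trans[OF abs_ge_self cauchy_schwarz(2)[OF L(1) uw(1)]]] c)
  also have "\<dots> \<le> c * (nrm2 N v G * (nrm4 N u * nrm4 N w))"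
    unfolding nrm4_def real_sqrt_mult[symmetric]
    by (intro mult_left_mono c real_sqrt_le_mono nrm_nonneg) (use uw(2) in \<open>simp add: real_sqrt_mult\<close>)
  finally show "\<bar>\<integral>x. F x \<partial>N\<bar> \<le> c * (nrm2 N v G * (nrm4 N u * nrm4 N w))" .
qed

lemma measurable_matrix_vector:
  fixes u :: "plane \<Rightarrow> plane"
  assumes "F \<in> borel_measurable N" "u \<in> borel_measurable N"
  shows "(\<lambda>x. (F x :: mat2) *v u x) \<in> borel_measurable N"
proof -
  have [measurable]: "(\<lambda>x. F x $ i $ j) \<in> borel_measurable N" "(\<lambda>x. u x $ i) \<in> borel_measurable N" for i j
    using assms by (simp_all add: measurable_mat_iff measurable_plane_iff)
  show ?thesis unfolding measurable_plane_iff matrix_vector_mult_def by (simp add: sum_2)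
qed

text \<open>Isolates what the stability estimate uses of the transport: the density
  \<open>J\<close>, the transported gradient \<open>E\<close> and the transported value
  \<open>Q\<close> are measurable along fields, additive where applicable, and bounded uniformly
  over the parameters in \<open>P\<close>. The domain itself appears only through the measure
  \<open>N\<close>.\<close>

locale forms =
  fixes N :: "plane measure" and P :: "real set" and J :: "real \<Rightarrow> plane \<Rightarrow> real"
    and E :: "real \<Rightarrow> plane \<Rightarrow> plane \<Rightarrow> mat2 \<Rightarrow> mat2" and Q :: "real \<Rightarrow> plane \<Rightarrow> plane \<Rightarrow> plane" and M :: real
  assumes E_add: "E t x (v + v') (G + G') = E t x v G + E t x v' G'" and Q_add: "Q t x (v + v') = Q t x v + Q t x v'"
    and bJ: "t \<in> P \<Longrightarrow> x \<in> space N \<Longrightarrow> \<bar>J t x\<bar> \<le> M"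
    and bE: "t \<in> P \<Longrightarrow> x \<in> space N \<Longrightarrow> norm (E t x v G) \<le> M * norm (v, G)"
    and bQ: "t \<in> P \<Longrightarrow> x \<in> space N \<Longrightarrow> norm (Q t x v) \<le> M * norm v"
    and M1: "1 \<le> M"
    and mJ: "t \<in> P \<Longrightarrow> J t \<in> borel_measurable N"
    and mE: "t \<in> P \<Longrightarrow> u \<in> borel_measurable N \<Longrightarrow> H \<in> borel_measurable N \<Longrightarrow> (\<lambda>x. E t x (u x) (H x)) \<in> borel_measurable N"
    and mQ: "t \<in> P \<Longrightarrow> u \<in> borel_measurable N \<Longrightarrow> (\<lambda>x. Q t x (u x)) \<in> borel_measurable N"
begin

text \<open>The integrands of the Dirichlet form and of the convection term after transport, where \<open>G\<close> and
  \<open>H\<close> play the part of the gradients of \<open>v\<close> and \<open>w\<close>.\<close>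

definition iA where "iA t v G w H x = J t x * (E t x (v x) (G x) \<bullet> E t x (w x) (H x))" for v w :: "plane \<Rightarrow> plane" and G H x
definition iB where "iB t u v G w x = J t x * ((E t x (v x) (G x) *v Q t x (u x)) \<bullet> Q t x (w x))" for u v w :: "plane \<Rightarrow> plane" and G x
definition A where "A t v G w H = (\<integral>x. iA t v G w H x \<partial>N)"
definition B where "B t u v G w = (\<integral>x. iB t u v G w x \<partial>N)"

definition close :: "real \<Rightarrow> real \<Rightarrow> real \<Rightarrow> bool" where
  "close s t \<eta> \<longleftrightarrow> 0 \<le> \<eta> \<and> (\<forall>x\<in>space N. \<bar>J s x - J t x\<bar> \<le> \<eta> \<and>
      (\<forall>v G. norm (E s x v G - E t x v G) \<le> \<eta> * norm (v, G)) \<and> (\<forall>v. norm (Q s x v - Q t x v) \<le> \<eta> * norm v))"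

lemma fldD: "fld N v G \<Longrightarrow> v \<in> borel_measurable N" "fld N v G \<Longrightarrow> G \<in> borel_measurable N"
  by (auto simp: fld_def)

lemma miA: "t \<in> P \<Longrightarrow> fld N v G \<Longrightarrow> fld N w H \<Longrightarrow> iA t v G w H \<in> borel_measurable N"
  unfolding iA_def[abs_def] by (intro borel_measurable_times mJ borel_measurable_inner mE fldD)

lemma miB: "t \<in> P \<Longrightarrow> fld N u U \<Longrightarrow> fld N v G \<Longrightarrow> fld N w H \<Longrightarrow> iB t u v G w \<in> borel_measurable N"
  unfolding iB_def[abs_def] by (intro borel_measurable_times mJ borel_measurable_inner measurable_matrix_vector mE mQ fldD)

lemma iA_le:
  assumes "t \<in> P" "x \<in> space N"
  shows "\<bar>iA t v G w H x\<bar> \<le> M ^ 3 * (norm (v x, G x) * norm (w x, H x))"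
proof -
  have "\<bar>iA t v G w H x\<bar> \<le> M * ((M * norm (v x, G x)) * (M * norm (w x, H x)))"
    unfolding iA_def abs_mult
    by (intro mult_mono bJ order_trans[OF Cauchy_Schwarz_ineq2] mult_mono bE assms) (use M1 in \<open>auto intro!: mult_nonneg_nonneg\<close>)
  then show ?thesis by (simp add: power3_eq_cube mult_ac)
qed

lemma iB_le:
  assumes "t \<in> P" "x \<in> space N"
  shows "\<bar>iB t u v G w x\<bar> \<le> M ^ 4 * (norm (v x, G x) * (norm (u x) * norm (w x)))"
proof -
  have "\<bar>iB t u v G w x\<bar> \<le> M * (((M * norm (v x, G x)) * (M * norm (u x))) * (M * norm (w x)))"
    unfolding iB_def abs_mult
    by (intro mult_mono bJ order_trans[OF Cauchy_Schwarz_ineq2] order_trans[OF norm_matrix_vector_le] bE bQ assms)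
      (use M1 in \<open>auto intro!: mult_nonneg_nonneg\<close>)
  then show ?thesis by (simp add: power4_eq_xxxx mult_ac)
qed

text \<open>The factors are exchanged one at a time. The Dirichlet integrand has three of them,
  hence the constant 3; the convection integrand below has four.\<close>

lemma iA_close:
  assumes st: "s \<in> P" "t \<in> P" and c: "close s t \<eta>" and x: "x \<in> space N"
  shows "\<bar>iA s v G w H x - iA t v G w H x\<bar> \<le> (3 * M\<^sup>2 * \<eta>) * (norm (v x, G x) * norm (w x, H x))"
proof -
  let ?r = "norm (v x, G x)" and ?r' = "norm (w x, H x)"
  let ?e = "E s x (v x) (G x)" and ?e' = "E s x (w x) (H x)" and ?f = "E t x (v x) (G x)" and ?f' = "E t x (w x) (H x)"
  have \<eta>: "0 \<le> \<eta>" and cl: "\<bar>J s x - J t x\<bar> \<le> \<eta>" "norm (?e - ?f) \<le> \<eta> * ?r" "norm (?e' - ?f') \<le> \<eta> * ?r'"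
    using c x unfolding close_def by auto
  have "iA s v G w H x - iA t v G w H x = (J s x - J t x) * (?e \<bullet> ?e') + J t x * ((?e - ?f) \<bullet> ?e') + J t x * (?f \<bullet> (?e' - ?f'))"
    unfolding iA_def by (simp add: algebra_simps inner_diff_left inner_diff_right)
  moreover have "\<bar>(J s x - J t x) * (?e \<bullet> ?e')\<bar> \<le> \<eta> * ((M * ?r) * (M * ?r'))"
    unfolding abs_mult by (intro mult_mono cl order_trans[OF Cauchy_Schwarz_ineq2] bE st x) (use M1 \<eta> in \<open>auto intro!: mult_nonneg_nonneg\<close>)
  moreover have "\<bar>J t x * ((?e - ?f) \<bullet> ?e')\<bar> \<le> M * ((\<eta> * ?r) * (M * ?r'))"
    unfolding abs_mult by (intro mult_mono cl bJ order_trans[OF Cauchy_Schwarz_ineq2] bE st x) (use M1 \<eta> in \<open>auto intro!: mult_nonneg_nonneg\<close>)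
  moreover have "\<bar>J t x * (?f \<bullet> (?e' - ?f'))\<bar> \<le> M * ((M * ?r) * (\<eta> * ?r'))"
    unfolding abs_mult by (intro mult_mono cl bJ order_trans[OF Cauchy_Schwarz_ineq2] bE st x) (use M1 \<eta> in \<open>auto intro!: mult_nonneg_nonneg\<close>)
  ultimately have "\<bar>iA s v G w H x - iA t v G w H x\<bar> \<le> \<eta> * ((M * ?r) * (M * ?r')) + M * ((\<eta> * ?r) * (M * ?r')) + M * ((M * ?r) * (\<eta> * ?r'))"
    by linarith
  then show ?thesis by (simp add: power2_eq_square algebra_simps)
qed

lemma iB_close:
  assumes st: "s \<in> P" "t \<in> P" and c: "close s t \<eta>" and x: "x \<in> space N"
  shows "\<bar>iB s u v G w x - iB t u v G w x\<bar> \<le> (4 * M ^ 3 * \<eta>) * (norm (v x, G x) * (norm (u x) * norm (w x)))"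
proof -
  let ?r = "norm (v x, G x)" and ?a = "norm (u x)" and ?b = "norm (w x)"
  let ?e = "E s x (v x) (G x)" and ?f = "E t x (v x) (G x)"
  let ?p = "Q s x (u x)" and ?q = "Q t x (u x)" and ?p' = "Q s x (w x)" and ?q' = "Q t x (w x)"
  have \<eta>: "0 \<le> \<eta>" and cl: "\<bar>J s x - J t x\<bar> \<le> \<eta>" "norm (?e - ?f) \<le> \<eta> * ?r" "norm (?p - ?q) \<le> \<eta> * ?a" "norm (?p' - ?q') \<le> \<eta> * ?b"
    using c x unfolding close_def by auto
  note cs = order_trans[OF Cauchy_Schwarz_ineq2] and mv = order_trans[OF norm_matrix_vector_le]
  have "iB s u v G w x - iB t u v G w x = (J s x - J t x) * ((?e *v ?p) \<bullet> ?p') + J t x * (((?e - ?f) *v ?p) \<bullet> ?p')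
     + J t x * ((?f *v (?p - ?q)) \<bullet> ?p') + J t x * ((?f *v ?q) \<bullet> (?p' - ?q'))"
    unfolding iB_def by (simp add: algebra_simps inner_diff_left inner_diff_right matrix_vector_mult_diff_distrib matrix_vector_mult_diff_rdistrib)
  moreover have "\<bar>(J s x - J t x) * ((?e *v ?p) \<bullet> ?p')\<bar> \<le> \<eta> * (((M * ?r) * (M * ?a)) * (M * ?b))"
    unfolding abs_mult by (intro mult_mono cl cs mv bE bQ st x) (use M1 \<eta> in \<open>auto intro!: mult_nonneg_nonneg\<close>)
  moreover have "\<bar>J t x * (((?e - ?f) *v ?p) \<bullet> ?p')\<bar> \<le> M * (((\<eta> * ?r) * (M * ?a)) * (M * ?b))"
    unfolding abs_mult by (intro mult_mono bJ cl cs mv bE bQ st x) (use M1 \<eta> in \<open>auto intro!: mult_nonneg_nonneg\<close>)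
  moreover have "\<bar>J t x * ((?f *v (?p - ?q)) \<bullet> ?p')\<bar> \<le> M * (((M * ?r) * (\<eta> * ?a)) * (M * ?b))"
    unfolding abs_mult by (intro mult_mono bJ cl cs mv bE bQ st x) (use M1 \<eta> in \<open>auto intro!: mult_nonneg_nonneg\<close>)
  moreover have "\<bar>J t x * ((?f *v ?q) \<bullet> (?p' - ?q'))\<bar> \<le> M * (((M * ?r) * (M * ?a)) * (\<eta> * ?b))"
    unfolding abs_mult by (intro mult_mono bJ cl cs mv bE bQ st x) (use M1 \<eta> in \<open>auto intro!: mult_nonneg_nonneg\<close>)
  ultimately have "\<bar>iB s u v G w x - iB t u v G w x\<bar> \<le> \<eta> * (((M * ?r) * (M * ?a)) * (M * ?b)) + M * (((\<eta> * ?r) * (M * ?a)) * (M * ?b))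
     + M * (((M * ?r) * (\<eta> * ?a)) * (M * ?b)) + M * (((M * ?r) * (M * ?a)) * (\<eta> * ?b))"
    by linarith
  then show ?thesis by (simp add: power3_eq_cube algebra_simps)
qed

lemma A_bounds:
  assumes t: "t \<in> P" and f: "fld N v G" "fld N w H"
  shows "integrable N (iA t v G w H)" "\<bar>A t v G w H\<bar> \<le> M ^ 3 * (nrm2 N v G * nrm2 N w H)"
  unfolding A_def using bilinear_bound[OF f miA[OF t f] iA_le[OF t]] M1 by auto

lemma B_bounds:
  assumes t: "t \<in> P" and f: "fld N u U" "fld N v G" "fld N w H"
  shows "integrable N (iB t u v G w)" "\<bar>B t u v G w\<bar> \<le> M ^ 4 * (nrm2 N v G * (nrm4 N u * nrm4 N w))"
  unfolding B_def using trilinear_bound[OF f(2,1,3) miB[OF t f] iB_le[OF t]] M1 by auto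

lemma A_close:
  assumes st: "s \<in> P" "t \<in> P" and c: "close s t \<eta>" and f: "fld N v G" "fld N w H"
  shows "\<bar>A s v G w H - A t v G w H\<bar> \<le> (3 * M\<^sup>2 * \<eta>) * (nrm2 N v G * nrm2 N w H)"
proof -
  have \<eta>: "0 \<le> \<eta>" using c by (simp add: close_def)
  have "A s v G w H - A t v G w H = (\<integral>x. iA s v G w H x - iA t v G w H x \<partial>N)"
    unfolding A_def using A_bounds(1)[OF _ f] st by simp
  moreover have "\<bar>\<integral>x. iA s v G w H x - iA t v G w H x \<partial>N\<bar> \<le> (3 * M\<^sup>2 * \<eta>) * (nrm2 N v G * nrm2 N w H)"
  proof (rule bilinear_bound(2)[OF f])
    show "(\<lambda>x. iA s v G w H x - iA t v G w H x) \<in> borel_measurable N"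
      by (rule borel_measurable_diff[OF miA[OF st(1) f] miA[OF st(2) f]])
  qed (use iA_close[OF st c] \<eta> in auto)
  ultimately show ?thesis by simp
qed

lemma B_close:
  assumes st: "s \<in> P" "t \<in> P" and c: "close s t \<eta>" and f: "fld N u U" "fld N v G" "fld N w H"
  shows "\<bar>B s u v G w - B t u v G w\<bar> \<le> (4 * M ^ 3 * \<eta>) * (nrm2 N v G * (nrm4 N u * nrm4 N w))"
proof -
  have \<eta>: "0 \<le> \<eta>" using c by (simp add: close_def)
  have "B s u v G w - B t u v G w = (\<integral>x. iB s u v G w x - iB t u v G w x \<partial>N)"
    unfolding B_def using B_bounds(1)[OF _ f] st by simp
  moreover have "\<bar>\<integral>x. iB s u v G w x - iB t u v G w x \<partial>N\<bar> \<le> (4 * M ^ 3 * \<eta>) * (nrm2 N v G * (nrm4 N u * nrm4 N w))"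
  proof (rule trilinear_bound(2)[OF f(2,1,3)])
    show "(\<lambda>x. iB s u v G w x - iB t u v G w x) \<in> borel_measurable N"
      by (rule borel_measurable_diff[OF miB[OF st(1) f] miB[OF st(2) f]])
  qed (use iB_close[OF st c] \<eta> M1 in auto)
  ultimately show ?thesis by simp
qed

lemma A_add_left:
  assumes "t \<in> P" "fld N v G" "fld N v' G'" "fld N w H"
  shows "A t (\<lambda>x. v x + v' x) (\<lambda>x. G x + G' x) w H = A t v G w H + A t v' G' w H"
  unfolding A_def using A_bounds(1)[OF assms(1,2,4)] A_bounds(1)[OF assms(1,3,4)]
  by (simp add: iA_def[abs_def] E_add inner_add_left distrib_left)

lemma B_add_1:
  assumes "t \<in> P" "fld N u U" "fld N u' U'" "fld N v G" "fld N w H"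
  shows "B t (\<lambda>x. u x + u' x) v G w = B t u v G w + B t u' v G w"
  unfolding B_def using B_bounds(1)[OF assms(1,2,4,5)] B_bounds(1)[OF assms(1,3,4,5)]
  by (simp add: iB_def[abs_def] Q_add inner_add_left distrib_left matrix_vector_right_distrib)

lemma B_add_2:
  assumes "t \<in> P" "fld N u U" "fld N v G" "fld N v' G'" "fld N w H"
  shows "B t u (\<lambda>x. v x + v' x) (\<lambda>x. G x + G' x) w = B t u v G w + B t u v' G' w"
  unfolding B_def using B_bounds(1)[OF assms(1,2,3,5)] B_bounds(1)[OF assms(1,2,4,5)]
  by (simp add: iB_def[abs_def] E_add inner_add_left distrib_left matrix_vector_mult_add_rdistrib)

text \<open>The energy estimate for the difference \<open>w\<close> of the transported solutions
  \<open>v + w\<close> at \<open>s\<close> and \<open>v\<close> at \<open>t\<close>, both equations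
  being tested with \<open>w\<close>. By the skew-symmetry \<open>3\<close> the term in which
  \<open>w\<close> is transported drops out; the term that is quadratic in \<open>w\<close> and
  linear in \<open>v\<close> is absorbed since \<open>\<theta> < 1\<close>. Everything else is a
  difference of a form at \<open>s\<close> and the same form at \<open>t\<close>, hence of order
  \<open>\<eta>\<close>.\<close>

lemma stability:
  assumes st: "s \<in> P" "t \<in> P" and c: "close s t \<eta>" and v: "fld N v G" and w: "fld N w W"
    and 1: "A s (\<lambda>x. v x + w x) (\<lambda>x. G x + W x) w W + B s (\<lambda>x. v x + w x) (\<lambda>x. v x + w x) (\<lambda>x. G x + W x) w = 0"
    and 2: "A t v G w W + B t v v G w = 0" and 3: "B s (\<lambda>x. v x + w x) w W w = 0"
    and fs: "fld N (\<lambda>x. v x + w x) (\<lambda>x. G x + W x)"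
    and 4: "\<bar>B t w v G w\<bar> \<le> \<theta> * X\<^sup>2" and X: "A t w W w W = X\<^sup>2" "0 \<le> X" and \<theta>: "\<theta> < 1"
    and 5: "nrm2 N w W \<le> C * X" "nrm4 N w \<le> C * X" and C: "0 \<le> C"
  shows "(1 - \<theta>) * X\<^sup>2 \<le> \<eta> * ((3 * M\<^sup>2 * nrm2 N v G * C + 4 * M ^ 3 * nrm2 N v G * nrm4 N v * C) * X
     + (3 * M\<^sup>2 * C\<^sup>2 + 4 * M ^ 3 * nrm2 N v G * C\<^sup>2) * X\<^sup>2)"
proof -
  have \<eta>: "0 \<le> \<eta>" using c by (simp add: close_def)
  have M0: "0 \<le> M" using M1 by simp
  \<comment> \<open>Expansion of the equation at \<open>s\<close> after removing
    \<open>B s (v + w) w w\<close>; the convection terms left are those that differentiate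
    \<open>v\<close>.\<close>
  have s1: "A s v G w W + A s w W w W + B s v v G w + B s w v G w = 0"
    using 1 3 A_add_left[OF st(1) v w w] B_add_2[OF st(1) fs v w w] B_add_1[OF st(1) v w v w] by simp
  have "A t w W w W + B t w v G w = - (A s v G w W - A t v G w W) - (A s w W w W - A t w W w W) - (B s v v G w - B t v v G w) - (B s w v G w - B t w v G w)"
    using s1 2 by simp
  then have "X\<^sup>2 \<le> \<theta> * X\<^sup>2 + \<bar>A s v G w W - A t v G w W\<bar> + \<bar>A s w W w W - A t w W w W\<bar> + \<bar>B s v v G w - B t v v G w\<bar> + \<bar>B s w v G w - B t w v G w\<bar>"
    using 4 X(1) by linarith
  moreover have "\<bar>A s v G w W - A t v G w W\<bar> \<le> (3 * M\<^sup>2 * \<eta>) * (nrm2 N v G * (C * X))"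
    by (intro order_trans[OF A_close[OF st c v w]] mult_left_mono 5 nrm_nonneg) (use \<eta> M0 in auto)
  moreover have "\<bar>A s w W w W - A t w W w W\<bar> \<le> (3 * M\<^sup>2 * \<eta>) * ((C * X) * (C * X))"
    by (intro order_trans[OF A_close[OF st c w w]] mult_left_mono mult_mono 5 nrm_nonneg) (use \<eta> M0 C X in auto)
  moreover have "\<bar>B s v v G w - B t v v G w\<bar> \<le> (4 * M ^ 3 * \<eta>) * (nrm2 N v G * (nrm4 N v * (C * X)))"
    by (intro order_trans[OF B_close[OF st c v v w]] mult_left_mono 5 nrm_nonneg) (use \<eta> M0 in auto)
  moreover have "\<bar>B s w v G w - B t w v G w\<bar> \<le> (4 * M ^ 3 * \<eta>) * (nrm2 N v G * ((C * X) * (C * X)))"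
    by (intro order_trans[OF B_close[OF st c w v w]] mult_left_mono mult_mono 5 nrm_nonneg) (use \<eta> M0 C X in auto)
  ultimately have "X\<^sup>2 \<le> \<theta> * X\<^sup>2 + (3 * M\<^sup>2 * \<eta>) * (nrm2 N v G * (C * X)) + (3 * M\<^sup>2 * \<eta>) * ((C * X) * (C * X))
    + (4 * M ^ 3 * \<eta>) * (nrm2 N v G * (nrm4 N v * (C * X))) + (4 * M ^ 3 * \<eta>) * (nrm2 N v G * ((C * X) * (C * X)))"
    by linarith
  then show ?thesis by (simp add: algebra_simps power2_eq_square)
qed

text \<open>The functional at \<open>v + w\<close> is expanded by multilinearity. Terms free of
  \<open>w\<close> differ by the closeness of the forms, and terms containing \<open>w\<close> are
  small through the bound \<open>D\<close> on its norms.\<close>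

lemma functional_close:
  assumes st: "s \<in> P" "t \<in> P" and c: "close s t \<eta>" and v: "fld N v G" and w: "fld N w W" and z: "fld N z Z"
    and fs: "fld N (\<lambda>x. v x + w x) (\<lambda>x. G x + W x)"
    and 5: "nrm2 N w W \<le> D" "nrm4 N w \<le> D"
  shows "\<bar>(A s (\<lambda>x. v x + w x) (\<lambda>x. G x + W x) z Z + B s (\<lambda>x. v x + w x) (\<lambda>x. v x + w x) (\<lambda>x. G x + W x) z) - (A t v G z Z + B t v v G z)\<bar>
    \<le> (3 * M\<^sup>2 * \<eta>) * (nrm2 N v G * nrm2 N z Z) + M ^ 3 * (D * nrm2 N z Z)
      + (4 * M ^ 3 * \<eta>) * (nrm2 N v G * (nrm4 N v * nrm4 N z)) + M ^ 4 * (nrm2 N v G * (D * nrm4 N z))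
      + M ^ 4 * (D * (nrm4 N v * nrm4 N z)) + M ^ 4 * (D * (D * nrm4 N z))"
proof -
  have \<eta>: "0 \<le> \<eta>" using c by (simp add: close_def)
  have M0: "0 \<le> M" using M1 by simp
  have D: "0 \<le> D" using 5 nrm_nonneg order_trans by blast
  have e1: "A s (\<lambda>x. v x + w x) (\<lambda>x. G x + W x) z Z = A s v G z Z + A s w W z Z"
    by (rule A_add_left[OF st(1) v w z])
  have e2: "B s (\<lambda>x. v x + w x) (\<lambda>x. v x + w x) (\<lambda>x. G x + W x) z = B s v v G z + B s w v G z + B s v w W z + B s w w W z"
    using B_add_2[OF st(1) fs v w z] B_add_1[OF st(1) v w v z] B_add_1[OF st(1) v w w z] by simp
  have c1: "\<bar>A s v G z Z - A t v G z Z\<bar> \<le> (3 * M\<^sup>2 * \<eta>) * (nrm2 N v G * nrm2 N z Z)" by (rule A_close[OF st c v z])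
  have c2: "\<bar>A s w W z Z\<bar> \<le> M ^ 3 * (D * nrm2 N z Z)"
    by (intro order_trans[OF A_bounds(2)[OF st(1) w z]] mult_left_mono mult_right_mono 5 nrm_nonneg) (use M0 in auto)
  have c3: "\<bar>B s v v G z - B t v v G z\<bar> \<le> (4 * M ^ 3 * \<eta>) * (nrm2 N v G * (nrm4 N v * nrm4 N z))" by (rule B_close[OF st c v v z])
  have c4: "\<bar>B s w v G z\<bar> \<le> M ^ 4 * (nrm2 N v G * (D * nrm4 N z))"
    by (intro order_trans[OF B_bounds(2)[OF st(1) w v z]] mult_left_mono mult_right_mono 5 nrm_nonneg) (use M0 in auto)
  have c5: "\<bar>B s v w W z\<bar> \<le> M ^ 4 * (D * (nrm4 N v * nrm4 N z))"
    by (intro order_trans[OF B_bounds(2)[OF st(1) v w z]] mult_left_mono mult_right_mono 5 mult_nonneg_nonneg nrm_nonneg) (use M0 in auto)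
  have c6: "\<bar>B s w w W z\<bar> \<le> M ^ 4 * (D * (D * nrm4 N z))"
    by (intro order_trans[OF B_bounds(2)[OF st(1) w w z]] mult_left_mono mult_mono mult_right_mono 5 mult_nonneg_nonneg nrm_nonneg) (use M0 D in auto)
  have sum: "\<bar>(x1 + x2) - (y1 + y2)\<bar> \<le> k1 + k2 + k3 + k4 + k5 + k6"
    if "x1 = r1 + r2" "x2 = s1 + s2 + s3 + s4" "\<bar>r1 - y1\<bar> \<le> k1" "\<bar>r2\<bar> \<le> k2" "\<bar>s1 - y2\<bar> \<le> k3" "\<bar>s2\<bar> \<le> k4" "\<bar>s3\<bar> \<le> k5" "\<bar>s4\<bar> \<le> k6"
    for x1 x2 y1 y2 k1 k2 k3 k4 k5 k6 r1 r2 s1 s2 s3 s4 :: real using that by linarith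
  show ?thesis by (rule sum[OF e1 e2 c1 c2 c3 c4 c5 c6])
qed

end

section \<open>The family of parallelograms\<close>

text \<open>Homogeneity in the last variable reduces both claims to the unit sphere, where
  compactness of the set of parameters, points and directions gives a bound and uniform
  continuity.\<close>

lemma uniform_linear_family:
  fixes F :: "real \<Rightarrow> 'x::euclidean_space \<Rightarrow> 'z::euclidean_space \<Rightarrow> 'w::real_normed_vector"
  assumes X: "compact X" and c: "continuous_on ({0..1} \<times> X \<times> sphere 0 1) (\<lambda>(t, x, z). F t x z)"
    and hom: "\<And>t x r z. F t x (r *\<^sub>R z) = r *\<^sub>R F t x z"
  shows "\<exists>M\<ge>0. \<forall>t\<in>{0..1}. \<forall>x\<in>X. \<forall>z. norm (F t x z) \<le> M * norm z"
    and "t \<in> {0..1} \<Longrightarrow> 0 < \<eta> \<Longrightarrow> \<exists>\<delta>>0. \<forall>s\<in>{0..1}. \<bar>s - t\<bar> < \<delta> \<longrightarrow> (\<forall>x\<in>X. \<forall>z. norm (F s x z - F t x z) \<le> \<eta> * norm z)"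
proof -
  let ?S = "{0..1} \<times> X \<times> sphere 0 1 :: (real \<times> 'x \<times> 'z) set"
  have S: "compact ?S" by (intro compact_Times X) auto
  have unit: "F t x z = norm z *\<^sub>R F t x ((1 / norm z) *\<^sub>R z)" if "z \<noteq> 0" for t x z
    using that by (simp add: hom)
  have F0: "F t x 0 = 0" for t x using hom[of t x 0 0] by simp
  have sph: "(1 / norm z) *\<^sub>R z \<in> sphere 0 1" if "z \<noteq> 0" for z :: 'z using that by simp
  have "bounded ((\<lambda>(t, x, z). F t x z) ` ?S)"
    using compact_continuous_image[OF c S] compact_imp_bounded by blast
  then obtain M where M: "\<And>y. y \<in> (\<lambda>(t, x, z). F t x z) ` ?S \<Longrightarrow> norm y \<le> M" unfolding bounded_iff by blast
  show "\<exists>M\<ge>0. \<forall>t\<in>{0..1}. \<forall>x\<in>X. \<forall>z. norm (F t x z) \<le> M * norm z"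
  proof (intro exI[of _ "\<bar>M\<bar>"] conjI ballI allI)
    fix t x z assume tx: "t \<in> {0..1::real}" "x \<in> X"
    show "norm (F t x z) \<le> \<bar>M\<bar> * norm z"
    proof (cases "z = 0")
      case False
      have "norm (F t x ((1 / norm z) *\<^sub>R z)) \<le> M"
        by (rule M) (use tx sph[OF False] in force)
      then have "norm z * norm (F t x ((1 / norm z) *\<^sub>R z)) \<le> norm z * \<bar>M\<bar>" by (intro mult_left_mono) auto
      then show ?thesis using unit[OF False, of t x] by (metis abs_norm_cancel mult.commute norm_scaleR)
    qed (simp add: F0)
  qed simp
  assume t: "t \<in> {0..1}" and \<eta>: "0 < \<eta>"
  have "uniformly_continuous_on ?S (\<lambda>(t, x, z). F t x z)" by (rule compact_uniformly_continuous[OF c S])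
  then obtain \<delta> where \<delta>: "0 < \<delta>" "\<And>p q. p \<in> ?S \<Longrightarrow> q \<in> ?S \<Longrightarrow> dist q p < \<delta> \<Longrightarrow> dist (case q of (t, x, z) \<Rightarrow> F t x z) (case p of (t, x, z) \<Rightarrow> F t x z) < \<eta>"
    unfolding uniformly_continuous_on_def using \<eta> by metis
  show "\<exists>\<delta>>0. \<forall>s\<in>{0..1}. \<bar>s - t\<bar> < \<delta> \<longrightarrow> (\<forall>x\<in>X. \<forall>z. norm (F s x z - F t x z) \<le> \<eta> * norm z)"
  proof (intro exI[of _ \<delta>] conjI \<delta>(1) ballI impI allI)
    fix s x z assume s: "s \<in> {0..1::real}" "\<bar>s - t\<bar> < \<delta>" and x: "x \<in> X"
    show "norm (F s x z - F t x z) \<le> \<eta> * norm z"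
    proof (cases "z = 0")
      case False
      let ?z = "(1 / norm z) *\<^sub>R z"
      have "dist (s, x, ?z) (t, x, ?z) = \<bar>s - t\<bar>" by (simp add: dist_Pair_Pair dist_real_def)
      then have "dist (F s x ?z) (F t x ?z) < \<eta>"
        using \<delta>(2)[of "(t, x, ?z)" "(s, x, ?z)"] s t x sph[OF False] by simp
      then have "norm z * norm (F s x ?z - F t x ?z) \<le> norm z * \<eta>" by (intro mult_left_mono) (auto simp: dist_norm)
      moreover have "F s x z - F t x z = norm z *\<^sub>R (F s x ?z - F t x ?z)"
        using unit[OF False, of s x] unit[OF False, of t x] by (simp add: scaleR_diff_right)
      ultimately show ?thesis by (simp add: mult.commute)
    qed (simp add: F0)
  qed
qed

text \<open>The function attains a positive minimum on the compact product of \<open>X\<close> with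
  the unit sphere; homogeneity does the rest.\<close>

lemma positive_linear:
  fixes F :: "'x::euclidean_space \<Rightarrow> 'z::euclidean_space \<Rightarrow> real"
  assumes X: "compact X" and c: "continuous_on (X \<times> sphere 0 1) (\<lambda>(x, z). F x z)"
    and hom: "\<And>x r z. F x (r *\<^sub>R z) = \<bar>r\<bar> * F x z" and pos: "\<And>x z. x \<in> X \<Longrightarrow> z \<noteq> 0 \<Longrightarrow> 0 < F x z"
  shows "\<exists>C>0. \<forall>x\<in>X. \<forall>z. norm z \<le> C * F x z"
proof (cases "X = {}")
  case False
  let ?S = "X \<times> sphere 0 1 :: ('x \<times> 'z) set"
  obtain i :: 'z where i: "i \<in> Basis" using nonempty_Basis by blast
  then have "?S \<noteq> {}" using False by auto
  then obtain p where p: "p \<in> ?S" "\<And>q. q \<in> ?S \<Longrightarrow> (case p of (x, z) \<Rightarrow> F x z) \<le> (case q of (x, z) \<Rightarrow> F x z)"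
    using continuous_attains_inf[OF _ _ c] X by (metis compact_Times compact_sphere)
  define d where "d = (case p of (x, z) \<Rightarrow> F x z)"
  have d: "0 < d"
  proof -
    obtain x z where xz: "p = (x, z)" by (cases p)
    then have "x \<in> X" "z \<noteq> 0" using p(1) by auto
    then show ?thesis using pos xz by (simp add: d_def)
  qed
  have "norm z \<le> (1 / d) * F x z" if x: "x \<in> X" for x z
  proof (cases "z = 0")
    case True
    then show ?thesis using hom[of x 0 0] by simp
  next
    case False
    have "d \<le> F x ((1 / norm z) *\<^sub>R z)" using p(2)[of "(x, (1 / norm z) *\<^sub>R z)"] x False unfolding d_def by simp
    also have "\<dots> = F x z / norm z" by (simp add: hom)
    finally show ?thesis using d False by (simp add: field_simps)
  qed
  then show ?thesis using d by (intro exI[of _ "1/d"]) auto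
qed (auto intro: exI[of _ 1])

lemma reflect_nth: "reflect x $ 1 = x $ 1" "reflect x $ 2 = - x $ 2"
  by (simp_all add: reflect_def)

lemma reflect_reflect: "reflect (reflect x) = x"
  by (simp add: vec_eq_iff forall_2 reflect_nth)

lemma dd_lincomb:
  assumes "smooth f" "smooth g"
  shows "dd (\<lambda>s. e * (r * f s + r' * g s)) = (\<lambda>s. e * (r * dd f s + r' * dd g s))"
proof
  fix s
  have "((\<lambda>s. e * (r * f s + r' * g s)) has_real_derivative e * (r * dd f s + r' * dd g s)) (at s)"
    by (auto intro!: derivative_eq_intros dd_has_derivative assms)
  then show "dd (\<lambda>s. e * (r * f s + r' * g s)) s = e * (r * dd f s + r' * dd g s)"
    by (simp add: dir_deriv_eq[OF has_field_derivative_imp_has_derivative])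
qed

lemma measure_Rect: "a \<le> b \<Longrightarrow> c \<le> d \<Longrightarrow> measure lebesgue (Rect a b c d) = (b - a) * (d - c)"
proof -
  assume "a \<le> b" "c \<le> d"
  moreover have "measure lebesgue (Rect a b c d) = measure lborel (cbox (pt a c) (pt b d))"
    unfolding Rect_cbox by (rule measure_completion) simp
  ultimately show ?thesis by (subst (asm) measure_lborel_cbox) (auto simp: Basis_plane inner_axis inner_diff_left)
qed

text \<open>The rectangle \<open>[c - a, c + a] x [- b, b]\<close> is meant to be \<open>D\<close>,
  and \<open>m\<close> is half the vertical thickness of the bodies. The shifts live between
  \<open>p1\<close>, \<open>q1\<close> and \<open>- h1\<close>, \<open>h1\<close>, where the
  cut-offs fade out. The amplitude \<open>e\<close> is so small that the maps are invertible and, as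
  the midline stays below \<open>e * (a + 1)\<close> in modulus, that the bodies keep within height
  \<open>b\<close>.\<close>

locale family =
  fixes L H c a b m e M p1 q1 h1 :: real and cut1 cut2 :: "real \<Rightarrow> real"
  assumes geo: "0 < a" "- L < p1" "p1 < c - a" "c + a < q1" "q1 < L" "0 < m" "m < b" "b < H" "m < h1" "h1 < H"
    and cuts: "smooth cut1" "smooth cut2"
    and cut1: "\<And>s. c - a \<le> s \<Longrightarrow> s \<le> c + a \<Longrightarrow> cut1 s = 1" "\<And>s. s \<le> p1 \<or> q1 \<le> s \<Longrightarrow> cut1 s = 0"
    and cut2: "\<And>s. - m \<le> s \<Longrightarrow> s \<le> m \<Longrightarrow> cut2 s = 1" "\<And>s. s \<le> - h1 \<or> h1 \<le> s \<Longrightarrow> cut2 s = 0"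
    and e: "0 < e" "e * (a + 1) \<le> b - m"
    and shift: "\<And>t. shift (\<lambda>s. e * (cos (pi * t) * (cut1 s * (s - c)) + sin (pi * t) * cut1 s)) cut2 M"
begin

sublocale holed L H "c - a" "c + a" m
  using geo by unfold_locales auto

definition kf :: "real \<Rightarrow> real \<Rightarrow> real" where
  "kf t s = e * (cos (pi * t) * (cut1 s * (s - c)) + sin (pi * t) * cut1 s)"

text \<open>The midline of the parallelogram, of slope \<open>e * cos (pi * t)\<close> and value
  \<open>e * sin (pi * t)\<close> at the centre; \<open>kf\<close> continues it to a compactly
  supported profile.\<close>

definition hh :: "real \<Rightarrow> real \<Rightarrow> real" where "hh t s = e * (cos (pi * t) * (s - c) + sin (pi * t))"

lemma shift_kf: "shift (kf t) cut2 M"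
  using shift[of t] unfolding kf_def[abs_def] .

abbreviation TT where "TT t \<equiv> shift.T (kf t) cut2"
abbreviation SS where "SS t \<equiv> shift.S (kf t) cut2"

lemma kf_zero: "s \<le> p1 \<or> q1 \<le> s \<Longrightarrow> kf t s = 0"
  using cut1(2) by (simp add: kf_def)

lemma kf_hh: "c - a \<le> s \<Longrightarrow> s \<le> c + a \<Longrightarrow> kf t s = hh t s"
  using cut1(1) by (simp add: kf_def hh_def)

lemma T_outside: "\<not> (p1 < x$1 \<and> x$1 < q1 \<and> - h1 < x$2 \<and> x$2 < h1) \<Longrightarrow> TT t x = x"
proof -
  interpret shift "kf t" cut2 M by (rule shift_kf)
  assume "\<not> (p1 < x$1 \<and> x$1 < q1 \<and> - h1 < x$2 \<and> x$2 < h1)"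
  then have "cut2 (x$2) * kf t (x$1) = 0" using cut2(2) kf_zero by (metis mult_eq_0_iff not_less)
  then have "\<tau> x = x$2" by (simp add: \<tau>_def)
  then show ?thesis using pt_surj[of x] unfolding T_def by metis
qed

definition core :: "plane set" where "core = {x. p1 < x$1 \<and> x$1 < q1 \<and> - h1 < x$2 \<and> x$2 < h1}"

lemma T_core: "x \<in> core \<longleftrightarrow> TT t x \<in> core"
proof -
  interpret shift "kf t" cut2 M by (rule shift_kf)
  show ?thesis
    using T_outside[of x t] T_outside[of "TT t x" t] inj_T[of UNIV] unfolding core_def mem_Collect_eq
    by (metis (no_types, lifting) ST)
qed

lemma core_rect: "core \<subseteq> rect L H"
  using geo by (auto simp: core_def rect_def)

lemma T_rect: "TT t ` rect L H = rect L H"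
proof -
  interpret shift "kf t" cut2 M by (rule shift_kf)
  have 1: "TT t x \<in> rect L H \<longleftrightarrow> x \<in> rect L H" for x
  proof (cases "x \<in> core")
    case True
    then show ?thesis using T_core core_rect by blast
  next
    case False
    then have "TT t x = x" using T_outside by (auto simp: core_def)
    then show ?thesis by simp
  qed
  show ?thesis
  proof
    show "TT t ` rect L H \<subseteq> rect L H" using 1 by auto
    show "rect L H \<subseteq> TT t ` rect L H"
    proof
      fix y assume "y \<in> rect L H"
      then have "SS t y \<in> rect L H" using 1[of "SS t y"] by (simp add: TS)
      then show "y \<in> TT t ` rect L H" using TS[of y] by (metis image_eqI)
    qed
  qed
qed

definition BB :: "real \<Rightarrow> plane set" where "BB t = {x. \<bar>x$1 - c\<bar> \<le> a \<and> \<bar>x$2 - hh t (x$1)\<bar> \<le> m}"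

lemma T_hole: "TT t ` hole = BB t"
proof -
  interpret shift "kf t" cut2 M by (rule shift_kf)
  have T: "TT t x = pt (x$1) (x$2 + hh t (x$1))" if "x \<in> hole" for x
    using that cut2(1) kf_hh[of "x$1" t] by (simp add: T_def \<tau>_def hole_def Rect_def)
  show ?thesis
  proof
    show "TT t ` hole \<subseteq> BB t" using T by (auto simp: BB_def hole_def Rect_def abs_le_iff)
    show "BB t \<subseteq> TT t ` hole"
    proof
      fix y assume y: "y \<in> BB t"
      let ?x = "pt (y$1) (y$2 - hh t (y$1))"
      have "?x \<in> hole" using y by (auto simp: BB_def hole_def Rect_def abs_le_iff)
      moreover have "TT t ?x = y" using T[OF \<open>?x \<in> hole\<close>] pt_surj[of y] by simp
      ultimately show "y \<in> TT t ` hole" by (metis image_eqI)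
    qed
  qed
qed

definition Om :: "real \<Rightarrow> plane set" where "Om t = rect L H - BB t"

abbreviation "NO t \<equiv> lebesgue_on (Om t)"

lemma T_Om: "TT t ` \<Omega> = Om t"
proof -
  interpret shift "kf t" cut2 M by (rule shift_kf)
  show ?thesis unfolding \<Omega>_def Om_def T_hole[symmetric] using T_rect inj_T[of UNIV] by (metis image_set_diff)
qed

lemma bdom_Om: "bdom (Om t)"
proof -
  interpret shift "kf t" cut2 M by (rule shift_kf)
  interpret diffeo_dom "TT t" "SS t" K \<Omega> by unfold_locales
  show ?thesis using img.bdom_axioms unfolding T_Om .
qed

lemma hh_bound: "\<bar>s - c\<bar> \<le> a \<Longrightarrow> \<bar>hh t s\<bar> \<le> b - m"
proof -
  assume s: "\<bar>s - c\<bar> \<le> a"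
  have "\<bar>cos (pi * t) * (s - c)\<bar> \<le> 1 * a" unfolding abs_mult by (intro mult_mono s) auto
  then have "\<bar>cos (pi * t) * (s - c) + sin (pi * t)\<bar> \<le> a + 1" using abs_sin_le_one[of "pi * t"] by linarith
  then have "e * \<bar>cos (pi * t) * (s - c) + sin (pi * t)\<bar> \<le> e * (a + 1)" using e by (intro mult_left_mono) auto
  from order_trans[OF this e(2)] show ?thesis using e(1) by (simp add: hh_def abs_mult)
qed

lemma BB_subset: "BB t \<subseteq> Rect (c - a) (c + a) (- b) b"
proof
  fix x assume "x \<in> BB t"
  then have x: "\<bar>x$1 - c\<bar> \<le> a" "\<bar>x$2 - hh t (x$1)\<bar> \<le> m" by (auto simp: BB_def)
  then show "x \<in> Rect (c - a) (c + a) (- b) b" using hh_bound[OF x(1), of t] by (auto simp: Rect_def abs_le_iff)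
qed

lemma BB_compact: "compact (BB t)"
proof -
  interpret shift "kf t" cut2 M by (rule shift_kf)
  show ?thesis unfolding T_hole[symmetric] hole_def by (intro compact_continuous_image continuous_T compact_Rect)
qed

lemma BB_convex: "convex (BB t)"
proof -
  have "BB t = {x. x$1 \<le> c + a} \<inter> {x. x$1 \<ge> c - a} \<inter>
      {x. x$2 - e * cos (pi * t) * x$1 \<le> m + e * (sin (pi * t) - cos (pi * t) * c)} \<inter>
      {x. x$2 - e * cos (pi * t) * x$1 \<ge> - m + e * (sin (pi * t) - cos (pi * t) * c)}"
    by (auto simp: BB_def hh_def abs_le_iff algebra_simps)
  moreover have "convex {x::plane. x$1 \<le> c + a}" "convex {x::plane. x$1 \<ge> c - a}"
    using convex_halfspace_le[of "axis 1 1 :: plane" "c + a"] convex_halfspace_ge[of "c - a" "axis 1 1 :: plane"]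
    by (simp_all add: inner_axis' )
  moreover have "(\<lambda>x::plane. x$2 - e * cos (pi * t) * x$1) = (\<lambda>x. (pt (- (e * cos (pi * t))) 1) \<bullet> x)"
    by (auto simp: inner_plane)
  then have "{x::plane. x$2 - e * cos (pi * t) * x$1 \<le> r} = {x. (pt (- (e * cos (pi * t))) 1) \<bullet> x \<le> r}"
    "{x::plane. x$2 - e * cos (pi * t) * x$1 \<ge> r} = {x. (pt (- (e * cos (pi * t))) 1) \<bullet> x \<ge> r}" for r
    by (auto simp: fun_eq_iff)
  ultimately show ?thesis by (simp only:) (intro convex_Int convex_halfspace_le convex_halfspace_ge; assumption)
qed

lemma measure_hole: "measure lebesgue hole = 4 * a * m"
  unfolding hole_def by (subst measure_Rect) (use geo in auto)

text \<open>Shearing preserves area: on the hole the shift has Jacobian one, because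
  \<open>cut2\<close> is constant near every point with \<open>- m < x2 < m\<close>. The two
  horizontal edges form a null set.\<close>

lemma measure_BB: "measure lebesgue (BB t) = 4 * a * m"
proof -
  interpret shift "kf t" cut2 M by (rule shift_kf)
  have hs: "hole \<in> sets lebesgue" by (simp add: hole_def)
  have Bs: "BB t \<in> sets lebesgue" using BB_compact lmeasurable_compact by blast
  have meas: "measure lebesgue A = (LINT x:A|lebesgue. 1)" if "A \<in> sets lebesgue" for A :: "plane set"
    using that by (simp add: set_lebesgue_integral_def)
  have "AE x in lborel. (x::plane) $ 2 \<noteq> m \<and> x $ 2 \<noteq> - m" by (intro AE_conjI AE_coordinate)
  then have ae: "AE x in lebesgue. (x::plane) $ 2 \<noteq> m \<and> x $ 2 \<noteq> - m" by (rule AE_completion)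
  have "(LINT x:BB t|lebesgue. 1) = (LINT x:hole|lebesgue. jac x * 1)"
    unfolding T_hole[symmetric] by (rule change_of_variables(2)[OF hs])
  also have "\<dots> = (LINT x:hole|lebesgue. 1)"
    unfolding set_lebesgue_integral_def
  proof (rule integral_cong_AE)
    show "AE x in lebesgue. indicator hole x *\<^sub>R (jac x * 1) = indicator hole x *\<^sub>R 1"
      using ae
    proof eventually_elim
      case (elim x)
      have "jac x = 1" if "x \<in> hole"
      proof -
        have "- m < x$2" "x$2 < m" using that elim by (auto simp: hole_def Rect_def)
        then have "dd cut2 (x$2) = dd (\<lambda>_. 1) (x$2)"
          by (intro smooth_locally_eq[OF cuts(2) smooth_const, of "{-m<..<m}"]) (auto simp: cut2(1))
        then show ?thesis by (simp add: jac_eq J_def dir_deriv_const)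
      qed
      then show ?case by (simp add: indicator_def)
    qed
    show "(\<lambda>x. indicator hole x *\<^sub>R (jac x * 1)) \<in> borel_measurable lebesgue"
      using hs jac_continuous by (intro borel_measurable_scaleR borel_measurable_times borel_imp_lebesgue borel_measurable_indicator borel_measurable_continuous_onI borel_measurable_const) (simp_all add: hole_def)
  qed (use hs in \<open>auto\<close>)
  finally show ?thesis using meas[OF hs] meas[OF Bs] measure_hole by simp
qed

text \<open>Symmetry would force the midline to vanish identically. Its value at the centre is a
  multiple of the sine and its slope a multiple of the cosine, which have no common zero.\<close>

lemma BB_nonsymmetric: "\<not> x1_symmetric (BB t)"
proof
  assume "x1_symmetric (BB t)"
  then have sym: "reflect ` BB t = BB t" by (simp add: x1_symmetric_def)
  have "hh t s = 0" if s: "\<bar>s - c\<bar> \<le> a" for s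
  proof -
    have "pt s (hh t s + m) \<in> BB t" "pt s (hh t s - m) \<in> BB t" using s geo by (auto simp: BB_def)
    then have "reflect (pt s (hh t s + m)) \<in> BB t" "reflect (pt s (hh t s - m)) \<in> BB t" using sym by blast+
    then show ?thesis using geo by (simp add: BB_def reflect_nth)
  qed
  from this[of c] this[of "c + a"] have "sin (pi * t) = 0" "cos (pi * t) = 0" using geo e by (auto simp: hh_def)
  then show False using sin_zero_abs_cos_one by fastforce
qed

lemma reflect_BB: "reflect ` BB 0 = BB 1"
proof -
  have h: "hh 1 s = - hh 0 s" for s by (simp add: hh_def algebra_simps)
  show ?thesis
  proof
    show "reflect ` BB 0 \<subseteq> BB 1" by (auto simp: BB_def reflect_nth h abs_le_iff)
    show "BB 1 \<subseteq> reflect ` BB 0"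
    proof
      fix y assume "y \<in> BB 1"
      then have "reflect y \<in> BB 0" by (auto simp: BB_def reflect_nth h abs_le_iff)
      then show "y \<in> reflect ` BB 0" by (metis image_eqI reflect_reflect)
    qed
  qed
qed

section \<open>Coefficients of the transported forms and their dependence on the parameter\<close>

definition Jf where "Jf t = shift.J (kf t) cut2"
definition Ef where "Ef t = shift.Emat (kf t) cut2"
definition Qf where "Qf t x v = shift.Nmat (kf t) cut2 x *v v"

definition kap1 :: "real \<Rightarrow> real" where "kap1 s = cut1 s * (s - c)"

lemma smooth_kap1: "smooth kap1"
  unfolding kap1_def[abs_def] by (intro smooth_mult cuts smooth_diff smooth_ident smooth_const)

text \<open>The parameter enters only through the coefficients cosine and sine of two fixed smooth
  functions. Hence the profile and its derivatives are jointly continuous in parameter and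
  position.\<close>

lemma kf_eq: "kf t = (\<lambda>s. e * (cos (pi * t) * kap1 s + sin (pi * t) * cut1 s))"
  "dd (kf t) = (\<lambda>s. e * (cos (pi * t) * dd kap1 s + sin (pi * t) * dd cut1 s))"
  "dd (dd (kf t)) = (\<lambda>s. e * (cos (pi * t) * dd (dd kap1) s + sin (pi * t) * dd (dd cut1) s))"
proof -
  show 1: "kf t = (\<lambda>s. e * (cos (pi * t) * kap1 s + sin (pi * t) * cut1 s))" by (simp add: kf_def[abs_def] kap1_def)
  show 2: "dd (kf t) = (\<lambda>s. e * (cos (pi * t) * dd kap1 s + sin (pi * t) * dd cut1 s))"
    unfolding 1 by (rule dd_lincomb[OF smooth_kap1 cuts(1)])
  show "dd (dd (kf t)) = (\<lambda>s. e * (cos (pi * t) * dd (dd kap1) s + sin (pi * t) * dd (dd cut1) s))"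
    unfolding 2 by (rule dd_lincomb[OF smooth_dd[OF smooth_kap1] smooth_dd[OF cuts(1)]])
qed

lemma continuous_on_kf:
  fixes f :: "'d::t2_space \<Rightarrow> real" and g :: "'d \<Rightarrow> real"
  assumes "continuous_on D f" "continuous_on D g"
  shows "continuous_on D (\<lambda>d. kf (f d) (g d))" "continuous_on D (\<lambda>d. dd (kf (f d)) (g d))" "continuous_on D (\<lambda>d. dd (dd (kf (f d))) (g d))"
proof -
  have c: "continuous_on D (\<lambda>d. h (g d))" if "smooth h" for h :: "real \<Rightarrow> real"
    by (rule continuous_on_compose2[OF smooth_continuous_on[OF that, of UNIV] assms(2)]) auto
  show "continuous_on D (\<lambda>d. kf (f d) (g d))" "continuous_on D (\<lambda>d. dd (kf (f d)) (g d))" "continuous_on D (\<lambda>d. dd (dd (kf (f d))) (g d))"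
    by (subst kf_eq, intro continuous_intros assms c smooth_dd smooth_kap1 cuts)+
qed

lemma continuous_on_cut2:
  fixes g :: "'d::t2_space \<Rightarrow> real"
  assumes "continuous_on D g"
  shows "continuous_on D (\<lambda>d. cut2 (g d))" "continuous_on D (\<lambda>d. dd cut2 (g d))" "continuous_on D (\<lambda>d. dd (dd cut2) (g d))"
  by (rule continuous_on_compose2[OF smooth_continuous_on[of _ UNIV] assms]; auto intro!: cuts smooth_dd)+

lemma continuous_on_forms:
  fixes t :: "'d::t2_space \<Rightarrow> real" and x v :: "'d \<Rightarrow> plane" and G :: "'d \<Rightarrow> mat2"
  assumes t: "continuous_on D t" and x: "continuous_on D x" and v: "continuous_on D v" and G: "continuous_on D G"
  shows "continuous_on D (\<lambda>d. Jf (t d) (x d))" "continuous_on D (\<lambda>d. Ef (t d) (x d) (v d) (G d))" "continuous_on D (\<lambda>d. Qf (t d) (x d) (v d))"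
proof -
  have x1: "continuous_on D (\<lambda>d. x d $ i)" and v1: "continuous_on D (\<lambda>d. v d $ i)" and G1: "continuous_on D (\<lambda>d. G d $ i $ j)" for i j
    by (intro continuous_intros x v G)+
  have J: "Jf s y = 1 + dd cut2 (y$2) * kf s (y$1)" for s y
    unfolding Jf_def shift.J_def[OF shift_kf] ..
  have Jn: "Jf s y \<noteq> 0" for s y unfolding Jf_def by (rule shift.J_ge(3)[OF shift_kf])
  show cJ: "continuous_on D (\<lambda>d. Jf (t d) (x d))"
    unfolding J by (intro continuous_intros continuous_on_kf continuous_on_cut2 t x1)
  have J0: "\<forall>d\<in>D. Jf (t d) (x d) \<noteq> 0" "\<forall>d\<in>D. (Jf (t d) (x d))\<^sup>2 \<noteq> 0" using Jn by auto
  have cJ2: "continuous_on D (\<lambda>d. (Jf (t d) (x d))\<^sup>2)" by (rule continuous_on_power[OF cJ])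
  note base = continuous_on_kf[OF t x1] continuous_on_cut2[OF x1] v1 G1 cJ cJ2 J0 continuous_on_const[of D "1::real"]
  show "continuous_on D (\<lambda>d. Ef (t d) (x d) (v d) (G d))"
    unfolding Ef_def shift.Emat_formula[OF shift_kf] shift.Eformula_def[OF shift_kf] Let_def Jf_def[symmetric]
    by (intro continuous_on_vec_lambda, rename_tac i l, (case_tac "i = 1"; case_tac "l = 1"; simp only: simp_thms if_True if_False),
      (intro base continuous_on_add continuous_on_diff continuous_on_mult continuous_on_divide continuous_on_minus)+)
  have Q: "Qf s y w = (\<chi> i. if i = 1 then 1 / Jf s y * w$1 else cut2 (y$2) * dd (kf s) (y$1) / Jf s y * w$1 + w$2)" for s y w
    unfolding Qf_def shift.Nmat_def[OF shift_kf] Jf_def shift.\<tau>1_def[OF shift_kf]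
    by (simp add: matrix_vector_mult_def vec_eq_iff forall_2 sum_2)
  show "continuous_on D (\<lambda>d. Qf (t d) (x d) (v d))"
    unfolding Q
    by (intro continuous_on_vec_lambda, rename_tac i, (case_tac "i = 1"; simp only: simp_thms if_True if_False),
      (intro base continuous_on_add continuous_on_diff continuous_on_mult continuous_on_divide continuous_on_minus)+)
qed

end

text \<open>The weak formulation without its pressure term, which is the entire formulation once the
  test fields are solenoidal.\<close>

definition aform :: "plane set \<Rightarrow> (plane \<Rightarrow> plane) \<Rightarrow> (plane \<Rightarrow> plane) \<Rightarrow> real" where
  "aform \<Omega> u w = (LINT x:\<Omega>|lebesgue. wgrad \<Omega> u x \<bullet> wgrad \<Omega> w x) + (LINT x:\<Omega>|lebesgue. convection \<Omega> u x \<bullet> w x)"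

lemma (in bdom) aform_AE:
  assumes u: "AE x in NN. wgrad \<Omega> u x = U x" and w: "AE x in NN. wgrad \<Omega> w x = W x"
    and m: "(\<lambda>x. U x \<bullet> W x) \<in> borel_measurable NN" "(\<lambda>x. (U x *v u x) \<bullet> w x) \<in> borel_measurable NN"
  shows "aform \<Omega> u w = (\<integral>x. U x \<bullet> W x \<partial>NN) + (\<integral>x. (U x *v u x) \<bullet> w x \<partial>NN)"
proof -
  have "AE x in NN. wgrad \<Omega> u x \<bullet> wgrad \<Omega> w x = U x \<bullet> W x" "AE x in NN. convection \<Omega> u x \<bullet> w x = (U x *v u x) \<bullet> w x"
    using u w by (eventually_elim, simp add: convection_def)+
  then show ?thesis unfolding aform_def by (simp only: integral_dom_AE(2) m)
qed

lemma (in holed) vtrace_fld: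
  assumes v: "vtrace \<Omega> v G g" shows "fld NN v G"
proof -
  have s: "strace \<Omega> (\<lambda>x. v x $ i) (\<lambda>j x. G x $ i $ j) (\<lambda>x. g x $ i)" for i using v by (simp add: vtrace_def)
  have L: "L2m NN (\<lambda>x. v x $ i)" "L2m NN (\<lambda>x. G x $ i $ j)" for i j
    using strace_L2m[OF s] by auto
  have m [measurable]: "v \<in> borel_measurable NN" "G \<in> borel_measurable NN"
    using L by (auto simp: measurable_plane_iff measurable_mat_iff L2m_def)
  have n: "(norm (v x, G x))\<^sup>2 = (v x $ 1)\<^sup>2 + (v x $ 2)\<^sup>2 + ((G x $ 1 $ 1)\<^sup>2 + (G x $ 1 $ 2)\<^sup>2 + (G x $ 2 $ 1)\<^sup>2 + (G x $ 2 $ 2)\<^sup>2)" for x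
    by (simp add: norm_Pair norm_plane norm_mat)
  have "integrable NN (\<lambda>x. (norm (v x, G x))\<^sup>2)"
    unfolding n by (intro Bochner_Integration.integrable_add) (use L in \<open>auto simp: L2m_def\<close>)
  moreover have "L2m NN (\<lambda>x. (norm (v x))\<^sup>2)"
    unfolding norm_plane by (intro L2m_add strace_L4[OF s])
  ultimately show ?thesis using m by (simp add: fld_def L2m_def)
qed

section \<open>Uniform upper bounds, lower bounds and pull-back of the forms\<close>

context family begin

abbreviation "AA \<equiv> forms.A NN Jf Ef"
abbreviation "BF \<equiv> forms.B NN Jf Ef Qf"

lemma Ef_add: "Ef t x (v + v') (G + G') = Ef t x v G + Ef t x v' G'"
proof -
  interpret shift "kf t" cut2 M by (rule shift_kf)
  show ?thesis unfolding Ef_def Emat_def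
    by (simp add: vec_eq_iff forall_2 matrix_matrix_mult_def sum_2 algebra_simps)
qed

lemma Ef_scale: "Ef t x (r *\<^sub>R v) (r *\<^sub>R G) = r *\<^sub>R Ef t x v G"
proof -
  interpret shift "kf t" cut2 M by (rule shift_kf)
  show ?thesis unfolding Ef_def Emat_def
    by (simp add: vec_eq_iff forall_2 matrix_matrix_mult_def sum_2 algebra_simps)
qed

lemma Qf_add: "Qf t x (v + v') = Qf t x v + Qf t x v'"
  by (simp add: Qf_def matrix_vector_right_distrib)

lemma Qf_scale: "Qf t x (r *\<^sub>R v) = r *\<^sub>R Qf t x v"
  by (simp add: Qf_def matrix_vector_mult_scaleR)

lemma compact_closure_Om: "compact (closure \<Omega>)"
  using bounded_dom by (simp add: compact_closure)

lemma Ef_uniform: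
  shows "\<exists>M\<ge>0. \<forall>t\<in>{0..1}. \<forall>x\<in>closure \<Omega>. \<forall>z. norm (Ef t x (fst z) (snd z)) \<le> M * norm z"
    "t \<in> {0..1} \<Longrightarrow> 0 < \<eta> \<Longrightarrow> \<exists>\<delta>>0. \<forall>s\<in>{0..1}. \<bar>s - t\<bar> < \<delta> \<longrightarrow> (\<forall>x\<in>closure \<Omega>. \<forall>z. norm (Ef s x (fst z) (snd z) - Ef t x (fst z) (snd z)) \<le> \<eta> * norm z)"
proof -
  have c: "continuous_on ({0..1} \<times> closure \<Omega> \<times> sphere 0 1) (\<lambda>(t, x, z). Ef t x (fst z) (snd z))"
    by (auto simp: case_prod_unfold intro!: continuous_on_forms continuous_intros)
  have hom: "Ef t x (fst (r *\<^sub>R z)) (snd (r *\<^sub>R z)) = r *\<^sub>R Ef t x (fst z) (snd z)" for t x r z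
    by (simp add: Ef_scale)
  note U = uniform_linear_family[OF compact_closure_Om c hom]
  show "\<exists>M\<ge>0. \<forall>t\<in>{0..1}. \<forall>x\<in>closure \<Omega>. \<forall>z. norm (Ef t x (fst z) (snd z)) \<le> M * norm z" by (rule U(1))
  assume "t \<in> {0..1}" "0 < \<eta>"
  then show "\<exists>\<delta>>0. \<forall>s\<in>{0..1}. \<bar>s - t\<bar> < \<delta> \<longrightarrow> (\<forall>x\<in>closure \<Omega>. \<forall>z. norm (Ef s x (fst z) (snd z) - Ef t x (fst z) (snd z)) \<le> \<eta> * norm z)"
    by (rule U(2))
qed

lemma Qf_uniform:
  shows "\<exists>M\<ge>0. \<forall>t\<in>{0..1}. \<forall>x\<in>closure \<Omega>. \<forall>z. norm (Qf t x z) \<le> M * norm z"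
    "t \<in> {0..1} \<Longrightarrow> 0 < \<eta> \<Longrightarrow> \<exists>\<delta>>0. \<forall>s\<in>{0..1}. \<bar>s - t\<bar> < \<delta> \<longrightarrow> (\<forall>x\<in>closure \<Omega>. \<forall>z. norm (Qf s x z - Qf t x z) \<le> \<eta> * norm z)"
proof -
  have c: "continuous_on ({0..1} \<times> closure \<Omega> \<times> sphere 0 1) (\<lambda>(t, x, z). Qf t x z)"
    by (auto simp: case_prod_unfold intro!: continuous_on_forms continuous_intros)
  note U = uniform_linear_family[OF compact_closure_Om c Qf_scale]
  show "\<exists>M\<ge>0. \<forall>t\<in>{0..1}. \<forall>x\<in>closure \<Omega>. \<forall>z. norm (Qf t x z) \<le> M * norm z" by (rule U(1))
  assume "t \<in> {0..1}" "0 < \<eta>"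
  then show "\<exists>\<delta>>0. \<forall>s\<in>{0..1}. \<bar>s - t\<bar> < \<delta> \<longrightarrow> (\<forall>x\<in>closure \<Omega>. \<forall>z. norm (Qf s x z - Qf t x z) \<le> \<eta> * norm z)"
    by (rule U(2))
qed

lemma Jf_uniform:
  shows "\<exists>M\<ge>0. \<forall>t\<in>{0..1}. \<forall>x\<in>closure \<Omega>. \<bar>Jf t x\<bar> \<le> M"
    "t \<in> {0..1} \<Longrightarrow> 0 < \<eta> \<Longrightarrow> \<exists>\<delta>>0. \<forall>s\<in>{0..1}. \<bar>s - t\<bar> < \<delta> \<longrightarrow> (\<forall>x\<in>closure \<Omega>. \<bar>Jf s x - Jf t x\<bar> \<le> \<eta>)"
proof -
  have c: "continuous_on ({0..1} \<times> closure \<Omega> \<times> sphere 0 1) (\<lambda>(t, x, z::real). z *\<^sub>R Jf t x)"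
    by (auto simp: case_prod_unfold intro!: continuous_on_forms continuous_intros)
  note U = uniform_linear_family[OF compact_closure_Om c]
  obtain M where M: "0 \<le> M" "\<forall>t\<in>{0..1}. \<forall>x\<in>closure \<Omega>. \<forall>z::real. norm (z *\<^sub>R Jf t x) \<le> M * norm z"
    using U(1) by auto
  show "\<exists>M\<ge>0. \<forall>t\<in>{0..1}. \<forall>x\<in>closure \<Omega>. \<bar>Jf t x\<bar> \<le> M"
  proof (intro exI conjI ballI)
    fix t x assume "t \<in> {0..1::real}" "x \<in> closure \<Omega>"
    then have "norm (1 *\<^sub>R Jf t x) \<le> M * norm (1::real)" using M(2) by blast
    then show "\<bar>Jf t x\<bar> \<le> M" by simp
  qed (rule M(1))
  assume t: "t \<in> {0..1}" "0 < \<eta>"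
  obtain \<delta> where \<delta>: "0 < \<delta>" "\<forall>s\<in>{0..1}. \<bar>s - t\<bar> < \<delta> \<longrightarrow> (\<forall>x\<in>closure \<Omega>. \<forall>z::real. norm (z *\<^sub>R Jf s x - z *\<^sub>R Jf t x) \<le> \<eta> * norm z)"
    using U(2)[OF _ t] by auto
  show "\<exists>\<delta>>0. \<forall>s\<in>{0..1}. \<bar>s - t\<bar> < \<delta> \<longrightarrow> (\<forall>x\<in>closure \<Omega>. \<bar>Jf s x - Jf t x\<bar> \<le> \<eta>)"
  proof (intro exI conjI ballI impI)
    fix s x assume "s \<in> {0..1::real}" "\<bar>s - t\<bar> < \<delta>" "x \<in> closure \<Omega>"
    then have "norm (1 *\<^sub>R Jf s x - 1 *\<^sub>R Jf t x) \<le> \<eta> * norm (1::real)" using \<delta>(2) by blast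
    then show "\<bar>Jf s x - Jf t x\<bar> \<le> \<eta>" by simp
  qed (rule \<delta>(1))
qed

lemma measurable_Ef:
  assumes "u \<in> borel_measurable NN" "H' \<in> borel_measurable NN"
  shows "(\<lambda>x. Ef t x (u x) (H' x)) \<in> borel_measurable NN"
proof -
  interpret shift "kf t" cut2 M by (rule shift_kf)
  have "(\<lambda>x. (u x, H' x)) \<in> borel_measurable NN" using assms by simp
  have [measurable]: "(\<lambda>x. u x $ i) \<in> borel_measurable NN" "(\<lambda>x. H' x $ i $ j) \<in> borel_measurable NN" for i j
    using assms by (simp_all add: measurable_plane_iff measurable_mat_iff)
  have [measurable]: "(\<lambda>x. Nmat x $ i $ j) \<in> borel_measurable NN" "(\<lambda>x. Kmat x $ i $ j) \<in> borel_measurable NN"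
    "pd l (\<lambda>y. Nmat y $ i $ j) \<in> borel_measurable NN" for i j l
    by (intro continuous_measurable_dom smooth_continuous_on smooth_Nmat smooth_Kmat smooth_dir_deriv axis_in_Basis)+
  show ?thesis
    unfolding measurable_mat_iff Ef_def Emat_def by (simp add: matrix_matrix_mult_def sum_2)
qed

lemma measurable_Qf:
  assumes "u \<in> borel_measurable NN" shows "(\<lambda>x. Qf t x (u x)) \<in> borel_measurable NN"
proof -
  interpret shift "kf t" cut2 M by (rule shift_kf)
  have [measurable]: "(\<lambda>x. u x $ i) \<in> borel_measurable NN" for i
    using assms by (simp add: measurable_plane_iff)
  have [measurable]: "(\<lambda>x. Nmat x $ i $ j) \<in> borel_measurable NN" for i j
    by (intro continuous_measurable_dom smooth_continuous_on smooth_Nmat)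
  show ?thesis
    unfolding measurable_plane_iff Qf_def by (simp add: matrix_vector_mult_def sum_2)
qed

lemma measurable_Jf: "Jf t \<in> borel_measurable NN"
proof -
  interpret shift "kf t" cut2 M by (rule shift_kf)
  show ?thesis unfolding Jf_def by (intro continuous_measurable_dom smooth_continuous_on smooth_J)
qed

lemma forms_ex: "\<exists>M'. forms NN {0..1} Jf Ef Qf M'"
proof -
  obtain M1 where M1: "0 \<le> M1" "\<forall>t\<in>{0..1}. \<forall>x\<in>closure \<Omega>. \<forall>z. norm (Ef t x (fst z) (snd z)) \<le> M1 * norm z" using Ef_uniform(1) by auto
  obtain M2 where M2: "0 \<le> M2" "\<forall>t\<in>{0..1}. \<forall>x\<in>closure \<Omega>. \<forall>z. norm (Qf t x z) \<le> M2 * norm z" using Qf_uniform(1) by auto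
  obtain M3 where M3: "0 \<le> M3" "\<forall>t\<in>{0..1}. \<forall>x\<in>closure \<Omega>. \<bar>Jf t x\<bar> \<le> M3" using Jf_uniform(1) by auto
  have sp: "x \<in> closure \<Omega>" if "x \<in> space NN" for x using that closure_subset by auto
  have "forms NN {0..1} Jf Ef Qf (1 + M1 + M2 + M3)"
  proof
    fix t x v G assume t: "t \<in> {0..1::real}" "x \<in> space NN"
    show "\<bar>Jf t x\<bar> \<le> 1 + M1 + M2 + M3" using M1(1) M2(1) M3 t sp by fastforce
    have "norm (Ef t x v G) \<le> M1 * norm (v, G)" using M1(2) t sp by (metis fst_conv snd_conv)
    also have "\<dots> \<le> (1 + M1 + M2 + M3) * norm (v, G)" by (rule mult_right_mono) (use M2(1) M3(1) in auto)
    finally show "norm (Ef t x v G) \<le> (1 + M1 + M2 + M3) * norm (v, G)" .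
    have "norm (Qf t x v) \<le> M2 * norm v" using M2(2) t sp by blast
    also have "\<dots> \<le> (1 + M1 + M2 + M3) * norm v" by (rule mult_right_mono) (use M1(1) M3(1) in auto)
    finally show "norm (Qf t x v) \<le> (1 + M1 + M2 + M3) * norm v" .
  qed (use M1(1) M2(1) M3(1) in \<open>auto intro: Ef_add Qf_add measurable_Jf measurable_Ef measurable_Qf\<close>)
  then show ?thesis ..
qed

lemma close_ex:
  assumes f: "forms NN {0..1} Jf Ef Qf M'" and t: "t \<in> {0..1}" "0 < \<eta>"
  shows "\<exists>\<delta>>0. \<forall>s\<in>{0..1}. \<bar>s - t\<bar> < \<delta> \<longrightarrow> forms.close NN Jf Ef Qf s t \<eta>"
proof -
  obtain d1 where d1: "0 < d1" "\<forall>s\<in>{0..1}. \<bar>s - t\<bar> < d1 \<longrightarrow> (\<forall>x\<in>closure \<Omega>. \<forall>z. norm (Ef s x (fst z) (snd z) - Ef t x (fst z) (snd z)) \<le> \<eta> * norm z)"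
    using Ef_uniform(2)[OF t] by auto
  obtain d2 where d2: "0 < d2" "\<forall>s\<in>{0..1}. \<bar>s - t\<bar> < d2 \<longrightarrow> (\<forall>x\<in>closure \<Omega>. \<forall>z. norm (Qf s x z - Qf t x z) \<le> \<eta> * norm z)"
    using Qf_uniform(2)[OF t] by auto
  obtain d3 where d3: "0 < d3" "\<forall>s\<in>{0..1}. \<bar>s - t\<bar> < d3 \<longrightarrow> (\<forall>x\<in>closure \<Omega>. \<bar>Jf s x - Jf t x\<bar> \<le> \<eta>)"
    using Jf_uniform(2)[OF t] by auto
  have sp: "x \<in> closure \<Omega>" if "x \<in> space NN" for x using that closure_subset by auto
  show ?thesis
  proof (intro exI[of _ "min d1 (min d2 d3)"] conjI ballI impI)
    fix s assume s: "s \<in> {0..1}" "\<bar>s - t\<bar> < min d1 (min d2 d3)"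
    show "forms.close NN Jf Ef Qf s t \<eta>"
      unfolding forms.close_def[OF f]
    proof (intro conjI ballI allI)
      fix x assume x: "x \<in> space NN"
      show "\<bar>Jf s x - Jf t x\<bar> \<le> \<eta>" using d3(2) s sp[OF x] by simp
      show "norm (Qf s x v - Qf t x v) \<le> \<eta> * norm v" for v using d2(2) s sp[OF x] by simp
      have sd: "\<bar>s - t\<bar> < d1" using s(2) by simp
      show "norm (Ef s x v G - Ef t x v G) \<le> \<eta> * norm (v, G)" for v G
        using d1(2)[rule_format, OF s(1) sd sp[OF x], of "(v, G)"] unfolding fst_conv snd_conv .
    qed (use t in simp)
  qed (use d1 d2 d3 in simp)
qed

lemma Qf_lower: "t \<in> {0..1} \<Longrightarrow> \<exists>C>0. \<forall>x\<in>closure \<Omega>. \<forall>v. norm v \<le> C * norm (Qf t x v)"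
proof (rule positive_linear[OF compact_closure_Om])
  interpret shift "kf t" cut2 M by (rule shift_kf)
  show "continuous_on (closure \<Omega> \<times> sphere 0 1) (\<lambda>(x, z). norm (Qf t x z))"
    by (auto simp: case_prod_unfold intro!: continuous_on_forms continuous_intros)
  show "norm (Qf t x (r *\<^sub>R z)) = \<bar>r\<bar> * norm (Qf t x z)" for x r z by (simp add: Qf_scale)
  fix x z :: plane assume z: "z \<noteq> 0"
  show "0 < norm (Qf t x z)"
  proof (rule ccontr)
    assume "\<not> ?thesis"
    then have "Nadj x *v (Nmat x *v z) = 0" by (simp add: Qf_def)
    then show False using z by (simp add: matrix_vector_mul_assoc Nmat_Nadj)
  qed
qed

text \<open>If both transported quantities vanish, then so does the value, since \<open>Nmat\<close>
  is invertible; the terms with derivatives of \<open>Nmat\<close> are then gone, and cancelling the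
  invertible matrices on both sides shows that the gradient vanishes as well.\<close>

lemma Ef_lower: "t \<in> {0..1} \<Longrightarrow> \<exists>C>0. \<forall>x\<in>closure \<Omega>. \<forall>v G. norm (v, G) \<le> C * (norm (Ef t x v G) + norm (Qf t x v))"
proof -
  assume t: "t \<in> {0..1}"
  interpret shift "kf t" cut2 M by (rule shift_kf)
  have "\<exists>C>0. \<forall>x\<in>closure \<Omega>. \<forall>z. norm z \<le> C * (norm (Ef t x (fst z) (snd z)) + norm (Qf t x (fst z)))"
  proof (rule positive_linear[OF compact_closure_Om])
    show "continuous_on (closure \<Omega> \<times> sphere 0 1) (\<lambda>(x, z). norm (Ef t x (fst z) (snd z)) + norm (Qf t x (fst z)))"
      by (auto simp: case_prod_unfold intro!: continuous_on_forms continuous_intros)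
    show "norm (Ef t x (fst (r *\<^sub>R z)) (snd (r *\<^sub>R z))) + norm (Qf t x (fst (r *\<^sub>R z))) = \<bar>r\<bar> * (norm (Ef t x (fst z) (snd z)) + norm (Qf t x (fst z)))" for x r z
      by (simp add: Ef_scale Qf_scale distrib_left)
    fix x and z :: "plane \<times> mat2" assume z: "z \<noteq> 0"
    show "0 < norm (Ef t x (fst z) (snd z)) + norm (Qf t x (fst z))"
    proof (rule ccontr)
      assume "\<not> ?thesis"
      then have "norm (Ef t x (fst z) (snd z)) = 0" "norm (Qf t x (fst z)) = 0"
        using norm_ge_zero[of "Ef t x (fst z) (snd z)"] norm_ge_zero[of "Qf t x (fst z)"] by linarith+
      then have E: "Emat x (fst z) (snd z) = 0" and Q: "Nmat x *v fst z = 0" by (simp_all add: Ef_def Qf_def)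
      have "Nadj x *v (Nmat x *v fst z) = 0" unfolding Q by simp
      then have v: "fst z = 0" by (simp add: matrix_vector_mul_assoc Nmat_Nadj)
      have "(\<chi> i j. pd j (\<lambda>y. Nmat y $ i $ 1) x * fst z $ 1 + pd j (\<lambda>y. Nmat y $ i $ 2) x * fst z $ 2) = (0 :: mat2)"
        unfolding v by (simp add: vec_eq_iff)
      then have "(Nmat x ** snd z) ** Kmat x = 0" using E unfolding Emat_def by simp
      then have "Nadj x ** ((Nmat x ** snd z) ** Kmat x) ** Dmat T x = 0" by simp
      then have "(Nadj x ** Nmat x) ** snd z ** (Kmat x ** Dmat T x) = 0" by (simp only: matrix_mul_assoc)
      then have "snd z = 0" by (simp add: Nmat_Nadj Kmat_Dmat)
      then show False using v z by (simp add: prod_eq_iff)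
    qed
  qed
  then obtain C where "0 < C" "\<forall>x\<in>closure \<Omega>. \<forall>z. norm z \<le> C * (norm (Ef t x (fst z) (snd z)) + norm (Qf t x (fst z)))" by blast
  then show ?thesis by (intro exI[of _ C]) (metis fst_conv snd_conv)
qed

abbreviation "psh t \<equiv> shift.push (kf t) cut2"
abbreviation "pll t \<equiv> shift.pull (kf t) cut2"

lemma push_T: "psh t v (TT t x) = Qf t x (v x)"
  unfolding shift.push_def[OF shift_kf] Qf_def shift.ST[OF shift_kf] ..

lemma vtrace_push':
  assumes "vtrace \<Omega> v G g"
  shows "vtrace (Om t) (psh t v) (\<lambda>y. Ef t (SS t y) (v (SS t y)) (G (SS t y))) (psh t g)"
  using shift.vtrace_push[OF shift_kf bdom_axioms assms] unfolding T_Om Ef_def .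

lemma integral_Om:
  fixes f :: "plane \<Rightarrow> real"
  shows "(\<integral>y. f y \<partial>NO t) = (\<integral>x. Jf t x * f (TT t x) \<partial>NN)"
    "integrable (NO t) f \<longleftrightarrow> integrable NN (\<lambda>x. Jf t x * f (TT t x))"
proof -
  interpret shift "kf t" cut2 M by (rule shift_kf)
  interpret diffeo_dom "TT t" "SS t" K \<Omega> by unfold_locales
  show "(\<integral>y. f y \<partial>NO t) = (\<integral>x. Jf t x * f (TT t x) \<partial>NN)"
    "integrable (NO t) f \<longleftrightarrow> integrable NN (\<lambda>x. Jf t x * f (TT t x))"
    using integral_image[of f] integrable_image_iff[of f] unfolding T_Om jac_eq Jf_def by auto
qed

text \<open>Change of variables to the reference domain. Besides the weak formulation, the Dirichlet
  norm and the convection term that must be absorbed are identified, so that estimates known on the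
  actual domain become estimates of \<open>AA\<close> and \<open>BF\<close>.\<close>

lemma aform_push:
  assumes t: "t \<in> {0..1}" and v: "vtrace \<Omega> v G g" and w: "vtrace \<Omega> w W h"
  shows "aform (Om t) (psh t v) (psh t w) = AA t v G w W + BF t v v G w"
    and "(\<integral>y. (norm (wgrad (Om t) (psh t w) y))\<^sup>2 \<partial>NO t) = AA t w W w W"
    and "(\<integral>y. (wgrad (Om t) (psh t v) y *v psh t w y) \<bullet> psh t w y \<partial>NO t) = BF t w v G w"
proof -
  obtain M' where "forms NN {0..1} Jf Ef Qf M'" using forms_ex by blast
  then interpret forms NN "{0..1}" Jf Ef Qf M' .
  interpret O: bdom "Om t" by (rule bdom_Om)
  let ?U = "\<lambda>y. Ef t (SS t y) (v (SS t y)) (G (SS t y))" and ?W = "\<lambda>y. Ef t (SS t y) (w (SS t y)) (W (SS t y))"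
  note fv = vtrace_fld[OF v] and fw = vtrace_fld[OF w]
  note pv = vtrace_push'[OF v, of t] and pw = vtrace_push'[OF w, of t]
  have Uae: "AE y in NO t. wgrad (Om t) (psh t v) y = ?U y" by (rule O.vtrace_wgrad_AE[OF pv])
  have Wae: "AE y in NO t. wgrad (Om t) (psh t w) y = ?W y" by (rule O.vtrace_wgrad_AE[OF pw])
  have m: "psh t f \<in> borel_measurable (NO t)" "(\<lambda>y. Ef t (SS t y) (f (SS t y)) (F (SS t y))) \<in> borel_measurable (NO t)"
    if "vtrace \<Omega> f F ff" for f F ff
    using vtrace_push'[OF that, of t] O.strace_L2m unfolding vtrace_def measurable_plane_iff measurable_mat_iff L2m_def by blast+
  note mv = m[OF v] and mw = m[OF w]
  note mm = measurable_matrix_vector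
  have ST: "SS t (TT t x) = x" for x by (rule shift.ST[OF shift_kf])
  have "aform (Om t) (psh t v) (psh t w) = (\<integral>y. ?U y \<bullet> ?W y \<partial>NO t) + (\<integral>y. (?U y *v psh t v y) \<bullet> psh t w y \<partial>NO t)"
    by (rule O.aform_AE[OF Uae Wae]) (intro borel_measurable_inner mm mv mw)+
  also have "\<dots> = AA t v G w W + BF t v v G w"
    unfolding integral_Om A_def B_def iA_def[abs_def] iB_def[abs_def] by (simp add: ST push_T)
  finally show "aform (Om t) (psh t v) (psh t w) = AA t v G w W + BF t v v G w" .
  have "(\<integral>y. (norm (wgrad (Om t) (psh t w) y))\<^sup>2 \<partial>NO t) = (\<integral>y. ?W y \<bullet> ?W y \<partial>NO t)"
    by (rule O.integral_dom_AE(1)[OF eventually_mono[OF Wae] borel_measurable_inner[OF mw(2) mw(2)]]) (simp add: power2_norm_eq_inner)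
  also have "\<dots> = AA t w W w W" unfolding integral_Om A_def iA_def[abs_def] by (simp add: ST)
  finally show "(\<integral>y. (norm (wgrad (Om t) (psh t w) y))\<^sup>2 \<partial>NO t) = AA t w W w W" .
  have "(\<integral>y. (wgrad (Om t) (psh t v) y *v psh t w y) \<bullet> psh t w y \<partial>NO t) = (\<integral>y. (?U y *v psh t w y) \<bullet> psh t w y \<partial>NO t)"
    by (rule O.integral_dom_AE(1)[OF eventually_mono[OF Uae] borel_measurable_inner[OF mm[OF mv(2) mw(1)] mw(1)]]) simp
  also have "\<dots> = BF t w v G w" unfolding integral_Om B_def iB_def[abs_def] by (simp add: ST push_T)
  finally show "(\<integral>y. (wgrad (Om t) (psh t v) y *v psh t w y) \<bullet> psh t w y \<partial>NO t) = BF t w v G w" .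
qed

text \<open>The Piola transform cancels the coefficients in the transport term.\<close>

lemma skew:
  assumes t: "t \<in> {0..1}" and v: "vtrace \<Omega> v G g" and div: "AE x in NN. trace (G x) = 0"
    and w: "vtrace \<Omega> w W h" and zero: "null_trace h"
  shows "BF t v w W w = 0"
proof -
  obtain M' where "forms NN {0..1} Jf Ef Qf M'" using forms_ex by blast
  then interpret forms NN "{0..1}" Jf Ef Qf M' .
  interpret S: shift "kf t" cut2 M by (rule shift_kf)
  define f where "f = (\<lambda>x. S.Nmat x *v w x)"
  define Y where "Y = (\<lambda>x. S.Nmat x ** W x + (\<chi> i j. pd j (\<lambda>y. S.Nmat y $ i $ 1) x * w x $ 1 + pd j (\<lambda>y. S.Nmat y $ i $ 2) x * w x $ 2))"
  have fY: "vtrace \<Omega> f Y (\<lambda>x. S.Nmat x *v h x)" unfolding f_def Y_def by (rule vtrace_matrix_mult[OF S.smooth_Nmat w])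
  have sf: "strace \<Omega> (\<lambda>x. f x $ i) (\<lambda>j x. Y x $ i $ j) (\<lambda>x. (S.Nmat x *v h x) $ i)" for i using fY by (simp add: vtrace_def)
  have sv: "strace \<Omega> (\<lambda>x. v x $ l) (\<lambda>j x. G x $ l $ j) (\<lambda>x. g x $ l)" for l using v by (simp add: vtrace_def)
  have z: "AE x in hausdorff1. x \<in> frontier \<Omega> \<longrightarrow> (S.Nmat x *v h x) $ i = 0" for i
    using zero by eventually_elim simp
  note ibp = ibp_zero_trace[OF sv sf z]
  \<comment> \<open>The Jacobian, \<open>Kmat\<close> and \<open>Nmat\<close> multiply to the
    identity: this leaves plain \<open>v\<close> as the transporting field.\<close>
  have KN: "S.J x *\<^sub>R (S.Kmat x *v (S.Nmat x *v y)) = y" for x y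
    using S.J_ge(3)[of x] by (simp add: S.Kmat_def S.Nmat_def matrix_vector_mult_def vec_eq_iff forall_2 sum_2 field_simps)
  have pt: "iB t v w W w x = (\<Sum>i\<in>UNIV. \<Sum>l\<in>UNIV. (v x $ l * f x $ i) * Y x $ i $ l)" for x
  proof -
    have "iB t v w W w x = (Y x *v (S.J x *\<^sub>R (S.Kmat x *v (S.Nmat x *v v x)))) \<bullet> f x"
      by (simp add: iB_def Jf_def Ef_def S.Emat_def Qf_def f_def Y_def matrix_vector_mul_assoc[symmetric] matrix_vector_mult_scaleR)
    also have "\<dots> = (Y x *v v x) \<bullet> f x" by (simp only: KN)
    also have "\<dots> = (\<Sum>i\<in>UNIV. \<Sum>l\<in>UNIV. (v x $ l * f x $ i) * Y x $ i $ l)"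
      by (simp add: inner_plane matrix_vector_mult_def sum_2 algebra_simps)
    finally show ?thesis .
  qed
  \<comment> \<open>Componentwise integration by parts with coefficient \<open>v x $ l\<close>;
    summing over \<open>l\<close> turns the derivatives of the coefficients into the divergence of
    \<open>v\<close>.\<close>
  have "2 * BF t v w W w = (\<Sum>i\<in>UNIV. \<Sum>l\<in>UNIV. 2 * (\<integral>x. (v x $ l * f x $ i) * Y x $ i $ l \<partial>NN))"
    unfolding B_def pt using ibp(3) by (simp add: sum_distrib_left)
  also have "\<dots> = (\<Sum>i\<in>UNIV. \<Sum>l\<in>UNIV. - (\<integral>x. G x $ l $ l * (f x $ i)\<^sup>2 \<partial>NN))"
    using ibp(1) by (intro sum.cong refl) (simp add: eq_neg_iff_add_eq_0 add.commute)
  also have "\<dots> = (\<Sum>i\<in>UNIV. - (\<integral>x. (\<Sum>l\<in>UNIV. G x $ l $ l * (f x $ i)\<^sup>2) \<partial>NN))"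
    using ibp(2) by (simp add: sum_negf)
  also have "\<dots> = 0"
  proof -
    have "(\<integral>x. (\<Sum>l\<in>UNIV. G x $ l $ l * (f x $ i)\<^sup>2) \<partial>NN) = 0" for i
      by (rule integral_eq_zero_AE) (use div in \<open>eventually_elim, simp add: trace_def sum_2 distrib_right[symmetric]\<close>)
    then show ?thesis by simp
  qed
  finally show ?thesis by simp
qed

end

section \<open>Continuity of the solution in the body\<close>

lemma (in bdom) S0_inequality:
  assumes w: "w \<in> H1_zero \<Omega>" and S: "0 < S0 \<Omega>"
  shows "S0 \<Omega> * (Lp_norm 4 \<Omega> w)\<^sup>2 \<le> (Lp_norm 2 \<Omega> (wgrad \<Omega> w))\<^sup>2"
proof (cases "AE x in lebesgue. x \<in> \<Omega> \<longrightarrow> w x = 0")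
  case True
  then have "(LINT x:\<Omega>|lebesgue. (norm (w x)) ^ 4) = 0"
    unfolding set_lebesgue_integral_def by (intro integral_eq_zero_AE) (auto simp: indicator_def elim: eventually_mono)
  then show ?thesis by (simp add: Lp_norm_def)
next
  case False
  let ?A = "{(Lp_norm 2 \<Omega> (wgrad \<Omega> v))\<^sup>2 / (Lp_norm 4 \<Omega> v)\<^sup>2 | v. v \<in> H1_zero \<Omega> \<and> \<not> (AE x in lebesgue. x \<in> \<Omega> \<longrightarrow> v x = 0)}"
  have "bdd_below ?A" by (rule bdd_belowI[of _ 0]) auto
  then have le: "S0 \<Omega> \<le> (Lp_norm 2 \<Omega> (wgrad \<Omega> w))\<^sup>2 / (Lp_norm 4 \<Omega> w)\<^sup>2"
    unfolding S0_def by (rule cInf_lower[rotated]) (use w False in blast)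
  \<comment> \<open>Division by zero yields zero, so a vanishing denominator would give
    \<open>S0 \<Omega> \<le> 0\<close>.\<close>
  then have "Lp_norm 4 \<Omega> w \<noteq> 0" using S by auto
  then show ?thesis using le by (simp add: field_simps)
qed

lemma (in bdom) Lp_norm_4: "(Lp_norm 4 \<Omega> w) ^ 4 = (\<integral>x. (norm (w x)) ^ 4 \<partial>NN)"
  using dom_sets by (simp add: Lp_norm_def set_integral_lebesgue_on)

section \<open>Solutions pulled back to the reference domain\<close>

context family begin

text \<open>The formulation free of pressure, tested with solenoidal fields. The outer datum
  \<open>d\<close> does not depend on the parameter; this is what makes differences of pulled-back
  solutions admissible.\<close>

definition is_sol :: "(plane \<Rightarrow> plane) \<Rightarrow> real \<Rightarrow> (plane \<Rightarrow> plane) \<Rightarrow> (plane \<Rightarrow> plane) \<Rightarrow> bool" where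
  "is_sol d t u g \<longleftrightarrow> vtrace (Om t) u (wgrad (Om t) u) g \<and> (AE y in NO t. wdiv (Om t) u y = 0) \<and>
     (AE y in hausdorff1. y \<in> frontier (BB t) \<longrightarrow> g y = 0) \<and> (AE y in hausdorff1. y \<in> frontier (rect L H) \<longrightarrow> g y = d y) \<and>
     (\<forall>\<phi>\<in>H1_zero (Om t). (AE y in NO t. wdiv (Om t) \<phi> y = 0) \<longrightarrow> aform (Om t) u \<phi> = 0)"

lemma AE_SS: "(AE y in NO t. P y) \<longleftrightarrow> (AE x in NN. P (TT t x))"
proof
  interpret shift "kf t" cut2 M by (rule shift_kf)
  interpret O: bdom "Om t" by (rule bdom_Om)
  interpret F: diffeo_dom "TT t" "SS t" K \<Omega> by unfold_locales
  interpret R: diffeo_dom "SS t" "TT t" K "Om t"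
    by (rule diffeo_dom.intro[OF swap_diffeo]) unfold_locales
  have im: "SS t ` Om t = \<Omega>" unfolding T_Om[of t, symmetric] by (simp add: image_image ST)
  show "AE x in NN. P (TT t x)" if "AE y in NO t. P y" using R.AE_image[OF that] unfolding im .
  show "AE y in NO t. P y" if "AE x in NN. P (TT t x)" using F.AE_image[OF that] unfolding T_Om TS .
qed

lemma AE_wdiv_psh:
  assumes v: "vtrace \<Omega> v G g"
  shows "(AE y in NO t. wdiv (Om t) (psh t v) y = 0) \<longleftrightarrow> (AE x in NN. trace (G x) = 0)"
proof -
  interpret shift "kf t" cut2 M by (rule shift_kf)
  interpret O: bdom "Om t" by (rule bdom_Om)
  have "AE y in NO t. wgrad (Om t) (psh t v) y = Ef t (SS t y) (v (SS t y)) (G (SS t y))"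
    by (rule O.vtrace_wgrad_AE[OF vtrace_push'[OF v]])
  then have "AE x in NN. wgrad (Om t) (psh t v) (TT t x) = Ef t x (v x) (G x)" unfolding AE_SS by (simp add: ST)
  then have "AE x in NN. wdiv (Om t) (psh t v) (TT t x) = trace (G x) / J x"
    by eventually_elim (simp add: wdiv_def Ef_def trace_Emat)
  then have "AE x in NN. wdiv (Om t) (psh t v) (TT t x) = 0 \<longleftrightarrow> trace (G x) = 0"
    by eventually_elim (simp add: J_ge)
  then show ?thesis unfolding AE_SS by (rule eventually_subst)
qed

text \<open>The inequalities are strict because \<open>Nmat\<close> and \<open>Nadj\<close> contain
  derivatives of the cut-offs, and locality yields their vanishing on open sets where the cut-offs
  vanish.\<close>

lemma outside_core:
  assumes "x$1 < p1 \<or> q1 < x$1 \<or> x$2 < - h1 \<or> h1 < x$2"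
  shows "TT t x = x" "SS t x = x" "psh t v x = v x" "pll t v x = v x"
proof -
  interpret shift "kf t" cut2 M by (rule shift_kf)
  show T: "TT t x = x" by (rule T_outside) (use assms in auto)
  then show S: "SS t x = x" using ST[of x] by simp
  have z: "f (x$2) * h (x$1) = 0"
    if "\<And>s. s < - h1 \<or> h1 < s \<Longrightarrow> f s = 0" "\<And>s. s < p1 \<or> q1 < s \<Longrightarrow> h s = 0" for f h :: "real \<Rightarrow> real"
    using assms that(1)[of "x$2"] that(2)[of "x$1"] by auto
  have dz: "dd f s = 0" if f: "smooth f" and U: "open U" "s \<in> U" "\<And>s. s \<in> U \<Longrightarrow> f s = 0" for f U s
  proof -
    have "dd f s = dd (\<lambda>_. 0) s" by (rule smooth_locally_eq[OF f smooth_const U(1)]) (use U in auto)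
    then show ?thesis by (simp add: dir_deriv_const)
  qed
  have d2: "dd cut2 s = 0" if "s < - h1 \<or> h1 < s" for s
    by (rule dz[OF cuts(2), of "{..< - h1} \<union> {h1 <..}"]) (use that cut2(2) in auto)
  have dk: "dd (kf t) s = 0" if "s < p1 \<or> q1 < s" for s
    by (rule dz[OF smk, of "{..< p1} \<union> {q1 <..}"]) (use that kf_zero in auto)
  have "dd cut2 (x$2) * kf t (x$1) = 0" by (rule z) (use d2 kf_zero in auto)
  moreover have "cut2 (x$2) * dd (kf t) (x$1) = 0" by (rule z) (use dk cut2(2) in auto)
  ultimately have J: "J x = 1" "\<tau>1 x = 0" by (simp_all add: J_def \<tau>1_def)
  show "psh t v x = v x" "pll t v x = v x"
    unfolding push_def pull_def S T Nmat_def Nadj_def J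
    by (simp_all add: vec_eq_iff forall_2 matrix_vector_mult_def sum_2)
qed

text \<open>Separates the outer boundary, where the shift acts as the identity, from the boundary of
  the hole, which the shift carries into the boundary of the body.\<close>

lemma frontier_Om_cases:
  assumes "x \<in> frontier \<Omega>"
  obtains "x \<in> frontier (rect L H)" "x$1 < p1 \<or> q1 < x$1 \<or> x$2 < - h1 \<or> h1 < x$2" | "TT t x \<in> frontier (BB t)"
proof -
  interpret shift "kf t" cut2 M by (rule shift_kf)
  interpret F: diffeo_dom "TT t" "SS t" K \<Omega> by unfold_locales
  have cl: "x \<in> closure \<Omega>" "x \<notin> \<Omega>" using assms open_dom by (auto simp: frontier_def interior_open)
  show thesis
  proof (cases "x \<in> hole")
    case True
    then have "TT t x \<in> BB t" unfolding T_hole[symmetric] by blast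
    moreover have "TT t x \<in> frontier (Om t)" using F.frontier_image assms unfolding T_Om by blast
    then have "TT t x \<in> closure (- BB t)" using closure_mono[of "Om t" "- BB t"] by (auto simp: frontier_def Om_def)
    ultimately show thesis using that(2) BB_compact[of t] closure_subset[of "BB t"] by (auto simp: frontier_closures)
  next
    case False
    then have nr: "x \<notin> rect L H" using cl(2) by (auto simp: \<Omega>_def)
    moreover have "x \<in> closure (rect L H)" using cl(1) closure_mono[of \<Omega> "rect L H"] by (auto simp: \<Omega>_def)
    moreover have "interior (rect L H) = rect L H" using open_rect by (rule interior_open)
    moreover have "x$1 < p1 \<or> q1 < x$1 \<or> x$2 < - h1 \<or> h1 < x$2" using nr geo by (auto simp: rect_def)
    ultimately show thesis using that(1) by (simp add: frontier_def)
  qed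
qed

lemma AE_frontier_psh:
  assumes "null_trace h"
  shows "AE y in hausdorff1. y \<in> frontier (Om t) \<longrightarrow> psh t h y = 0"
proof -
  interpret shift "kf t" cut2 M by (rule shift_kf)
  interpret F: diffeo_dom "TT t" "SS t" K \<Omega> by unfold_locales
  have "AE y in hausdorff1. SS t y \<in> frontier \<Omega> \<longrightarrow> h (SS t y) = 0"
    by (rule lipschitz_homeo.AE_hausdorff1_comp[OF swap assms])
  then show ?thesis
  proof eventually_elim
    case (elim y)
    then show ?case using F.frontier_image unfolding T_Om by (auto simp: push_def ST)
  qed
qed

lemma test_psh:
  assumes w: "vtrace \<Omega> w W h" and z: "null_trace h"
  shows "psh t w \<in> H1_zero (Om t)"
proof -
  interpret O: bdom "Om t" by (rule bdom_Om)
  have v: "vtrace (Om t) (psh t w) (\<lambda>y. Ef t (SS t y) (w (SS t y)) (W (SS t y))) (psh t h)" by (rule vtrace_push'[OF w])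
  show ?thesis
    unfolding H1_zero_def ae_eq_on_def using O.vtrace_H1[OF v] O.vtrace_is_trace[OF v] AE_frontier_psh[OF z] by blast
qed

text \<open>After the pull-back the boundary values are the same for all parameters: the datum
  \<open>d\<close> on the outer boundary and zero at the hole. Two pulled-back solutions therefore
  differ by a solenoidal field of zero trace.\<close>

lemma pulled_sol:
  assumes u: "is_sol d t u g"
  obtains G where "vtrace \<Omega> (pll t u) G (pll t g)" "AE x in NN. trace (G x) = 0" "psh t (pll t u) = u"
    "AE x in hausdorff1. x \<in> frontier \<Omega> \<longrightarrow> pll t g x = (if x \<in> frontier (rect L H) then d x else 0)"
proof -
  interpret shift "kf t" cut2 M by (rule shift_kf)
  have v: "vtrace (TT t ` \<Omega>) u (wgrad (Om t) u) g" using u by (simp add: is_sol_def T_Om)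
  obtain G where G: "vtrace \<Omega> (pll t u) G (pll t g)" using vtrace_pull[OF _ v] bdom_Om unfolding T_Om by blast
  have pp: "psh t (pll t u) = u" by (rule push_pull)
  have "AE x in NN. trace (G x) = 0" using AE_wdiv_psh[OF G, of t] u unfolding pp by (simp add: is_sol_def)
  moreover have "AE x in hausdorff1. TT t x \<in> frontier (BB t) \<longrightarrow> g (TT t x) = 0"
    by (rule AE_hausdorff1_comp) (use u in \<open>simp add: is_sol_def\<close>)
  moreover have "AE x in hausdorff1. x \<in> frontier (rect L H) \<longrightarrow> g x = d x" using u by (simp add: is_sol_def)
  ultimately show ?thesis
  proof (intro that[OF G _ pp])
    assume "AE x in hausdorff1. TT t x \<in> frontier (BB t) \<longrightarrow> g (TT t x) = 0" "AE x in hausdorff1. x \<in> frontier (rect L H) \<longrightarrow> g x = d x"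
    then show "AE x in hausdorff1. x \<in> frontier \<Omega> \<longrightarrow> pll t g x = (if x \<in> frontier (rect L H) then d x else 0)"
    proof eventually_elim
      case (elim x)
      show ?case
      proof
        assume "x \<in> frontier \<Omega>"
        then show "pll t g x = (if x \<in> frontier (rect L H) then d x else 0)"
        proof (cases rule: frontier_Om_cases[where x=x and t=t, case_names 1 2])
          case 1
          then show ?thesis using elim outside_core(4)[OF 1(2)] by simp
        next
          case 2
          have "TT t x \<notin> frontier (rect L H)"
          proof -
            have "TT t x \<in> Rect (c - a) (c + a) (- b) b" using 2 BB_subset[of t] BB_compact[of t]
              by (meson compact_imp_closed frontier_subset_closed subsetD)
            then have "TT t x \<in> rect L H" using geo by (auto simp: Rect_def rect_def)
            then show ?thesis using open_rect by (simp add: frontier_def interior_open)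
          qed
          moreover have "x \<in> frontier (rect L H) \<Longrightarrow> TT t x = x"
            using open_rect geo by (intro outside_core(1)) (auto simp: frontier_def interior_open rect_def)
          ultimately have "x \<notin> frontier (rect L H)" by metis
          then show ?thesis using elim 2 by (simp add: pull_def)
        qed
      qed
    qed
  qed
qed

text \<open>Hoelder's inequality and the definition of \<open>S0\<close>: the convection term is at
  most the norm of the gradient of the solution times the squared fourth-power norm of the test
  field, and \<open>S0\<close> converts the latter into the Dirichlet form. The threshold property
  makes the resulting factor smaller than one.\<close>

lemma convection_bound:
  assumes t: "t \<in> {0..1}" and v: "vtrace \<Omega> v G g" and w: "vtrace \<Omega> w W h" and z: "null_trace h"
    and S: "0 < S0 (Om t)"
  shows "\<bar>BF t w v G w\<bar> \<le> Lp_norm 2 (Om t) (wgrad (Om t) (psh t v)) / S0 (Om t) * AA t w W w W"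
    and "(\<integral>y. (norm (psh t w y)) ^ 4 \<partial>NO t) \<le> (AA t w W w W / S0 (Om t))\<^sup>2"
    and "L2m (NO t) (\<lambda>y. (norm (psh t w y))\<^sup>2)"
proof -
  interpret O: bdom "Om t" by (rule bdom_Om)
  let ?N = "NO t" and ?w = "psh t w" and ?V = "wgrad (Om t) (psh t v)"
  have fw: "fld NN w W" by (rule vtrace_fld[OF w])
  have pw: "vtrace (Om t) ?w (\<lambda>y. Ef t (SS t y) (w (SS t y)) (W (SS t y))) (psh t h)" by (rule vtrace_push'[OF w])
  have pv: "vtrace (Om t) (psh t v) (\<lambda>y. Ef t (SS t y) (v (SS t y)) (G (SS t y))) (psh t g)" by (rule vtrace_push'[OF v])
  have mw: "?w \<in> borel_measurable ?N" using O.H1_wgrad(3)[OF O.vtrace_H1[OF pw]] by (simp add: measurable_plane_iff L2m_def)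
  have LV: "L2 (Om t) ?V" unfolding O.L2_mat_iff using O.H1_wgrad(2)[OF O.vtrace_H1[OF pv]] by blast
  then have mV: "?V \<in> borel_measurable ?N" and LnV: "L2m ?N (\<lambda>y. norm (?V y))" by (auto simp: O.L2_iff L2m_def)
  obtain M' where "forms NN {0..1} Jf Ef Qf M'" using forms_ex by blast
  then interpret forms NN "{0..1}" Jf Ef Qf M' .
  \<comment> \<open>Without integrability the norm \<open>Lp_norm 4\<close> would be zero by
    convention. It is inherited from the reference domain, where fourth powers are already under
    control.\<close>
  have i4: "integrable ?N (\<lambda>y. (norm (?w y)) ^ 4)"
  proof -
    have L: "L2m NN (\<lambda>x. (norm (w x))\<^sup>2)" and mw' [measurable]: "w \<in> borel_measurable NN" using fw by (auto simp: fld_def)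
    have mQw [measurable]: "(\<lambda>x. Qf t x (w x)) \<in> borel_measurable NN" and mJ' [measurable]: "Jf t \<in> borel_measurable NN"
      by (rule mQ[OF t mw']) (rule mJ[OF t])
    have i: "integrable NN (\<lambda>x. (M' * M' ^ 4) * (norm (w x)) ^ 4)" using L by (simp add: L2m_def flip: power_mult)
    have "integrable NN (\<lambda>x. Jf t x * (norm (Qf t x (w x))) ^ 4)"
    proof (rule dominated_integral(1)[OF _ i])
      fix x assume x: "x \<in> space NN"
      have "\<bar>Jf t x\<bar> * (norm (Qf t x (w x))) ^ 4 \<le> M' * (M' * norm (w x)) ^ 4"
        by (intro mult_mono bJ[OF t x] power_mono bQ[OF t x]) (use M1 in auto)
      then show "\<bar>Jf t x * (norm (Qf t x (w x))) ^ 4\<bar> \<le> (M' * M' ^ 4) * (norm (w x)) ^ 4"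
        by (simp add: abs_mult power_mult_distrib mult_ac)
    qed measurable
    then show ?thesis unfolding integral_Om(2) push_T .
  qed
  then show L2: "L2m ?N (\<lambda>y. (norm (?w y))\<^sup>2)" using mw by (simp add: L2m_def flip: power_mult)
  have I: "S0 (Om t) * (Lp_norm 4 (Om t) ?w)\<^sup>2 \<le> AA t w W w W"
    using O.S0_inequality[OF test_psh[OF w z] S] unfolding O.Lp_norm_2 aform_push(2)[OF t v w] .
  then have I': "(Lp_norm 4 (Om t) ?w)\<^sup>2 \<le> AA t w W w W / S0 (Om t)" using S by (simp add: field_simps)
  have e4: "(\<integral>y. (norm (?w y)) ^ 4 \<partial>?N) = ((Lp_norm 4 (Om t) ?w)\<^sup>2)\<^sup>2"
    using O.Lp_norm_4[of ?w] by (simp flip: power_mult)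
  then have e4': "(\<integral>y. ((norm (?w y))\<^sup>2)\<^sup>2 \<partial>?N) = ((Lp_norm 4 (Om t) ?w)\<^sup>2)\<^sup>2"
    by (simp flip: power_mult)
  show "(\<integral>y. (norm (?w y)) ^ 4 \<partial>?N) \<le> (AA t w W w W / S0 (Om t))\<^sup>2"
    unfolding e4 by (rule power_mono[OF I']) simp
  have "\<bar>BF t w v G w\<bar> = \<bar>\<integral>y. (?V y *v ?w y) \<bullet> ?w y \<partial>?N\<bar>" unfolding aform_push(3)[OF t v w] ..
  also have "\<dots> \<le> (\<integral>y. norm (?V y) * (norm (?w y))\<^sup>2 \<partial>?N)"
  proof (rule dominated_integral(2))
    show "(\<lambda>y. (?V y *v ?w y) \<bullet> ?w y) \<in> borel_measurable ?N"
      by (intro borel_measurable_inner measurable_matrix_vector mV mw)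
    show "integrable ?N (\<lambda>y. norm (?V y) * (norm (?w y))\<^sup>2)" by (rule L2m_mult_integrable[OF LnV L2])
    show "\<bar>(?V y *v ?w y) \<bullet> ?w y\<bar> \<le> norm (?V y) * (norm (?w y))\<^sup>2" for y
      using order_trans[OF Cauchy_Schwarz_ineq2 mult_right_mono[OF norm_matrix_vector_le norm_ge_zero], of "?V y" "?w y" "?w y"]
      by (simp add: power2_eq_square mult.assoc)
  qed
  also have "\<dots> \<le> sqrt (\<integral>y. (norm (?V y))\<^sup>2 \<partial>?N) * sqrt (\<integral>y. ((norm (?w y))\<^sup>2)\<^sup>2 \<partial>?N)"
    by (rule order_trans[OF abs_ge_self cauchy_schwarz(2)[OF LnV L2]])
  also have "sqrt (\<integral>y. (norm (?V y))\<^sup>2 \<partial>?N) = Lp_norm 2 (Om t) ?V"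
    unfolding O.Lp_norm_2[symmetric] by (simp add: Lp_norm_def sqrt_def set_lebesgue_integral_def integral_nonneg_AE)
  also have "sqrt (\<integral>y. ((norm (?w y))\<^sup>2)\<^sup>2 \<partial>?N) = (Lp_norm 4 (Om t) ?w)\<^sup>2"
    unfolding e4' real_sqrt_abs abs_power2 ..
  also have "Lp_norm 2 (Om t) ?V * (Lp_norm 4 (Om t) ?w)\<^sup>2 \<le> Lp_norm 2 (Om t) ?V * (AA t w W w W / S0 (Om t))"
    by (intro mult_left_mono I') (simp add: Lp_norm_def set_lebesgue_integral_def integral_nonneg_AE)
  finally show "\<bar>BF t w v G w\<bar> \<le> Lp_norm 2 (Om t) ?V / S0 (Om t) * AA t w W w W" by simp
qed

text \<open>For zero trace, \<open>S0\<close> bounds the fourth powers by the Dirichlet form, and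
  the finite area turns this into a bound for second powers; so no separate Poincare inequality
  appears. The lower bounds for \<open>Ef\<close> and \<open>Qf\<close> lead back to the field on
  the reference domain.\<close>

lemma coercive:
  assumes t: "t \<in> {0..1}" and S: "0 < S0 (Om t)"
  shows "\<exists>C\<ge>0. \<forall>w W h. vtrace \<Omega> w W h \<longrightarrow> null_trace h \<longrightarrow>
     0 \<le> AA t w W w W \<and> nrm2 NN w W \<le> C * sqrt (AA t w W w W) \<and> nrm4 NN w \<le> C * sqrt (AA t w W w W)"
proof -
  obtain M' where "forms NN {0..1} Jf Ef Qf M'" using forms_ex by blast
  then interpret forms NN "{0..1}" Jf Ef Qf M' .
  interpret O: bdom "Om t" by (rule bdom_Om)
  obtain C1 where C1: "0 < C1" "\<forall>x\<in>closure \<Omega>. \<forall>v G. norm (v, G) \<le> C1 * (norm (Ef t x v G) + norm (Qf t x v))" using Ef_lower[OF t] by blast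
  obtain C2 where C2: "0 < C2" "\<forall>x\<in>closure \<Omega>. \<forall>v. norm v \<le> C2 * norm (Qf t x v)" using Qf_lower[OF t] by blast
  define \<mu> where "\<mu> = sqrt (\<integral>x. 1 \<partial>NN)"
  \<comment> \<open>The first summand serves \<open>nrm2\<close>, the second \<open>nrm4\<close>.
    The square root of the area is \<open>\<mu>\<close>, and the factor \<open>sqrt 2\<close> stems
    from the lower bound \<open>1/2\<close> of the Jacobian.\<close>
  define C where "C = sqrt (4 * C1\<^sup>2 * (1 + \<mu> * sqrt 2 / S0 (Om t))) + C2 * sqrt (sqrt 2 / S0 (Om t))"
  have \<mu>: "0 \<le> \<mu>" by (simp add: \<mu>_def integral_nonneg_AE)
  have C0: "0 \<le> sqrt (4 * C1\<^sup>2 * (1 + \<mu> * sqrt 2 / S0 (Om t)))" "0 \<le> C2 * sqrt (sqrt 2 / S0 (Om t))" using S C2 \<mu> by auto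
  have J: "1/2 \<le> Jf t x" for x unfolding Jf_def by (rule shift.J_ge(1)[OF shift_kf])
  have sp: "x \<in> closure \<Omega>" if "x \<in> space NN" for x using that closure_subset by auto
  show ?thesis
  proof (intro exI[of _ C] conjI allI impI)
    show "0 \<le> C" using C0 by (simp add: C_def)
    fix w W h assume w: "vtrace \<Omega> w W h" and z: "null_trace h"
    define Y where "Y = AA t w W w W"
    have Y0: "0 \<le> Y" unfolding Y_def aform_push(2)[OF t w w, symmetric] by (simp add: integral_nonneg_AE)
    then show "0 \<le> AA t w W w W" by (simp add: Y_def)
    have f: "fld NN w W" by (rule vtrace_fld[OF w])
    note cb = convection_bound(2,3)[OF t w w z S]
    let ?E = "\<lambda>x. Ef t x (w x) (W x)" and ?Q = "\<lambda>x. Qf t x (w x)"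
    let ?e2 = "\<integral>x. (norm (?E x))\<^sup>2 \<partial>NN" and ?q2 = "\<integral>x. (norm (?Q x))\<^sup>2 \<partial>NN" and ?q4 = "\<integral>x. (norm (?Q x)) ^ 4 \<partial>NN"
    have m [measurable]: "?E \<in> borel_measurable NN" "?Q \<in> borel_measurable NN" "w \<in> borel_measurable NN" "W \<in> borel_measurable NN" "Jf t \<in> borel_measurable NN"
      using mE[OF t fldD[OF f]] mQ[OF t fldD(1)[OF f]] fldD[OF f] mJ[OF t] by auto
    \<comment> \<open>Removes the Jacobian from the integral at the cost of a factor 2.\<close>
    have half: "integrable NN F \<and> (\<integral>x. F x \<partial>NN) \<le> 2 * (\<integral>x. Jf t x * F x \<partial>NN)"
      if F: "F \<in> borel_measurable NN" "\<And>x. 0 \<le> F x" "integrable NN (\<lambda>x. Jf t x * F x)" for F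
    proof -
      have i: "integrable NN (\<lambda>x. 2 * (Jf t x * F x))" using F(3) by simp
      have le: "F x \<le> 2 * (Jf t x * F x)" for x using mult_right_mono[OF J[of x] F(2)[of x]] by simp
      have "integrable NN F" by (rule dominated_integral(1)[OF F(1) i]) (use le F(2) in simp)
      then show ?thesis using integral_mono[OF _ i le] by simp
    qed
    have E2: "integrable NN (\<lambda>x. (norm (?E x))\<^sup>2)" "?e2 \<le> 2 * Y"
    proof -
      have "iA t w W w W = (\<lambda>x. Jf t x * (norm (?E x))\<^sup>2)" by (auto simp: iA_def power2_norm_eq_inner)
      then have "integrable NN (\<lambda>x. Jf t x * (norm (?E x))\<^sup>2)" "Y = (\<integral>x. Jf t x * (norm (?E x))\<^sup>2 \<partial>NN)"
        using A_bounds(1)[OF t f f] by (simp_all add: Y_def A_def)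
      then show "integrable NN (\<lambda>x. (norm (?E x))\<^sup>2)" "?e2 \<le> 2 * Y"
        using half[of "\<lambda>x. (norm (?E x))\<^sup>2"] by auto
    qed
    have Q4: "integrable NN (\<lambda>x. (norm (?Q x)) ^ 4)" "?q4 \<le> 2 * (Y / S0 (Om t))\<^sup>2"
    proof -
      have "integrable (NO t) (\<lambda>y. (norm (psh t w y)) ^ 4)" using cb(2) by (simp add: L2m_def flip: power_mult)
      then have "integrable NN (\<lambda>x. Jf t x * (norm (?Q x)) ^ 4)" unfolding integral_Om(2) push_T .
      moreover have "(\<integral>x. Jf t x * (norm (?Q x)) ^ 4 \<partial>NN) \<le> (Y / S0 (Om t))\<^sup>2"
        using cb(1) unfolding integral_Om(1) push_T Y_def .
      ultimately show "integrable NN (\<lambda>x. (norm (?Q x)) ^ 4)" "?q4 \<le> 2 * (Y / S0 (Om t))\<^sup>2"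
        using half[of "\<lambda>x. (norm (?Q x)) ^ 4"] by auto
    qed
    have s4: "sqrt ?q4 \<le> sqrt 2 * (Y / S0 (Om t))"
      using real_sqrt_le_mono[OF Q4(2)] Y0 S by (simp add: real_sqrt_mult)
    have Q2: "integrable NN (\<lambda>x. (norm (?Q x))\<^sup>2)" "?q2 \<le> \<mu> * (sqrt 2 * (Y / S0 (Om t)))"
    proof -
      have L: "L2m NN (\<lambda>x. (norm (?Q x))\<^sup>2)" using Q4(1) by (simp add: L2m_def flip: power_mult)
      have one: "L2m NN (\<lambda>x. 1)" using finite_measure_dom by (auto simp: L2m_def finite_measure.integrable_const)
      show "integrable NN (\<lambda>x. (norm (?Q x))\<^sup>2)" using L2m_mult_integrable[OF one L] by simp
      have "(\<integral>x. 1 * (norm (?Q x))\<^sup>2 \<partial>NN) \<le> \<mu> * sqrt (\<integral>x. ((norm (?Q x))\<^sup>2)\<^sup>2 \<partial>NN)"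
        using order_trans[OF abs_ge_self cauchy_schwarz(2)[OF one L]] by (simp add: \<mu>_def)
      also have "\<dots> \<le> \<mu> * (sqrt 2 * (Y / S0 (Om t)))" by (intro mult_left_mono \<mu>) (use s4 in \<open>simp flip: power_mult\<close>)
      finally show "?q2 \<le> \<mu> * (sqrt 2 * (Y / S0 (Om t)))" by simp
    qed
    have "(\<integral>x. (norm (w x, W x))\<^sup>2 \<partial>NN) \<le> (\<integral>x. 2 * C1\<^sup>2 * ((norm (?E x))\<^sup>2 + (norm (?Q x))\<^sup>2) \<partial>NN)"
    proof (rule integral_mono)
      show "integrable NN (\<lambda>x. (norm (w x, W x))\<^sup>2)" using f by (simp add: fld_def L2m_def)
      show "integrable NN (\<lambda>x. 2 * C1\<^sup>2 * ((norm (?E x))\<^sup>2 + (norm (?Q x))\<^sup>2))" using E2(1) Q2(1) by simp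
      fix x assume "x \<in> space NN"
      then have "norm (w x, W x) \<le> C1 * (norm (?E x) + norm (?Q x))" using C1(2) sp by blast
      then have "(norm (w x, W x))\<^sup>2 \<le> C1\<^sup>2 * (norm (?E x) + norm (?Q x))\<^sup>2"
        by (metis norm_ge_zero power_mono power_mult_distrib)
      also have "\<dots> \<le> C1\<^sup>2 * (2 * ((norm (?E x))\<^sup>2 + (norm (?Q x))\<^sup>2))"
        using sum_squares_bound[of "norm (?E x)" "norm (?Q x)"] by (intro mult_left_mono) (auto simp: power2_sum)
      finally show "(norm (w x, W x))\<^sup>2 \<le> 2 * C1\<^sup>2 * ((norm (?E x))\<^sup>2 + (norm (?Q x))\<^sup>2)" by (simp add: algebra_simps)
    qed
    also have "\<dots> \<le> 2 * C1\<^sup>2 * (2 * Y + \<mu> * (sqrt 2 * (Y / S0 (Om t))))"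
      using E2 Q2 by (simp add: add_mono mult_left_mono)
    also have "\<dots> \<le> 4 * C1\<^sup>2 * (1 + \<mu> * sqrt 2 / S0 (Om t)) * Y"
    proof -
      have "0 \<le> \<mu> * (sqrt 2 * (Y / S0 (Om t)))" using \<mu> Y0 S by simp
      then have "\<mu> * (sqrt 2 * (Y / S0 (Om t))) \<le> 2 * (\<mu> * (sqrt 2 * (Y / S0 (Om t))))" by (simp only: mult_2 le_add_same_cancel1)
      then have "2 * C1\<^sup>2 * (2 * Y + \<mu> * (sqrt 2 * (Y / S0 (Om t)))) \<le> 2 * C1\<^sup>2 * (2 * Y + 2 * (\<mu> * (sqrt 2 * (Y / S0 (Om t)))))"
        by (intro mult_left_mono add_left_mono) simp_all
      then show ?thesis by (simp add: algebra_simps)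
    qed
    finally have "nrm2 NN w W \<le> sqrt (4 * C1\<^sup>2 * (1 + \<mu> * sqrt 2 / S0 (Om t))) * sqrt Y"
      unfolding nrm2_def real_sqrt_mult[symmetric] by (rule real_sqrt_le_mono)
    also have "\<dots> \<le> C * sqrt Y" unfolding C_def by (intro mult_right_mono) (use C0 Y0 in auto)
    finally show "nrm2 NN w W \<le> C * sqrt (AA t w W w W)" by (simp add: Y_def)
    have "(\<integral>x. (norm (w x)) ^ 4 \<partial>NN) \<le> (\<integral>x. C2 ^ 4 * (norm (?Q x)) ^ 4 \<partial>NN)"
    proof (rule integral_mono)
      show "integrable NN (\<lambda>x. (norm (w x)) ^ 4)" using f by (simp add: fld_def L2m_def flip: power_mult)
      show "integrable NN (\<lambda>x. C2 ^ 4 * (norm (?Q x)) ^ 4)" using Q4(1) by simp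
      fix x assume "x \<in> space NN"
      then have "norm (w x) \<le> C2 * norm (?Q x)" using C2(2) sp by blast
      then show "(norm (w x)) ^ 4 \<le> C2 ^ 4 * (norm (?Q x)) ^ 4" by (metis norm_ge_zero power_mono power_mult_distrib)
    qed
    then have "sqrt (\<integral>x. (norm (w x)) ^ 4 \<partial>NN) \<le> sqrt (C2 ^ 4 * ?q4)"
      by (intro real_sqrt_le_mono) simp
    also have "\<dots> = C2\<^sup>2 * sqrt ?q4"
      using real_sqrt_abs[of "C2\<^sup>2"] by (simp add: real_sqrt_mult flip: power_mult)
    also have "\<dots> \<le> C2\<^sup>2 * (sqrt 2 * (Y / S0 (Om t)))" by (intro mult_left_mono s4) simp
    also have "\<dots> = C2\<^sup>2 * (sqrt 2 / S0 (Om t)) * Y" by simp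
    finally have "nrm4 NN w \<le> sqrt (C2\<^sup>2 * (sqrt 2 / S0 (Om t)) * Y)" unfolding nrm4_def by (rule real_sqrt_le_mono)
    also have "\<dots> = C2 * sqrt (sqrt 2 / S0 (Om t)) * sqrt Y" using C2(1) by (simp only: real_sqrt_mult) simp
    also have "\<dots> \<le> C * sqrt Y" unfolding C_def by (intro mult_right_mono) (use C0 Y0 in auto)
    finally show "nrm4 NN w \<le> C * sqrt (AA t w W w W)" by (simp add: Y_def)
  qed
qed

text \<open>All constants belong to the fixed parameter \<open>t\<close>. The energy estimate bounds
  the difference of the pulled-back solutions at \<open>s\<close> and \<open>t\<close> by a multiple
  of \<open>\<eta>\<close>, and the functional follows because its test field is fixed by all
  transports.\<close>

lemma functional_continuous:
  assumes sol: "\<And>t. t \<in> {0..1} \<Longrightarrow> is_sol d t (u t) (g t)"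
    and S: "\<And>t. t \<in> {0..1} \<Longrightarrow> Lp_norm 2 (Om t) (wgrad (Om t) (u t)) < S0 (Om t)"
    and z: "vtrace \<Omega> z Z zg" and fix_z: "\<And>t. psh t z = z"
  shows "continuous_on {0..1} (\<lambda>t. aform (Om t) (u t) z)"
  unfolding continuous_on_iff
proof (intro ballI allI impI)
  fix t \<epsilon> :: real assume t: "t \<in> {0..1}" and \<epsilon>: "0 < \<epsilon>"
  obtain M' where F: "forms NN {0..1} Jf Ef Qf M'" using forms_ex by blast
  then interpret forms NN "{0..1}" Jf Ef Qf M' .
  define v where "v s = pll s (u s)" for s
  let ?R = "\<lambda>s G. vtrace \<Omega> (v s) G (pll s (g s)) \<and> (AE x in NN. trace (G x) = 0) \<and> psh s (v s) = u s \<and>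
      (AE x in hausdorff1. x \<in> frontier \<Omega> \<longrightarrow> pll s (g s) x = (if x \<in> frontier (rect L H) then d x else 0))"
  have "\<forall>s\<in>{0..1}. \<exists>G. ?R s G"
  proof
    fix s :: real assume s: "s \<in> {0..1}"
    show "\<exists>G. ?R s G"
      by (rule pulled_sol[OF sol[OF s]]) (unfold v_def, (intro exI conjI; assumption))
  qed
  then obtain G where R: "\<forall>s\<in>{0..1}. ?R s (G s)" by (auto dest!: bchoice)
  have G: "vtrace \<Omega> (v s) (G s) (pll s (g s))" "AE x in NN. trace (G s x) = 0" "psh s (v s) = u s"
      "AE x in hausdorff1. x \<in> frontier \<Omega> \<longrightarrow> pll s (g s) x = (if x \<in> frontier (rect L H) then d x else 0)"
    if "s \<in> {0..1}" for s using bspec[OF R that] by blast+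
  have L0: "0 \<le> Lp_norm 2 (Om t) (wgrad (Om t) (u t))" by (simp add: Lp_norm_def set_lebesgue_integral_def integral_nonneg_AE)
  then have S0: "0 < S0 (Om t)" using S[OF t] by linarith
  define \<theta> where "\<theta> = Lp_norm 2 (Om t) (wgrad (Om t) (u t)) / S0 (Om t)"
  have \<theta>: "\<theta> < 1" using S[OF t] S0 by (simp add: \<theta>_def)
  obtain C where C: "0 \<le> C" and coer: "\<forall>w W h. vtrace \<Omega> w W h \<longrightarrow> null_trace h \<longrightarrow>
     0 \<le> AA t w W w W \<and> nrm2 NN w W \<le> C * sqrt (AA t w W w W) \<and> nrm4 NN w \<le> C * sqrt (AA t w W w W)"
    using coercive[OF t S0] by blast
  define n2 where "n2 = nrm2 NN (v t) (G t)"
  define n4 where "n4 = nrm4 NN (v t)"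
  define K1 where "K1 = 3 * M'\<^sup>2 * n2 * C + 4 * M' ^ 3 * n2 * n4 * C"
  define K2 where "K2 = 3 * M'\<^sup>2 * C\<^sup>2 + 4 * M' ^ 3 * n2 * C\<^sup>2"
  have n0: "0 \<le> n2" "0 \<le> n4" by (simp_all add: n2_def n4_def nrm_nonneg)
  have M0: "0 \<le> M'" using M1 by simp
  have K0: "0 \<le> K1" "0 \<le> K2" using n0 M0 C by (simp_all add: K1_def K2_def)
  \<comment> \<open>The energy norm \<open>X\<close> of the difference will turn out to be at most
    \<open>2 * K1 / (1 - \<theta>) * \<eta>\<close>, so that \<open>Dc * \<eta>\<close> bounds both
    norms of the difference.\<close>
  define Dc where "Dc = C * (2 * K1 / (1 - \<theta>))"
  define \<beta> where "\<beta> \<eta> = (3 * M'\<^sup>2 * \<eta>) * (n2 * nrm2 NN z Z) + M' ^ 3 * (Dc * \<eta> * nrm2 NN z Z)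
      + (4 * M' ^ 3 * \<eta>) * (n2 * (n4 * nrm4 NN z)) + M' ^ 4 * (n2 * (Dc * \<eta> * nrm4 NN z))
      + M' ^ 4 * (Dc * \<eta> * (n4 * nrm4 NN z)) + M' ^ 4 * (Dc * \<eta> * (Dc * \<eta> * nrm4 NN z))" for \<eta>
  have "(\<beta> \<longlongrightarrow> \<beta> 0) (at_right 0)" unfolding \<beta>_def by (intro tendsto_intros)
  then have e1: "\<forall>\<^sub>F \<eta> in at_right 0. \<beta> \<eta> < \<epsilon>" using order_tendstoD(2)[of \<beta> 0 "at_right 0" \<epsilon>] \<epsilon> by (simp add: \<beta>_def)
  have "((\<lambda>\<eta>. \<eta> * K2) \<longlongrightarrow> 0 * K2) (at_right 0)" by (intro tendsto_intros)
  then have e2: "\<forall>\<^sub>F \<eta> in at_right 0. \<eta> * K2 < (1 - \<theta>) / 2" using order_tendstoD(2)[of _ "0 * K2" "at_right 0" "(1 - \<theta>) / 2"] \<theta> by simp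
  have "\<forall>\<^sub>F \<eta> in at_right (0::real). 0 < \<eta>" by (rule eventually_at_right_less)
  with e1 e2 have "\<forall>\<^sub>F \<eta> in at_right 0. \<beta> \<eta> < \<epsilon> \<and> \<eta> * K2 < (1 - \<theta>) / 2 \<and> 0 < \<eta>" by eventually_elim auto
  then obtain \<eta> where \<eta>: "\<beta> \<eta> < \<epsilon>" "\<eta> * K2 < (1 - \<theta>) / 2" "0 < \<eta>"
    using eventually_happens[of _ "at_right (0::real)"] by auto
  obtain \<delta> where \<delta>: "0 < \<delta>" "\<forall>s\<in>{0..1}. \<bar>s - t\<bar> < \<delta> \<longrightarrow> close s t \<eta>" using close_ex[OF F t \<eta>(3)] by blast
  show "\<exists>\<delta>>0. \<forall>s\<in>{0..1}. dist s t < \<delta> \<longrightarrow> dist (aform (Om s) (u s) z) (aform (Om t) (u t) z) < \<epsilon>"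
  proof (intro exI[of _ \<delta>] conjI \<delta>(1) ballI impI)
    fix s assume s: "s \<in> {0..1}" and "dist s t < \<delta>"
    then have c: "close s t \<eta>" using \<delta>(2) by (simp add: dist_real_def)
    define w where "w x = v s x - v t x" for x
    define W where "W x = G s x - G t x" for x
    define h where "h x = pll s (g s) x - pll t (g t) x" for x
    have vw: "(\<lambda>x. v t x + w x) = v s" "(\<lambda>x. G t x + W x) = G s" by (simp_all add: w_def W_def)
    have w: "vtrace \<Omega> w W h" unfolding w_def[abs_def] W_def[abs_def] h_def[abs_def] by (rule vtrace_diff[OF G(1)[OF s] G(1)[OF t]])
    have h0: "null_trace h"
      using G(4)[OF s] G(4)[OF t] by eventually_elim (auto simp: h_def)
    have dw: "AE x in NN. trace (W x) = 0" using G(2)[OF s] G(2)[OF t] by eventually_elim (simp add: W_def trace_sub)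
    \<comment> \<open>One field \<open>w\<close> on the reference domain tests both equations: its
      transforms are admissible in the domain of \<open>s\<close> and in that of
      \<open>t\<close>.\<close>
    have eq: "AA r (v r) (G r) w W + BF r (v r) (v r) (G r) w = 0" if r: "r \<in> {0..1}" for r
    proof -
      have "aform (Om r) (u r) (psh r w) = 0"
        using sol[OF r] test_psh[OF w h0] AE_wdiv_psh[OF w] dw unfolding is_sol_def by blast
      then show ?thesis using aform_push(1)[OF r G(1)[OF r] w] G(3)[OF r] by simp
    qed
    note fv = vtrace_fld[OF G(1)[OF t]] and fw = vtrace_fld[OF w] and fs = vtrace_fld[OF G(1)[OF s]] and fz = vtrace_fld[OF z]
    define X where "X = sqrt (AA t w W w W)"
    have co: "nrm2 NN w W \<le> C * X" "nrm4 NN w \<le> C * X" "0 \<le> AA t w W w W" unfolding X_def using coer[rule_format, OF w h0] by blast+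
    have X: "AA t w W w W = X\<^sup>2" "0 \<le> X" using co(3) by (simp_all add: X_def)
    have cb: "\<bar>BF t w (v t) (G t) w\<bar> \<le> \<theta> * X\<^sup>2"
      using convection_bound(1)[OF t G(1)[OF t] w h0 S0] unfolding G(3)[OF t] X(1) \<theta>_def .
    have "(1 - \<theta>) * X\<^sup>2 \<le> \<eta> * (K1 * X + K2 * X\<^sup>2)"
      unfolding K1_def K2_def n2_def n4_def
      by (rule stability[OF s t c fv fw _ eq[OF t] _ _ cb X \<theta> co(1,2) C]) (unfold vw, (rule eq[OF s] skew[OF s G(1)[OF s] G(2)[OF s] w h0] fs)+)
    then have "(1 - \<theta>) * X\<^sup>2 \<le> \<eta> * K1 * X + (\<eta> * K2) * X\<^sup>2" by (simp add: algebra_simps)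
    also have "(\<eta> * K2) * X\<^sup>2 \<le> (1 - \<theta>) / 2 * X\<^sup>2" by (rule mult_right_mono) (use \<eta>(2) in auto)
    finally have "(1 - \<theta>) / 2 * X\<^sup>2 \<le> \<eta> * K1 * X" by (simp add: field_simps)
    then have "X * ((1 - \<theta>) / 2 * X) \<le> X * (\<eta> * K1)" by (simp add: power2_eq_square mult_ac)
    \<comment> \<open>Cancellation of \<open>X\<close>; for \<open>X = 0\<close> the right-hand side
      is nonnegative.\<close>
    then have "(1 - \<theta>) / 2 * X \<le> \<eta> * K1" using X(2) K0 \<eta>(3) by (cases "X = 0") (auto simp: mult_le_cancel_left)
    then have "X \<le> 2 * K1 / (1 - \<theta>) * \<eta>" using \<theta> by (simp add: field_simps)
    then have "C * X \<le> Dc * \<eta>" using mult_left_mono[OF _ C] by (fastforce simp: Dc_def mult.assoc)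
    then have D: "nrm2 NN w W \<le> Dc * \<eta>" "nrm4 NN w \<le> Dc * \<eta>" using co by linarith+
    have aS: "aform (Om r) (u r) z = AA r (v r) (G r) z Z + BF r (v r) (v r) (G r) z" if r: "r \<in> {0..1}" for r
      using aform_push(1)[OF r G(1)[OF r] z] unfolding G(3)[OF r] fix_z .
    have "\<bar>aform (Om s) (u s) z - aform (Om t) (u t) z\<bar> \<le> \<beta> \<eta>"
      using functional_close[OF s t c fv fw fz _ D] fs unfolding vw aS[OF s] aS[OF t] \<beta>_def n2_def n4_def by blast
    then show "dist (aform (Om s) (u s) z) (aform (Om t) (u t) z) < \<epsilon>" using \<eta>(1) by (simp add: dist_real_def)
  qed
qed

end

section \<open>The lift as a functional of the velocity\<close>

context bdom begin

lemma inner_smooth_integrable: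
  assumes G: "\<And>i j. L2m NN (\<lambda>x. (G x :: mat2) $ i $ j)" and w: "\<And>i. smooth (\<lambda>x. w x $ i)"
  shows "integrable NN (\<lambda>x. G x \<bullet> Dmat w x)"
  unfolding inner_mat Dmat_def vec_lambda_beta
  by (intro Bochner_Integration.integrable_add L2m_mult_integrable G smooth_L2m w)

lemma convection_smooth_integrable:
  assumes G: "\<And>i j. L2m NN (\<lambda>x. (G x :: mat2) $ i $ j)" and u: "\<And>i. L2m NN (\<lambda>x. u x $ i)"
    and w: "\<And>i. smooth (\<lambda>x. w x $ i)"
  shows "integrable NN (\<lambda>x. (G x *v u x) \<bullet> w x)"
proof -
  have "(G x *v u x) \<bullet> w x = (G x $ 1 $ 1 * (w x $ 1 * u x $ 1) + G x $ 1 $ 2 * (w x $ 1 * u x $ 2)) + (G x $ 2 $ 1 * (w x $ 2 * u x $ 1) + G x $ 2 $ 2 * (w x $ 2 * u x $ 2))" for x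
    by (simp add: inner_plane matrix_vector_mult_def sum_2 algebra_simps)
  moreover have "L2m NN (\<lambda>x. w x $ i * u x $ j)" for i j
    by (rule L2m_mult_continuous[OF u smooth_continuous_on[OF w]])
  ultimately show ?thesis by (simp only:) (intro Bochner_Integration.integrable_add L2m_mult_integrable G; assumption)
qed

lemma wgrad_Dmat_AE: "(\<And>i. smooth (\<lambda>x. w x $ i)) \<Longrightarrow> AE x in NN. wgrad \<Omega> w x = Dmat w x"
  by (simp add: Dmat_def wgrad_smooth_AE)

lemma aform_smooth:
  assumes u: "vtrace \<Omega> u G g" and w: "\<And>i. smooth (\<lambda>x. w x $ i)"
  shows "aform \<Omega> u w = (\<integral>x. wgrad \<Omega> u x \<bullet> Dmat w x \<partial>NN) + (\<integral>x. (wgrad \<Omega> u x *v u x) \<bullet> w x \<partial>NN)"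
  using H1_wgrad(2,3)[OF vtrace_H1[OF u]]
  by (intro aform_AE[OF _ wgrad_Dmat_AE[OF w]] borel_measurable_integrable inner_smooth_integrable convection_smooth_integrable w) auto

lemma trace_Dmat_integrable:
  assumes p: "L2m NN p" and w: "\<And>i. smooth (\<lambda>x. w x $ i)"
  shows "integrable NN (\<lambda>x. p x * trace (Dmat w x))"
  unfolding trace_def Dmat_def vec_lambda_beta sum_2 distrib_left
  by (intro Bochner_Integration.integrable_add L2m_mult_integrable p smooth_L2m w)

text \<open>Two integrations by parts and the symmetry of second derivatives move the index of
  differentiation from 2 to \<open>j\<close>, which leaves the divergence of \<open>u\<close>. The
  cut-off \<open>\<phi>\<close> is not a test function on the domain, being one near the body, but
  its derivatives agree there with the test functions \<open>\<eta> j\<close>.\<close>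

lemma transpose_term:
  assumes W: "\<And>i j. is_weak_deriv \<Omega> (axis j 1) (\<lambda>y. u y $ i) (\<lambda>x. G x $ i $ j)"
    and L: "\<And>i j. L2m NN (\<lambda>x. G x $ i $ j)"
    and div: "AE x in NN. trace (G x) = 0"
    and \<phi>: "smooth \<phi>" and \<eta>: "\<And>j. test_fun \<Omega> (\<eta> j)" "\<And>x j. x \<in> \<Omega> \<Longrightarrow> \<eta> j x = pd j \<phi> x"
  shows "(\<integral>x. (\<Sum>j\<in>UNIV. G x $ j $ 2 * pd j \<phi> x) \<partial>NN) = 0"
proof -
  have weak: "(\<integral>x. u x $ i * pd l (\<eta> k) x \<partial>NN) = - (\<integral>x. G x $ i $ l * \<eta> k x \<partial>NN)" for i l k
    using W[of l i] \<eta>(1)[of k] dom_sets unfolding is_weak_deriv_def by (simp add: set_integral_lebesgue_on)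
  have cong: "(\<integral>x. f x \<partial>NN) = (\<integral>x. f' x \<partial>NN)" if "\<And>x. x \<in> \<Omega> \<Longrightarrow> f x = f' x" for f f' :: "plane \<Rightarrow> real"
    by (rule Bochner_Integration.integral_cong) (use that in auto)
  have pd: "pd l (\<eta> k) x = pd l (pd k \<phi>) x" if "x \<in> \<Omega>" for l k x
    by (rule smooth_locally_eq[OF _ _ open_dom _ that]) (use \<eta> \<phi> in \<open>auto simp: test_fun_def intro: smooth_dir_deriv\<close>)
  have swap: "pd 2 (\<eta> j) x = pd j (\<eta> 2) x" if "x \<in> \<Omega>" for j x
    using exhaust_2[of j] clairaut[OF \<phi>] pd[OF that] by auto
  have step: "(\<integral>x. G x $ j $ 2 * pd j \<phi> x \<partial>NN) = (\<integral>x. G x $ j $ j * pd 2 \<phi> x \<partial>NN)" for j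
  proof -
    have "(\<integral>x. G x $ j $ 2 * pd j \<phi> x \<partial>NN) = (\<integral>x. G x $ j $ 2 * \<eta> j x \<partial>NN)" by (rule cong) (simp add: \<eta>)
    also have "\<dots> = - (\<integral>x. u x $ j * pd 2 (\<eta> j) x \<partial>NN)" using weak[of j 2 j] by simp
    also have "\<dots> = - (\<integral>x. u x $ j * pd j (\<eta> 2) x \<partial>NN)" by (simp add: swap cong[of "\<lambda>x. u x $ j * pd 2 (\<eta> j) x" "\<lambda>x. u x $ j * pd j (\<eta> 2) x"])
    also have "\<dots> = (\<integral>x. G x $ j $ j * \<eta> 2 x \<partial>NN)" using weak[of j j 2] by simp
    also have "\<dots> = (\<integral>x. G x $ j $ j * pd 2 \<phi> x \<partial>NN)" by (rule cong) (simp add: \<eta>)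
    finally show ?thesis .
  qed
  have i: "integrable NN (\<lambda>x. G x $ i $ j * pd k \<phi> x)" for i j k
    by (intro L2m_mult_integrable L smooth_L2m \<phi>)
  have "(\<integral>x. (\<Sum>j\<in>UNIV. G x $ j $ 2 * pd j \<phi> x) \<partial>NN) = (\<integral>x. (\<Sum>j\<in>UNIV. G x $ j $ j * pd 2 \<phi> x) \<partial>NN)"
    using i step by simp
  also have "\<dots> = 0"
    by (rule integral_eq_zero_AE) (use div in \<open>eventually_elim, simp add: trace_def sum_2 distrib_right[symmetric]\<close>)
  finally show ?thesis .
qed

end

text \<open>The rectangle in \<open>V1\<close> contains all bodies and the whole region moved by the
  shifts, so that one stream function works for every parameter. Evenness is what produces the
  change of sign under reflection.\<close>

locale solenoidal = family +
  fixes \<psi> :: "plane \<Rightarrow> real" and V1 V0 :: "plane set"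
  assumes smooth_\<psi>: "smooth \<psi>" and V1: "open V1" "Rect p1 q1 (- h1) h1 \<subseteq> V1" "\<And>x. x \<in> V1 \<Longrightarrow> \<psi> x = x $ 1"
    and V0: "open V0" "frontier (rect L H) \<subseteq> V0" "\<And>x. x \<in> V0 \<Longrightarrow> \<psi> x = 0"
    and \<psi>_even: "\<And>x. \<psi> (reflect x) = \<psi> x"
begin

text \<open>A solenoidal extension of \<open>e\<^sub>2\<close>, since the stream function \<open>\<psi>\<close> is \<open>x\<^sub>1\<close> near the body.\<close>

definition wb :: "plane \<Rightarrow> plane" where "wb x = pt (- pd 2 \<psi> x) (pd 1 \<psi> x)"

lemma smooth_wb: "smooth (\<lambda>x. wb x $ i)"
  using exhaust_2[of i] smooth_minus[OF smooth_dir_deriv[OF smooth_\<psi> axis_in_Basis]] smooth_dir_deriv[OF smooth_\<psi> axis_in_Basis]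
  by (auto simp: wb_def)

lemma pd_\<psi>: "x \<in> V1 \<Longrightarrow> pd j \<psi> x = (if j = 1 then 1 else 0)" "x \<in> V0 \<Longrightarrow> pd j \<psi> x = 0"
proof -
  show "x \<in> V1 \<Longrightarrow> pd j \<psi> x = (if j = 1 then 1 else 0)"
    using smooth_locally_eq[OF smooth_\<psi> smooth_coord[of 1] V1(1,3), of x "axis j 1"] by (auto simp: pd_coord)
  show "x \<in> V0 \<Longrightarrow> pd j \<psi> x = 0"
    using smooth_locally_eq[OF smooth_\<psi> smooth_const[of 0] V0(1,3), of x "axis j 1"] by (simp add: dir_deriv_const)
qed

lemma wb_V: "x \<in> V1 \<Longrightarrow> wb x = e2" "x \<in> V0 \<Longrightarrow> wb x = 0"
  by (simp_all add: wb_def pd_\<psi> vec_eq_iff forall_2 e2_def) (simp_all add: axis_def)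

lemma trace_Dmat_wb: "trace (Dmat wb x) = 0"
proof -
  have "(\<lambda>y. wb y $ 1) = (\<lambda>y. - pd 2 \<psi> y)" "(\<lambda>y. wb y $ 2) = pd 1 \<psi>" by (auto simp: wb_def)
  moreover have "pd 1 (\<lambda>y. - pd 2 \<psi> y) x = - pd 1 (pd 2 \<psi>) x"
    using dir_deriv_diff[of "\<lambda>_. 0" x "pd 2 \<psi>" "axis 1 1"] smooth_differentiable[OF smooth_dir_deriv[OF smooth_\<psi> axis_in_Basis]]
    by (simp add: dir_deriv_const)
  ultimately show ?thesis using clairaut[OF smooth_\<psi>] by (simp add: trace_def sum_2 Dmat_def)
qed

text \<open>The shift moves points only within a rectangle on which \<open>wb\<close> equals
  \<open>e2\<close>, and \<open>e2\<close> is the second column of \<open>Nmat\<close>.\<close>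

lemma psh_wb: "psh t wb = wb"
proof
  interpret shift "kf t" cut2 M by (rule shift_kf)
  fix y show "psh t wb y = wb y"
  proof (cases "y \<in> Rect p1 q1 (- h1) h1")
    case True
    have "SS t y \<in> Rect p1 q1 (- h1) h1"
    proof (rule ccontr)
      assume n: "\<not> ?thesis"
      then have "TT t (SS t y) = SS t y" by (intro outside_core(1)) (auto simp: Rect_def)
      then show False using n True by (simp add: TS)
    qed
    then have "wb (SS t y) = e2" "wb y = e2" using True wb_V(1) V1(2) by auto
    then show ?thesis by (simp add: push_def Nmat_def vec_eq_iff forall_2 matrix_vector_mult_def sum_2 e2_def axis_def)
  next
    case False
    then show ?thesis by (intro outside_core(3)) (auto simp: Rect_def)
  qed
qed

lemma BB_V1: "BB t \<subseteq> V1"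
proof -
  have "hole \<subseteq> core" using geo by (auto simp: hole_def core_def Rect_def)
  then have "BB t \<subseteq> core" unfolding T_hole[of t, symmetric] using T_core by blast
  also have "core \<subseteq> Rect p1 q1 (- h1) h1" by (auto simp: core_def Rect_def)
  finally show ?thesis using V1(2) by blast
qed

lemma frontier_Om_subset: "frontier (Om t) \<subseteq> frontier (rect L H) \<union> BB t"
proof
  fix x assume x: "x \<in> frontier (Om t)"
  have "Om t \<subseteq> rect L H" by (auto simp: Om_def)
  then have c: "x \<in> closure (rect L H)" using x closure_mono by (auto simp: frontier_def)
  have "open (Om t)" using bdom.open_dom[OF bdom_Om] .
  then have "x \<notin> Om t" using x by (simp add: frontier_def interior_open)
  then show "x \<in> frontier (rect L H) \<union> BB t" using c open_rect by (auto simp: Om_def frontier_def interior_open)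
qed

text \<open>A cut-off is arbitrary beyond the outer boundary, so its derivatives are set to zero
  there. The result is smooth because they vanish near the outer boundary, and its support avoids
  the body, near which the cut-off is constant.\<close>

lemma cutoff_test:
  assumes c: "cutoff (rect L H) (BB t) \<phi>"
  obtains \<eta> where "\<And>j. test_fun (Om t) (\<eta> j)" "\<And>x j. x \<in> Om t \<Longrightarrow> \<eta> j x = pd j \<phi> x"
proof -
  from c obtain U W where \<phi>: "smooth \<phi>" and U: "open U" "BB t \<subseteq> U" "\<And>x. x \<in> U \<Longrightarrow> \<phi> x = 1"
    and W: "open W" "frontier (rect L H) \<subseteq> W" "\<And>x. x \<in> W \<Longrightarrow> \<phi> x = 0" unfolding cutoff_def by blast
  define \<eta> where "\<eta> j x = (if x \<in> rect L H then pd j \<phi> x else 0)" for j x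
  have pU: "pd j \<phi> x = 0" if "x \<in> U" for j x
    using smooth_locally_eq[OF \<phi> smooth_const[of 1] U(1,3) that, of "axis j 1"] by (simp add: dir_deriv_const)
  have pW: "pd j \<phi> x = 0" if "x \<in> W" for j x
    using smooth_locally_eq[OF \<phi> smooth_const[of 0] W(1,3) that, of "axis j 1"] by (simp add: dir_deriv_const)
  have cl: "closure (rect L H) = rect L H \<union> frontier (rect L H)"
    using open_rect closure_subset[of "rect L H"] by (auto simp: frontier_def interior_open)
  have "test_fun (Om t) (\<eta> j)" for j
  proof -
    have "smooth (\<eta> j)"
    proof (rule smooth_glue[of "pd j \<phi>" "rect L H" "W \<union> - closure (rect L H)"])
      show "smooth (pd j \<phi>)" by (intro smooth_dir_deriv \<phi> axis_in_Basis)
      show "open (rect L H)" "open (W \<union> - closure (rect L H))" using open_rect W(1) by auto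
      show "rect L H \<union> (W \<union> - closure (rect L H)) = UNIV" using W(2) cl by auto
      show "\<eta> j x = 0" if "x \<in> W \<union> - closure (rect L H)" for x
        using that pW closure_subset[of "rect L H"] by (auto simp: \<eta>_def)
    qed (simp add: \<eta>_def)
    moreover have sub: "closure {x. \<eta> j x \<noteq> 0} \<subseteq> closure (rect L H) - (U \<union> W)"
    proof (rule closure_minimal)
      show "{x. \<eta> j x \<noteq> 0} \<subseteq> closure (rect L H) - (U \<union> W)"
        using pU pW closure_subset[of "rect L H"] by (auto simp: \<eta>_def split: if_splits)
      show "closed (closure (rect L H) - (U \<union> W))" using U W by (intro closed_Diff) auto
    qed
    moreover have "closure (rect L H) - (U \<union> W) \<subseteq> Om t" using U(2) W(2) cl by (auto simp: Om_def)
    moreover have "bounded (rect L H)"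
      by (rule bounded_subset[OF compact_imp_bounded[OF compact_Rect(1)], of _ "-L" L "-H" H]) (auto simp: rect_def Rect_def)
    then have "compact (closure {x. \<eta> j x \<noteq> 0})"
      using bounded_subset[OF bounded_closure sub[THEN order_trans, OF Diff_subset]] by (simp add: compact_eq_bounded_closed)
    ultimately show ?thesis unfolding test_fun_def by blast
  qed
  then show thesis by (rule that) (simp add: \<eta>_def Om_def)
qed

text \<open>The existence of a cut-off makes the definite description in \<open>lift\<close>
  determinate. This derivative is one, since \<open>\<psi>\<close> equals the first coordinate near
  the bodies and vanishes near the outer boundary.\<close>

lemma cutoff_ex: "cutoff (rect L H) (BB t) (pd 1 \<psi>)"
  unfolding cutoff_def using smooth_dir_deriv[OF smooth_\<psi> axis_in_Basis] V1 V0 BB_V1 pd_\<psi> by (metis (full_types))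

text \<open>The difference of \<open>\<phi> *\<^sub>R e2\<close> and \<open>wb\<close> vanishes on
  the whole boundary, so the weak formulation exchanges one for the other. The pressure only sees
  the divergence, which for this difference is that of \<open>\<phi> *\<^sub>R e2\<close>, and this
  cancels the pressure part of the stress.\<close>

lemma stress_pairing_eq:
  assumes u: "vtrace (Om t) u (wgrad (Om t) u) g" and div: "AE y in NO t. wdiv (Om t) u y = 0"
    and p: "L2 (Om t) p" and c: "cutoff (rect L H) (BB t) \<phi>"
    and weak: "\<And>\<zeta>. \<zeta> \<in> H1_zero (Om t) \<Longrightarrow> aform (Om t) u \<zeta> - (LINT x:Om t|lebesgue. p x * wdiv (Om t) \<zeta> x) = 0"
  shows "stress_pairing (rect L H) (BB t) \<phi> u p = aform (Om t) u wb"
proof -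
  interpret O: bdom "Om t" by (rule bdom_Om)
  let ?N = "NO t"
  define G where "G = wgrad (Om t) u"
  have W: "is_weak_deriv (Om t) (axis j 1) (\<lambda>y. u y $ i) (\<lambda>x. G x $ i $ j)" and L: "L2m ?N (\<lambda>x. G x $ i $ j)" "L2m ?N (\<lambda>x. u x $ i)" for i j
    using O.H1_wgrad[OF O.vtrace_H1[OF u]] by (auto simp: G_def)
  have Lp: "L2m ?N p" using p by (simp add: O.L2_real_iff)
  from c obtain U V where \<phi>: "smooth \<phi>" and U: "open U" "BB t \<subseteq> U" "\<And>x. x \<in> U \<Longrightarrow> \<phi> x = 1"
    and V: "open V" "frontier (rect L H) \<subseteq> V" "\<And>x. x \<in> V \<Longrightarrow> \<phi> x = 0" unfolding cutoff_def by blast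
  define w1 where "w1 y = \<phi> y *\<^sub>R e2" for y
  define \<zeta> where "\<zeta> y = w1 y - wb y" for y
  have w1c: "(\<lambda>y. w1 y $ 1) = (\<lambda>y. 0)" "(\<lambda>y. w1 y $ 2) = \<phi>" by (auto simp: w1_def e2_def axis_def)
  have sw: "smooth (\<lambda>x. w1 x $ i)" for i using exhaust_2[of i] w1c \<phi> smooth_const[of 0] by auto
  have s\<zeta>: "smooth (\<lambda>x. \<zeta> x $ i)" for i unfolding \<zeta>_def vector_minus_component by (rule smooth_diff[OF sw smooth_wb])
  have D\<zeta>: "Dmat \<zeta> x = Dmat w1 x - Dmat wb x" for x
    unfolding Dmat_def \<zeta>_def vector_minus_component
    by (simp add: vec_eq_iff dir_deriv_diff[OF smooth_differentiable[OF sw] smooth_differentiable[OF smooth_wb]])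
  have "\<zeta> x = 0" if "x \<in> frontier (Om t)" for x
  proof -
    from frontier_Om_subset[of t] that consider "x \<in> frontier (rect L H)" | "x \<in> BB t" by blast
    then show ?thesis
    proof cases
      case 1
      then have "\<phi> x = 0" "wb x = 0" using V(2,3) V0(2) wb_V(2) by blast+
      then show ?thesis by (simp add: \<zeta>_def w1_def)
    next
      case 2
      then have "\<phi> x = 1" "wb x = e2" using U(2,3) BB_V1[of t] wb_V(1) by blast+
      then show ?thesis by (simp add: \<zeta>_def w1_def)
    qed
  qed
  then have "\<zeta> \<in> H1_zero (Om t)"
    unfolding H1_zero_def ae_eq_on_def using O.vtrace_H1[OF O.vtrace_smooth[OF s\<zeta>]] O.vtrace_is_trace[OF O.vtrace_smooth[OF s\<zeta>]] by auto
  then have w0: "aform (Om t) u \<zeta> - (LINT x:Om t|lebesgue. p x * wdiv (Om t) \<zeta> x) = 0" by (rule weak)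
  note af = O.aform_smooth[OF u, folded G_def]
  have pr: "(LINT x:Om t|lebesgue. p x * wdiv (Om t) \<zeta> x) = (\<integral>x. p x * trace (Dmat w1 x) \<partial>?N)"
  proof (rule O.integral_dom_AE(2))
    show "AE x in ?N. p x * wdiv (Om t) \<zeta> x = p x * trace (Dmat w1 x)"
      using O.wgrad_Dmat_AE[OF s\<zeta>] by eventually_elim (simp add: wdiv_def D\<zeta> trace_sub trace_Dmat_wb)
  qed (rule borel_measurable_integrable[OF O.trace_Dmat_integrable[OF Lp sw]])
  note i = O.inner_smooth_integrable[OF L(1)] O.convection_smooth_integrable[OF L]
  have split: "aform (Om t) u \<zeta> = aform (Om t) u w1 - aform (Om t) u wb"
    unfolding af[OF s\<zeta>] af[OF sw] af[OF smooth_wb] D\<zeta> inner_diff_right \<zeta>_def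
    using i(1)[OF sw] i(1)[OF smooth_wb] i(2)[OF sw] i(2)[OF smooth_wb] by simp
  let ?T = "\<lambda>x. (\<Sum>j\<in>UNIV. G x $ j $ 2 * pd j \<phi> x)"
  obtain \<eta> where \<eta>: "\<And>j. test_fun (Om t) (\<eta> j)" "\<And>x j. x \<in> Om t \<Longrightarrow> \<eta> j x = pd j \<phi> x"
    using cutoff_test[OF c] by blast
  have T0: "(\<integral>x. ?T x \<partial>?N) = 0"
    by (rule O.transpose_term[OF W L(1) _ \<phi> \<eta>]) (use div in \<open>simp_all add: wdiv_def G_def\<close>)
  have Ti: "integrable ?N ?T" by (intro Bochner_Integration.integrable_sum L2m_mult_integrable L O.smooth_L2m \<phi>)
  have st: "stress (Om t) u p x \<bullet> Dmat w1 x = G x \<bullet> Dmat w1 x + ?T x - p x * trace (Dmat w1 x)" for x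
    by (simp add: stress_def G_def inner_mat Dmat_def w1c dir_deriv_const transpose_def mat_def trace_def sum_2 algebra_simps)
  have "(LINT x:Om t|lebesgue. stress (Om t) u p x \<bullet> wgrad (Om t) w1 x) = (\<integral>x. G x \<bullet> Dmat w1 x + ?T x - p x * trace (Dmat w1 x) \<partial>?N)"
  proof (rule O.integral_dom_AE(2))
    show "AE x in ?N. stress (Om t) u p x \<bullet> wgrad (Om t) w1 x = G x \<bullet> Dmat w1 x + ?T x - p x * trace (Dmat w1 x)"
      using O.wgrad_Dmat_AE[OF sw] by eventually_elim (simp only: st)
  qed (intro borel_measurable_integrable Bochner_Integration.integrable_add Bochner_Integration.integrable_diff i sw Ti O.trace_Dmat_integrable Lp)
  also have "\<dots> = (\<integral>x. G x \<bullet> Dmat w1 x \<partial>?N) - (\<integral>x. p x * trace (Dmat w1 x) \<partial>?N)"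
    using i(1)[OF sw] Ti O.trace_Dmat_integrable[OF Lp sw] T0 by simp
  finally have 1: "(LINT x:Om t|lebesgue. stress (Om t) u p x \<bullet> wgrad (Om t) w1 x) = (\<integral>x. G x \<bullet> Dmat w1 x \<partial>?N) - (\<integral>x. p x * trace (Dmat w1 x) \<partial>?N)" .
  have 2: "(LINT x:Om t|lebesgue. convection (Om t) u x \<bullet> w1 x) = (\<integral>x. (G x *v u x) \<bullet> w1 x \<partial>?N)"
    by (rule O.integral_dom_AE(2)[OF _ borel_measurable_integrable[OF i(2)[OF sw]]]) (simp add: convection_def G_def)
  show ?thesis
    using w0 unfolding stress_pairing_def Om_def[symmetric] w1_def[symmetric] 1 2 split pr af[OF sw] by simp
qed

lemma lift_eq:
  assumes u: "vtrace (Om t) u (wgrad (Om t) u) g" and div: "AE y in NO t. wdiv (Om t) u y = 0"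
    and p: "L2 (Om t) p"
    and weak: "\<And>\<zeta>. \<zeta> \<in> H1_zero (Om t) \<Longrightarrow> aform (Om t) u \<zeta> - (LINT x:Om t|lebesgue. p x * wdiv (Om t) \<zeta> x) = 0"
  shows "lift (rect L H) (BB t) u p = - aform (Om t) u wb"
  unfolding lift_def
  by (rule the_equality) (use stress_pairing_eq[OF u div p _ weak] cutoff_ex in auto)

end

section \<open>Reflection in the horizontal axis\<close>

definition Rm :: mat2 where "Rm = (\<chi> i j. if i = j then (if i = 1 then 1 else - 1) else 0)"

definition Rf :: "(plane \<Rightarrow> plane) \<Rightarrow> plane \<Rightarrow> plane" where "Rf u y = reflect (u (reflect y))"

lemma Rm_mult: "Rm *v v = reflect v"
  by (simp add: vec_eq_iff forall_2 reflect_nth Rm_def matrix_vector_mult_def sum_2)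

lemma Rf_Rf: "Rf (Rf u) = u"
  by (simp add: Rf_def fun_eq_iff reflect_reflect)

lemma linear_reflect: "linear reflect"
  by (rule linearI) (simp_all add: vec_eq_iff forall_2 reflect_nth)

lemma pd_reflect: "pd j (\<lambda>y. reflect y $ i) x = Rm $ i $ j"
  and smooth_reflect: "smooth (\<lambda>y. reflect y $ i)"
proof -
  have 2: "(\<lambda>y. reflect y $ 2) = (\<lambda>y. 0 - y $ 2)" "(\<lambda>y. reflect y $ 1) = (\<lambda>y. y $ 1)" by (simp_all add: reflect_nth)
  have "pd j (\<lambda>y. 0 - y $ 2) x = - (if 2 = j then 1 else 0)"
    by (subst dir_deriv_diff) (simp_all add: smooth_differentiable[OF smooth_coord] pd_coord dir_deriv_const)
  then show "pd j (\<lambda>y. reflect y $ i) x = Rm $ i $ j"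
    using exhaust_2[of i] exhaust_2[of j] by (auto simp: 2 pd_coord Rm_def)
  show "smooth (\<lambda>y. reflect y $ i)"
    using exhaust_2[of i] smooth_diff[OF smooth_const[of 0] smooth_coord[of 2]] smooth_coord[of 1] 2 by auto
qed

lemma Dmat_reflect: "Dmat reflect x = Rm"
  by (simp add: Dmat_def pd_reflect vec_eq_iff)

lemma diffeo_reflect: "diffeo reflect reflect 1"
proof -
  have "dist (reflect x) (reflect y) \<le> 1 * dist x y" for x y
  proof -
    have "(dist (reflect x) (reflect y))\<^sup>2 = (dist x y)\<^sup>2"
      unfolding dist_norm norm_plane by (simp add: reflect_nth power2_eq_square algebra_simps)
    then show ?thesis by simp
  qed
  then show ?thesis by unfold_locales (auto simp: reflect_reflect smooth_reflect)
qed

lemma inner_reflect: "(Rm ** X ** Rm) \<bullet> (Rm ** Y ** Rm) = X \<bullet> Y" "reflect v \<bullet> reflect w = v \<bullet> w"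
    "(Rm ** X ** Rm) *v reflect v = reflect (X *v v)" "trace (Rm ** X ** Rm) = trace X"
  by (simp_all add: inner_mat inner_plane reflect_nth vec_eq_iff forall_2 Rm_def matrix_matrix_mult_def matrix_vector_mult_def sum_2 trace_def)

context bdom begin

lemma reflect_dom: "diffeo_dom reflect reflect 1 \<Omega>"
  using diffeo_reflect bdom_axioms by (rule diffeo_dom.intro)

lemma integral_reflect:
  fixes f :: "plane \<Rightarrow> real" shows "(\<integral>y. f y \<partial>lebesgue_on (reflect ` \<Omega>)) = (\<integral>x. f (reflect x) \<partial>NN)"
proof -
  interpret diffeo_dom reflect reflect 1 \<Omega> by (rule reflect_dom)
  have "jac x = 1" for x by (simp add: jac_def Dmat_reflect det_2 Rm_def)
  then show ?thesis using integral_image[of f] by simp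
qed

lemma AE_reflect: "AE x in NN. P x \<Longrightarrow> AE y in lebesgue_on (reflect ` \<Omega>). P (reflect y)"
  by (rule diffeo_dom.AE_image[OF reflect_dom])

lemma vtrace_Rf:
  assumes "vtrace \<Omega> u G g"
  shows "vtrace (reflect ` \<Omega>) (Rf u) (\<lambda>y. Rm ** G (reflect y) ** Rm) (Rf g)"
proof -
  interpret diffeo_dom reflect reflect 1 \<Omega> by (rule reflect_dom)
  have "(\<chi> i j. pd j (\<lambda>y. Rm $ i $ 1) x * u (reflect x) $ 1 + pd j (\<lambda>y. Rm $ i $ 2) x * u (reflect x) $ 2) = (0 :: mat2)" for x
    by (simp add: vec_eq_iff dir_deriv_const)
  then show ?thesis
    using img.vtrace_matrix_mult[where N="\<lambda>_. Rm", OF smooth_const vtrace_comp[OF assms]]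
    unfolding Rm_mult Dmat_reflect matrix_mul_assoc Rf_def[abs_def] by simp
qed

lemma wgrad_Rf:
  assumes "vtrace \<Omega> u G g"
  shows "AE x in NN. wgrad (reflect ` \<Omega>) (Rf u) (reflect x) = Rm ** wgrad \<Omega> u x ** Rm"
proof -
  interpret R: diffeo_dom reflect reflect 1 \<Omega> by (rule reflect_dom)
  have im: "reflect ` reflect ` \<Omega> = \<Omega>" by (simp add: image_image reflect_reflect)
  have "AE y in lebesgue_on (reflect ` \<Omega>). wgrad (reflect ` \<Omega>) (Rf u) y = Rm ** G (reflect y) ** Rm"
    by (rule R.img.vtrace_wgrad_AE[OF vtrace_Rf[OF assms]])
  from R.img.AE_reflect[OF this] vtrace_wgrad_AE[OF assms] show ?thesis
    unfolding im reflect_reflect by eventually_elim simp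
qed

lemma set_integral_reflect:
  fixes f F :: "plane \<Rightarrow> real"
  assumes "AE x in NN. f (reflect x) = F x" "F \<in> borel_measurable NN"
  shows "(LINT y:reflect ` \<Omega>|lebesgue. f y) = (LINT x:\<Omega>|lebesgue. F x)"
proof -
  interpret R: diffeo_dom reflect reflect 1 \<Omega> by (rule reflect_dom)
  have "(LINT y:reflect ` \<Omega>|lebesgue. f y) = (\<integral>x. f (reflect x) \<partial>NN)"
    using R.img.dom_sets by (simp add: set_integral_lebesgue_on integral_reflect)
  also have "\<dots> = (\<integral>x. F x \<partial>NN)"
    by (rule integral_dom_AE(1)[OF assms])
  finally show ?thesis using dom_sets by (simp add: set_integral_lebesgue_on)
qed

lemma H1_measurable:
  assumes "vtrace \<Omega> u G g"
  shows "u \<in> borel_measurable NN" "wgrad \<Omega> u \<in> borel_measurable NN"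
  using H1_wgrad(2,3)[OF vtrace_H1[OF assms]] by (auto simp: measurable_plane_iff measurable_mat_iff L2m_def)

lemma aform_Rf:
  assumes u: "vtrace \<Omega> u U g" and w: "vtrace \<Omega> w W h"
  shows "aform (reflect ` \<Omega>) (Rf u) (Rf w) = aform \<Omega> u w"
proof -
  note m = H1_measurable[OF u] H1_measurable[OF w]
  have "(LINT y:reflect ` \<Omega>|lebesgue. wgrad (reflect ` \<Omega>) (Rf u) y \<bullet> wgrad (reflect ` \<Omega>) (Rf w) y) = (LINT x:\<Omega>|lebesgue. wgrad \<Omega> u x \<bullet> wgrad \<Omega> w x)"
  proof (rule set_integral_reflect)
    show "AE x in NN. wgrad (reflect ` \<Omega>) (Rf u) (reflect x) \<bullet> wgrad (reflect ` \<Omega>) (Rf w) (reflect x) = wgrad \<Omega> u x \<bullet> wgrad \<Omega> w x"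
      using wgrad_Rf[OF u] wgrad_Rf[OF w] by eventually_elim (simp add: inner_reflect)
  qed (intro borel_measurable_inner m)
  moreover have "(LINT y:reflect ` \<Omega>|lebesgue. convection (reflect ` \<Omega>) (Rf u) y \<bullet> Rf w y) = (LINT x:\<Omega>|lebesgue. convection \<Omega> u x \<bullet> w x)"
  proof (rule set_integral_reflect)
    show "AE x in NN. convection (reflect ` \<Omega>) (Rf u) (reflect x) \<bullet> Rf w (reflect x) = convection \<Omega> u x \<bullet> w x"
      using wgrad_Rf[OF u] by eventually_elim (simp add: convection_def Rf_def reflect_reflect inner_reflect)
    show "(\<lambda>x. convection \<Omega> u x \<bullet> w x) \<in> borel_measurable NN"
      unfolding convection_def by (intro borel_measurable_inner measurable_matrix_vector m)
  qed
  ultimately show ?thesis by (simp add: aform_def)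
qed

lemma AE_hausdorff1_reflect: "AE x in hausdorff1. P x \<Longrightarrow> AE y in hausdorff1. P (reflect y)"
  by (rule lipschitz_homeo.AE_hausdorff1_comp) (rule diffeo.axioms(1)[OF diffeo_reflect])

lemma H1_zero_Rf:
  assumes "\<phi> \<in> H1_zero \<Omega>" shows "Rf \<phi> \<in> H1_zero (reflect ` \<Omega>)"
proof -
  interpret R: diffeo_dom reflect reflect 1 \<Omega> by (rule reflect_dom)
  obtain g where t: "is_trace \<Omega> \<phi> g" and z: "null_trace g"
    using assms by (auto simp: H1_zero_def ae_eq_on_def)
  note v = vtrace_Rf[OF is_trace_vtrace[OF t]]
  have "AE y in hausdorff1. y \<in> frontier (reflect ` \<Omega>) \<longrightarrow> Rf g y = 0"
    using AE_hausdorff1_reflect[OF z]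
  proof eventually_elim
    case (elim y)
    then show ?case unfolding R.frontier_image by (auto simp: Rf_def reflect_reflect linear_0[OF linear_reflect])
  qed
  then show ?thesis
    unfolding H1_zero_def ae_eq_on_def using R.img.vtrace_H1[OF v] R.img.vtrace_is_trace[OF v] by blast
qed

end

section \<open>Reflected weak solutions\<close>

context family begin

lemma closed_rect_sides: "frontier (rect L H) \<subseteq> side_b L H \<union> side_t L H \<union> side_l L H \<union> side_r L H"
proof
  fix x assume x: "x \<in> frontier (rect L H)"
  have "closure (rect L H) \<subseteq> Rect (-L) L (-H) H" by (rule closure_minimal[OF _ compact_Rect(2)]) (auto simp: rect_def Rect_def)
  then have "x \<in> Rect (-L) L (-H) H" "x \<notin> rect L H" using x open_rect by (auto simp: frontier_def interior_open)
  then show "x \<in> side_b L H \<union> side_t L H \<union> side_l L H \<union> side_r L H"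
    by (auto simp: Rect_def rect_def side_b_def side_t_def side_l_def side_r_def)
qed

definition bdata :: "real \<Rightarrow> (real \<Rightarrow> real) \<Rightarrow> (real \<Rightarrow> real) \<Rightarrow> plane \<Rightarrow> plane" where
  "bdata lam Vin Vout x = (if x \<in> side_l L H then (lam * Vin (x$2)) *\<^sub>R e1
     else if x \<in> side_r L H then (lam * Vout (x$2)) *\<^sub>R e1 else 0)"

lemma weak_solutionD:
  assumes "weak_solution L H (BB t) lam Vin Vout u p"
  obtains g where "is_sol (bdata lam Vin Vout) t u g"
    "AE y in hausdorff1. y \<in> side_b L H \<longrightarrow> g y = 0" "AE y in hausdorff1. y \<in> side_t L H \<longrightarrow> g y = 0"
    "AE y in hausdorff1. y \<in> side_l L H \<longrightarrow> g y = (lam * Vin (y$2)) *\<^sub>R e1"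
    "AE y in hausdorff1. y \<in> side_r L H \<longrightarrow> g y = (lam * Vout (y$2)) *\<^sub>R e1"
    "L2 (Om t) p" "(LINT x:Om t|lebesgue. p x) = 0"
    "\<forall>\<zeta>\<in>H1_zero (Om t). aform (Om t) u \<zeta> - (LINT x:Om t|lebesgue. p x * wdiv (Om t) \<zeta> x) = 0"
proof -
  interpret O: bdom "Om t" by (rule bdom_Om)
  note W = assms[unfolded weak_solution_def Let_def Om_def[symmetric] aform_def[symmetric]]
  from W obtain g where g: "is_trace (Om t) u g" "AE y in hausdorff1. y \<in> frontier (BB t) \<longrightarrow> g y = 0"
    "AE y in hausdorff1. y \<in> side_b L H \<longrightarrow> g y = 0" "AE y in hausdorff1. y \<in> side_t L H \<longrightarrow> g y = 0"
    "AE y in hausdorff1. y \<in> side_l L H \<longrightarrow> g y = (lam * Vin (y$2)) *\<^sub>R e1"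
    "AE y in hausdorff1. y \<in> side_r L H \<longrightarrow> g y = (lam * Vout (y$2)) *\<^sub>R e1"
    unfolding attains_data_def ae_eq_on_def Om_def[symmetric] by blast
  have div: "AE y in NO t. wdiv (Om t) u y = 0"
    using W unfolding V_star_def Om_def[symmetric] O.AE_dom by blast
  have weak: "\<forall>\<zeta>\<in>H1_zero (Om t). aform (Om t) u \<zeta> - (LINT x:Om t|lebesgue. p x * wdiv (Om t) \<zeta> x) = 0"
    using W by blast
  have p: "L2 (Om t) p" "(LINT x:Om t|lebesgue. p x) = 0" using W by (auto simp: L2_zero_def)
  have fr: "AE y in hausdorff1. y \<in> frontier (rect L H) \<longrightarrow> g y = bdata lam Vin Vout y"
    using g(3-6)
  proof eventually_elim
    case (elim y)
    then show ?case using closed_rect_sides by (auto simp: bdata_def)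
  qed
  have z: "aform (Om t) u \<phi> = 0" if \<phi>: "\<phi> \<in> H1_zero (Om t)" "AE y in NO t. wdiv (Om t) \<phi> y = 0" for \<phi>
  proof -
    have "(LINT x:Om t|lebesgue. p x * wdiv (Om t) \<phi> x) = 0"
      unfolding set_lebesgue_integral_def
      by (rule integral_eq_zero_AE) (use \<phi>(2) in \<open>auto simp: O.AE_dom indicator_def elim: eventually_mono\<close>)
    then show ?thesis using weak \<phi>(1) by simp
  qed
  have "is_sol (bdata lam Vin Vout) t u g"
    unfolding is_sol_def using O.is_trace_vtrace[OF g(1)] div g(2) fr z by blast
  then show thesis using that g(3-6) p weak by blast
qed

lemma reflect_Om: "reflect ` Om 0 = Om 1"
proof -
  have i: "inj reflect" by (metis injI reflect_reflect)
  have "reflect ` rect L H = rect L H"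
  proof
    show "reflect ` rect L H \<subseteq> rect L H" by (auto simp: rect_def reflect_nth)
    show "rect L H \<subseteq> reflect ` rect L H"
    proof
      fix y assume "y \<in> rect L H"
      then have "reflect y \<in> rect L H" by (auto simp: rect_def reflect_nth)
      then show "y \<in> reflect ` rect L H" by (metis image_eqI reflect_reflect)
    qed
  qed
  then show ?thesis unfolding Om_def image_set_diff[OF i] reflect_BB by simp
qed

text \<open>Reflection is an isometry under which Dirichlet form, convection, divergence and
  pressure term are invariant. The body goes over into its mirror image, and the lateral data return
  to themselves because the flow is even.\<close>

lemma reflected_solution:
  assumes even: "\<And>s. Vin (- s) = Vin s" "\<And>s. Vout (- s) = Vout s"
    and sol: "weak_solution L H (BB 0) lam Vin Vout u p"
  shows "weak_solution L H (BB 1) lam Vin Vout (Rf u) (\<lambda>y. p (reflect y))"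
proof -
  interpret O: bdom "Om 0" by (rule bdom_Om)
  interpret R: diffeo_dom reflect reflect 1 "Om 0" by (rule O.reflect_dom)
  interpret O1: bdom "Om 1" by (rule bdom_Om)
  have im1: "reflect ` Om 1 = Om 0" unfolding reflect_Om[symmetric] by (simp add: image_image reflect_reflect)
  obtain g where g: "is_sol (bdata lam Vin Vout) 0 u g"
    "AE y in hausdorff1. y \<in> side_b L H \<longrightarrow> g y = 0" "AE y in hausdorff1. y \<in> side_t L H \<longrightarrow> g y = 0"
    "AE y in hausdorff1. y \<in> side_l L H \<longrightarrow> g y = (lam * Vin (y$2)) *\<^sub>R e1"
    "AE y in hausdorff1. y \<in> side_r L H \<longrightarrow> g y = (lam * Vout (y$2)) *\<^sub>R e1"
    and p: "L2 (Om 0) p" "(LINT x:Om 0|lebesgue. p x) = 0"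
    and weak: "\<forall>\<zeta>\<in>H1_zero (Om 0). aform (Om 0) u \<zeta> - (LINT x:Om 0|lebesgue. p x * wdiv (Om 0) \<zeta> x) = 0"
    by (rule weak_solutionD[OF sol]) (rule that)
  have u: "vtrace (Om 0) u (wgrad (Om 0) u) g" and div: "AE y in NO 0. wdiv (Om 0) u y = 0"
    and gB: "AE y in hausdorff1. y \<in> frontier (BB 0) \<longrightarrow> g y = 0" using g(1) by (auto simp: is_sol_def)
  have Ru: "vtrace (Om 1) (Rf u) (\<lambda>y. Rm ** wgrad (Om 0) u (reflect y) ** Rm) (Rf g)"
    using O.vtrace_Rf[OF u] unfolding reflect_Om .
  note H1u = O1.vtrace_H1[OF Ru] and tr = O1.vtrace_is_trace[OF Ru]
  have "frontier (BB 1) = reflect ` frontier (BB 0)"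
  proof -
    have i: "inj reflect" by (metis injI reflect_reflect)
    show ?thesis
      unfolding reflect_BB[symmetric] frontier_def closure_injective_linear_image[OF linear_reflect i, symmetric]
        interior_injective_linear_image[OF linear_reflect i] image_set_diff[OF i] ..
  qed
  then have fB: "y \<in> frontier (BB 1) \<Longrightarrow> reflect y \<in> frontier (BB 0)" for y by (auto simp: reflect_reflect)
  have r0: "reflect 0 = 0" "reflect (r *\<^sub>R e1) = r *\<^sub>R e1" for r
    by (auto simp: vec_eq_iff forall_2 reflect_nth e1_def axis_def)
  note A = O.AE_hausdorff1_reflect
  have b: "AE y in hausdorff1. y \<in> frontier (BB 1) \<longrightarrow> Rf g y = 0"
    using A[OF gB] by eventually_elim (use fB in \<open>auto simp: Rf_def r0\<close>)
  \<comment> \<open>Bottom and top are exchanged, hence \<open>g(3)\<close> before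
    \<open>g(2)\<close> below; on the lateral sides \<open>e1\<close> is fixed and evenness
    applies.\<close>
  have sd: "AE y in hausdorff1. y \<in> side_b L H \<longrightarrow> Rf g y = 0" "AE y in hausdorff1. y \<in> side_t L H \<longrightarrow> Rf g y = 0"
    "AE y in hausdorff1. y \<in> side_l L H \<longrightarrow> Rf g y = (lam * Vin (y$2)) *\<^sub>R e1"
    "AE y in hausdorff1. y \<in> side_r L H \<longrightarrow> Rf g y = (lam * Vout (y$2)) *\<^sub>R e1"
    using A[OF g(3)] A[OF g(2)] A[OF g(4)] A[OF g(5)]
    by (eventually_elim, auto simp: Rf_def r0 reflect_nth side_b_def side_t_def side_l_def side_r_def even)+
  have dv: "AE y in NO 1. wdiv (Om 1) (Rf \<phi>) y = wdiv (Om 0) \<phi> (reflect y)" if "vtrace (Om 0) \<phi> G h" for \<phi> G h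
    using O.AE_reflect[OF O.wgrad_Rf[OF that]] unfolding reflect_reflect reflect_Om
    by eventually_elim (simp add: wdiv_def inner_reflect)
  have d1: "AE y in NO 1. wdiv (Om 1) (Rf u) y = 0"
    using dv[OF u] O.AE_reflect[OF div, unfolded reflect_Om] by eventually_elim simp
  have Vs: "Rf u \<in> V_star (rect L H) (BB 1)"
    unfolding V_star_def H1_star_def Om_def[symmetric] ae_eq_on_def using H1u tr b d1 by (auto simp: O1.AE_dom)
  have P: "(\<lambda>y. p (reflect y)) \<in> L2_zero (Om 1)"
  proof -
    have L: "L2m (NO 0) p" using p(1) by (simp add: O.L2_real_iff)
    have "(LINT y:Om 1|lebesgue. p (reflect y)) = (LINT x:Om 0|lebesgue. p x)"
      unfolding reflect_Om[symmetric] by (rule O.set_integral_reflect) (use L in \<open>auto simp: reflect_reflect L2m_def\<close>)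
    then show ?thesis using R.L2m_comp[OF L] p(2) unfolding reflect_Om by (simp add: L2_zero_def O1.L2_real_iff)
  qed
  have at: "attains_data L H (BB 1) lam Vin Vout (Rf u)"
    unfolding attains_data_def ae_eq_on_def Om_def[symmetric] using tr b sd by blast
  have "aform (Om 1) (Rf u) \<phi> - (LINT x:Om 1|lebesgue. p (reflect x) * wdiv (Om 1) \<phi> x) = 0" if \<phi>: "\<phi> \<in> H1_zero (Om 1)" for \<phi>
  proof -
    \<comment> \<open>Every test field on the mirror domain is the reflection of one on the original
      domain, because reflection is an involution.\<close>
    define \<zeta> where "\<zeta> = Rf \<phi>"
    have \<zeta>: "\<zeta> \<in> H1_zero (Om 0)" "Rf \<zeta> = \<phi>" using O1.H1_zero_Rf[OF \<phi>] by (simp_all add: \<zeta>_def im1 Rf_Rf)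
    then obtain h where "is_trace (Om 0) \<zeta> h" by (auto simp: H1_zero_def)
    then have v: "vtrace (Om 0) \<zeta> (wgrad (Om 0) \<zeta>) h" by (rule O.is_trace_vtrace)
    have "aform (Om 1) (Rf u) \<phi> = aform (Om 0) u \<zeta>" using O.aform_Rf[OF u v] unfolding \<zeta>(2) reflect_Om .
    moreover have "(LINT x:Om 1|lebesgue. p (reflect x) * wdiv (Om 1) \<phi> x) = (LINT x:Om 0|lebesgue. p x * wdiv (Om 0) \<zeta> x)"
      unfolding reflect_Om[symmetric]
    proof (rule O.set_integral_reflect)
      show "AE x in NO 0. p (reflect (reflect x)) * wdiv (reflect ` Om 0) \<phi> (reflect x) = p x * wdiv (Om 0) \<zeta> x"
        using O.wgrad_Rf[OF v] by eventually_elim (simp add: wdiv_def inner_reflect reflect_reflect \<zeta>(2))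
      have "(\<lambda>x. wdiv (Om 0) \<zeta> x) \<in> borel_measurable (NO 0)"
        unfolding wdiv_def trace_def sum_2
        using O.H1_measurable(2)[OF v] unfolding measurable_mat_iff by (intro borel_measurable_add) blast+
      then show "(\<lambda>x. p x * wdiv (Om 0) \<zeta> x) \<in> borel_measurable (NO 0)"
        using p(1) by (intro borel_measurable_times) (simp_all add: O.L2_iff)
    qed
    ultimately show ?thesis using weak \<zeta>(1) by simp
  qed
  then show ?thesis unfolding weak_solution_def Let_def Om_def[symmetric] aform_def[symmetric] using Vs P at by blast
qed

end

section \<open>Opposite lifts and the intermediate value argument\<close>

context solenoidal begin

text \<open>For an even stream function the horizontal derivative is even and the vertical one odd.
  Reflection changes the sign of the second component, so the field as a whole is reversed.\<close>

lemma Rf_wb: "Rf wb = (\<lambda>y. - wb y)"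
proof
  fix y
  have "pd j \<psi> y = pd j (\<lambda>x. reflect x $ 1) y * pd 1 \<psi> (reflect y) + pd j (\<lambda>x. reflect x $ 2) y * pd 2 \<psi> (reflect y)" for j
    using pd_comp[OF smooth_\<psi> smooth_reflect, of j y] unfolding \<psi>_even .
  then have "pd 1 \<psi> y = pd 1 \<psi> (reflect y)" "pd 2 \<psi> y = - pd 2 \<psi> (reflect y)" by (simp_all add: pd_reflect Rm_def)
  then show "Rf wb y = - wb y" by (simp add: Rf_def wb_def vec_eq_iff forall_2 reflect_nth)
qed

lemma aform_reflected:
  assumes u: "vtrace (Om 0) u G g" shows "aform (Om 1) (Rf u) wb = - aform (Om 0) u wb"
proof -
  interpret O: bdom "Om 0" by (rule bdom_Om)
  have s: "smooth (\<lambda>x. (- wb x) $ i)" for i using smooth_minus[OF smooth_wb] by simp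
  have "Dmat (\<lambda>x. - wb x) x = - Dmat wb x" for x
    unfolding Dmat_def using dir_deriv_diff[of "\<lambda>_. 0" x "\<lambda>x. wb x $ _"] smooth_differentiable[OF smooth_wb]
    by (simp add: vec_eq_iff dir_deriv_const)
  then have neg: "aform (Om 0) u (\<lambda>x. - wb x) = - aform (Om 0) u wb"
    unfolding O.aform_smooth[OF u s] O.aform_smooth[OF u smooth_wb] by simp
  have "aform (Om 1) (Rf u) (Rf (Rf wb)) = aform (Om 0) u (Rf wb)"
    unfolding reflect_Om[symmetric] by (rule O.aform_Rf[OF u]) (unfold Rf_wb, rule O.vtrace_smooth[OF s])
  then show ?thesis using neg by (simp add: Rf_Rf) (simp add: Rf_wb)
qed

lemma zero_lift:
  assumes even: "\<And>s. Vin (- s) = Vin s" "\<And>s. Vout (- s) = Vout s"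
    and ex: "\<And>t. \<exists>u p. weak_solution L H (BB t) lam Vin Vout u p"
    and S: "\<And>t u p. weak_solution L H (BB t) lam Vin Vout u p \<Longrightarrow> Lp_norm 2 (Om t) (wgrad (Om t) u) < S0 (Om t)"
  obtains t u p where "weak_solution L H (BB t) lam Vin Vout u p" "lift (rect L H) (BB t) u p = 0"
proof -
  obtain u0 p0 where s0: "weak_solution L H (BB 0) lam Vin Vout u0 p0" using ex by blast
  let ?W = "\<lambda>t u p. weak_solution L H (BB t) lam Vin Vout u p"
  \<comment> \<open>The velocity chosen at \<open>t = 1\<close> is the mirror image of the one at
    \<open>t = 0\<close>, so that the values of the functional at the two ends are opposite by
    construction.\<close>
  have "\<exists>u p. ?W t u p \<and> (t = 0 \<longrightarrow> u = u0) \<and> (t = 1 \<longrightarrow> u = Rf u0)" for t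
    using ex[of t] s0 reflected_solution[OF even s0] by (cases "t = 0"; cases "t = 1") auto
  then obtain u p where up: "\<And>t. ?W t (u t) (p t)" "u 0 = u0" "u 1 = Rf u0" by metis
  have "\<exists>g. is_sol (bdata lam Vin Vout) t (u t) g" for t by (rule weak_solutionD[OF up(1)[of t]]) (rule exI)
  then obtain g where g: "\<And>t. is_sol (bdata lam Vin Vout) t (u t) (g t)" by metis
  define \<Phi> where "\<Phi> t = aform (Om t) (u t) wb" for t
  have cont: "continuous_on {0..1} \<Phi>"
    unfolding \<Phi>_def[abs_def] by (rule functional_continuous[OF g S[OF up(1)] vtrace_smooth[OF smooth_wb] psh_wb])
  have v: "vtrace (Om t) (u t) (wgrad (Om t) (u t)) (g t)" for t using g[of t] by (simp add: is_sol_def)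
  have "\<Phi> 1 = - \<Phi> 0" using aform_reflected[OF v[of 0]] by (simp add: \<Phi>_def up)
  then have "\<exists>t. 0 \<le> t \<and> t \<le> 1 \<and> \<Phi> t = 0"
    using IVT'[of \<Phi> 0 0 1] IVT2'[of \<Phi> 1 0 0] cont by (cases "\<Phi> 0 \<le> 0") auto
  then obtain t where t: "\<Phi> t = 0" by blast
  have "lift (rect L H) (BB t) (u t) (p t) = - \<Phi> t"
  proof (rule weak_solutionD[OF up(1)[of t]])
    fix g' assume s: "is_sol (bdata lam Vin Vout) t (u t) g'" and P: "L2 (Om t) (p t)"
      and w: "\<forall>\<zeta>\<in>H1_zero (Om t). aform (Om t) (u t) \<zeta> - (LINT x:Om t|lebesgue. p t x * wdiv (Om t) \<zeta> x) = 0"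
    show ?thesis unfolding \<Phi>_def by (rule lift_eq[where g=g', OF _ _ P bspec[OF w]]) (use s in \<open>auto simp: is_sol_def\<close>)
  qed
  then show thesis using that[OF up(1)[of t]] t by simp
qed

end

section \<open>Even flow shapes\<close>

lemma AE_uminus: "AE x in lebesgue. P x \<Longrightarrow> AE x in lebesgue. P (- x :: real)"
proof -
  assume "AE x in lebesgue. P x"
  then obtain N where N: "\<forall>x. x \<notin> N \<longrightarrow> P x" "N \<in> null_sets lebesgue" by (auto elim!: AE_E3)
  then have "negligible N" by (simp add: negligible_iff_null_sets)
  then have "negligible (uminus ` N)" by (intro negligible_differentiable_image_negligible) (auto intro: differentiable_on_minus)
  then have "AE x in lebesgue. x \<notin> uminus ` N" unfolding negligible_iff_null_sets by (rule AE_not_in)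
  then show ?thesis
  proof eventually_elim
    case (elim x)
    then have "- x \<notin> N" by (metis image_eqI minus_minus)
    then show ?case using N(1) by blast
  qed
qed

lemma set_integral_uminus:
  fixes f :: "real \<Rightarrow> real"
  shows "(LINT x:{- H<..<H}|lebesgue. f (- x)) = (LINT x:{- H<..<H}|lebesgue. f x)"
proof -
  have "indicator {- H<..<H} (- x) = (indicator {- H<..<H} x :: real)" for x by (auto simp: indicator_def)
  then show ?thesis
    using lebesgue_integral_real_affine[of "- 1" "\<lambda>x. indicator {- H<..<H} x *\<^sub>R f x" 0] by (simp add: set_lebesgue_integral_def)
qed

lemma measurable_uminus: "(uminus :: real \<Rightarrow> real) \<in> lebesgue \<rightarrow>\<^sub>M lebesgue"
  using lebesgue_affine_measurable[where c = "\<lambda>x::real. - 1" and t = 0] by simp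

lemma loc_integrable_uminus:
  assumes "loc_integrable {- H<..<H} (f :: real \<Rightarrow> real)" shows "loc_integrable {- H<..<H} (\<lambda>s. f (- s))"
  unfolding loc_integrable_def
proof (intro allI impI)
  fix K assume K: "compact K \<and> K \<subseteq> {- H<..<H}"
  have "compact (uminus ` K)" "uminus ` K \<subseteq> {- H<..<H}" using K by (auto intro: compact_negations)
  then have "integrable lebesgue (\<lambda>x. indicator (uminus ` K) x *\<^sub>R f x)"
    using assms unfolding loc_integrable_def set_integrable_def by blast
  from lebesgue_integrable_real_affine[OF this, of "- 1" 0]
  have "integrable lebesgue (\<lambda>x. indicator (uminus ` K) (- x) *\<^sub>R f (- x))" by simp
  moreover have "indicator (uminus ` K) (- x) = (indicator K x :: real)" for x by (auto simp: indicator_def)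
  ultimately show "set_integrable lebesgue K (\<lambda>s. f (- s))" by (simp add: set_integrable_def)
qed

lemma test_fun_uminus:
  fixes \<phi> :: "real \<Rightarrow> real"
  assumes "test_fun {- H<..<H} \<phi>"
  shows "test_fun {- H<..<H} (\<lambda>s. \<phi> (- s))" "dd (\<lambda>s. \<phi> (- s)) s = - dd \<phi> (- s)"
proof -
  have \<phi>: "smooth \<phi>" "compact (closure {x. \<phi> x \<noteq> 0})" "closure {x. \<phi> x \<noteq> 0} \<subseteq> {- H<..<H}" using assms by (auto simp: test_fun_def)
  have "smooth (\<lambda>s. \<phi> (- s))" by (rule smooth_comp_real[OF \<phi>(1) smooth_minus[OF smooth_ident]])
  moreover have K: "compact (uminus ` closure {x. \<phi> x \<noteq> 0})" by (rule compact_negations[OF \<phi>(2)])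
  moreover have sub: "closure {x. \<phi> (- x) \<noteq> 0} \<subseteq> uminus ` closure {x. \<phi> x \<noteq> 0}"
  proof (rule closure_minimal[OF _ compact_imp_closed[OF K]])
    show "{x. \<phi> (- x) \<noteq> 0} \<subseteq> uminus ` closure {x. \<phi> x \<noteq> 0}"
      using closure_subset[of "{x. \<phi> x \<noteq> 0}"] by (auto intro!: image_eqI[where x = "- _"])
  qed
  moreover have "uminus ` closure {x. \<phi> x \<noteq> 0} \<subseteq> {- H<..<H}" using \<phi>(3) by auto
  moreover have "compact (closure {x. \<phi> (- x) \<noteq> 0})"
    using compact_Int_closed[OF K closed_closure[of "{x. \<phi> (- x) \<noteq> 0}"]] sub by (simp add: Int_absorb1)
  ultimately show "test_fun {- H<..<H} (\<lambda>s. \<phi> (- s))" unfolding test_fun_def by blast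
  have "((\<lambda>s. \<phi> (- s)) has_real_derivative dd \<phi> (- s) * (- 1)) (at s)"
    by (rule DERIV_chain2[OF dd_has_derivative[OF \<phi>(1)]]) (auto intro!: derivative_eq_intros)
  then show "dd (\<lambda>s. \<phi> (- s)) s = - dd \<phi> (- s)"
    by (simp add: dir_deriv_eq[OF has_field_derivative_imp_has_derivative])
qed

lemma weak_deriv_uminus:
  fixes V W :: "real \<Rightarrow> real"
  assumes "is_weak_deriv {- H<..<H} 1 V W"
  shows "is_weak_deriv {- H<..<H} 1 (\<lambda>s. V (- s)) (\<lambda>s. - W (- s))"
proof -
  have l: "loc_integrable {- H<..<H} V" "loc_integrable {- H<..<H} W" using assms by (auto simp: is_weak_deriv_def)
  have "loc_integrable {- H<..<H} (\<lambda>s. - W (- s))"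
    using loc_integrable_diff[OF loc_integrable_continuous[OF continuous_on_const[of UNIV 0]] loc_integrable_uminus[OF l(2)]] by simp
  moreover have "(LINT x:{- H<..<H}|lebesgue. V (- x) * dd \<phi> x) = - (LINT x:{- H<..<H}|lebesgue. - W (- x) * \<phi> x)"
    if t: "test_fun {- H<..<H} \<phi>" for \<phi>
  proof -
    have "(LINT x:{- H<..<H}|lebesgue. V (- x) * dd \<phi> x) = (LINT x:{- H<..<H}|lebesgue. V x * dd \<phi> (- x))"
      using set_integral_uminus[of H "\<lambda>x. V x * dd \<phi> (- x)"] by simp
    also have "\<dots> = - (LINT x:{- H<..<H}|lebesgue. V x * dd (\<lambda>s. \<phi> (- s)) x)"
      by (simp add: test_fun_uminus(2)[OF t] set_lebesgue_integral_def)
    also have "\<dots> = (LINT x:{- H<..<H}|lebesgue. W x * \<phi> (- x))"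
      using assms test_fun_uminus(1)[OF t] by (simp add: is_weak_deriv_def)
    also have "\<dots> = - (LINT x:{- H<..<H}|lebesgue. - W (- x) * \<phi> x)"
      using set_integral_uminus[of H "\<lambda>x. W x * \<phi> (- x)"] by (simp add: set_lebesgue_integral_def)
    finally show ?thesis .
  qed
  ultimately show ?thesis unfolding is_weak_deriv_def using loc_integrable_uminus[OF l(1)] by simp
qed

lemma weak_deriv_mean:
  assumes b: "b \<in> Basis" and f: "is_weak_deriv S b f g" and f': "is_weak_deriv S b f' g'"
  shows "is_weak_deriv S b (\<lambda>x. (f x + f' x) / 2) (\<lambda>x. (g x + g' x) / 2)"
proof -
  have l: "loc_integrable S f" "loc_integrable S g" "loc_integrable S f'" "loc_integrable S g'" using f f' by (auto simp: is_weak_deriv_def)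
  have m: "loc_integrable S (\<lambda>x. (h x + h' x) / 2)" if "loc_integrable S h" "loc_integrable S h'" for h h'
    unfolding loc_integrable_def
  proof (intro allI impI)
    fix K assume "compact K \<and> K \<subseteq> S"
    then have "set_integrable lebesgue K h" "set_integrable lebesgue K h'" using that by (auto simp: loc_integrable_def)
    then show "set_integrable lebesgue K (\<lambda>x. (h x + h' x) / 2)" by (intro set_integrable_divide set_integral_add) auto
  qed
  have "(LINT x:S|lebesgue. (f x + f' x) / 2 * dir_deriv b \<phi> x) = - (LINT x:S|lebesgue. (g x + g' x) / 2 * \<phi> x)" if t: "test_fun S \<phi>" for \<phi>
  proof -
    note i = loc_integrable_test_integrable[OF _ t b]
    have mean: "(LINT x:S|lebesgue. (h x + h' x) / 2 * k x) = ((LINT x:S|lebesgue. h x * k x) + (LINT x:S|lebesgue. h' x * k x)) / 2"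
      if "set_integrable lebesgue S (\<lambda>x. h x * k x)" "set_integrable lebesgue S (\<lambda>x. h' x * k x)" for h h' k :: "'a \<Rightarrow> real"
    proof -
      have "(LINT x:S|lebesgue. (h x + h' x) / 2 * k x) = (LINT x:S|lebesgue. (h x * k x + h' x * k x) / 2)" by (simp add: field_simps)
      also have "\<dots> = (LINT x:S|lebesgue. h x * k x + h' x * k x) / 2" by simp
      finally show ?thesis using set_integral_add(2)[OF that] by simp
    qed
    have "(LINT x:S|lebesgue. f x * dir_deriv b \<phi> x) = - (LINT x:S|lebesgue. g x * \<phi> x)"
      "(LINT x:S|lebesgue. f' x * dir_deriv b \<phi> x) = - (LINT x:S|lebesgue. g' x * \<phi> x)"
      using f f' t by (auto simp: is_weak_deriv_def)
    moreover have "(k :: real) = - l \<Longrightarrow> k' = - l' \<Longrightarrow> (k + k') / 2 = - ((l + l') / 2)" for k k' l l' by (simp add: add_divide_distrib)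
    ultimately show ?thesis
      unfolding mean[OF i(2)[OF l(1)] i(2)[OF l(3)]] mean[OF i(1)[OF l(2)] i(1)[OF l(4)]] by blast
  qed
  then show ?thesis unfolding is_weak_deriv_def using m l by blast
qed

text \<open>Every essential bound of \<open>f\<close> also bounds the mean. The sign
  \<open>\<sigma> = 1\<close> is for the flow shape and \<open>-1\<close> for its weak derivative,
  as reflection reverses derivatives.\<close>

lemma Linf_mean:
  fixes f :: "real \<Rightarrow> real"
  assumes f: "Linf {- H<..<H} f" and \<sigma>: "\<bar>\<sigma>\<bar> = 1"
  shows "Linf {- H<..<H} (\<lambda>s. (f s + \<sigma> * f (- s)) / 2)" "Linf_norm {- H<..<H} (\<lambda>s. (f s + \<sigma> * f (- s)) / 2) \<le> Linf_norm {- H<..<H} f"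
proof -
  let ?I = "{- H<..<H} :: real set" and ?g = "\<lambda>s. (f s + \<sigma> * f (- s)) / 2"
  have sub: "ess_bounds ?I f \<subseteq> ess_bounds ?I ?g"
  proof
    fix C assume C: "C \<in> ess_bounds ?I f"
    then have 1: "AE x in lebesgue. x \<in> ?I \<longrightarrow> \<bar>f x\<bar> \<le> C" by (simp add: ess_bounds_def)
    have "AE x in lebesgue. x \<in> ?I \<longrightarrow> \<bar>?g x\<bar> \<le> C"
      using 1 AE_uminus[OF 1]
    proof eventually_elim
      case (elim x)
      have "\<bar>\<sigma> * f (- x)\<bar> = \<bar>f (- x)\<bar>" using \<sigma> by (simp add: abs_mult)
      then show ?case using elim by auto
    qed
    then show "C \<in> ess_bounds ?I ?g" using C by (simp add: ess_bounds_def)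
  qed
  have ne: "ess_bounds ?I f \<noteq> {}" using f by (simp add: Linf_def)
  show "Linf_norm ?I ?g \<le> Linf_norm ?I f"
    unfolding Linf_norm_def by (rule cInf_superset_mono[OF ne _ sub]) (auto simp: ess_bounds_def intro: bdd_belowI[of _ 0])
  have m: "(\<lambda>x. indicator ?I x *\<^sub>R f x) \<in> borel_measurable lebesgue" using f by (simp add: Linf_def set_borel_measurable_def)
  have "(\<lambda>x. indicator ?I (- x) *\<^sub>R f (- x)) \<in> borel_measurable lebesgue"
    using measurable_comp[OF measurable_uminus m] by (simp add: comp_def)
  then have "(\<lambda>x. (indicator ?I x *\<^sub>R f x + \<sigma> * (indicator ?I (- x) *\<^sub>R f (- x))) / 2) \<in> borel_measurable lebesgue"
    using m by (intro borel_measurable_divide borel_measurable_add borel_measurable_times borel_measurable_const)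
  also have "(\<lambda>x. (indicator ?I x *\<^sub>R f x + \<sigma> * (indicator ?I (- x) *\<^sub>R f (- x))) / 2) = (\<lambda>x. indicator ?I x *\<^sub>R ?g x)"
  proof
    fix x show "(indicator ?I x *\<^sub>R f x + \<sigma> * (indicator ?I (- x) *\<^sub>R f (- x))) / 2 = indicator ?I x *\<^sub>R ?g x"
      by (cases "x \<in> ?I") auto
  qed
  finally show "Linf ?I ?g" using ne sub unfolding Linf_def set_borel_measurable_def by blast
qed

lemma Linf_norm_cong_AE: "AE x in lebesgue. x \<in> S \<longrightarrow> f x = g x \<Longrightarrow> Linf_norm S f = Linf_norm S g"
proof -
  assume ae: "AE x in lebesgue. x \<in> S \<longrightarrow> f x = g x"
  have "(AE x in lebesgue. x \<in> S \<longrightarrow> \<bar>f x\<bar> \<le> C) \<longleftrightarrow> (AE x in lebesgue. x \<in> S \<longrightarrow> \<bar>g x\<bar> \<le> C)" for C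
    by (rule eventually_subst) (use ae in \<open>eventually_elim, auto\<close>)
  then show ?thesis by (simp add: Linf_norm_def ess_bounds_def)
qed

lemma W1inf_mean:
  assumes V: "W1inf (- H) H V"
  shows "W1inf (- H) H (\<lambda>s. (V s + V (- s)) / 2)" "W1inf_norm (- H) H (\<lambda>s. (V s + V (- s)) / 2) \<le> W1inf_norm (- H) H V"
proof -
  let ?I = "{- H<..<H} :: real set" and ?V = "\<lambda>s. (V s + V (- s)) / 2"
  have c: "continuous_on {- H..H} V" using V by (simp add: W1inf_def)
  have L: "Linf ?I V" using V by (simp add: W1inf_def)
  obtain W where W: "is_weak_deriv ?I 1 V W" "Linf ?I W" using V by (auto simp: W1inf_def)
  let ?W = "\<lambda>s. (W s + - 1 * W (- s)) / 2"
  have dW: "is_weak_deriv ?I 1 ?V ?W" using weak_deriv_mean[OF _ W(1) weak_deriv_uminus[OF W(1)]] by simp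
  have LV: "Linf ?I ?V" "Linf_norm ?I ?V \<le> Linf_norm ?I V" using Linf_mean[OF L, of 1] by simp_all
  note LW = Linf_mean[OF W(2), of "- 1", simplified abs_minus_cancel abs_one, OF refl]
  have "continuous_on {- H..H} (\<lambda>s. V (- s))"
    by (rule continuous_on_compose2[OF c]) (auto intro!: continuous_intros)
  then have "continuous_on {- H..H} ?V" using c by (intro continuous_intros) auto
  then show "W1inf (- H) H ?V" using LV dW LW(1) unfolding W1inf_def by blast
  have o: "open ?I" "(1::real) \<in> Basis" by auto
  \<comment> \<open>The norm refers to the chosen representative \<open>weak_deriv\<close>;
    uniqueness almost everywhere allows it to be computed with \<open>?W\<close>.\<close>
  have "Linf_norm ?I (weak_deriv ?I 1 ?V) = Linf_norm ?I ?W" by (rule Linf_norm_cong_AE[OF weak_deriv_eq_AE[OF o dW]])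
  moreover have "Linf_norm ?I (weak_deriv ?I 1 V) = Linf_norm ?I W" by (rule Linf_norm_cong_AE[OF weak_deriv_eq_AE[OF o W(1)]])
  ultimately show "W1inf_norm (- H) H ?V \<le> W1inf_norm (- H) H V" using LV(2) LW(2) unfolding W1inf_norm_def by linarith
qed

lemma even_flow_shape:
  assumes "flow_shapes H r \<noteq> {}"
  obtains Vin Vout where "(Vin, Vout) \<in> flow_shapes H r" "\<And>s. Vin (- s) = Vin s" "\<And>s. Vout (- s) = Vout s"
proof -
  obtain V0 V1 where V: "(V0, V1) \<in> flow_shapes H r" using assms by auto
  let ?m = "\<lambda>V s. (V s + V (- s)) / (2 :: real)"
  have F: "W1inf (- H) H V0" "W1inf (- H) H V1" "W1inf_norm (- H) H V0 + W1inf_norm (- H) H V1 \<le> r"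
     "V0 (- H) = 0" "V0 H = 0" "V1 (- H) = 0" "V1 H = 0"
     "(LINT s:{- H<..<H}|lebesgue. V0 s) = 1" "(LINT s:{- H<..<H}|lebesgue. V1 s) = 1"
    using V by (auto simp: flow_shapes_def)
  have one: "(LINT s:{- H<..<H}|lebesgue. ?m W s) = 1" if W: "(LINT s:{- H<..<H}|lebesgue. W s) = 1" for W
  proof -
    \<comment> \<open>Integrability is read off from the value 1: a non-integrable function would
      have integral zero by convention.\<close>
    have i: "integrable lebesgue (\<lambda>x. indicator {- H<..<H} x *\<^sub>R W x)"
      using W not_integrable_integral_eq unfolding set_lebesgue_integral_def by fastforce
    have ind: "indicator {- H<..<H} (- x) = (indicator {- H<..<H} x :: real)" for x by (auto simp: indicator_def)
    have "set_integrable lebesgue {- H<..<H} W" "set_integrable lebesgue {- H<..<H} (\<lambda>s. W (- s))"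
      using i lebesgue_integrable_real_affine[OF i, of "- 1" 0] by (simp_all add: set_integrable_def ind)
    then have "(LINT s:{- H<..<H}|lebesgue. W s + W (- s)) = 2"
      using set_integral_add(2)[of lebesgue "{- H<..<H}" W "\<lambda>s. W (- s)"] W set_integral_uminus[of H W] by simp
    then show ?thesis by simp
  qed
  show thesis
  proof
    show "(?m V0, ?m V1) \<in> flow_shapes H r"
      using W1inf_mean[OF F(1)] W1inf_mean[OF F(2)] F(3-7) one[OF F(8)] one[OF F(9)] by (simp add: flow_shapes_def)
  qed (simp_all add: add.commute)
qed

section \<open>Choice of the family\<close>

lemma smooth_compact_bound:
  assumes f: "smooth f" and z: "\<And>s. s \<le> p \<or> q \<le> s \<Longrightarrow> f s = (0 :: real)"
  obtains M where "0 \<le> M" "\<And>s. \<bar>f s\<bar> \<le> M" "\<And>s. \<bar>dd f s\<bar> \<le> M"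
proof -
  have b: "\<exists>M. \<forall>s\<in>{p..q}. \<bar>h s\<bar> \<le> M" if h: "smooth h" for h
  proof -
    have "bounded (h ` {p..q})"
      by (intro compact_imp_bounded compact_continuous_image smooth_continuous_on h) simp
    then show ?thesis by (auto simp: bounded_iff)
  qed
  obtain M1 M2 where M: "\<forall>s\<in>{p..q}. \<bar>f s\<bar> \<le> M1" "\<forall>s\<in>{p..q}. \<bar>dd f s\<bar> \<le> M2" using b[OF f] b[OF smooth_dd[OF f]] by blast
  have dz: "dd f s = 0" if "s < p \<or> q < s" for s
  proof -
    have "dd f s = dd (\<lambda>_. 0) s" by (rule smooth_locally_eq[OF f smooth_const, of "{..<p} \<union> {q<..}"]) (use that z in auto)
    then show ?thesis by (simp add: dir_deriv_const)
  qed
  have le: "\<bar>h s\<bar> \<le> \<bar>M1\<bar> + \<bar>M2\<bar>" if "h = f \<or> h = dd f" for h s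
  proof (cases "s \<in> {p..q}")
    case True
    then have "\<bar>f s\<bar> \<le> M1" "\<bar>dd f s\<bar> \<le> M2" using M by auto
    then show ?thesis using that by auto
  next
    case False
    then have "f s = 0" "dd f s = 0" using z[of s] dz[of s] by auto
    then show ?thesis using that by auto
  qed
  show thesis by (rule that[of "\<bar>M1\<bar> + \<bar>M2\<bar>"]) (use le in auto)
qed

lemma shift_exists:
  assumes f: "smooth f" "\<And>s. s \<le> p \<or> q \<le> s \<Longrightarrow> f s = 0" and g: "smooth g" "\<And>s. s \<le> p \<or> q \<le> s \<Longrightarrow> g s = 0"
    and k: "smooth k" "\<And>s. s \<le> p' \<or> q' \<le> s \<Longrightarrow> k s = 0" and \<delta>: "0 < \<delta>"
  shows "\<exists>e M. 0 < e \<and> e \<le> \<delta> \<and> (\<forall>t. shift (\<lambda>s. e * (cos (pi * t) * f s + sin (pi * t) * g s)) k M)"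
proof -
  obtain Mf where Mf: "0 \<le> Mf" "\<And>s. \<bar>f s\<bar> \<le> Mf" "\<And>s. \<bar>dd f s\<bar> \<le> Mf" using smooth_compact_bound[OF f] by blast
  obtain Mg where Mg: "0 \<le> Mg" "\<And>s. \<bar>g s\<bar> \<le> Mg" "\<And>s. \<bar>dd g s\<bar> \<le> Mg" using smooth_compact_bound[OF g] by blast
  obtain Mk where Mk: "0 \<le> Mk" "\<And>s. \<bar>k s\<bar> \<le> Mk" "\<And>s. \<bar>dd k s\<bar> \<le> Mk" using smooth_compact_bound[OF k] by blast
  define M where "M = 1 + Mf + Mg + Mk"
  \<comment> \<open>The combination of \<open>f\<close> and \<open>g\<close> is at most
    \<open>2 * M\<close>, so its product with the derivative of \<open>k\<close> is at most
    \<open>2 * e * M * M\<close>, and this choice of \<open>e\<close> makes that at most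
    \<open>1/2\<close>.\<close>
  define e where "e = min \<delta> (1 / (4 * M * M))"
  have M: "1 \<le> M" "Mf \<le> M" "Mg \<le> M" "Mk \<le> M" using Mf Mg Mk by (auto simp: M_def)
  have MM: "1 \<le> M * M" using mult_mono[of 1 M 1 M] M by simp
  have e: "0 < e" "e \<le> \<delta>" "e * (2 * M * M) \<le> 1 / 2"
  proof -
    show "0 < e" "e \<le> \<delta>" using \<delta> MM by (auto simp: e_def mult.assoc)
    have "e * (2 * M * M) \<le> 1 / (4 * M * M) * (2 * M * M)" by (rule mult_right_mono) (use MM in \<open>auto simp: e_def mult.assoc\<close>)
    also have "\<dots> = 1 / 2" using M by (simp add: field_simps)
    finally show "e * (2 * M * M) \<le> 1 / 2" .
  qed
  have comb: "\<bar>e * (cos (pi * t) * x + sin (pi * t) * y)\<bar> \<le> e * (2 * M)" if "\<bar>x\<bar> \<le> M" "\<bar>y\<bar> \<le> M" for x y t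
  proof -
    have "\<bar>cos (pi * t) * x\<bar> \<le> 1 * M" "\<bar>sin (pi * t) * y\<bar> \<le> 1 * M" unfolding abs_mult by (intro mult_mono that; simp)+
    then have "\<bar>cos (pi * t) * x + sin (pi * t) * y\<bar> \<le> 2 * M" by linarith
    then show ?thesis using e(1) by (simp add: abs_mult)
  qed
  have eM: "e * (2 * M) \<le> M"
  proof -
    have "e * (2 * M) \<le> e * (2 * M * M)" using e(1) M by (intro mult_left_mono) auto
    then show ?thesis using e(3) M by linarith
  qed
  have "shift (\<lambda>s. e * (cos (pi * t) * f s + sin (pi * t) * g s)) k M" for t
  proof
    show "smooth (\<lambda>s. e * (cos (pi * t) * f s + sin (pi * t) * g s))"
      by (intro smooth_mult smooth_add smooth_const f g)
    show "\<bar>e * (cos (pi * t) * f s + sin (pi * t) * g s)\<bar> \<le> M" for s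
      by (rule order_trans[OF comb eM]) (use Mf(2)[of s] Mg(2)[of s] M in linarith)+
    show "\<bar>dd (\<lambda>s. e * (cos (pi * t) * f s + sin (pi * t) * g s)) s\<bar> \<le> M" for s
      unfolding dd_lincomb[OF f(1) g(1)] by (rule order_trans[OF comb eM]) (use Mf(3)[of s] Mg(3)[of s] M in linarith)+
    show "\<bar>k s\<bar> \<le> M" "\<bar>dd k s\<bar> \<le> M" for s using Mk(2,3)[of s] M by linarith+
    fix s s'
    have "\<bar>dd k s'\<bar> * \<bar>e * (cos (pi * t) * f s + sin (pi * t) * g s)\<bar> \<le> M * (e * (2 * M))"
      by (intro mult_mono comb) (use Mk(3)[of s'] Mf(2)[of s] Mg(2)[of s] M in auto)
    also have "\<dots> \<le> 1 / 2" using e(3) by (simp add: mult_ac)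
    finally show "\<bar>dd k s' * (e * (cos (pi * t) * f s + sin (pi * t) * g s))\<bar> \<le> 1 / 2" by (simp add: abs_mult)
  qed (use k M in auto)
  then show ?thesis using e by blast
qed

text \<open>Symmetry puts the centre on the axis: the reflections of the topmost and the lowest
  point above and below the centre still lie in \<open>D\<close>. The strict inequalities come from
  two corners lying in the open rectangle.\<close>

lemma symmetric_rectangle:
  assumes D: "closed_homothetic D (rect L H)" "D \<subseteq> rect L H" "x1_symmetric D" and LH: "0 < L" "0 < H"
  obtains a b c where "0 < a" "0 < b" "D = Rect (c - a) (c + a) (- b) b" "- L < c - a" "c + a < L" "b < H"
proof -
  obtain z \<tau> where z: "0 < \<tau>" "D = (\<lambda>x. z + \<tau> *\<^sub>R x) ` closure (rect L H)" using D(1) by (auto simp: closed_homothetic_def)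
  have "rect L H = box (pt (- L) (- H)) (pt L H)" by (auto simp: rect_def mem_box Basis_plane inner_axis)
  moreover have "box (pt (- L) (- H)) (pt L H) \<noteq> {}" using LH by (auto simp: box_ne_empty Basis_plane inner_axis)
  ultimately have cl: "closure (rect L H) = Rect (- L) L (- H) H" by (simp add: Rect_cbox)
  have mem: "x \<in> D \<longleftrightarrow> \<bar>x$1 - z$1\<bar> \<le> \<tau> * L \<and> \<bar>x$2 - z$2\<bar> \<le> \<tau> * H" for x
  proof
    assume "x \<in> D"
    then obtain y where y: "x = z + \<tau> *\<^sub>R y" "y \<in> Rect (- L) L (- H) H" unfolding z(2) cl by blast
    have "\<bar>\<tau> * y$1\<bar> \<le> \<tau> * L" "\<bar>\<tau> * y$2\<bar> \<le> \<tau> * H"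
      using y(2) z(1) by (auto simp: abs_mult Rect_def abs_le_iff)
    then show "\<bar>x$1 - z$1\<bar> \<le> \<tau> * L \<and> \<bar>x$2 - z$2\<bar> \<le> \<tau> * H" using y(1) by simp
  next
    assume x: "\<bar>x$1 - z$1\<bar> \<le> \<tau> * L \<and> \<bar>x$2 - z$2\<bar> \<le> \<tau> * H"
    have "(1 / \<tau>) *\<^sub>R (x - z) \<in> Rect (- L) L (- H) H"
      using x z(1) by (auto simp: Rect_def abs_le_iff field_simps)
    moreover have "x = z + \<tau> *\<^sub>R ((1 / \<tau>) *\<^sub>R (x - z))" using z(1) by simp
    ultimately show "x \<in> D" unfolding z(2) cl by (rule image_eqI[rotated])
  qed
  have sym: "x \<in> D \<Longrightarrow> reflect x \<in> D" for x using D(3) unfolding x1_symmetric_def by blast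
  have pos: "0 < \<tau> * L" "0 < \<tau> * H" using z(1) LH by auto
  have "pt (z$1) (z$2 + \<tau> * H) \<in> D" "pt (z$1) (z$2 - \<tau> * H) \<in> D" unfolding mem using pos by auto
  then have "reflect (pt (z$1) (z$2 + \<tau> * H)) \<in> D" "reflect (pt (z$1) (z$2 - \<tau> * H)) \<in> D" using sym by blast+
  then have z2: "z$2 = 0" unfolding mem by (simp add: reflect_nth abs_le_iff)
  have De: "D = Rect (z$1 - \<tau> * L) (z$1 + \<tau> * L) (- (\<tau> * H)) (\<tau> * H)"
    using z2 by (auto simp: mem Rect_def abs_le_iff)
  have "pt (z$1 - \<tau> * L) (\<tau> * H) \<in> D" "pt (z$1 + \<tau> * L) (\<tau> * H) \<in> D" unfolding De using pos by (auto simp: Rect_def)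
  then have "pt (z$1 - \<tau> * L) (\<tau> * H) \<in> rect L H" "pt (z$1 + \<tau> * L) (\<tau> * H) \<in> rect L H" using D(2) by blast+
  then show thesis using that[OF pos De] by (simp add: rect_def)
qed

theorem theorem3p1:
  fixes L H \<alpha> r \<Lambda> lam :: real and D :: "(real^2) set"
  assumes "0 < H" and "H < L"
    and "closed_homothetic D (rect L H)" and "D \<subseteq> rect L H" and "x1_symmetric D"
    and "0 < \<alpha>" and "\<alpha> < measure lebesgue D"
    and "0 < r" and "flow_shapes H r \<noteq> {}"
    and "is_threshold L H D \<alpha> r \<Lambda>"
    and "lam \<in> {0..\<Lambda>}"
  shows "\<exists>B\<in>bodies \<alpha> D. \<exists>(Vin, Vout)\<in>flow_shapes H r.
           (\<not> x1_symmetric B \<or> \<not> even_flow H Vin Vout) \<and>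
           has_unique_pair (rect L H - B)
             (\<lambda>u p. weak_solution L H B lam Vin Vout u p \<and> lift (rect L H) B u p = 0)"
proof -
  have L: "0 < L" using assms(1,2) by simp
  obtain a b c where D: "0 < a" "0 < b" "D = Rect (c - a) (c + a) (- b) b" "- L < c - a" "c + a < L" "b < H"
    by (rule symmetric_rectangle[OF assms(3-5) L assms(1)])
  obtain Vin Vout where V: "(Vin, Vout) \<in> flow_shapes H r" "\<And>s. Vin (- s) = Vin s" "\<And>s. Vout (- s) = Vout s"
    using even_flow_shape[OF assms(9)] by blast
  define m where "m = \<alpha> / (4 * a)"
  have \<alpha>: "\<alpha> = 4 * a * m" using D(1) by (simp add: m_def)
  have "measure lebesgue D = (c + a - (c - a)) * (b - - b)" unfolding D(3) by (rule measure_Rect) (use D in auto)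
  then have "\<alpha> < (2 * a) * (2 * b)" using assms(7) by (simp only:) simp
  then have m: "0 < m" "m < b" using assms(6) D(1) by (simp_all add: m_def field_simps)
  \<comment> \<open>Midpoints between the sides of \<open>D\<close> and those of the outer
    rectangle, leaving room for the cut-offs on either side.\<close>
  define p1 where "p1 = (c - a - L) / 2"
  define q1 where "q1 = (c + a + L) / 2"
  define h1 where "h1 = (b + H) / 2"
  have o: "- L < p1" "p1 < c - a" "c + a < q1" "q1 < L" "m < h1" "h1 < H" "- h1 < - m" using D m by (auto simp: p1_def q1_def h1_def)
  have aa: "c - a \<le> c + a" "- m \<le> m" using D m by auto
  obtain cut1 where c1: "smooth cut1" "\<And>s. s \<le> p1 \<or> q1 \<le> s \<Longrightarrow> cut1 s = 0" "\<And>s. c - a \<le> s \<Longrightarrow> s \<le> c + a \<Longrightarrow> cut1 s = 1"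
    using smooth_plateau[OF o(2) aa(1) o(3)] by blast
  obtain cut2 where c2: "smooth cut2" "\<And>s. s \<le> - h1 \<or> h1 \<le> s \<Longrightarrow> cut2 s = 0" "\<And>s. - m \<le> s \<Longrightarrow> s \<le> m \<Longrightarrow> cut2 s = 1"
    using smooth_plateau[OF o(7) aa(2) o(5)] by blast
  have "smooth (\<lambda>s. cut1 s * (s - c))" "0 < (b - m) / (a + 1)"
    using m D by (auto intro!: smooth_mult smooth_diff c1 smooth_ident smooth_const)
  then have "\<exists>e M. 0 < e \<and> e \<le> (b - m) / (a + 1) \<and> (\<forall>t. shift (\<lambda>s. e * (cos (pi * t) * (cut1 s * (s - c)) + sin (pi * t) * cut1 s)) cut2 M)"
    by (intro shift_exists[where p = p1 and q = q1 and p' = "- h1" and q' = h1] c1(1) c2(1)) (use c1(2) c2(2) in auto)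
  then obtain e M where e: "0 < e" "e \<le> (b - m) / (a + 1)"
    and sh: "\<And>t. shift (\<lambda>s. e * (cos (pi * t) * (cut1 s * (s - c)) + sin (pi * t) * cut1 s)) cut2 M" by blast
  have e': "e * (a + 1) \<le> b - m" using e D(1) by (simp add: field_simps)
  interpret family L H c a b m e M p1 q1 h1 cut1 cut2
    by (rule family.intro) (use D m o c1 c2 e e' sh in auto)
  \<comment> \<open>Further points between \<open>- L\<close> and \<open>p1\<close> and between
    \<open>q1\<close> and \<open>L\<close>: the factor is one on a neighbourhood of the shifted
    region and zero near the lateral sides.\<close>
  obtain s1 where s1: "smooth s1" "\<And>s. s \<le> (p1 - 3 * L) / 4 \<or> (q1 + 3 * L) / 4 \<le> s \<Longrightarrow> s1 s = 0" "\<And>s. (p1 - L) / 2 \<le> s \<Longrightarrow> s \<le> (q1 + L) / 2 \<Longrightarrow> s1 s = 1"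
    using smooth_plateau[of "(p1 - 3 * L) / 4" "(p1 - L) / 2" "(q1 + L) / 2" "(q1 + 3 * L) / 4"] o D by auto
  define h2 where "h2 = (h1 + H) / 2"
  define h3 where "h3 = (h2 + H) / 2"
  have "h1 < h2" "h2 < h3" "h3 < H" using o by (auto simp: h2_def h3_def)
  then have h: "h1 < h2" "h2 < h3" "h3 < H" "- h3 < - h2" "- h2 \<le> h2" using o m by linarith+
  obtain s2 where s2: "smooth s2" "\<And>s. s \<le> - h3 \<or> h3 \<le> s \<Longrightarrow> s2 s = 0" "\<And>s. - h2 \<le> s \<Longrightarrow> s \<le> h2 \<Longrightarrow> s2 s = 1"
    using smooth_plateau[OF h(4,5,2)] by blast
  \<comment> \<open>The product of \<open>s2\<close> with its reflection is even, whereas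
    \<open>s2\<close> alone need not be.\<close>
  define \<psi> where "\<psi> x = x$1 * s1 (x$1) * (s2 (x$2) * s2 (- x$2))" for x :: plane
  have op: "open {x::plane. x$i < r}" "open {x::plane. r < x$i}" for i r
    by (intro open_Collect_less continuous_intros)+
  define V1 where "V1 = {x::plane. (p1 - L) / 2 < x$1} \<inter> {x. x$1 < (q1 + L) / 2} \<inter> {x. - h2 < x$2} \<inter> {x. x$2 < h2}"
  define V0 where "V0 = {x::plane. x$1 < (p1 - 3 * L) / 4} \<union> {x. (q1 + 3 * L) / 4 < x$1} \<union> {x. x$2 < - h3} \<union> {x. h3 < x$2}"
  interpret solenoidal L H c a b m e M p1 q1 h1 cut1 cut2 \<psi> V1 V0
  proof
    have "smooth (\<lambda>s. s2 (- s))" by (rule smooth_comp_real[OF s2(1) smooth_minus[OF smooth_ident]])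
    then show "smooth \<psi>"
      unfolding \<psi>_def by (intro smooth_mult smooth_coord smooth_of_coord[OF s1(1)] smooth_of_coord[OF s2(1)] smooth_of_coord[of "\<lambda>s. s2 (- s)"])
    show "open V1" "open V0" unfolding V1_def V0_def by (intro open_Int open_Un op)+
    show "Rect p1 q1 (- h1) h1 \<subseteq> V1" using o h by (auto simp: Rect_def V1_def)
    show "\<psi> x = x $ 1" if "x \<in> V1" for x using that s1(3)[of "x$1"] s2(3)[of "x$2"] s2(3)[of "- x$2"] by (auto simp: V1_def \<psi>_def)
    show "\<psi> x = 0" if "x \<in> V0" for x using that s1(2)[of "x$1"] s2(2)[of "x$2"] by (auto simp: V0_def \<psi>_def)
    show "frontier (rect L H) \<subseteq> V0"
      using closed_rect_sides o h by (fastforce simp: V0_def side_b_def side_t_def side_l_def side_r_def)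
    show "\<psi> (reflect x) = \<psi> x" for x by (simp add: \<psi>_def reflect_nth mult_ac)
  qed
  have BB: "BB t \<in> bodies \<alpha> D" for t
  proof -
    have "pt c (hh t c) \<in> BB t" using D m by (simp add: BB_def)
    then show ?thesis unfolding bodies_def D(3) \<alpha> using BB_compact BB_convex BB_subset measure_BB by blast
  qed
  have thr: "has_unique_pair (Om t) (weak_solution L H (BB t) lam Vin Vout)"
    "weak_solution L H (BB t) lam Vin Vout u p \<Longrightarrow> Lp_norm 2 (Om t) (wgrad (Om t) u) < S0 (Om t)" for t u p
    using assms(10,11) BB[of t] V(1) unfolding is_threshold_def Let_def Om_def by fast+
  have ex: "\<exists>u p. weak_solution L H (BB t) lam Vin Vout u p" for t using thr(1)[of t] unfolding has_unique_pair_def by blast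
  obtain t u p where z: "weak_solution L H (BB t) lam Vin Vout u p" "lift (rect L H) (BB t) u p = 0"
    by (rule zero_lift[OF V(2,3) ex thr(2)])
  \<comment> \<open>All weak solutions agree almost everywhere with one pair. The pair of zero lift
    found above is therefore unique, and it may serve as the representative.\<close>
  obtain u0 p0 where u0: "\<And>u' p'. weak_solution L H (BB t) lam Vin Vout u' p' \<Longrightarrow> AE x in lebesgue. x \<in> Om t \<longrightarrow> u' x = u0 x \<and> p' x = p0 x"
    using thr(1)[of t] unfolding has_unique_pair_def by blast
  have "has_unique_pair (rect L H - BB t) (\<lambda>u p. weak_solution L H (BB t) lam Vin Vout u p \<and> lift (rect L H) (BB t) u p = 0)"
    unfolding has_unique_pair_def Om_def[symmetric]
  proof (intro exI conjI allI impI)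
    fix u' p' assume s: "weak_solution L H (BB t) lam Vin Vout u' p' \<and> lift (rect L H) (BB t) u' p' = 0"
    show "AE x in lebesgue. x \<in> Om t \<longrightarrow> u' x = u x \<and> p' x = p x"
      using u0[OF z(1)] u0[OF conjunct1[OF s]] by eventually_elim auto
  qed (rule z)+
  then show ?thesis using BB[of t] V(1) BB_nonsymmetric by blast
qed

end
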